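(* Let $\mathcal{C}$ be a Krull--Schmidt cluster category, let $\mathcal{T}$ be a maximally mutable cluster-tilting subcategory of $\mathcal{C}$, and let $\mathcal{P}$ be a full additively closed subcategory of projective-injective objects of $\mathcal{C}$. Then the $\mathcal{A}$-cluster character is compatible with partial stabilisation: for every object $X$ of $\mathcal{C}$ for which the cluster characters are defined (i.e. $\mathsf{E}^{\mathcal{T}}X\in\operatorname{fd}\underline{\mathcal{T}}$, or $\ker\beta_{\mathcal{T}/\mathcal{P}}$ has finite rank), \[(\pi_{\mathcal{T}}^{\mathcal{T}/\mathcal{P}})_*\bigl(\mathrm{CC}_{\mathcal{A}}^{\mathcal{T}}(X)\bigr)=\mathrm{CC}_{\mathcal{A}}^{\mathcal{T}/\mathcal{P}}(\pi X)\in\mathbb{K}[[\mathsf{K}_0(\mathcal{T}/\mathcal{P})]],\] where $\pi\colon\mathcal{C}\to\mathcal{C}/\mathcal{P}$ is the quotient functor.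
   Context: $\mathbb{K}$ is a perfect field; categories are additive and $\mathbb{K}$-linear; $\operatorname{indec}\mathcal{A}$ is a set of representatives of the isomorphism classes of indecomposable objects of $\mathcal{A}$. Cluster categories. Extriangulated categories are those of Nakaoka--Palu: they carry a bifunctor $\operatorname{Ext}^1$, and each element of $\operatorname{Ext}^1_{\mathcal{C}}(X,Y)$ is realised by a conflation $Y\to E\to X$ (an inflation followed by a deflation). Exact categories, and triangulated categories with $\operatorname{Ext}^1(X,Y)=\operatorname{Hom}(X,\Sigma Y)$, are examples. An object $P$ is projective if $\operatorname{Ext}^1(P,-)=0$ and injective if $\operatorname{Ext}^1(-,P)=0$; $\mathcal{C}$ is Frobenius if it has enough projectives and enough injectives and these coincide. For a full additively closed subcategory $\mathcal{P}$ of projective-injectives, the additive quotient $\mathcal{C}/\mathcal{P}$ (partial stabilisation) is extriangulated with $\operatorname{Ext}^1_{\mathcal{C}/\mathcal{P}}=\operatorname{Ext}^1_{\mathcal{C}}$ and conflations the images of those of $\mathcal{C}$; $\mathcal{C}$ is algebraic if it is equivalent, as an extriangulated category, to such a quotient $\mathcal{E}/\mathcal{P}$ of an exact category $\mathcal{E}$. If $\mathcal{C}$ is Frobenius, $\underline{\mathcal{C}}$ denotes its quotient by all projectives, which is triangulated with suspension $\Sigma$. A right $\mathcal{T}$-approximation of $X$ is a map $T_0\to X$ with $T_0\in\mathcal{T}$ through which every map from an object of $\mathcal{T}$ to $X$ factors; left approximations are dual. A full subcategory $\mathcal{T}\subseteq\mathcal{C}$ is cluster-tilting if $\mathcal{T}=\{X:\operatorname{Ext}^1(T,X)=0\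 \forall T\in\mathcal{T}\}=\{X:\operatorname{Ext}^1(X,T)=0\ \forall T\in\mathcal{T}\}$ and every object of $\mathcal{C}$ has a left $\mathcal{T}$-approximation which is an inflation and a right $\mathcal{T}$-approximation which is a deflation. A cluster category is an idempotent complete algebraic Frobenius extriangulated category $\mathcal{C}$ having a cluster-tilting subcategory and such that $\underline{\mathcal{C}}$ is Hom-finite and $2$-Calabi--Yau (functorially $\operatorname{Hom}(X,Y)\cong\operatorname{Hom}_{\mathbb{K}}(\operatorname{Hom}(Y,\Sigma^2X),\mathbb{K})$). $\underline{\mathcal{T}}$ is the image of $\mathcal{T}$ in $\underline{\mathcal{C}}$. In the Krull--Schmidt case $\mathcal{C}/\mathcal{P}$ is again a Krull--Schmidt cluster category, with the same stable category, and $\mathcal{T}/\mathcal{P}=\pi\mathcal{T}$ is a (maximally mutable, if $\mathcal{T}$ is) cluster-tilting subcategory of it. Mutation. For $T\in\operatorname{indec}\mathcal{T}$, $\mathcal{T}\setminus T$ is the additively closed subcategory with indecomposables $\operatorname{indec}\mathcal{T}\setminus\{T\}$. $T$ is mutable in $\mathcal{T}$ if there is an indecomposable $T^*\not\cong T$ such that $\operatorname{add}(\mathcal{T}\setminus T\cup\{T^*\})$ is cluster-tilting and there are non-split conflations $T^*\to T^+\to T$ and $T\to T^-\to T^*$ in which $T^+\to T$ and $T\to T^-$ are right and left $(\mathcal{T}\setminus T)$-approximations. $\mathcal{T}$ is maximally mutable if all its non-projective indecomposables are mutable. Index, coindex, $\beta$. $\mathsf{K}_0(\mathcal{T})$ is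 the Grothendieck group of $\mathcal{T}$ with its split exact structure. For $X\in\mathcal{C}$ there are conflations $K\to R\to X$ and $X\to L\to C$ with $K,R,L,C\in\mathcal{T}$; put $\operatorname{ind}_{\mathcal{C}}^{\mathcal{T}}[X]=[R]-[K]$ and $\operatorname{coind}_{\mathcal{C}}^{\mathcal{T}}[X]=[L]-[C]$ in $\mathsf{K}_0(\mathcal{T})$ (independent of choices). A $\mathcal{T}$-module is a contravariant $\mathbb{K}$-linear functor $\mathcal{T}\to\operatorname{Mod}\mathbb{K}$ (a $\underline{\mathcal{T}}$-module is one vanishing on projectives); $\operatorname{fd}$ denotes those with finite-dimensional values, non-zero on only finitely many indecomposables. $\mathsf{E}^{\mathcal{T}}X=\operatorname{Ext}^1_{\mathcal{C}}(-,X)|_{\mathcal{T}}$. For $\mathcal{T}$ maximally mutable every $M\in\operatorname{fd}\underline{\mathcal{T}}$ is isomorphic to some $\mathsf{E}^{\mathcal{T}}X$, and $\beta_{\mathcal{T}}\colon\mathsf{K}_0(\operatorname{fd}\underline{\mathcal{T}})\to\mathsf{K}_0(\mathcal{T})$ is the well-defined homomorphism with $\beta_{\mathcal{T}}[\mathsf{E}^{\mathcal{T}}X]=\operatorname{coind}_{\mathcal{C}}^{\mathcal{T}}[X]-\operatorname{ind}_{\mathcal{C}}^{\mathcal{T}}[X]$. The same definitions apply to $\mathcal{T}/\mathcal{P}$ in $\mathcal{C}/\mathcal{P}$, and $\ker\beta_{\mathcal{T}}\subseteq\ker\beta_{\mathcal{T}/\mathcal{P}}$. Cluster character. It is assumed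 that $\mathbb{K}$ admits an Euler--Poincaré characteristic and one is fixed: a function $\chi$ from proper algebraic varieties over $\mathbb{K}$ to $\mathbb{Z}$ with $\chi(\mathbb{A}^n)=1$, $\chi(U)=\chi(V_1)+\chi(V_2)$ when $U=V_1\sqcup V_2$ with $V_i$ constructible, and $\chi(U)=c\,\chi(V)$ for surjective constructible $f\colon U\to V$ all of whose fibres have characteristic $c$. $\mathrm{Gr}_{[L]}(M)$ is the projective variety parametrising submodules $L'\leq M$ with $[L']=[L]\in\mathsf{K}_0(\operatorname{fd}\underline{\mathcal{T}})$. $\mathbb{K}[[\mathsf{K}_0(\mathcal{T})]]$ is the space of possibly infinite linear combinations of symbols $a^v$, $v\in\mathsf{K}_0(\mathcal{T})$. If $\mathsf{E}^{\mathcal{T}}X\in\operatorname{fd}\underline{\mathcal{T}}$ or $\ker\beta_{\mathcal{T}}$ has finite rank, \[\mathrm{CC}_{\mathcal{A}}^{\mathcal{T}}(X)=a^{\operatorname{ind}_{\mathcal{C}}^{\mathcal{T}}[X]}\sum_{[L]\in\mathsf{K}_0(\operatorname{fd}\underline{\mathcal{T}})}\chi(\mathrm{Gr}_{[L]}(\mathsf{E}^{\mathcal{T}}X))\,a^{\beta_{\mathcal{T}}[L]}\in\mathbb{K}[[\mathsf{K}_0(\mathcal{T})]].\] $\pi_{\mathcal{T}}^{\mathcal{T}/\mathcal{P}}\colon\mathsf{K}_0(\mathcal{T})\to\mathsf{K}_0(\mathcal{T}/\mathcal{P})$ is $[T]\mapsto[T]$, and $(\pi_{\mathcal{T}}^{\mathcal{T}/\mathcal{P}})_*$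 is the induced linear map $a^t\mapsto a^{\pi_{\mathcal{T}}^{\mathcal{T}/\mathcal{P}}(t)}$, applied termwise (so $a^{[P]}\mapsto1$ for $P\in\mathcal{P}$). *)

theory Defs
  imports
    "HOL-Algebra.Algebraic_Closure_Type"
    "HOL-Algebra.Free_Abelian_Groups"
    "HOL-Library.Nat_Bijection"
    "Jordan_Normal_Form.VS_Connect"
    "Jordan_Normal_Form.DL_Submatrix"
begin

text \<open>Free the letter \<open>X\<close> for objects.\<close>

no_notation Polynomials.var (\<open>X\<index>\<close>)

section \<open>Linear and additive categories\<close>

text \<open>
  The ground field is a type \<open>'k\<close> of class \<open>field\<close>; vector spaces are \<open>module\<close> records of HOL-Algebra
  over \<open>class_ring\<close>. Since elements of different Hom spaces need not be distinct, composition
  takes the objects as arguments: \<open>Comp C X Y Z g f\<close> is the composite of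
  \<open>f\<close> from \<open>X\<close> to \<open>Y\<close> and \<open>g\<close> from \<open>Y\<close> to \<open>Z\<close>. Full subcategories are sets of objects.
\<close>

abbreviation vspace :: "('k::field, 'v) module \<Rightarrow> bool"
  where "vspace V \<equiv> vectorspace class_ring V"

abbreviation lin :: "('k::field, 'v) module \<Rightarrow> ('k, 'w) module \<Rightarrow> ('v \<Rightarrow> 'w) \<Rightarrow> bool"
  where "lin V W f \<equiv> linear_map class_ring V W f"

abbreviation findim :: "('k::field, 'v) module \<Rightarrow> bool"
  where "findim V \<equiv> vectorspace.fin_dim class_ring V"

definition perfect_field :: "'k::field itself \<Rightarrow> bool"
  where "perfect_field _ \<longleftrightarrow> CHAR('k) = 0 \<or> surj (\<lambda>x::'k. x ^ CHAR('k))"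

record ('k, 'o, 'm) lincat =
  Obj :: "'o set"
  Hom :: "'o \<Rightarrow> 'o \<Rightarrow> ('k, 'm) module"
  Ident :: "'o \<Rightarrow> 'm"
  Comp :: "'o \<Rightarrow> 'o \<Rightarrow> 'o \<Rightarrow> 'm \<Rightarrow> 'm \<Rightarrow> 'm"

abbreviation Mor :: "('k, 'o, 'm, 'z) lincat_scheme \<Rightarrow> 'o \<Rightarrow> 'o \<Rightarrow> 'm set"
  where "Mor C X Y \<equiv> carrier (Hom C X Y)"

definition linear_category :: "('k::field, 'o, 'm, 'z) lincat_scheme \<Rightarrow> bool" where
  "linear_category C \<longleftrightarrow>
     (\<forall>X\<in>Obj C. \<forall>Y\<in>Obj C. vspace (Hom C X Y)) \<and>
     (\<forall>X\<in>Obj C. Ident C X \<in> Mor C X X) \<and>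
     (\<forall>X\<in>Obj C. \<forall>Y\<in>Obj C. \<forall>f\<in>Mor C X Y.
        Comp C X Y Y (Ident C Y) f = f \<and> Comp C X X Y f (Ident C X) = f) \<and>
     (\<forall>X\<in>Obj C. \<forall>Y\<in>Obj C. \<forall>Z\<in>Obj C.
        (\<forall>g\<in>Mor C Y Z. lin (Hom C X Y) (Hom C X Z) (\<lambda>f. Comp C X Y Z g f)) \<and>
        (\<forall>f\<in>Mor C X Y. lin (Hom C Y Z) (Hom C X Z) (\<lambda>g. Comp C X Y Z g f))) \<and>
     (\<forall>W\<in>Obj C. \<forall>X\<in>Obj C. \<forall>Y\<in>Obj C. \<forall>Z\<in>Obj C.
        \<forall>f\<in>Mor C W X. \<forall>g\<in>Mor C X Y. \<forall>h\<in>Mor C Y Z.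
        Comp C W Y Z h (Comp C W X Y g f) = Comp C W X Z (Comp C X Y Z h g) f)"

definition iso_arrow :: "('k, 'o, 'm, 'z) lincat_scheme \<Rightarrow> 'o \<Rightarrow> 'o \<Rightarrow> 'm \<Rightarrow> bool" where
  "iso_arrow C X Y f \<longleftrightarrow> f \<in> Mor C X Y \<and>
     (\<exists>g\<in>Mor C Y X. Comp C X Y X g f = Ident C X \<and> Comp C Y X Y f g = Ident C Y)"

definition isomorphic :: "('k, 'o, 'm, 'z) lincat_scheme \<Rightarrow> 'o \<Rightarrow> 'o \<Rightarrow> bool" where
  "isomorphic C X Y \<longleftrightarrow> X \<in> Obj C \<and> Y \<in> Obj C \<and> (\<exists>f. iso_arrow C X Y f)"

text \<open>\<open>Y\<close> is the biproduct of the objects in \<open>Xs\<close>, with injections \<open>i\<close> and projections \<open>p\<close>; for the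
  empty list, a zero object.\<close>

definition biproduct ::
  "('k, 'o, 'm, 'z) lincat_scheme \<Rightarrow> 'o list \<Rightarrow> 'o \<Rightarrow> (nat \<Rightarrow> 'm) \<Rightarrow> (nat \<Rightarrow> 'm) \<Rightarrow> bool" where
  "biproduct C Xs Y i p \<longleftrightarrow> set Xs \<subseteq> Obj C \<and> Y \<in> Obj C \<and>
     (\<forall>j<length Xs. i j \<in> Mor C (Xs ! j) Y \<and> p j \<in> Mor C Y (Xs ! j)) \<and>
     (\<forall>j<length Xs. \<forall>l<length Xs.
        Comp C (Xs ! l) Y (Xs ! j) (p j) (i l) =
          (if j = l then Ident C (Xs ! j) else ring.zero (Hom C (Xs ! l) (Xs ! j)))) \<and>
     finsum (Hom C Y Y) (\<lambda>j. Comp C Y (Xs ! j) Y (i j) (p j)) {..<length Xs} = Ident C Y"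

definition direct_sum_of :: "('k, 'o, 'm, 'z) lincat_scheme \<Rightarrow> 'o list \<Rightarrow> 'o \<Rightarrow> bool" where
  "direct_sum_of C Xs Y \<longleftrightarrow> (\<exists>i p. biproduct C Xs Y i p)"

definition additive_category :: "('k::field, 'o, 'm, 'z) lincat_scheme \<Rightarrow> bool" where
  "additive_category C \<longleftrightarrow> linear_category C \<and>
     (\<forall>Xs. set Xs \<subseteq> Obj C \<longrightarrow> (\<exists>Y. direct_sum_of C Xs Y))"

definition zero_object :: "('k, 'o, 'm, 'z) lincat_scheme \<Rightarrow> 'o \<Rightarrow> bool" where
  "zero_object C X \<longleftrightarrow> X \<in> Obj C \<and> Ident C X = ring.zero (Hom C X X)"

definition indecomposable :: "('k, 'o, 'm, 'z) lincat_scheme \<Rightarrow> 'o \<Rightarrow> bool" where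
  "indecomposable C X \<longleftrightarrow> X \<in> Obj C \<and> \<not> zero_object C X \<and>
     (\<forall>A B. direct_sum_of C [A, B] X \<longrightarrow> zero_object C A \<or> zero_object C B)"

definition idempotent_complete :: "('k, 'o, 'm, 'z) lincat_scheme \<Rightarrow> bool" where
  "idempotent_complete C \<longleftrightarrow>
     (\<forall>X\<in>Obj C. \<forall>e\<in>Mor C X X. Comp C X X X e e = e \<longrightarrow>
        (\<exists>Y\<in>Obj C. \<exists>r\<in>Mor C X Y. \<exists>s\<in>Mor C Y X.
           Comp C X Y X s r = e \<and> Comp C Y X Y r s = Ident C Y))"

definition local_endo :: "('k, 'o, 'm, 'z) lincat_scheme \<Rightarrow> 'o \<Rightarrow> bool" where
  "local_endo C X \<longleftrightarrow> X \<in> Obj C \<and> \<not> zero_object C X \<and>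
     (\<forall>f\<in>Mor C X X. \<forall>g\<in>Mor C X X. iso_arrow C X X (ring.add (Hom C X X) f g) \<longrightarrow>
        iso_arrow C X X f \<or> iso_arrow C X X g)"

definition krull_schmidt :: "('k, 'o, 'm, 'z) lincat_scheme \<Rightarrow> bool" where
  "krull_schmidt C \<longleftrightarrow>
     (\<forall>X\<in>Obj C. \<exists>Xs. direct_sum_of C Xs X \<and> (\<forall>Y\<in>set Xs. local_endo C Y))"

text \<open>Direct summands of finite direct sums of objects of \<open>S\<close>.\<close>

definition add_closure :: "('k, 'o, 'm, 'z) lincat_scheme \<Rightarrow> 'o set \<Rightarrow> 'o set" where
  "add_closure C S =
     {X. \<exists>Xs Y Z. set Xs \<subseteq> S \<and> direct_sum_of C Xs Z \<and> direct_sum_of C [X, Y] Z}"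

definition additively_closed :: "('k, 'o, 'm, 'z) lincat_scheme \<Rightarrow> 'o set \<Rightarrow> bool" where
  "additively_closed C P \<longleftrightarrow> P \<subseteq> Obj C \<and> add_closure C P = P"

section \<open>Extriangulated categories\<close>

text \<open>
  \<open>Ext C X A\<close> is $\mathrm{Ext}^1(X,A)$; \<open>Push C X A A' a\<close> and \<open>Pull C X' X A c\<close> are the actions
  of \<open>a\<close> from \<open>A\<close> to \<open>A'\<close> and of \<open>c\<close> from \<open>X'\<close> to \<open>X\<close>. The realisation of \<open>\<delta>\<close> in \<open>Ext C X A\<close>, an
  equivalence class of sequences from \<open>A\<close> to \<open>X\<close>, is the set \<open>Real C X A \<delta>\<close> of
  triples \<open>(B, x, y)\<close>, with \<open>x\<close> from \<open>A\<close> to \<open>B\<close> and \<open>y\<close> from \<open>B\<close> to \<open>X\<close>.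
\<close>

record ('k, 'o, 'm, 'e) extricat = "('k, 'o, 'm) lincat" +
  Ext :: "'o \<Rightarrow> 'o \<Rightarrow> ('k, 'e) module"
  Push :: "'o \<Rightarrow> 'o \<Rightarrow> 'o \<Rightarrow> 'm \<Rightarrow> 'e \<Rightarrow> 'e"
  Pull :: "'o \<Rightarrow> 'o \<Rightarrow> 'o \<Rightarrow> 'm \<Rightarrow> 'e \<Rightarrow> 'e"
  Real :: "'o \<Rightarrow> 'o \<Rightarrow> 'e \<Rightarrow> ('o \<times> 'm \<times> 'm) set"

abbreviation Exts :: "('k, 'o, 'm, 'e) extricat \<Rightarrow> 'o \<Rightarrow> 'o \<Rightarrow> 'e set"
  where "Exts C X A \<equiv> carrier (Ext C X A)"

definition ext_bifunctor :: "('k::field, 'o, 'm, 'e) extricat \<Rightarrow> bool" where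
  "ext_bifunctor C \<longleftrightarrow>
     (\<forall>X\<in>Obj C. \<forall>A\<in>Obj C. vspace (Ext C X A)) \<and>
     (\<forall>X\<in>Obj C. \<forall>A\<in>Obj C. \<forall>A'\<in>Obj C.
        (\<forall>a\<in>Mor C A A'. lin (Ext C X A) (Ext C X A') (Push C X A A' a)) \<and>
        (\<forall>\<delta>\<in>Exts C X A. lin (Hom C A A') (Ext C X A') (\<lambda>a. Push C X A A' a \<delta>))) \<and>
     (\<forall>X'\<in>Obj C. \<forall>X\<in>Obj C. \<forall>A\<in>Obj C.
        (\<forall>c\<in>Mor C X' X. lin (Ext C X A) (Ext C X' A) (Pull C X' X A c)) \<and>
        (\<forall>\<delta>\<in>Exts C X A. lin (Hom C X' X) (Ext C X' A) (\<lambda>c. Pull C X' X A c \<delta>))) \<and>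
     (\<forall>X\<in>Obj C. \<forall>A\<in>Obj C. \<forall>\<delta>\<in>Exts C X A.
        Push C X A A (Ident C A) \<delta> = \<delta> \<and> Pull C X X A (Ident C X) \<delta> = \<delta>) \<and>
     (\<forall>X\<in>Obj C. \<forall>A\<in>Obj C. \<forall>A'\<in>Obj C. \<forall>A''\<in>Obj C.
        \<forall>\<delta>\<in>Exts C X A. \<forall>a\<in>Mor C A A'. \<forall>a'\<in>Mor C A' A''.
        Push C X A A'' (Comp C A A' A'' a' a) \<delta> = Push C X A' A'' a' (Push C X A A' a \<delta>)) \<and>
     (\<forall>X''\<in>Obj C. \<forall>X'\<in>Obj C. \<forall>X\<in>Obj C. \<forall>A\<in>Obj C.
        \<forall>\<delta>\<in>Exts C X A. \<forall>c\<in>Mor C X' X. \<forall>c'\<in>Mor C X'' X'.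
        Pull C X'' X A (Comp C X'' X' X c c') \<delta> = Pull C X'' X' A c' (Pull C X' X A c \<delta>)) \<and>
     (\<forall>X'\<in>Obj C. \<forall>X\<in>Obj C. \<forall>A\<in>Obj C. \<forall>A'\<in>Obj C.
        \<forall>\<delta>\<in>Exts C X A. \<forall>a\<in>Mor C A A'. \<forall>c\<in>Mor C X' X.
        Push C X' A A' a (Pull C X' X A c \<delta>) = Pull C X' X A' c (Push C X A A' a \<delta>))"

definition sequence :: "('k, 'o, 'm, 'z) lincat_scheme \<Rightarrow> 'o \<Rightarrow> 'o \<Rightarrow> 'o \<times> 'm \<times> 'm \<Rightarrow> bool" where
  "sequence C A X s \<longleftrightarrow>
     (case s of (B, x, y) \<Rightarrow> B \<in> Obj C \<and> x \<in> Mor C A B \<and> y \<in> Mor C B X)"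

definition seq_equiv ::
  "('k, 'o, 'm, 'z) lincat_scheme \<Rightarrow> 'o \<Rightarrow> 'o \<Rightarrow> 'o \<times> 'm \<times> 'm \<Rightarrow> 'o \<times> 'm \<times> 'm \<Rightarrow> bool" where
  "seq_equiv C A X s s' \<longleftrightarrow> sequence C A X s \<and> sequence C A X s' \<and>
     (case (s, s') of ((B, x, y), (B', x', y')) \<Rightarrow>
        \<exists>b. iso_arrow C B B' b \<and> Comp C A B B' b x = x' \<and> Comp C B B' X y' b = y)"

text \<open>Morphisms $(a,c)$ from \<open>\<delta>\<close> in \<open>Ext C X A\<close> to \<open>\<delta>'\<close> in \<open>Ext C X' A'\<close>.\<close>

definition ext_morphism ::
  "('k, 'o, 'm, 'e) extricat \<Rightarrow> 'o \<Rightarrow> 'o \<Rightarrow> 'e \<Rightarrow> 'o \<Rightarrow> 'o \<Rightarrow> 'e \<Rightarrow> 'm \<Rightarrow> 'm \<Rightarrow> bool" where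
  "ext_morphism C X A \<delta> X' A' \<delta>' a c \<longleftrightarrow>
     a \<in> Mor C A A' \<and> c \<in> Mor C X X' \<and> Push C X A A' a \<delta> = Pull C X X' A' c \<delta>'"

definition realization :: "('k, 'o, 'm, 'e) extricat \<Rightarrow> bool" where
  "realization C \<longleftrightarrow>
     (\<forall>X\<in>Obj C. \<forall>A\<in>Obj C. \<forall>\<delta>\<in>Exts C X A.
        \<exists>s. sequence C A X s \<and> Real C X A \<delta> = {s'. seq_equiv C A X s s'}) \<and>
     (\<forall>X\<in>Obj C. \<forall>A\<in>Obj C. \<forall>\<delta>\<in>Exts C X A. \<forall>X'\<in>Obj C. \<forall>A'\<in>Obj C. \<forall>\<delta>'\<in>Exts C X' A'.
        \<forall>B x y B' x' y' a c.
          (B, x, y) \<in> Real C X A \<delta> \<and> (B', x', y') \<in> Real C X' A' \<delta>' \<and>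
          ext_morphism C X A \<delta> X' A' \<delta>' a c \<longrightarrow>
          (\<exists>b\<in>Mor C B B'. Comp C A B B' b x = Comp C A A' B' x' a \<and>
                         Comp C B B' X' y' b = Comp C B X X' c y))"

text \<open>The morphism between two biproducts \<open>Y\<close> of \<open>Xs\<close> and \<open>Y'\<close> of \<open>Xs'\<close> with diagonal entries \<open>f j\<close>.\<close>

definition diag_mor ::
  "('k, 'o, 'm, 'z) lincat_scheme \<Rightarrow> 'o list \<Rightarrow> 'o \<Rightarrow> (nat \<Rightarrow> 'm) \<Rightarrow> 'o list \<Rightarrow> 'o \<Rightarrow> (nat \<Rightarrow> 'm)
    \<Rightarrow> (nat \<Rightarrow> 'm) \<Rightarrow> 'm" where
  "diag_mor C Xs Y p Xs' Y' i' f =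
     finsum (Hom C Y Y')
       (\<lambda>j. Comp C Y (Xs' ! j) Y' (i' j) (Comp C Y (Xs ! j) (Xs' ! j) (f j) (p j))) {..<length Xs}"

definition additive_realization :: "('k, 'o, 'm, 'e) extricat \<Rightarrow> bool" where
  "additive_realization C \<longleftrightarrow> realization C \<and>
     (\<forall>A X Y i p. biproduct C [A, X] Y i p \<longrightarrow> (Y, i 0, p 1) \<in> Real C X A (ring.zero (Ext C X A))) \<and>
     (\<forall>X\<in>Obj C. \<forall>A\<in>Obj C. \<forall>\<delta>\<in>Exts C X A. \<forall>X'\<in>Obj C. \<forall>A'\<in>Obj C. \<forall>\<delta>'\<in>Exts C X' A'.
        \<forall>B x y B' x' y' AA iA pA BB iB pB XX iX pX.
          (B, x, y) \<in> Real C X A \<delta> \<and> (B', x', y') \<in> Real C X' A' \<delta>' \<and>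
          biproduct C [A, A'] AA iA pA \<and> biproduct C [B, B'] BB iB pB \<and>
          biproduct C [X, X'] XX iX pX \<longrightarrow>
          (BB, diag_mor C [A, A'] AA pA [B, B'] BB iB (\<lambda>j. [x, x'] ! j),
               diag_mor C [B, B'] BB pB [X, X'] XX iX (\<lambda>j. [y, y'] ! j))
          \<in> Real C XX AA
              (ring.add (Ext C XX AA)
                (Push C XX A AA (iA 0) (Pull C XX X A (pX 0) \<delta>))
                (Push C XX A' AA (iA 1) (Pull C XX X' A' (pX 1) \<delta>'))))"

definition ET3 :: "('k, 'o, 'm, 'e) extricat \<Rightarrow> bool" where
  "ET3 C \<longleftrightarrow>
     (\<forall>X\<in>Obj C. \<forall>A\<in>Obj C. \<forall>\<delta>\<in>Exts C X A. \<forall>X'\<in>Obj C. \<forall>A'\<in>Obj C. \<forall>\<delta>'\<in>Exts C X' A'.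
        \<forall>B x y B' x' y'.
          (B, x, y) \<in> Real C X A \<delta> \<and> (B', x', y') \<in> Real C X' A' \<delta>' \<longrightarrow>
          (\<forall>a\<in>Mor C A A'. \<forall>b\<in>Mor C B B'. Comp C A B B' b x = Comp C A A' B' x' a \<longrightarrow>
             (\<exists>c. ext_morphism C X A \<delta> X' A' \<delta>' a c \<and>
                  Comp C B B' X' y' b = Comp C B X X' c y)))"

definition ET3_op :: "('k, 'o, 'm, 'e) extricat \<Rightarrow> bool" where
  "ET3_op C \<longleftrightarrow>
     (\<forall>X\<in>Obj C. \<forall>A\<in>Obj C. \<forall>\<delta>\<in>Exts C X A. \<forall>X'\<in>Obj C. \<forall>A'\<in>Obj C. \<forall>\<delta>'\<in>Exts C X' A'.
        \<forall>B x y B' x' y'.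
          (B, x, y) \<in> Real C X A \<delta> \<and> (B', x', y') \<in> Real C X' A' \<delta>' \<longrightarrow>
          (\<forall>b\<in>Mor C B B'. \<forall>c\<in>Mor C X X'. Comp C B B' X' y' b = Comp C B X X' c y \<longrightarrow>
             (\<exists>a. ext_morphism C X A \<delta> X' A' \<delta>' a c \<and>
                  Comp C A B B' b x = Comp C A A' B' x' a)))"

definition ET4 :: "('k, 'o, 'm, 'e) extricat \<Rightarrow> bool" where
  "ET4 C \<longleftrightarrow>
     (\<forall>A\<in>Obj C. \<forall>B\<in>Obj C. \<forall>X\<in>Obj C. \<forall>D\<in>Obj C. \<forall>F\<in>Obj C.
        \<forall>\<delta>\<in>Exts C D A. \<forall>\<delta>'\<in>Exts C F B. \<forall>f f' g g'.
          (B, f, f') \<in> Real C D A \<delta> \<and> (X, g, g') \<in> Real C F B \<delta>' \<longrightarrow>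
          (\<exists>E\<in>Obj C. \<exists>\<delta>''\<in>Exts C E A. \<exists>h\<in>Mor C A X. \<exists>h'\<in>Mor C X E. \<exists>d\<in>Mor C D E. \<exists>e\<in>Mor C E F.
             h = Comp C A B X g f \<and>
             Comp C B X E h' g = Comp C B D E d f' \<and>
             Comp C X E F e h' = g' \<and>
             (X, h, h') \<in> Real C E A \<delta>'' \<and>
             (E, d, e) \<in> Real C F D (Push C F B D f' \<delta>') \<and>
             Pull C D E A d \<delta>'' = \<delta> \<and>
             Push C E A B f \<delta>'' = Pull C E F B e \<delta>'))"

definition ET4_op :: "('k, 'o, 'm, 'e) extricat \<Rightarrow> bool" where
  "ET4_op C \<longleftrightarrow>
     (\<forall>A\<in>Obj C. \<forall>B\<in>Obj C. \<forall>X\<in>Obj C. \<forall>D\<in>Obj C. \<forall>F\<in>Obj C.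
        \<forall>\<delta>\<in>Exts C B D. \<forall>\<delta>'\<in>Exts C X F. \<forall>f f' g g'.
          (A, f', f) \<in> Real C B D \<delta> \<and> (B, g', g) \<in> Real C X F \<delta>' \<longrightarrow>
          (\<exists>E\<in>Obj C. \<exists>\<delta>''\<in>Exts C X E. \<exists>h'\<in>Mor C E A. \<exists>h\<in>Mor C A X. \<exists>d\<in>Mor C D E. \<exists>e\<in>Mor C E F.
             h = Comp C A B X g f \<and>
             Comp C E A B f h' = Comp C E F B g' e \<and>
             Comp C D E A h' d = f' \<and>
             (A, h', h) \<in> Real C X E \<delta>'' \<and>
             (E, d, e) \<in> Real C F D (Pull C F B D g' \<delta>) \<and>
             Push C X E F e \<delta>'' = \<delta>' \<and>
             Push C B D E d \<delta> = Pull C B X E g \<delta>''))"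

definition extriangulated :: "('k::field, 'o, 'm, 'e) extricat \<Rightarrow> bool" where
  "extriangulated C \<longleftrightarrow> additive_category C \<and> ext_bifunctor C \<and> additive_realization C \<and>
     ET3 C \<and> ET3_op C \<and> ET4 C \<and> ET4_op C"

definition conflation :: "('k, 'o, 'm, 'e) extricat \<Rightarrow> 'o \<Rightarrow> 'm \<Rightarrow> 'o \<Rightarrow> 'm \<Rightarrow> 'o \<Rightarrow> bool" where
  "conflation C A x B y X \<longleftrightarrow> A \<in> Obj C \<and> X \<in> Obj C \<and> (\<exists>\<delta>\<in>Exts C X A. (B, x, y) \<in> Real C X A \<delta>)"

definition inflation :: "('k, 'o, 'm, 'e) extricat \<Rightarrow> 'o \<Rightarrow> 'o \<Rightarrow> 'm \<Rightarrow> bool" where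
  "inflation C A B x \<longleftrightarrow> (\<exists>y X. conflation C A x B y X)"

definition deflation :: "('k, 'o, 'm, 'e) extricat \<Rightarrow> 'o \<Rightarrow> 'o \<Rightarrow> 'm \<Rightarrow> bool" where
  "deflation C B X y \<longleftrightarrow> (\<exists>A x. conflation C A x B y X)"

definition split_deflation :: "('k, 'o, 'm, 'e) extricat \<Rightarrow> 'o \<Rightarrow> 'o \<Rightarrow> 'm \<Rightarrow> bool" where
  "split_deflation C B X y \<longleftrightarrow> (\<exists>s\<in>Mor C X B. Comp C X B X y s = Ident C X)"

definition projectives :: "('k, 'o, 'm, 'e) extricat \<Rightarrow> 'o set" where
  "projectives C = {P \<in> Obj C. \<forall>X\<in>Obj C. Exts C P X = {ring.zero (Ext C P X)}}"

definition injectives :: "('k, 'o, 'm, 'e) extricat \<Rightarrow> 'o set" where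
  "injectives C = {P \<in> Obj C. \<forall>X\<in>Obj C. Exts C X P = {ring.zero (Ext C X P)}}"

definition frobenius :: "('k, 'o, 'm, 'e) extricat \<Rightarrow> bool" where
  "frobenius C \<longleftrightarrow> projectives C = injectives C \<and>
     (\<forall>X\<in>Obj C. \<exists>P\<in>projectives C. \<exists>y. deflation C P X y) \<and>
     (\<forall>X\<in>Obj C. \<exists>I\<in>injectives C. \<exists>x. inflation C X I x)"

section \<open>Partial stabilisation\<close>

definition factoring ::
  "('k, 'o, 'm, 'z) lincat_scheme \<Rightarrow> 'o set \<Rightarrow> 'o \<Rightarrow> 'o \<Rightarrow> 'm set" where
  "factoring C P X Y =
     {Comp C X Q Y b a | Q a b. Q \<in> P \<and> a \<in> Mor C X Q \<and> b \<in> Mor C Q Y}"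

text \<open>The fields \<open>mult\<close> and \<open>one\<close> of a module record are not used.\<close>

definition quot_module :: "('k, 'v) module \<Rightarrow> 'v set \<Rightarrow> ('k, 'v set) module" where
  "quot_module V W =
     \<lparr>carrier = a_rcosets\<^bsub>V\<^esub> W, monoid.mult = (\<lambda>_ _. undefined), one = undefined,
      ring.zero = W, ring.add = set_add V,
      module.smult = (\<lambda>c S. set_add V W ((\<lambda>v. c \<odot>\<^bsub>V\<^esub> v) ` S))\<rparr>"

definition quot_class ::
  "('k, 'o, 'm, 'z) lincat_scheme \<Rightarrow> 'o set \<Rightarrow> 'o \<Rightarrow> 'o \<Rightarrow> 'm \<Rightarrow> 'm set" where
  "quot_class C P X Y f = a_r_coset (Hom C X Y) (factoring C P X Y) f"

definition quot_cat :: "('k, 'o, 'm, 'z) lincat_scheme \<Rightarrow> 'o set \<Rightarrow> ('k, 'o, 'm set) lincat" where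
  "quot_cat C P =
     \<lparr>Obj = Obj C,
      Hom = (\<lambda>X Y. quot_module (Hom C X Y) (factoring C P X Y)),
      Ident = (\<lambda>X. quot_class C P X X (Ident C X)),
      Comp = (\<lambda>X Y Z G F. set_add (Hom C X Z) (factoring C P X Z)
                            {Comp C X Y Z g f | g f. g \<in> G \<and> f \<in> F})\<rparr>"

text \<open>
  Morphisms factoring through projective-injectives in \<open>P\<close> act by zero on \<open>Ext\<close>, so that the actions
  \<open>Push\<close> and \<open>Pull\<close> below do not depend on the chosen representatives.
\<close>

definition partial_stab ::
  "('k, 'o, 'm, 'e) extricat \<Rightarrow> 'o set \<Rightarrow> ('k, 'o, 'm set, 'e) extricat" where
  "partial_stab C P =
     \<lparr>Obj = Obj (quot_cat C P), Hom = Hom (quot_cat C P),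
      Ident = Ident (quot_cat C P), Comp = Comp (quot_cat C P),
      Ext = Ext C,
      Push = (\<lambda>X A A' F \<delta>. Push C X A A' (SOME a. a \<in> F) \<delta>),
      Pull = (\<lambda>X' X A F \<delta>. Pull C X' X A (SOME c. c \<in> F) \<delta>),
      Real = (\<lambda>X A \<delta>. {s. \<exists>(B, x, y)\<in>Real C X A \<delta>.
                seq_equiv (quot_cat C P) A X (B, quot_class C P A B x, quot_class C P B X y) s})\<rparr>"

definition stable :: "('k, 'o, 'm, 'e) extricat \<Rightarrow> ('k, 'o, 'm set, 'e) extricat" where
  "stable C = partial_stab C (projectives C)"

section \<open>Exact categories and algebraic extriangulated categories\<close>

definition is_kernel :: "('k, 'o, 'm, 'z) lincat_scheme \<Rightarrow> 'o \<Rightarrow> 'm \<Rightarrow> 'o \<Rightarrow> 'm \<Rightarrow> 'o \<Rightarrow> bool" where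
  "is_kernel C A i B p Z \<longleftrightarrow> i \<in> Mor C A B \<and> p \<in> Mor C B Z \<and> Comp C A B Z p i = ring.zero (Hom C A Z) \<and>
     (\<forall>W\<in>Obj C. \<forall>f\<in>Mor C W B. Comp C W B Z p f = ring.zero (Hom C W Z) \<longrightarrow>
        (\<exists>!g. g \<in> Mor C W A \<and> Comp C W A B i g = f))"

definition is_cokernel :: "('k, 'o, 'm, 'z) lincat_scheme \<Rightarrow> 'o \<Rightarrow> 'm \<Rightarrow> 'o \<Rightarrow> 'm \<Rightarrow> 'o \<Rightarrow> bool" where
  "is_cokernel C A i B p Z \<longleftrightarrow> i \<in> Mor C A B \<and> p \<in> Mor C B Z \<and> Comp C A B Z p i = ring.zero (Hom C A Z) \<and>
     (\<forall>W\<in>Obj C. \<forall>f\<in>Mor C B W. Comp C A B W f i = ring.zero (Hom C A W) \<longrightarrow>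
        (\<exists>!g. g \<in> Mor C Z W \<and> Comp C B Z W g p = f))"

text \<open>\<open>i\<close> from \<open>A\<close> to \<open>B\<close> and \<open>f\<close> from \<open>A\<close> to \<open>A'\<close> have the pushout \<open>B'\<close>, with \<open>f'\<close> from \<open>B\<close>
  and \<open>i'\<close> from \<open>A'\<close>.\<close>

definition pushout ::
  "('k, 'o, 'm, 'z) lincat_scheme \<Rightarrow> 'o \<Rightarrow> 'o \<Rightarrow> 'o \<Rightarrow> 'o \<Rightarrow> 'm \<Rightarrow> 'm \<Rightarrow> 'm \<Rightarrow> 'm \<Rightarrow> bool" where
  "pushout C A B A' B' i f f' i' \<longleftrightarrow>
     B' \<in> Obj C \<and> f' \<in> Mor C B B' \<and> i' \<in> Mor C A' B' \<and>
     Comp C A B B' f' i = Comp C A A' B' i' f \<and>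
     (\<forall>W\<in>Obj C. \<forall>u\<in>Mor C B W. \<forall>v\<in>Mor C A' W. Comp C A B W u i = Comp C A A' W v f \<longrightarrow>
        (\<exists>!h. h \<in> Mor C B' W \<and> Comp C B B' W h f' = u \<and> Comp C A' B' W h i' = v))"

text \<open>\<open>p\<close> from \<open>B\<close> to \<open>Z\<close> and \<open>f\<close> from \<open>Z'\<close> to \<open>Z\<close> have the pullback \<open>B'\<close>, with \<open>f'\<close> to \<open>B\<close>
  and \<open>p'\<close> to \<open>Z'\<close>.\<close>

definition pullback ::
  "('k, 'o, 'm, 'z) lincat_scheme \<Rightarrow> 'o \<Rightarrow> 'o \<Rightarrow> 'o \<Rightarrow> 'o \<Rightarrow> 'm \<Rightarrow> 'm \<Rightarrow> 'm \<Rightarrow> 'm \<Rightarrow> bool" where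
  "pullback C B Z B' Z' p f f' p' \<longleftrightarrow>
     B' \<in> Obj C \<and> f' \<in> Mor C B' B \<and> p' \<in> Mor C B' Z' \<and>
     Comp C B' B Z p f' = Comp C B' Z' Z f p' \<and>
     (\<forall>W\<in>Obj C. \<forall>u\<in>Mor C W B. \<forall>v\<in>Mor C W Z'. Comp C W B Z p u = Comp C W Z' Z f v \<longrightarrow>
        (\<exists>!h. h \<in> Mor C W B' \<and> Comp C W B' B f' h = u \<and> Comp C W B' Z' p' h = v))"

text \<open>Quillen's axioms in the form given by Buehler, for a class \<open>S\<close> of kernel-cokernel pairs
  in an additive category.\<close>

definition quillen_exact ::
  "('k::field, 'o, 'm, 'z) lincat_scheme \<Rightarrow> ('o \<Rightarrow> 'm \<Rightarrow> 'o \<Rightarrow> 'm \<Rightarrow> 'o \<Rightarrow> bool) \<Rightarrow> bool" where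
  "quillen_exact C S \<longleftrightarrow>
     (let M = (\<lambda>A B i. \<exists>p Z. S A i B p Z); E = (\<lambda>B Z p. \<exists>A i. S A i B p Z) in
      additive_category C \<and>
      (\<forall>A i B p Z. S A i B p Z \<longrightarrow> A \<in> Obj C \<and> B \<in> Obj C \<and> Z \<in> Obj C \<and>
         is_kernel C A i B p Z \<and> is_cokernel C A i B p Z) \<and>
      (\<forall>A i B p Z. S A i B p Z \<longrightarrow>
         (\<forall>A'\<in>Obj C. \<forall>B'\<in>Obj C. \<forall>Z'\<in>Obj C. \<forall>i'\<in>Mor C A' B'. \<forall>p'\<in>Mor C B' Z'. \<forall>a b c.
            iso_arrow C A A' a \<and> iso_arrow C B B' b \<and> iso_arrow C Z Z' c \<and>
            Comp C A B B' b i = Comp C A A' B' i' a \<and>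
            Comp C B Z Z' c p = Comp C B B' Z' p' b \<longrightarrow> S A' i' B' p' Z')) \<and>
      (\<forall>X\<in>Obj C. M X X (Ident C X) \<and> E X X (Ident C X)) \<and>
      (\<forall>X Y Z f g. M X Y f \<and> M Y Z g \<longrightarrow> M X Z (Comp C X Y Z g f)) \<and>
      (\<forall>X Y Z f g. E X Y f \<and> E Y Z g \<longrightarrow> E X Z (Comp C X Y Z g f)) \<and>
      (\<forall>A B i. M A B i \<longrightarrow> (\<forall>A'\<in>Obj C. \<forall>f\<in>Mor C A A'.
         \<exists>B' f' i'. pushout C A B A' B' i f f' i' \<and> M A' B' i')) \<and>
      (\<forall>B Z p. E B Z p \<longrightarrow> (\<forall>Z'\<in>Obj C. \<forall>f\<in>Mor C Z' Z.
         \<exists>B' f' p'. pullback C B Z B' Z' p f f' p' \<and> E B' Z' p')))"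

text \<open>
  An exact category, viewed as an extriangulated category. When conflations are kernel-cokernel
  pairs, (ET3) shows that an extension is determined by its realisation, so \<open>Ext\<close> is
  the Yoneda $\mathrm{Ext}^1$ of the exact structure.
\<close>

definition exact_extri :: "('k::field, 'o, 'm, 'e) extricat \<Rightarrow> bool" where
  "exact_extri C \<longleftrightarrow> extriangulated C \<and> quillen_exact C (conflation C)"

definition extri_equivalence ::
  "('k::field, 'o, 'm, 'e) extricat \<Rightarrow> ('k, 'o2, 'm2, 'e2) extricat
    \<Rightarrow> ('o \<Rightarrow> 'o2) \<Rightarrow> ('o \<Rightarrow> 'o \<Rightarrow> 'm \<Rightarrow> 'm2) \<Rightarrow> ('o \<Rightarrow> 'o \<Rightarrow> 'e \<Rightarrow> 'e2) \<Rightarrow> bool" where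
  "extri_equivalence C D Fo Fm \<Gamma> \<longleftrightarrow>
     (\<forall>X\<in>Obj C. Fo X \<in> Obj D \<and> Fm X X (Ident C X) = Ident D (Fo X)) \<and>
     (\<forall>X\<in>Obj C. \<forall>Y\<in>Obj C. lin (Hom C X Y) (Hom D (Fo X) (Fo Y)) (Fm X Y) \<and>
        bij_betw (Fm X Y) (Mor C X Y) (Mor D (Fo X) (Fo Y))) \<and>
     (\<forall>X\<in>Obj C. \<forall>Y\<in>Obj C. \<forall>Z\<in>Obj C. \<forall>f\<in>Mor C X Y. \<forall>g\<in>Mor C Y Z.
        Fm X Z (Comp C X Y Z g f) = Comp D (Fo X) (Fo Y) (Fo Z) (Fm Y Z g) (Fm X Y f)) \<and>
     (\<forall>Y\<in>Obj D. \<exists>X\<in>Obj C. isomorphic D (Fo X) Y) \<and>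
     (\<forall>X\<in>Obj C. \<forall>A\<in>Obj C. lin (Ext C X A) (Ext D (Fo X) (Fo A)) (\<Gamma> X A) \<and>
        bij_betw (\<Gamma> X A) (Exts C X A) (Exts D (Fo X) (Fo A))) \<and>
     (\<forall>X\<in>Obj C. \<forall>A\<in>Obj C. \<forall>A'\<in>Obj C. \<forall>a\<in>Mor C A A'. \<forall>\<delta>\<in>Exts C X A.
        \<Gamma> X A' (Push C X A A' a \<delta>) = Push D (Fo X) (Fo A) (Fo A') (Fm A A' a) (\<Gamma> X A \<delta>)) \<and>
     (\<forall>X'\<in>Obj C. \<forall>X\<in>Obj C. \<forall>A\<in>Obj C. \<forall>c\<in>Mor C X' X. \<forall>\<delta>\<in>Exts C X A.
        \<Gamma> X' A (Pull C X' X A c \<delta>) = Pull D (Fo X') (Fo X) (Fo A) (Fm X' X c) (\<Gamma> X A \<delta>)) \<and>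
     (\<forall>X\<in>Obj C. \<forall>A\<in>Obj C. \<forall>\<delta>\<in>Exts C X A. \<forall>(B, x, y)\<in>Real C X A \<delta>.
        (Fo B, Fm A B x, Fm B X y) \<in> Real D (Fo X) (Fo A) (\<Gamma> X A \<delta>))"

text \<open>
  \<open>C\<close> is algebraic with model \<open>E/Q\<close>. HOL has no existential quantifier over types, so that
  ``algebraic'' is expressed by an assumption on an arbitrary such model.
\<close>

definition algebraic_via ::
  "('k::field, 'o, 'm, 'e) extricat \<Rightarrow> ('k, 'o2, 'm2, 'e2) extricat \<Rightarrow> 'o2 set \<Rightarrow> bool" where
  "algebraic_via C E Q \<longleftrightarrow> exact_extri E \<and> additively_closed E Q \<and>
     Q \<subseteq> projectives E \<inter> injectives E \<and>
     (\<exists>Fo Fm \<Gamma>. extri_equivalence C (partial_stab E Q) Fo Fm \<Gamma>)"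

section \<open>Cluster categories\<close>

definition right_approx :: "('k, 'o, 'm, 'z) lincat_scheme \<Rightarrow> 'o set \<Rightarrow> 'o \<Rightarrow> 'o \<Rightarrow> 'm \<Rightarrow> bool" where
  "right_approx C T T0 X f \<longleftrightarrow> T0 \<in> T \<and> f \<in> Mor C T0 X \<and>
     (\<forall>T1\<in>T. \<forall>g\<in>Mor C T1 X. \<exists>h\<in>Mor C T1 T0. Comp C T1 T0 X f h = g)"

definition left_approx :: "('k, 'o, 'm, 'z) lincat_scheme \<Rightarrow> 'o set \<Rightarrow> 'o \<Rightarrow> 'o \<Rightarrow> 'm \<Rightarrow> bool" where
  "left_approx C T X T0 f \<longleftrightarrow> T0 \<in> T \<and> f \<in> Mor C X T0 \<and>
     (\<forall>T1\<in>T. \<forall>g\<in>Mor C X T1. \<exists>h\<in>Mor C T0 T1. Comp C X T0 T1 h f = g)"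

definition cluster_tilting :: "('k, 'o, 'm, 'e) extricat \<Rightarrow> 'o set \<Rightarrow> bool" where
  "cluster_tilting C T \<longleftrightarrow>
     T = {X \<in> Obj C. \<forall>U\<in>T. Exts C U X = {ring.zero (Ext C U X)}} \<and>
     T = {X \<in> Obj C. \<forall>U\<in>T. Exts C X U = {ring.zero (Ext C X U)}} \<and>
     (\<forall>X\<in>Obj C. (\<exists>U f. left_approx C T X U f \<and> inflation C X U f) \<and>
                (\<exists>U f. right_approx C T U X f \<and> deflation C U X f))"

text \<open>
  The suspension functor of the stable category: \<open>S X\<close> is the end term of a conflation
  starting at \<open>X\<close> with injective middle term, which realises \<open>\<delta> X\<close>, and the value of \<open>\<Sigma>\<close> at the class
  of \<open>f\<close> is the class of any \<open>c\<close> completing \<open>f\<close> to a morphism between these conflations.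
\<close>

definition suspension ::
  "('k, 'o, 'm, 'e) extricat \<Rightarrow> ('o \<Rightarrow> 'o) \<Rightarrow> ('o \<Rightarrow> 'e) \<Rightarrow> ('o \<Rightarrow> 'o \<Rightarrow> 'm set \<Rightarrow> 'm set) \<Rightarrow> bool" where
  "suspension C S \<delta> \<Sigma> \<longleftrightarrow>
     (\<forall>X\<in>Obj C. S X \<in> Obj C \<and> \<delta> X \<in> Exts C (S X) X \<and>
        (\<exists>I\<in>injectives C. \<exists>x y. (I, x, y) \<in> Real C (S X) X (\<delta> X))) \<and>
     (\<forall>X\<in>Obj C. \<forall>Y\<in>Obj C. \<forall>f\<in>Mor C X Y. \<forall>c\<in>Mor C (S X) (S Y).
        ext_morphism C (S X) X (\<delta> X) (S Y) Y (\<delta> Y) f c \<longrightarrow>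
        \<Sigma> X Y (quot_class C (projectives C) X Y f) = quot_class C (projectives C) (S X) (S Y) c)"

definition functional :: "('k::field, 'v) module \<Rightarrow> ('v \<Rightarrow> 'k) \<Rightarrow> bool" where
  "functional V l \<longleftrightarrow>
     (\<forall>v\<in>carrier V. \<forall>w\<in>carrier V. l (v \<oplus>\<^bsub>V\<^esub> w) = l v + l w) \<and>
     (\<forall>c. \<forall>v\<in>carrier V. l (c \<odot>\<^bsub>V\<^esub> v) = c * l v)"

text \<open>\<open>\<phi> X Y\<close> is the isomorphism from $\mathrm{Hom}(X,Y)$ to the dual of
  $\mathrm{Hom}(Y,\Sigma^2X)$, natural in both arguments.\<close>

definition two_calabi_yau :: "('k::field, 'o, 'm, 'e) extricat \<Rightarrow> bool" where
  "two_calabi_yau C \<longleftrightarrow>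
     (\<exists>S \<delta> \<Sigma> \<phi>. suspension C S \<delta> \<Sigma> \<and>
       (let D = stable C in
        (\<forall>X\<in>Obj C. \<forall>Y\<in>Obj C.
           (\<forall>f\<in>Mor D X Y. functional (Hom D Y (S (S X))) (\<phi> X Y f)) \<and>
           (\<forall>g\<in>Mor D Y (S (S X)). functional (Hom D X Y) (\<lambda>f. \<phi> X Y f g)) \<and>
           (\<forall>l. functional (Hom D Y (S (S X))) l \<longrightarrow>
              (\<exists>!f. f \<in> Mor D X Y \<and> (\<forall>g\<in>Mor D Y (S (S X)). \<phi> X Y f g = l g)))) \<and>
        (\<forall>X\<in>Obj C. \<forall>Y\<in>Obj C. \<forall>Y'\<in>Obj C.
           \<forall>f\<in>Mor D X Y. \<forall>y\<in>Mor D Y Y'. \<forall>g\<in>Mor D Y' (S (S X)).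
           \<phi> X Y' (Comp D X Y Y' y f) g = \<phi> X Y f (Comp D Y Y' (S (S X)) g y)) \<and>
        (\<forall>X'\<in>Obj C. \<forall>X\<in>Obj C. \<forall>Y\<in>Obj C.
           \<forall>f\<in>Mor D X Y. \<forall>x\<in>Mor D X' X. \<forall>g\<in>Mor D Y (S (S X')).
           \<phi> X' Y (Comp D X' X Y f x) g =
           \<phi> X Y f (Comp D Y (S (S X')) (S (S X)) (\<Sigma> (S X') (S X) (\<Sigma> X' X x)) g))))"

definition cluster_category ::
  "('k::field, 'o, 'm, 'e) extricat \<Rightarrow> ('k, 'o2, 'm2, 'e2) extricat \<Rightarrow> 'o2 set \<Rightarrow> bool" where
  "cluster_category C E Q \<longleftrightarrow>
     extriangulated C \<and> idempotent_complete C \<and> algebraic_via C E Q \<and> frobenius C \<and>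
     (\<exists>T. cluster_tilting C T) \<and>
     (\<forall>X\<in>Obj C. \<forall>Y\<in>Obj C. findim (Hom (stable C) X Y)) \<and>
     two_calabi_yau C"

definition without :: "('k, 'o, 'm, 'e) extricat \<Rightarrow> 'o set \<Rightarrow> 'o \<Rightarrow> 'o set" where
  "without C T U = add_closure C {V \<in> T. indecomposable C V \<and> \<not> isomorphic C V U}"

definition mutable :: "('k, 'o, 'm, 'e) extricat \<Rightarrow> 'o set \<Rightarrow> 'o \<Rightarrow> bool" where
  "mutable C T U \<longleftrightarrow>
     (\<exists>U'. indecomposable C U' \<and> \<not> isomorphic C U' U \<and>
        cluster_tilting C (add_closure C (without C T U \<union> {U'})) \<and>
        (\<exists>Up x y. conflation C U' x Up y U \<and> \<not> split_deflation C Up U y \<and>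
           right_approx C (without C T U) Up U y) \<and>
        (\<exists>Um x y. conflation C U x Um y U' \<and> \<not> split_deflation C Um U' y \<and>
           left_approx C (without C T U) U Um x))"

definition maximally_mutable :: "('k, 'o, 'm, 'e) extricat \<Rightarrow> 'o set \<Rightarrow> bool" where
  "maximally_mutable C T \<longleftrightarrow>
     (\<forall>U\<in>T. indecomposable C U \<and> U \<notin> projectives C \<longrightarrow> mutable C T U)"

section \<open>Grothendieck groups, index and coindex\<close>

text \<open>
  The free abelian group on \<open>S\<close> modulo $[Y]-[X]-[Z]$ for the sequences \<open>(X, Y, Z)\<close> in \<open>R\<close>. Elements are
  cosets; the library's notation for quotient groups is multiplicative.
\<close>

definition K0_rel :: "'a set \<Rightarrow> ('a \<times> 'a \<times> 'a) set \<Rightarrow> ('a \<Rightarrow>\<^sub>0 int) set" where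
  "K0_rel S R = generate (free_Abelian_group S) {frag_of Y - frag_of X - frag_of Z | X Y Z. (X, Y, Z) \<in> R}"

definition K0 :: "'a set \<Rightarrow> ('a \<times> 'a \<times> 'a) set \<Rightarrow> ('a \<Rightarrow>\<^sub>0 int) set monoid" where
  "K0 S R = free_Abelian_group S Mod K0_rel S R"

definition K0_coset :: "'a set \<Rightarrow> ('a \<times> 'a \<times> 'a) set \<Rightarrow> ('a \<Rightarrow>\<^sub>0 int) \<Rightarrow> ('a \<Rightarrow>\<^sub>0 int) set" where
  "K0_coset S R c = K0_rel S R #>\<^bsub>free_Abelian_group S\<^esub> c"

definition split_seqs :: "('k, 'o, 'm, 'z) lincat_scheme \<Rightarrow> 'o set \<Rightarrow> ('o \<times> 'o \<times> 'o) set" where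
  "split_seqs C T = {(X, Y, Z). X \<in> T \<and> Y \<in> T \<and> Z \<in> T \<and> direct_sum_of C [X, Z] Y}"

abbreviation K0T :: "('k, 'o, 'm, 'z) lincat_scheme \<Rightarrow> 'o set \<Rightarrow> ('o \<Rightarrow>\<^sub>0 int) set monoid" where
  "K0T C T \<equiv> K0 T (split_seqs C T)"

definition classT :: "('k, 'o, 'm, 'z) lincat_scheme \<Rightarrow> 'o set \<Rightarrow> 'o \<Rightarrow> ('o \<Rightarrow>\<^sub>0 int) set" where
  "classT C T X = K0_coset T (split_seqs C T) (frag_of X)"

text \<open>The relations of \<open>K0T (partial_stab C P) T\<close> contain those of \<open>K0T C T\<close>, so that the homomorphism
  with $[T]\mapsto[T]$ adds the former to a coset of the latter.\<close>

definition proj_K0 ::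
  "('k, 'o, 'm, 'e) extricat \<Rightarrow> 'o set \<Rightarrow> 'o set \<Rightarrow> ('o \<Rightarrow>\<^sub>0 int) set \<Rightarrow> ('o \<Rightarrow>\<^sub>0 int) set" where
  "proj_K0 C P T v =
     K0_rel T (split_seqs (partial_stab C P) T) <#>\<^bsub>free_Abelian_group T\<^esub> v"

definition index :: "('k, 'o, 'm, 'e) extricat \<Rightarrow> 'o set \<Rightarrow> 'o \<Rightarrow> ('o \<Rightarrow>\<^sub>0 int) set" where
  "index C T X = (THE v. \<exists>K\<in>T. \<exists>R\<in>T. \<exists>x y. conflation C K x R y X \<and>
     v = classT C T R \<otimes>\<^bsub>K0T C T\<^esub> inv\<^bsub>K0T C T\<^esub> classT C T K)"

definition coindex :: "('k, 'o, 'm, 'e) extricat \<Rightarrow> 'o set \<Rightarrow> 'o \<Rightarrow> ('o \<Rightarrow>\<^sub>0 int) set" where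
  "coindex C T X = (THE v. \<exists>L\<in>T. \<exists>D\<in>T. \<exists>x y. conflation C X x L y D \<and>
     v = classT C T L \<otimes>\<^bsub>K0T C T\<^esub> inv\<^bsub>K0T C T\<^esub> classT C T D)"

section \<open>Modules over cluster-tilting subcategories\<close>

text \<open>
  A contravariant functor \<open>M\<close> from \<open>T\<close> to vector spaces over a field \<open>'f\<close>; \<open>mact M X Y f\<close> is the
  map from \<open>M(Y)\<close> to \<open>M(X)\<close> induced by \<open>f\<close> from \<open>X\<close> to \<open>Y\<close>. Linearity over \<open>'k\<close> is with respect to a field
  homomorphism \<open>\<iota>\<close> from \<open>'k\<close> to \<open>'f\<close>: it is \<open>id\<close> for modules over the ground field, and
  \<open>to_ac\<close> for modules over its algebraic closure.
\<close>

record ('f, 'o, 'm, 'v) tmod =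
  mval :: "'o \<Rightarrow> ('f, 'v) module"
  mact :: "'o \<Rightarrow> 'o \<Rightarrow> 'm \<Rightarrow> 'v \<Rightarrow> 'v"

abbreviation mcar :: "('f, 'o, 'm, 'v) tmod \<Rightarrow> 'o \<Rightarrow> 'v set"
  where "mcar M X \<equiv> carrier (mval M X)"

definition T_module ::
  "('k::field \<Rightarrow> 'f::field) \<Rightarrow> ('k, 'o, 'm, 'z) lincat_scheme \<Rightarrow> 'o set \<Rightarrow> ('f, 'o, 'm, 'v) tmod \<Rightarrow> bool"
  where
  "T_module \<iota> C T M \<longleftrightarrow>
     (\<forall>X\<in>T. vspace (mval M X)) \<and>
     (\<forall>X\<in>T. \<forall>Y\<in>T. \<forall>f\<in>Mor C X Y. lin (mval M Y) (mval M X) (mact M X Y f)) \<and>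
     (\<forall>X\<in>T. \<forall>v\<in>mcar M X. mact M X X (Ident C X) v = v) \<and>
     (\<forall>X\<in>T. \<forall>Y\<in>T. \<forall>Z\<in>T. \<forall>f\<in>Mor C X Y. \<forall>g\<in>Mor C Y Z. \<forall>v\<in>mcar M Z.
        mact M X Z (Comp C X Y Z g f) v = mact M X Y f (mact M Y Z g v)) \<and>
     (\<forall>X\<in>T. \<forall>Y\<in>T. \<forall>f\<in>Mor C X Y. \<forall>g\<in>Mor C X Y. \<forall>v\<in>mcar M Y.
        mact M X Y (f \<oplus>\<^bsub>Hom C X Y\<^esub> g) v = mact M X Y f v \<oplus>\<^bsub>mval M X\<^esub> mact M X Y g v) \<and>
     (\<forall>X\<in>T. \<forall>Y\<in>T. \<forall>f\<in>Mor C X Y. \<forall>c. \<forall>v\<in>mcar M Y.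
        mact M X Y (c \<odot>\<^bsub>Hom C X Y\<^esub> f) v = \<iota> c \<odot>\<^bsub>mval M X\<^esub> mact M X Y f v)"

text \<open>The finite-dimensional modules over the image of \<open>T\<close> in the stable category.\<close>

definition fd_module ::
  "('k::field \<Rightarrow> 'f::field) \<Rightarrow> ('k, 'o, 'm, 'e) extricat \<Rightarrow> 'o set \<Rightarrow> ('f, 'o, 'm, 'v) tmod \<Rightarrow> bool"
  where
  "fd_module \<iota> C T M \<longleftrightarrow> T_module \<iota> C T M \<and>
     (\<forall>X\<in>T \<inter> projectives C. mcar M X = {ring.zero (mval M X)}) \<and>
     (\<forall>X\<in>T. findim (mval M X)) \<and>
     (\<exists>J. finite J \<and> (\<forall>X\<in>T. indecomposable C X \<and> mcar M X \<noteq> {ring.zero (mval M X)} \<longrightarrow>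
        (\<exists>Y\<in>J. isomorphic C X Y)))"

definition T_module_hom ::
  "('k::field, 'o, 'm, 'z) lincat_scheme \<Rightarrow> 'o set \<Rightarrow> ('f::field, 'o, 'm, 'v) tmod \<Rightarrow> ('f, 'o, 'm, 'w) tmod
    \<Rightarrow> ('o \<Rightarrow> 'v \<Rightarrow> 'w) \<Rightarrow> bool" where
  "T_module_hom C T M N h \<longleftrightarrow>
     (\<forall>X\<in>T. lin (mval M X) (mval N X) (h X)) \<and>
     (\<forall>X\<in>T. \<forall>Y\<in>T. \<forall>f\<in>Mor C X Y. \<forall>v\<in>mcar M Y. h X (mact M X Y f v) = mact N X Y f (h Y v))"

definition short_exact ::
  "('k::field, 'o, 'm, 'z) lincat_scheme \<Rightarrow> 'o set \<Rightarrow> ('f::field, 'o, 'm, 'u) tmod \<Rightarrow> ('f, 'o, 'm, 'v) tmod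
    \<Rightarrow> ('f, 'o, 'm, 'w) tmod \<Rightarrow> bool" where
  "short_exact C T L M N \<longleftrightarrow>
     (\<exists>h g. T_module_hom C T L M h \<and> T_module_hom C T M N g \<and>
        (\<forall>X\<in>T. inj_on (h X) (mcar L X) \<and> g X ` mcar M X = mcar N X \<and>
           h X ` mcar L X = {v \<in> mcar M X. g X v = ring.zero (mval N X)}))"

text \<open>Every finite-dimensional vector space is isomorphic to one whose elements are of type \<open>'f vec\<close>;
  the Grothendieck group is formed from the modules with such values.\<close>

definition fd_modules ::
  "('k::field \<Rightarrow> 'f::field) \<Rightarrow> ('k, 'o, 'm, 'e) extricat \<Rightarrow> 'o set \<Rightarrow> ('f, 'o, 'm, 'f vec) tmod set" where
  "fd_modules \<iota> C T = {M. fd_module \<iota> C T M}"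

definition fd_exact_seqs ::
  "('k::field \<Rightarrow> 'f::field) \<Rightarrow> ('k, 'o, 'm, 'e) extricat \<Rightarrow> 'o set
    \<Rightarrow> (('f, 'o, 'm, 'f vec) tmod \<times> ('f, 'o, 'm, 'f vec) tmod \<times> ('f, 'o, 'm, 'f vec) tmod) set" where
  "fd_exact_seqs \<iota> C T = {(L, M, N). L \<in> fd_modules \<iota> C T \<and> M \<in> fd_modules \<iota> C T \<and>
     N \<in> fd_modules \<iota> C T \<and> short_exact C T L M N}"

abbreviation K0fd ::
  "('k::field \<Rightarrow> 'f::field) \<Rightarrow> ('k, 'o, 'm, 'e) extricat \<Rightarrow> 'o set
    \<Rightarrow> (('f, 'o, 'm, 'f vec) tmod \<Rightarrow>\<^sub>0 int) set monoid" where
  "K0fd \<iota> C T \<equiv> K0 (fd_modules \<iota> C T) (fd_exact_seqs \<iota> C T)"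

abbreviation K0fd_coset ::
  "('k::field \<Rightarrow> 'f::field) \<Rightarrow> ('k, 'o, 'm, 'e) extricat \<Rightarrow> 'o set
    \<Rightarrow> (('f, 'o, 'm, 'f vec) tmod \<Rightarrow>\<^sub>0 int) \<Rightarrow> (('f, 'o, 'm, 'f vec) tmod \<Rightarrow>\<^sub>0 int) set" where
  "K0fd_coset \<iota> C T \<equiv> K0_coset (fd_modules \<iota> C T) (fd_exact_seqs \<iota> C T)"

definition chosen_basis :: "('k::field, 'v) module \<Rightarrow> 'v list" where
  "chosen_basis V = (SOME bs. distinct bs \<and> vectorspace.basis class_ring V (set bs))"

definition vdim :: "('k::field, 'v) module \<Rightarrow> nat" where
  "vdim V = length (chosen_basis V)"

definition coords :: "('k::field, 'v) module \<Rightarrow> 'v \<Rightarrow> 'k vec" where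
  "coords V v = (THE c. c \<in> carrier_vec (vdim V) \<and>
     v = finsum V (\<lambda>i. (c $ i) \<odot>\<^bsub>V\<^esub> (chosen_basis V ! i)) {..<vdim V})"

text \<open>
  The module $M\otimes_{\mathbb K}\mathbb F$, with values $\mathbb F^n$, in coordinates with respect to the
  chosen bases of the values of \<open>M\<close>. For \<open>\<iota> = id\<close> it is a copy of \<open>M\<close> with values of type \<open>'k vec\<close>.
\<close>

definition base_change ::
  "('k::field \<Rightarrow> 'f::field) \<Rightarrow> ('k, 'o, 'm, 'v) tmod \<Rightarrow> ('f, 'o, 'm, 'f vec) tmod" where
  "base_change \<iota> M =
     \<lparr>mval = (\<lambda>X. module_vec TYPE('f) (vdim (mval M X))),
      mact = (\<lambda>X Y f w.
        mat (vdim (mval M X)) (vdim (mval M Y))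
          (\<lambda>(i, j). \<iota> (coords (mval M X) (mact M X Y f (chosen_basis (mval M Y) ! j)) $ i)) *\<^sub>v w)\<rparr>"

definition class_fd ::
  "('k::field, 'o, 'm, 'e) extricat \<Rightarrow> 'o set \<Rightarrow> ('k, 'o, 'm, 'v) tmod
    \<Rightarrow> (('k, 'o, 'm, 'k vec) tmod \<Rightarrow>\<^sub>0 int) set" where
  "class_fd C T M = K0fd_coset id C T (frag_of (base_change id M))"

text \<open>$\mathsf{E}^{\mathcal T}X$\<close>

definition Efun :: "('k, 'o, 'm, 'e) extricat \<Rightarrow> 'o \<Rightarrow> ('k, 'o, 'm, 'e) tmod" where
  "Efun C X = \<lparr>mval = (\<lambda>Y. Ext C Y X), mact = (\<lambda>Y Z f \<delta>. Pull C Y Z X f \<delta>)\<rparr>"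

text \<open>The characterising property of the homomorphism $\beta_{\mathcal T}$.\<close>

definition is_beta ::
  "('k::field, 'o, 'm, 'e) extricat \<Rightarrow> 'o set
    \<Rightarrow> ((('k, 'o, 'm, 'k vec) tmod \<Rightarrow>\<^sub>0 int) set \<Rightarrow> ('o \<Rightarrow>\<^sub>0 int) set) \<Rightarrow> bool" where
  "is_beta C T \<beta> \<longleftrightarrow> \<beta> \<in> hom (K0fd id C T) (K0T C T) \<and>
     (\<forall>X\<in>Obj C. fd_module id C T (Efun C X) \<longrightarrow>
        \<beta> (class_fd C T (Efun C X)) = coindex C T X \<otimes>\<^bsub>K0T C T\<^esub> inv\<^bsub>K0T C T\<^esub> index C T X)"

definition finite_rank :: "('a, 'b) monoid_scheme \<Rightarrow> 'a set \<Rightarrow> bool" where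
  "finite_rank G H \<longleftrightarrow> (\<exists>S. finite S \<and> S \<subseteq> H \<and>
     (\<forall>h\<in>H. \<exists>n>0::nat. h [^]\<^bsub>G\<^esub> n \<in> generate G S))"

section \<open>Varieties and the Euler-Poincare characteristic\<close>

text \<open>
  As the field is perfect, a subset of projective space over \<open>'k\<close> is represented by
  its set of points over the algebraic closure. Subsets of $\mathbb P^n$ are represented by their cones
  of homogeneous coordinate vectors, which are sequences vanishing beyond \<open>n\<close>.
  A polynomial is a finitely supported function on monomials, themselves finitely supported exponent vectors.
\<close>

type_synonym 'k mpoly = "(nat \<Rightarrow>\<^sub>0 nat) \<Rightarrow>\<^sub>0 'k"
type_synonym 'k point = "nat \<Rightarrow> 'k alg_closure"

definition eval_mpoly :: "'k::field mpoly \<Rightarrow> 'k point \<Rightarrow> 'k alg_closure" where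
  "eval_mpoly p x =
     (\<Sum>m\<in>Poly_Mapping.keys p. to_ac (Poly_Mapping.lookup p m) * (\<Prod>i\<in>Poly_Mapping.keys m. x i ^ Poly_Mapping.lookup m i))"

definition homogeneous :: "nat \<Rightarrow> 'k::field mpoly \<Rightarrow> bool" where
  "homogeneous d p \<longleftrightarrow>
     (\<forall>m\<in>Poly_Mapping.keys p. (\<Sum>i\<in>Poly_Mapping.keys m. Poly_Mapping.lookup m i) = d)"

definition proj_space :: "nat \<Rightarrow> 'k::field point set" where
  "proj_space n = {x. (\<forall>i>n. x i = 0) \<and> (\<exists>i. x i \<noteq> 0)}"

definition same_point :: "'k::field point \<Rightarrow> 'k point \<Rightarrow> bool" where
  "same_point x y \<longleftrightarrow> (\<exists>c. c \<noteq> 0 \<and> (\<forall>i. x i = c * y i))"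

inductive constructible_in :: "nat \<Rightarrow> 'k::field point set \<Rightarrow> bool" for n where
  zero_locus: "homogeneous d p \<Longrightarrow> constructible_in n {x \<in> proj_space n. eval_mpoly p x = 0}"
| complement: "constructible_in n U \<Longrightarrow> constructible_in n (proj_space n - U)"
| union: "constructible_in n U \<Longrightarrow> constructible_in n V \<Longrightarrow> constructible_in n (U \<union> V)"

definition constructible :: "'k::field point set \<Rightarrow> bool" where
  "constructible U \<longleftrightarrow> (\<exists>n. constructible_in n U)"

text \<open>Maps that are piecewise morphisms: there is a finite constructible decomposition of the source
  such that on each piece the map is given by homogeneous polynomials of the same degree.\<close>

definition constructible_map ::
  "'k::field point set \<Rightarrow> 'k point set \<Rightarrow> ('k point \<Rightarrow> 'k point) \<Rightarrow> bool" where
  "constructible_map U V f \<longleftrightarrow> f ` U \<subseteq> V \<and>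
     (\<exists>\<U>. finite \<U> \<and> \<Union> \<U> = U \<and> disjoint \<U> \<and>
        (\<forall>W\<in>\<U>. constructible W \<and>
           (\<exists>d F. (\<forall>i. homogeneous d (F i)) \<and>
              (\<forall>x\<in>W. same_point (f x) (\<lambda>i. eval_mpoly (F i) x)))))"

text \<open>
  The function \<open>\<chi>\<close> on constructible sets defined over \<open>'k\<close>, and on the geometric fibres of maps
  between them, which are defined over finite extensions of \<open>'k\<close>. The second axiom is the first for
  affine 0-space over the residue field of a closed point; with the last one it gives the invariance
  under isomorphisms.
\<close>

definition euler_characteristic :: "('k::field point set \<Rightarrow> int) \<Rightarrow> bool" where
  "euler_characteristic \<chi> \<longleftrightarrow>
     (\<forall>n. \<chi> {x \<in> proj_space n. x 0 \<noteq> 0} = 1) \<and>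
     (\<forall>n. \<forall>v\<in>proj_space n. \<chi> {x. same_point x v} = 1) \<and>
     (\<forall>U V1 V2. constructible U \<and> constructible V1 \<and> constructible V2 \<and>
        U = V1 \<union> V2 \<and> V1 \<inter> V2 = {} \<longrightarrow> \<chi> U = \<chi> V1 + \<chi> V2) \<and>
     (\<forall>U V f c. constructible U \<and> constructible V \<and> constructible_map U V f \<and>
        (\<forall>v\<in>V. \<exists>u\<in>U. same_point (f u) v) \<and>
        (\<forall>v\<in>V. \<chi> {u \<in> U. same_point (f u) v} = c) \<longrightarrow> \<chi> U = c * \<chi> V)"

section \<open>Quiver Grassmannians and the cluster character\<close>

definition restrict_mod :: "('f, 'o, 'm, 'v) tmod \<Rightarrow> ('o \<Rightarrow> 'v set) \<Rightarrow> ('f, 'o, 'm, 'v) tmod" where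
  "restrict_mod N W = N\<lparr>mval := (\<lambda>X. (mval N X)\<lparr>carrier := W X\<rparr>)\<rparr>"

definition T_submodule ::
  "('k::field, 'o, 'm, 'z) lincat_scheme \<Rightarrow> 'o set \<Rightarrow> ('f::field, 'o, 'm, 'v) tmod \<Rightarrow> ('o \<Rightarrow> 'v set) \<Rightarrow> bool"
  where
  "T_submodule C T N W \<longleftrightarrow>
     (\<forall>X\<in>T. subspace class_ring (W X) (mval N X)) \<and>
     (\<forall>X\<in>T. \<forall>Y\<in>T. \<forall>f\<in>Mor C X Y. mact N X Y f ` W Y \<subseteq> W X)"

text \<open>
  The points over the algebraic closure of the Grassmannian of submodules of \<open>M\<close> of class \<open>\<xi>\<close>:
  submodules of the base change of \<open>M\<close> whose class is the base change of \<open>\<xi>\<close>.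
\<close>

definition grass_points ::
  "('k::field, 'o, 'm, 'e) extricat \<Rightarrow> 'o set \<Rightarrow> ('k, 'o, 'm, 'v) tmod
    \<Rightarrow> (('k, 'o, 'm, 'k vec) tmod \<Rightarrow>\<^sub>0 int) set \<Rightarrow> ('o \<Rightarrow> 'k alg_closure vec set) set" where
  "grass_points C T M \<xi> =
     {W. T_submodule C T (base_change to_ac M) W \<and>
         fd_module to_ac C T (restrict_mod (base_change to_ac M) W) \<and>
         (\<exists>c\<in>\<xi>. K0fd_coset to_ac C T (frag_of (restrict_mod (base_change to_ac M) W)) =
                 K0fd_coset to_ac C T (frag_extend (\<lambda>L. frag_of (base_change to_ac L)) c))}"

text \<open>
  A list of objects of \<open>T\<close> on whose values all submodules in question are generated. Then \<open>W\<close> is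
  determined by its values on the list: the others are the images of linear maps of constant rank.
\<close>

definition generating_objects ::
  "('k::field, 'o, 'm, 'e) extricat \<Rightarrow> 'o set \<Rightarrow> ('k, 'o, 'm, 'v) tmod
    \<Rightarrow> (('k, 'o, 'm, 'k vec) tmod \<Rightarrow>\<^sub>0 int) set \<Rightarrow> 'o list" where
  "generating_objects C T M \<xi> =
     (SOME Js. set Js \<subseteq> T \<and>
        (\<forall>W\<in>grass_points C T M \<xi>. \<forall>X\<in>T.
           W X = LinearCombinations.module.span class_ring (mval (base_change to_ac M) X)
             {mact (base_change to_ac M) X J f w | J f w. J \<in> set Js \<and> f \<in> Mor C X J \<and> w \<in> W J}))"

text \<open>The subspace $W_{1}\oplus\dots\oplus W_{r}$ of the space of concatenated vectors.\<close>

definition concat_space :: "'f vec set list \<Rightarrow> 'f vec set" where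
  "concat_space Ws =
     {vec_of_list (concat (map list_of_vec ws)) | ws. list_all2 (\<lambda>w W. w \<in> W) ws Ws}"

definition is_basis_matrix :: "nat \<Rightarrow> 'f::field vec set \<Rightarrow> nat \<Rightarrow> 'f mat \<Rightarrow> bool" where
  "is_basis_matrix n W d B \<longleftrightarrow> B \<in> carrier_mat n d \<and>
     bij_betw (\<lambda>c. B *\<^sub>v c) (carrier_vec d) W"

text \<open>Pluecker coordinates: the maximal minors of a basis matrix. The minor with row set \<open>I\<close> is the
  coordinate with number \<open>set_encode I\<close>.\<close>

definition pluecker :: "nat \<Rightarrow> nat \<Rightarrow> 'f::field mat \<Rightarrow> nat \<Rightarrow> 'f" where
  "pluecker n d B j =
     (if set_decode j \<subseteq> {..<n} \<and> card (set_decode j) = d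
      then Determinant.det (submatrix B (set_decode j) UNIV) else 0)"

text \<open>
  The projective variety: each point \<open>W\<close> is sent to the point with the Pluecker coordinates of the direct
  sum of the values of \<open>W\<close> on the generating objects.
\<close>

definition grassmannian ::
  "('k::field, 'o, 'm, 'e) extricat \<Rightarrow> 'o set \<Rightarrow> ('k, 'o, 'm, 'v) tmod
    \<Rightarrow> (('k, 'o, 'm, 'k vec) tmod \<Rightarrow>\<^sub>0 int) set \<Rightarrow> 'k point set" where
  "grassmannian C T M \<xi> =
     (let Js = generating_objects C T M \<xi>; n = (\<Sum>J\<leftarrow>Js. vdim (mval M J)) in
      {x. \<exists>W\<in>grass_points C T M \<xi>. \<exists>d B. is_basis_matrix n (concat_space (map W Js)) d B \<and>
            same_point x (pluecker n d B)})"

text \<open>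
  An element of $\mathbb K[[\mathsf K_0(\mathcal T)]]$ is a function giving the coefficients of the symbols $a^v$.
  The classes contributing to the coefficient of $a^v$ in the cluster character are:
\<close>

definition cc_terms ::
  "('k::field point set \<Rightarrow> int) \<Rightarrow> ('k, 'o, 'm, 'e) extricat \<Rightarrow> 'o set
    \<Rightarrow> ((('k, 'o, 'm, 'k vec) tmod \<Rightarrow>\<^sub>0 int) set \<Rightarrow> ('o \<Rightarrow>\<^sub>0 int) set) \<Rightarrow> 'o
    \<Rightarrow> ('o \<Rightarrow>\<^sub>0 int) set \<Rightarrow> (('k, 'o, 'm, 'k vec) tmod \<Rightarrow>\<^sub>0 int) set set" where
  "cc_terms \<chi> C T \<beta> X v =
     {\<xi> \<in> carrier (K0fd id C T). index C T X \<otimes>\<^bsub>K0T C T\<^esub> \<beta> \<xi> = v \<and>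
        \<chi> (grassmannian C T (Efun C X) \<xi>) \<noteq> 0}"

definition CC ::
  "('k::field point set \<Rightarrow> int) \<Rightarrow> ('k, 'o, 'm, 'e) extricat \<Rightarrow> 'o set
    \<Rightarrow> ((('k, 'o, 'm, 'k vec) tmod \<Rightarrow>\<^sub>0 int) set \<Rightarrow> ('o \<Rightarrow>\<^sub>0 int) set) \<Rightarrow> 'o
    \<Rightarrow> ('o \<Rightarrow>\<^sub>0 int) set \<Rightarrow> 'k" where
  "CC \<chi> C T \<beta> X v =
     (\<Sum>\<xi>\<in>cc_terms \<chi> C T \<beta> X v. of_int (\<chi> (grassmannian C T (Efun C X) \<xi>)))"

text \<open>The termwise image of \<open>\<Sum> c\<^sub>v a\<^sup>v\<close> under \<open>\<pi>\<close>, and the condition that it is defined.\<close>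

definition pushforward_terms ::
  "('a, 'b) monoid_scheme \<Rightarrow> ('a \<Rightarrow> 'c) \<Rightarrow> ('a \<Rightarrow> 'k::zero) \<Rightarrow> 'c \<Rightarrow> 'a set" where
  "pushforward_terms G \<pi> s w = {v \<in> carrier G. \<pi> v = w \<and> s v \<noteq> 0}"

definition pushforward ::
  "('a, 'b) monoid_scheme \<Rightarrow> ('a \<Rightarrow> 'c) \<Rightarrow> ('a \<Rightarrow> 'k::comm_monoid_add) \<Rightarrow> 'c \<Rightarrow> 'k" where
  "pushforward G \<pi> s w = (\<Sum>v\<in>pushforward_terms G \<pi> s w. s v)"

end

theory Submission
  imports Defs "Jordan_Normal_Form.DL_Rank"
begin

text \<open>
  A finite-dimensional \<open>T\<close>-module vanishes on \<open>P\<close>, so that it is the same as a module over the image of \<open>T\<close> in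
  \<open>C/P\<close>. Hence both Grothendieck groups of finite-dimensional modules, and both quiver Grassmannians of
  $\mathsf{E}^{\mathcal T}X$, can be identified. As $\operatorname{Ext}^1$ and its realisation do not change either,
  the index and the coindex in \<open>C/P\<close> are the images under \<open>\<pi>\<close> of those in \<open>C\<close>; and \<open>\<beta>' = \<pi> \<circ> \<beta>\<close> because the
  Grothendieck group is generated by the simple modules, each of which is $\mathsf{E}^{\mathcal T}K$ for the kernel
  \<open>K\<close> of a right almost split deflation. The sums are finite because a class with non-empty Grassmannian
  has a bounded dimension vector, whose support is confined to a finite set: to that of $\mathsf{E}^{\mathcal T}X$,
  or, when the kernel of \<open>\<beta>'\<close> has finite rank, to that of one contributing class and of generators of the kernel.
\<close>

text \<open>\<open>is_beta\<close> pins down a homomorphism only on classes of the form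
  \<open>Efun C X\<close>, so \<open>\<beta>\<close> and \<open>\<beta>'\<close> are compared on
  generators of that form. The obstacle is to realise the simple modules. Mutability of U yields a
  deflation R -> U through which maps from the other indecomposables of T factor, but a radical
  endomorphism of U need not factor through it. Such endomorphisms are adjoined to the deflation one
  at a time; each lowers the dimension of Ext(U, K) for the first term K, and when none is left
  \<open>Efun C K\<close> is simple.

  Modules over the two categories have different types, and their data outside T are arbitrary. The
  Grothendieck groups are therefore identified by two maps that are inverse to each other only
  modulo the relations.

  The finite-rank hypothesis enters because two classes contributing to the same projected
  coefficient differ by an element of the kernel of \<open>\<beta>'\<close>. A positive multiple of
  it is generated by finitely many classes; dimensions are integers, so at an indecomposable where
  all these generators have dimension 0 the two classes have equal dimension.\<close>

no_notation Formal_Power_Series.fps_nth (infixl \<open>$\<close> 75)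

section \<open>Linear algebra\<close>

lemma vspace_module: "vspace V \<Longrightarrow> Module.module class_ring V"
  by (simp add: vectorspace_def)

lemma vspace_abelian_group: "vspace V \<Longrightarrow> abelian_group V"
  by (simp add: vectorspace_def module_def)

lemma vspaceI:
  fixes V :: "('k::field, 'v) module"
  assumes "abelian_group V"
    and "\<And>a x. x \<in> carrier V \<Longrightarrow> a \<odot>\<^bsub>V\<^esub> x \<in> carrier V"
    and "\<And>a b x. x \<in> carrier V \<Longrightarrow> (a + b) \<odot>\<^bsub>V\<^esub> x = a \<odot>\<^bsub>V\<^esub> x \<oplus>\<^bsub>V\<^esub> b \<odot>\<^bsub>V\<^esub> x"
    and "\<And>a x y. x \<in> carrier V \<Longrightarrow> y \<in> carrier V \<Longrightarrow>
      a \<odot>\<^bsub>V\<^esub> (x \<oplus>\<^bsub>V\<^esub> y) = a \<odot>\<^bsub>V\<^esub> x \<oplus>\<^bsub>V\<^esub> a \<odot>\<^bsub>V\<^esub> y"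
    and "\<And>a b x. x \<in> carrier V \<Longrightarrow> (a * b) \<odot>\<^bsub>V\<^esub> x = a \<odot>\<^bsub>V\<^esub> (b \<odot>\<^bsub>V\<^esub> x)"
    and "\<And>x. x \<in> carrier V \<Longrightarrow> 1 \<odot>\<^bsub>V\<^esub> x = x"
  shows "vspace V"
  using assms class_field
  by (auto simp: vectorspace_def module_def module_axioms_def field_def domain_def class_ring_simps)

lemma vs_closed:
  assumes "vspace V"
  shows "\<zero>\<^bsub>V\<^esub> \<in> carrier V"
    and "\<And>x y. x \<in> carrier V \<Longrightarrow> y \<in> carrier V \<Longrightarrow> x \<oplus>\<^bsub>V\<^esub> y \<in> carrier V"
    and "\<And>x y. x \<in> carrier V \<Longrightarrow> y \<in> carrier V \<Longrightarrow> x \<ominus>\<^bsub>V\<^esub> y \<in> carrier V"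
    and "\<And>x. x \<in> carrier V \<Longrightarrow> \<ominus>\<^bsub>V\<^esub> x \<in> carrier V"
    and "\<And>c x. x \<in> carrier V \<Longrightarrow> c \<odot>\<^bsub>V\<^esub> x \<in> carrier V"
proof -
  interpret vectorspace class_ring V by fact
  show "\<zero>\<^bsub>V\<^esub> \<in> carrier V"
    and "\<And>x y. x \<in> carrier V \<Longrightarrow> y \<in> carrier V \<Longrightarrow> x \<oplus>\<^bsub>V\<^esub> y \<in> carrier V"
    and "\<And>x y. x \<in> carrier V \<Longrightarrow> y \<in> carrier V \<Longrightarrow> x \<ominus>\<^bsub>V\<^esub> y \<in> carrier V"
    and "\<And>x. x \<in> carrier V \<Longrightarrow> \<ominus>\<^bsub>V\<^esub> x \<in> carrier V"
    and "\<And>c x. x \<in> carrier V \<Longrightarrow> c \<odot>\<^bsub>V\<^esub> x \<in> carrier V"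
    by (auto simp: class_ring_simps)
qed

lemma vs_laws:
  fixes V :: "('k::field, 'v) module"
  assumes "vspace V" and x: "x \<in> carrier V"
  shows "\<zero>\<^bsub>V\<^esub> \<oplus>\<^bsub>V\<^esub> x = x" "x \<oplus>\<^bsub>V\<^esub> \<zero>\<^bsub>V\<^esub> = x"
    "x \<ominus>\<^bsub>V\<^esub> x = \<zero>\<^bsub>V\<^esub>" "x \<ominus>\<^bsub>V\<^esub> \<zero>\<^bsub>V\<^esub> = x" "0 \<odot>\<^bsub>V\<^esub> x = \<zero>\<^bsub>V\<^esub>" "1 \<odot>\<^bsub>V\<^esub> x = x"
    "\<ominus>\<^bsub>V\<^esub> x = (- 1) \<odot>\<^bsub>V\<^esub> x"
    "y \<in> carrier V \<Longrightarrow> x \<ominus>\<^bsub>V\<^esub> y \<oplus>\<^bsub>V\<^esub> y = x"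
    "y \<in> carrier V \<Longrightarrow> y \<oplus>\<^bsub>V\<^esub> (x \<ominus>\<^bsub>V\<^esub> y) = x"
    "y \<in> carrier V \<Longrightarrow> (x \<oplus>\<^bsub>V\<^esub> y) \<ominus>\<^bsub>V\<^esub> y = x"
    "y \<in> carrier V \<Longrightarrow> x \<oplus>\<^bsub>V\<^esub> y = y \<oplus>\<^bsub>V\<^esub> x"
    "y \<in> carrier V \<Longrightarrow> x \<ominus>\<^bsub>V\<^esub> y = \<zero>\<^bsub>V\<^esub> \<longleftrightarrow> x = y"
proof -
  interpret vectorspace class_ring V by fact
  show "\<zero>\<^bsub>V\<^esub> \<oplus>\<^bsub>V\<^esub> x = x" "x \<oplus>\<^bsub>V\<^esub> \<zero>\<^bsub>V\<^esub> = x"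
    using x by auto
  show "x \<ominus>\<^bsub>V\<^esub> x = \<zero>\<^bsub>V\<^esub>" "x \<ominus>\<^bsub>V\<^esub> \<zero>\<^bsub>V\<^esub> = x"
    using x by (auto simp: M.minus_eq M.r_neg)
  have z: "\<zero>\<^bsub>class_ring\<^esub> = (0::'k)" and o: "\<one>\<^bsub>class_ring\<^esub> = (1::'k)"
    by (auto simp: class_ring_simps)
  show "0 \<odot>\<^bsub>V\<^esub> x = \<zero>\<^bsub>V\<^esub>" "1 \<odot>\<^bsub>V\<^esub> x = x"
    using x smult_l_null[OF x] smult_one[OF x] by (simp_all add: z o)
  have "(- 1) \<odot>\<^bsub>V\<^esub> x \<oplus>\<^bsub>V\<^esub> x = (- 1 + 1) \<odot>\<^bsub>V\<^esub> x"
    using smult_l_distr[of "- 1" 1 x] x smult_one[OF x] by (simp add: class_ring_simps)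
  also have "\<dots> = \<zero>\<^bsub>V\<^esub>"
    using smult_l_null[OF x] by (simp add: z)
  finally have "(- 1) \<odot>\<^bsub>V\<^esub> x \<oplus>\<^bsub>V\<^esub> x = \<zero>\<^bsub>V\<^esub>" .
  moreover have "(- 1) \<odot>\<^bsub>V\<^esub> x \<in> carrier V"
    using x by (simp add: class_ring_simps)
  ultimately show "\<ominus>\<^bsub>V\<^esub> x = (- 1) \<odot>\<^bsub>V\<^esub> x"
    using x by (metis M.minus_equality)
  show "y \<in> carrier V \<Longrightarrow> x \<ominus>\<^bsub>V\<^esub> y \<oplus>\<^bsub>V\<^esub> y = x"
    using x by (simp add: M.minus_eq M.a_assoc M.l_neg)
  show "y \<in> carrier V \<Longrightarrow> y \<oplus>\<^bsub>V\<^esub> (x \<ominus>\<^bsub>V\<^esub> y) = x"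
    using x by (simp add: M.minus_eq M.a_lcomm M.r_neg)
  show "y \<in> carrier V \<Longrightarrow> (x \<oplus>\<^bsub>V\<^esub> y) \<ominus>\<^bsub>V\<^esub> y = x"
    using x by (simp add: M.minus_eq M.a_assoc M.r_neg)
  show "y \<in> carrier V \<Longrightarrow> x \<oplus>\<^bsub>V\<^esub> y = y \<oplus>\<^bsub>V\<^esub> x"
    using x by (rule M.a_comm)
  show "y \<in> carrier V \<Longrightarrow> x \<ominus>\<^bsub>V\<^esub> y = \<zero>\<^bsub>V\<^esub> \<longleftrightarrow> x = y"
    using x by (simp add: M.minus_eq) (metis M.minus_equality M.minus_minus M.a_inv_closed M.r_neg)
qed

lemma vs_assoc:
  assumes "vspace V" "x \<in> carrier V" "y \<in> carrier V" "z \<in> carrier V"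
  shows "x \<oplus>\<^bsub>V\<^esub> y \<oplus>\<^bsub>V\<^esub> z = x \<oplus>\<^bsub>V\<^esub> (y \<oplus>\<^bsub>V\<^esub> z)"
  using vspace_abelian_group[OF assms(1)] assms
  by (simp add: abelian_group.axioms(1) abelian_monoid.a_assoc)

lemma vs_smult_laws:
  fixes V :: "('k::field, 'v) module"
  assumes "vspace V" "x \<in> carrier V"
  shows "(a + b) \<odot>\<^bsub>V\<^esub> x = a \<odot>\<^bsub>V\<^esub> x \<oplus>\<^bsub>V\<^esub> b \<odot>\<^bsub>V\<^esub> x"
    "(a * b) \<odot>\<^bsub>V\<^esub> x = a \<odot>\<^bsub>V\<^esub> (b \<odot>\<^bsub>V\<^esub> x)"
    "y \<in> carrier V \<Longrightarrow> a \<odot>\<^bsub>V\<^esub> (x \<oplus>\<^bsub>V\<^esub> y) = a \<odot>\<^bsub>V\<^esub> x \<oplus>\<^bsub>V\<^esub> a \<odot>\<^bsub>V\<^esub> y"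
    "a \<odot>\<^bsub>V\<^esub> \<zero>\<^bsub>V\<^esub> = \<zero>\<^bsub>V\<^esub>"
proof -
  interpret vectorspace class_ring V by fact
  show "(a + b) \<odot>\<^bsub>V\<^esub> x = a \<odot>\<^bsub>V\<^esub> x \<oplus>\<^bsub>V\<^esub> b \<odot>\<^bsub>V\<^esub> x"
    "(a * b) \<odot>\<^bsub>V\<^esub> x = a \<odot>\<^bsub>V\<^esub> (b \<odot>\<^bsub>V\<^esub> x)"
    using smult_l_distr[of a b x] smult_assoc1[of a b x] assms by (auto simp: class_ring_simps)
  show "y \<in> carrier V \<Longrightarrow> a \<odot>\<^bsub>V\<^esub> (x \<oplus>\<^bsub>V\<^esub> y) = a \<odot>\<^bsub>V\<^esub> x \<oplus>\<^bsub>V\<^esub> a \<odot>\<^bsub>V\<^esub> y"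
    using smult_r_distr[of a x y] assms by (auto simp: class_ring_simps)
  show "a \<odot>\<^bsub>V\<^esub> \<zero>\<^bsub>V\<^esub> = \<zero>\<^bsub>V\<^esub>"
    by (simp add: class_ring_simps)
qed

lemma linI:
  assumes "vspace V" "vspace W"
    and "\<And>v. v \<in> carrier V \<Longrightarrow> f v \<in> carrier W"
    and "\<And>v w. v \<in> carrier V \<Longrightarrow> w \<in> carrier V \<Longrightarrow> f (v \<oplus>\<^bsub>V\<^esub> w) = f v \<oplus>\<^bsub>W\<^esub> f w"
    and "\<And>c v. v \<in> carrier V \<Longrightarrow> f (c \<odot>\<^bsub>V\<^esub> v) = c \<odot>\<^bsub>W\<^esub> f v"
  shows "lin V W f"
  using assms vspace_module[OF assms(1)] vspace_module[OF assms(2)]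
  by (auto simp: linear_map_def mod_hom_def mod_hom_axioms_def module_hom_def)

lemma lin_vspace:
  assumes "lin V W f" shows "vspace V" "vspace W"
  using assms by (auto simp: linear_map_def)

lemma lin_closed: "lin V W f \<Longrightarrow> v \<in> carrier V \<Longrightarrow> f v \<in> carrier W"
  by (auto simp: linear_map_def mod_hom_def mod_hom_axioms_def module_hom_def)

lemma lin_add: "lin V W f \<Longrightarrow> v \<in> carrier V \<Longrightarrow> w \<in> carrier V \<Longrightarrow> f (v \<oplus>\<^bsub>V\<^esub> w) = f v \<oplus>\<^bsub>W\<^esub> f w"
  by (auto simp: linear_map_def mod_hom_def mod_hom_axioms_def module_hom_def)

lemma lin_smult: "lin V W f \<Longrightarrow> v \<in> carrier V \<Longrightarrow> f (c \<odot>\<^bsub>V\<^esub> v) = c \<odot>\<^bsub>W\<^esub> f v"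
  by (auto simp: linear_map_def mod_hom_def mod_hom_axioms_def module_hom_def class_ring_simps)

lemma lin_zero:
  assumes "lin V W f" shows "f \<zero>\<^bsub>V\<^esub> = \<zero>\<^bsub>W\<^esub>"
  using assms mod_hom.f0_is_0 linear_map.axioms(3) by metis

lemma lin_minus:
  assumes "lin V W f" "v \<in> carrier V" "w \<in> carrier V"
  shows "f (v \<ominus>\<^bsub>V\<^esub> w) = f v \<ominus>\<^bsub>W\<^esub> f w"
  using assms mod_hom.f_minus linear_map.axioms(3) by metis

lemma lin_finsum:
  assumes "lin V W f" "finite A" "g \<in> A \<rightarrow> carrier V"
  shows "f (finsum V g A) = finsum W (\<lambda>a. f (g a)) A"
  using assms(2,3)
proof induction
  case empty
  have "abelian_monoid V" "abelian_monoid W"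
    using lin_vspace[OF assms(1)] vspace_abelian_group abelian_group.axioms(1) by blast+
  then show ?case
    using lin_zero[OF assms(1)] by (simp add: abelian_monoid.finsum_empty)
next
  case (insert x F)
  have am: "abelian_monoid V" "abelian_monoid W"
    using lin_vspace[OF assms(1)] vspace_abelian_group abelian_group.axioms(1) by blast+
  have gF: "g \<in> F \<rightarrow> carrier V" "g x \<in> carrier V"
    using insert by auto
  have "finsum V g (insert x F) = g x \<oplus>\<^bsub>V\<^esub> finsum V g F"
    by (rule abelian_monoid.finsum_insert[OF am(1)]) (use insert gF in auto)
  moreover have "finsum W (\<lambda>a. f (g a)) (insert x F) = f (g x) \<oplus>\<^bsub>W\<^esub> finsum W (\<lambda>a. f (g a)) F"
    by (rule abelian_monoid.finsum_insert[OF am(2)]) (use insert gF lin_closed[OF assms(1)] in auto)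
  moreover have "finsum V g F \<in> carrier V"
    by (rule abelian_monoid.finsum_closed[OF am(1) gF(1)])
  ultimately show ?case
    using insert.IH[OF gF(1)] lin_add[OF assms(1) gF(2)] by simp
qed

text \<open>Maps are total functions constrained only on the carrier. Linearity must therefore pass
  to any function that agrees there, such as an action computed from a chosen
  representative.\<close>

lemma lin_cong:
  assumes "lin V W f" "\<And>v. v \<in> carrier V \<Longrightarrow> f v = g v"
  shows "lin V W g"
proof -
  note V = lin_vspace[OF assms(1)]
  show ?thesis
    by (rule linI)
      (use assms V lin_closed[OF assms(1)] lin_add[OF assms(1)] lin_smult[OF assms(1)]
        vs_closed[OF V(1)] in \<open>auto simp flip: assms(2)\<close>)
qed

lemma lin_comp:
  assumes "lin U V f" "lin V W g"
  shows "lin U W (\<lambda>x. g (f x))"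
  by (rule linI) (use lin_vspace assms in \<open>auto simp: lin_closed[OF assms(1)] lin_closed[OF assms(2)]
      lin_add[OF assms(1)] lin_add[OF assms(2)] lin_smult[OF assms(1)] lin_smult[OF assms(2)]\<close>)

section \<open>Subspaces, dimension and exactness\<close>

lemma subspaceI:
  fixes V :: "('k::field, 'v) module"
  assumes "vspace V" "W \<subseteq> carrier V" "\<zero>\<^bsub>V\<^esub> \<in> W"
    "\<And>x y. x \<in> W \<Longrightarrow> y \<in> W \<Longrightarrow> x \<oplus>\<^bsub>V\<^esub> y \<in> W" "\<And>c x. x \<in> W \<Longrightarrow> c \<odot>\<^bsub>V\<^esub> x \<in> W"
  shows "subspace class_ring W V"
  using assms vspace_module[OF assms(1)] by (auto simp: subspace_def submodule_def)

lemma subspaceD: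
  fixes V :: "('k::field, 'v) module"
  assumes "subspace class_ring W V"
  shows "vspace V" "W \<subseteq> carrier V" "\<zero>\<^bsub>V\<^esub> \<in> W"
    "\<And>x y. x \<in> W \<Longrightarrow> y \<in> W \<Longrightarrow> x \<oplus>\<^bsub>V\<^esub> y \<in> W" "\<And>c x. x \<in> W \<Longrightarrow> c \<odot>\<^bsub>V\<^esub> x \<in> W"
    "\<And>x y. x \<in> W \<Longrightarrow> y \<in> W \<Longrightarrow> x \<ominus>\<^bsub>V\<^esub> y \<in> W"
proof -
  show 1: "vspace V" "W \<subseteq> carrier V" "\<zero>\<^bsub>V\<^esub> \<in> W"
    "\<And>x y. x \<in> W \<Longrightarrow> y \<in> W \<Longrightarrow> x \<oplus>\<^bsub>V\<^esub> y \<in> W" "\<And>c x. x \<in> W \<Longrightarrow> c \<odot>\<^bsub>V\<^esub> x \<in> W"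
    using assms by (auto simp: subspace_def submodule_def class_ring_simps)
  show "\<And>x y. x \<in> W \<Longrightarrow> y \<in> W \<Longrightarrow> x \<ominus>\<^bsub>V\<^esub> y \<in> W"
    using 1 vs_laws(7)[OF 1(1)] by (simp add: a_minus_def subset_iff)
qed

lemma subspace_vspace: "subspace class_ring W V \<Longrightarrow> vspace (V\<lparr>carrier := W\<rparr>)"
  by (simp add: subspaceD(1) vectorspace.subspace_is_vs)

text \<open>\<open>findim\<close> asks for a finite generating set, which does not restrict to
  subspaces. Independent subsets of W are independent in V, so their size is at most dim V, and a
  maximal one generates W.\<close>

lemma findim_subspace:
  assumes V: "findim V" and W: "subspace class_ring W V"
  shows "findim (V\<lparr>carrier := W\<rparr>)"
proof -
  interpret V: vectorspace class_ring V using subspaceD(1)[OF W] .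
  interpret W: vectorspace class_ring "V\<lparr>carrier := W\<rparr>" using subspace_vspace[OF W] .
  have sm: "submodule class_ring W V"
    using W by (simp add: subspace_def)
  have *: "finite A \<and> card A \<le> V.dim" if "A \<subseteq> carrier (V\<lparr>carrier := W\<rparr>) \<and> W.lin_indpt A" for A
  proof -
    have A: "A \<subseteq> W" "A \<subseteq> carrier V"
      using that subspaceD(2)[OF W] by auto
    then have "V.lin_indpt A"
      using V.span_li_not_depend(2)[OF A(1) sm] that by simp
    then show ?thesis
      using V.li_le_dim[OF V A(2)] by auto
  qed
  have "W.lin_indpt {}"
    by (simp add: W.lin_dep_def)
  then obtain A where "finite A" "VectorSpace.maximal A (\<lambda>S. S \<subseteq> carrier (V\<lparr>carrier := W\<rparr>) \<and> W.lin_indpt S)"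
    using VectorSpace.maximal_exists[where P = "\<lambda>S. S \<subseteq> carrier (V\<lparr>carrier := W\<rparr>) \<and> W.lin_indpt S"
        and N = V.dim and B = "{}"] * by blast
  then show ?thesis
    using W.max_li_is_gen unfolding W.fin_dim_def VectorSpace.maximal_def by blast
qed

lemma chosen_basis:
  assumes "vspace V" "findim V"
  shows "distinct (chosen_basis V)" "vectorspace.basis class_ring V (set (chosen_basis V))"
proof -
  obtain B where B: "finite B" "vectorspace.basis class_ring V B"
    using vectorspace.finite_basis_exists[OF assms] by auto
  then obtain bs where "distinct bs" "set bs = B"
    using finite_distinct_list by blast
  then have "\<exists>bs. distinct bs \<and> vectorspace.basis class_ring V (set bs)"
    using B by blast
  then show "distinct (chosen_basis V)" "vectorspace.basis class_ring V (set (chosen_basis V))"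
    unfolding chosen_basis_def by (metis (mono_tags, lifting) someI_ex)+
qed

lemma vdim_eq_dim:
  assumes "vspace V" "findim V"
  shows "vdim V = vectorspace.dim class_ring V"
  using vectorspace.dim_basis[OF assms(1) _ chosen_basis(2)[OF assms]] chosen_basis(1)[OF assms]
  by (simp add: vdim_def distinct_card)

lemma findim_surj:
  assumes "lin V W f" "findim V" "f ` carrier V = carrier W"
  shows "findim W"
  using linear_map.rank_nullity_main(2)[OF assms(1,2,3)] .

text \<open>The image is a subspace of W, hence finite-dimensional, and the inverse of f maps it
  onto V.\<close>

lemma findim_inj:
  assumes f: "lin V W f" and W: "findim W" and inj: "inj_on f (carrier V)"
  shows "findim V"
proof -
  note vs = lin_vspace[OF f]
  let ?I = "W\<lparr>carrier := f ` carrier V\<rparr>"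
  have sub: "subspace class_ring (f ` carrier V) W"
  proof (rule subspaceI[OF vs(2)])
    show "f ` carrier V \<subseteq> carrier W"
      using lin_closed[OF f] by auto
    show "\<zero>\<^bsub>W\<^esub> \<in> f ` carrier V"
      using lin_zero[OF f] vs_closed(1)[OF vs(1)] by force
    show "x \<oplus>\<^bsub>W\<^esub> y \<in> f ` carrier V" if "x \<in> f ` carrier V" "y \<in> f ` carrier V" for x y
      using that lin_add[OF f] vs_closed(2)[OF vs(1)] by force
    show "c \<odot>\<^bsub>W\<^esub> x \<in> f ` carrier V" if "x \<in> f ` carrier V" for c x
      using that vs_closed(5)[OF vs(1)] by (force simp flip: lin_smult[OF f])
  qed
  let ?g = "the_inv_into (carrier V) f"
  have g: "?g (f v) = v" if "v \<in> carrier V" for v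
    using inj that by (rule the_inv_into_f_f)
  have "lin ?I V ?g"
  proof (rule linI[OF subspace_vspace[OF sub] vs(1)])
    show "?g v \<in> carrier V" if "v \<in> carrier ?I" for v
      using that g by auto
    show "?g (v \<oplus>\<^bsub>?I\<^esub> w) = ?g v \<oplus>\<^bsub>V\<^esub> ?g w" if "v \<in> carrier ?I" "w \<in> carrier ?I" for v w
      using that g vs_closed(2)[OF vs(1)] by (auto simp flip: lin_add[OF f])
    show "?g (c \<odot>\<^bsub>?I\<^esub> v) = c \<odot>\<^bsub>V\<^esub> ?g v" if "v \<in> carrier ?I" for c v
      using that g vs_closed(5)[OF vs(1)] by (auto simp flip: lin_smult[OF f])
  qed
  moreover have "?g ` carrier ?I = carrier V"
    using g by (auto simp: image_image)
  ultimately show ?thesis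
    using findim_surj findim_subspace[OF W sub] by blast
qed

lemma kernel_vdim:
  assumes f: "lin V W f" and V: "findim V" and surj: "f ` carrier V = carrier W"
  shows "vdim V = vdim W + vdim (V\<lparr>carrier := {v \<in> carrier V. f v = \<zero>\<^bsub>W\<^esub>}\<rparr>)"
    "subspace class_ring {v \<in> carrier V. f v = \<zero>\<^bsub>W\<^esub>} V"
proof -
  interpret linear_map class_ring V W f by fact
  have k: "kerT = {v \<in> carrier V. f v = \<zero>\<^bsub>W\<^esub>}"
    by (auto simp: ker_def)
  have i: "imT = carrier W"
    using surj by (simp add: im_def)
  show s: "subspace class_ring {v \<in> carrier V. f v = \<zero>\<^bsub>W\<^esub>} V"
    using kerT_is_subspace k by simp
  have "vectorspace.dim class_ring W + vectorspace.dim class_ring (V\<lparr>carrier := {v \<in> carrier V. f v = \<zero>\<^bsub>W\<^esub>}\<rparr>)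
    = vectorspace.dim class_ring V"
    using rank_nullity[OF V] by (simp add: k i)
  then show "vdim V = vdim W + vdim (V\<lparr>carrier := {v \<in> carrier V. f v = \<zero>\<^bsub>W\<^esub>}\<rparr>)"
    using vdim_eq_dim[OF V.vectorspace_axioms V] vdim_eq_dim[OF W.vectorspace_axioms findim_surj[OF assms]]
      vdim_eq_dim[OF subspace_vspace[OF s] findim_subspace[OF V s]] by simp
qed

lemma vdim_iso:
  assumes f: "lin V W f" and V: "findim V" and bij: "bij_betw f (carrier V) (carrier W)"
  shows "vdim V = vdim W"
proof -
  have "f ` carrier V = carrier W"
    using bij by (simp add: bij_betw_def)
  moreover have "vectorspace.dim class_ring V = vectorspace.dim class_ring W"
    using linear_map.dim_eq[OF f V] bij by (simp add: bij_betw_def)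
  ultimately show ?thesis
    using vdim_eq_dim findim_surj[OF f V] V lin_vspace[OF f] by metis
qed

text \<open>Since h identifies L with the kernel of g, this is rank-nullity. It is the additivity
  that makes dimensions well defined on the Grothendieck group of modules.\<close>

lemma vdim_exact:
  assumes h: "lin L M h" and g: "lin M N g" and M: "findim M"
    and inj: "inj_on h (carrier L)" and surj: "g ` carrier M = carrier N"
    and ex: "h ` carrier L = {v \<in> carrier M. g v = \<zero>\<^bsub>N\<^esub>}"
  shows "vdim M = vdim L + vdim N"
proof -
  let ?K = "M\<lparr>carrier := {v \<in> carrier M. g v = \<zero>\<^bsub>N\<^esub>}\<rparr>"
  note k = kernel_vdim[OF g M surj]
  have "lin L ?K h"
    by (rule linI) (use h lin_vspace[OF h] subspace_vspace[OF k(2)] ex in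
      \<open>auto simp: lin_add lin_smult intro: lin_closed\<close>)
  then have "vdim L = vdim ?K"
    using vdim_iso[of L ?K h] findim_inj[OF h M inj] inj ex by (simp add: bij_betw_def)
  then show ?thesis
    using k(1) by simp
qed

lemma vdim_zero_iff:
  assumes "vspace V" "findim V"
  shows "vdim V = 0 \<longleftrightarrow> carrier V = {\<zero>\<^bsub>V\<^esub>}"
proof -
  interpret vectorspace class_ring V by fact
  have b: "basis (set (chosen_basis V))"
    using chosen_basis[OF assms] by simp
  show ?thesis
  proof
    assume "vdim V = 0"
    then have "span {} = carrier V"
      using b by (simp add: vdim_def basis_def)
    then show "carrier V = {\<zero>\<^bsub>V\<^esub>}"
      using span_empty by simp
  next
    assume c: "carrier V = {\<zero>\<^bsub>V\<^esub>}"
    have "\<zero>\<^bsub>V\<^esub> \<notin> set (chosen_basis V)"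
      using b vs_zero_lin_dep by (auto simp: basis_def)
    moreover have "set (chosen_basis V) \<subseteq> {\<zero>\<^bsub>V\<^esub>}"
      using b c by (auto simp: basis_def)
    ultimately have "set (chosen_basis V) = {}"
      by (metis subset_singletonD insertI1)
    then show "vdim V = 0"
      by (simp add: vdim_def)
  qed
qed

lemma vdim_subspace_le:
  assumes "findim V" "subspace class_ring W V"
  shows "vdim (V\<lparr>carrier := W\<rparr>) \<le> vdim V"
  using vectorspace.subspace_dim[OF subspaceD(1)[OF assms(2)] assms(2,1) findim_subspace[OF assms]]
    vdim_eq_dim[OF subspaceD(1)[OF assms(2)] assms(1)]
    vdim_eq_dim[OF subspace_vspace[OF assms(2)] findim_subspace[OF assms]] by simp

text \<open>A basis of W stays independent in V and has dim V elements, so it spans V.\<close>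

lemma vdim_subspace_eq:
  assumes V: "findim V" and W: "subspace class_ring W V" and eq: "vdim (V\<lparr>carrier := W\<rparr>) = vdim V"
  shows "W = carrier V"
proof -
  interpret V: vectorspace class_ring V using subspaceD(1)[OF W] .
  interpret W: vectorspace class_ring "V\<lparr>carrier := W\<rparr>" using subspace_vspace[OF W] .
  let ?B = "set (chosen_basis (V\<lparr>carrier := W\<rparr>))"
  have fW: "W.fin_dim"
    by (rule findim_subspace[OF V W])
  have b: "W.basis ?B" "distinct (chosen_basis (V\<lparr>carrier := W\<rparr>))"
    using chosen_basis[OF W.vectorspace_axioms fW] by auto
  have sm: "submodule class_ring W V"
    using W by (simp add: subspace_def)
  have B: "?B \<subseteq> W" "?B \<subseteq> carrier V"
    using b subspaceD(2)[OF W] by (auto simp: W.basis_def)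
  have "V.lin_indpt ?B"
    using V.span_li_not_depend(2)[OF B(1) sm] b by (simp add: W.basis_def)
  moreover have "card ?B = V.dim"
    using eq vdim_eq_dim[OF V.vectorspace_axioms V] distinct_card[OF b(2)] by (simp add: vdim_def)
  ultimately have "V.basis ?B"
    using V.dim_li_is_basis[OF V] B by auto
  then have "carrier V = W.span ?B"
    using V.span_li_not_depend(1)[OF B(1) sm] by (simp add: V.basis_def)
  also have "\<dots> = W"
    using b by (simp add: W.basis_def)
  finally show ?thesis by simp
qed

section \<open>Coordinates with respect to a chosen basis\<close>

lemma vspace_vec: "vspace (module_vec TYPE('k::field) n)"
  by (rule vec_vs)

lemma findim_vec: "findim (module_vec TYPE('k::field) n)"
  by (rule vec_space.fin_dim)

lemma vdim_vec: "vdim (module_vec TYPE('k::field) n) = n"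
  using vdim_eq_dim[OF vspace_vec findim_vec] vec_space.dim_is_n[where ?'a = 'k] by metis

text \<open>The linear combination that occurs inside the definite description of
  \<open>coords\<close>. Being explicit, it is the easier one of the two to prove linear and
  bijective; \<open>coords\<close> is then its inverse.\<close>

definition comb :: "('k::field, 'v) module \<Rightarrow> 'k vec \<Rightarrow> 'v" where
  "comb V c = finsum V (\<lambda>i. (c $ i) \<odot>\<^bsub>V\<^esub> (chosen_basis V ! i)) {..<vdim V}"

context
  fixes V :: "('k::field, 'v) module"
  assumes V: "vspace V" and fd: "findim V"
begin

interpretation V: vectorspace class_ring V by (rule V)

lemma chosen_basis_in: "i < vdim V \<Longrightarrow> chosen_basis V ! i \<in> carrier V"
  using chosen_basis(2)[OF V fd] by (auto simp: V.basis_def vdim_def)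

lemma lin_comb_map: "lin (module_vec TYPE('k) (vdim V)) V (comb V)"
proof (rule linI[OF vspace_vec V])
  let ?M = "module_vec TYPE('k) (vdim V)"
  have t: "(\<lambda>i. (c $ i) \<odot>\<^bsub>V\<^esub> (chosen_basis V ! i)) \<in> {..<vdim V} \<rightarrow> carrier V" for c
    using chosen_basis_in vs_closed(5)[OF V] by auto
  show "comb V c \<in> carrier V" for c
    unfolding comb_def using t by (rule V.M.finsum_closed)
  show "comb V (c \<oplus>\<^bsub>?M\<^esub> d) = comb V c \<oplus>\<^bsub>V\<^esub> comb V d" if "c \<in> carrier ?M" "d \<in> carrier ?M" for c d
  proof -
    have "comb V (c \<oplus>\<^bsub>?M\<^esub> d) =
      finsum V (\<lambda>i. (c $ i) \<odot>\<^bsub>V\<^esub> (chosen_basis V ! i) \<oplus>\<^bsub>V\<^esub> (d $ i) \<odot>\<^bsub>V\<^esub> (chosen_basis V ! i)) {..<vdim V}"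
      unfolding comb_def
      by (rule V.M.finsum_cong') (use that chosen_basis_in vs_closed[OF V] in
          \<open>auto simp: module_vec_simps vs_smult_laws[OF V]\<close>)
    then show ?thesis
      using V.M.finsum_addf[OF t[of c] t[of d]] by (simp add: comb_def)
  qed
  show "comb V (a \<odot>\<^bsub>?M\<^esub> c) = a \<odot>\<^bsub>V\<^esub> comb V c" if "c \<in> carrier ?M" for a c
  proof -
    have "comb V (a \<odot>\<^bsub>?M\<^esub> c) = finsum V (\<lambda>i. a \<odot>\<^bsub>V\<^esub> ((c $ i) \<odot>\<^bsub>V\<^esub> (chosen_basis V ! i))) {..<vdim V}"
      unfolding comb_def
      by (rule V.M.finsum_cong') (use that chosen_basis_in vs_closed[OF V] in
          \<open>auto simp: module_vec_simps vs_smult_laws[OF V]\<close>)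
    also have "\<dots> = a \<odot>\<^bsub>V\<^esub> comb V c"
      unfolding comb_def using V.finsum_smult[OF _ t[of c], of a] by (simp add: class_ring_simps)
    finally show ?thesis .
  qed
qed

lemma comb_bij: "bij_betw (comb V) (carrier_vec (vdim V)) (carrier V)"
proof -
  let ?bs = "chosen_basis V" and ?n = "vdim V"
  have d: "distinct ?bs" and b: "V.basis (set ?bs)"
    using chosen_basis[OF V fd] by auto
  have n: "?n = length ?bs" by (simp add: vdim_def)
  have bij: "bij_betw (\<lambda>i. ?bs ! i) {..<?n} (set ?bs)"
    using bij_betw_nth[OF d] n by auto
  \<comment> \<open>\<open>lincomb\<close> attaches coefficients to basis vectors,
    \<open>comb\<close> to positions in the list; distinctness of the list translates one into the
    other.\<close>
  have lc: "comb V c = V.lincomb (\<lambda>b. c $ (the_inv_into {..<?n} (\<lambda>i. ?bs ! i) b)) (set ?bs)" for c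
  proof -
    have inj: "inj_on (\<lambda>i. ?bs ! i) {..<?n}" and im: "set ?bs = (\<lambda>i. ?bs ! i) ` {..<?n}"
      using bij by (auto simp: bij_betw_def)
    have "V.lincomb (\<lambda>b. c $ (the_inv_into {..<?n} (\<lambda>i. ?bs ! i) b)) (set ?bs) =
      finsum V (\<lambda>i. (c $ (the_inv_into {..<?n} (\<lambda>i. ?bs ! i) (?bs ! i))) \<odot>\<^bsub>V\<^esub> (?bs ! i)) {..<?n}"
      unfolding V.lincomb_def
      by (subst im, rule V.M.finsum_reindex[OF _ inj])
        (use chosen_basis_in vs_closed(5)[OF V] in auto)
    also have "\<dots> = comb V c"
      unfolding comb_def
      by (rule V.M.finsum_cong') (use chosen_basis_in vs_closed(5)[OF V] the_inv_into_f_f[OF inj] in auto)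
    finally show ?thesis by simp
  qed
  show ?thesis
    unfolding bij_betw_def
  proof
    show "inj_on (comb V) (carrier_vec ?n)"
    proof (rule inj_onI)
      fix c c' assume c: "c \<in> carrier_vec ?n" "c' \<in> carrier_vec ?n" and eq: "comb V c = comb V c'"
      have "comb V (c - c') = \<zero>\<^bsub>V\<^esub>"
      proof -
        have cc: "comb V (c - c') \<oplus>\<^bsub>V\<^esub> comb V c' = comb V c"
        proof -
          have "c - c' + c' = c"
            using c by (intro eq_vecI) auto
          then show ?thesis
            using lin_add[OF lin_comb_map, of "c - c'" c'] c by (simp add: module_vec_simps)
        qed
        have "comb V (c - c') \<in> carrier V" "comb V c' \<in> carrier V"
          using lin_closed[OF lin_comb_map] c by (simp_all add: module_vec_simps)
        then have "comb V (c - c') = comb V c \<ominus>\<^bsub>V\<^esub> comb V c'"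
          using cc vs_laws(10)[OF V] by metis
        then show ?thesis
          using eq c vs_laws(3)[OF V] lin_closed[OF lin_comb_map] by (simp add: module_vec_simps)
      qed
      then have z: "V.lincomb (\<lambda>b. (c - c') $ (the_inv_into {..<?n} (\<lambda>i. ?bs ! i) b)) (set ?bs) = \<zero>\<^bsub>V\<^esub>"
        using lc by simp
      have "(c - c') $ i = 0" if "i < ?n" for i
      proof (rule ccontr)
        assume "(c - c') $ i \<noteq> 0"
        moreover have "the_inv_into {..<?n} (\<lambda>i. ?bs ! i) (?bs ! i) = i"
          using that bij by (auto simp: bij_betw_def intro: the_inv_into_f_f)
        moreover have "?bs ! i \<in> set ?bs" using that n by simp
        ultimately have "V.lin_dep (set ?bs)"
          by (intro V.lin_dep_crit[OF _ order_refl _ _ _ z, of "?bs ! i"]) (auto simp: class_ring_simps)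
        then show False using b by (simp add: V.basis_def)
      qed
      then show "c = c'"
        using c by (intro eq_vecI) auto
    qed
    show "comb V ` carrier_vec ?n = carrier V"
    proof
      show "comb V ` carrier_vec ?n \<subseteq> carrier V"
        using lin_closed[OF lin_comb_map] by (auto simp: module_vec_simps)
      show "carrier V \<subseteq> comb V ` carrier_vec ?n"
      proof
        fix v assume v: "v \<in> carrier V"
        have bs: "set ?bs \<subseteq> carrier V" "V.span (set ?bs) = carrier V"
          using b unfolding V.basis_def by blast+
        obtain a where a: "V.lincomb a (set ?bs) = v"
          using V.finite_in_span[OF _ bs(1), of v] v bs(2) by blast
        let ?c = "vec ?n (\<lambda>i. a (?bs ! i))"
        have "comb V ?c = V.lincomb a (set ?bs)"
          unfolding lc V.lincomb_def
        proof (rule V.M.finsum_cong')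
          show "?c $ (the_inv_into {..<?n} (\<lambda>i. ?bs ! i) i) \<odot>\<^bsub>V\<^esub> i = a i \<odot>\<^bsub>V\<^esub> i" if i: "i \<in> set ?bs" for i
          proof -
            obtain j where "j < ?n" "i = ?bs ! j" using i n by (auto simp: in_set_conv_nth)
            moreover from this have "the_inv_into {..<?n} (\<lambda>i. ?bs ! i) i = j"
              using bij by (auto simp: bij_betw_def intro: the_inv_into_f_f)
            ultimately show ?thesis by simp
          qed
          show "(\<lambda>v. a v \<odot>\<^bsub>V\<^esub> v) \<in> set ?bs \<rightarrow> carrier V"
            using bs(1) vs_closed(5)[OF V] by auto
        qed simp
        then show "v \<in> comb V ` carrier_vec ?n" using a by (metis vec_carrier image_eqI)
      qed
    qed
  qed
qed

lemma coords:
  assumes "v \<in> carrier V"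
  shows "coords V v \<in> carrier_vec (vdim V)" "comb V (coords V v) = v"
proof -
  have "\<exists>!c. c \<in> carrier_vec (vdim V) \<and> v = comb V c"
  proof (rule ex_ex1I)
    have "v \<in> comb V ` carrier_vec (vdim V)"
      using comb_bij assms by (simp add: bij_betw_def)
    then show "\<exists>c. c \<in> carrier_vec (vdim V) \<and> v = comb V c"
      by blast
    show "c = d" if "c \<in> carrier_vec (vdim V) \<and> v = comb V c" "d \<in> carrier_vec (vdim V) \<and> v = comb V d" for c d
      using bij_betw_imp_inj_on[OF comb_bij] that by (auto dest: inj_onD)
  qed
  then have "coords V v \<in> carrier_vec (vdim V) \<and> v = comb V (coords V v)"
    unfolding coords_def comb_def by (rule theI')
  then show "coords V v \<in> carrier_vec (vdim V)" "comb V (coords V v) = v" by auto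
qed

lemma comb_inj: "c \<in> carrier_vec (vdim V) \<Longrightarrow> d \<in> carrier_vec (vdim V) \<Longrightarrow> comb V c = comb V d \<Longrightarrow> c = d"
  using comb_bij by (auto simp: bij_betw_def inj_on_def)

end

text \<open>This justifies the matrices in \<open>base_change\<close>: their columns are the
  coordinates of the images of the basis vectors. Both sides unfold to double sums, and the proof
  exchanges the order of summation.\<close>

lemma matrix_of_lin:
  fixes V :: "('k::field, 'v) module" and W :: "('k, 'w) module"
  assumes f: "lin V W f" and V: "findim V" and W: "findim W" and c: "c \<in> carrier_vec (vdim V)"
  shows "comb W (mat (vdim W) (vdim V) (\<lambda>(i, j). coords W (f (chosen_basis V ! j)) $ i) *\<^sub>v c) = f (comb V c)"
proof -
  note vs = lin_vspace[OF f]
  interpret W: vectorspace class_ring W by (rule vs)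
  let ?A = "mat (vdim W) (vdim V) (\<lambda>(i, j). coords W (f (chosen_basis V ! j)) $ i)"
  let ?w = "\<lambda>j. f (chosen_basis V ! j)"
  let ?b = "\<lambda>i. chosen_basis W ! i"
  have w: "?w j \<in> carrier W" if "j < vdim V" for j
    using lin_closed[OF f] chosen_basis_in[OF vs(1) V that] by simp
  have b: "?b i \<in> carrier W" if "i < vdim W" for i
    using chosen_basis_in[OF vs(2) W that] by simp
  have d: "dim_vec c = vdim V" using c by simp
  have "comb W (?A *\<^sub>v c) = finsum W (\<lambda>i. (\<Sum>j<vdim V. coords W (?w j) $ i * c $ j) \<odot>\<^bsub>W\<^esub> ?b i) {..<vdim W}"
    unfolding comb_def
    by (rule W.M.finsum_cong') (use b vs_closed(5)[OF vs(2)] d in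
        \<open>auto simp: scalar_prod_def atLeast0LessThan\<close>)
  also have "\<dots> = finsum W (\<lambda>i. finsum W (\<lambda>j. (coords W (?w j) $ i * c $ j) \<odot>\<^bsub>W\<^esub> ?b i) {..<vdim V}) {..<vdim W}"
  proof (rule W.M.finsum_cong')
    show "(\<Sum>j<vdim V. coords W (?w j) $ i * c $ j) \<odot>\<^bsub>W\<^esub> ?b i =
        finsum W (\<lambda>j. (coords W (?w j) $ i * c $ j) \<odot>\<^bsub>W\<^esub> ?b i) {..<vdim V}" if "i \<in> {..<vdim W}" for i
    proof -
      have "(\<Sum>j\<in>A. g j) \<odot>\<^bsub>W\<^esub> ?b i = finsum W (\<lambda>j. g j \<odot>\<^bsub>W\<^esub> ?b i) A" if A: "finite A" for A and g :: "nat \<Rightarrow> 'k"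
        using A
      proof induction
        case empty
        then show ?case using vs_laws(5)[OF vs(2) b] \<open>i \<in> {..<vdim W}\<close> by simp
      next
        case (insert x F)
        have "finsum W (\<lambda>j. g j \<odot>\<^bsub>W\<^esub> ?b i) (insert x F) = g x \<odot>\<^bsub>W\<^esub> ?b i \<oplus>\<^bsub>W\<^esub> finsum W (\<lambda>j. g j \<odot>\<^bsub>W\<^esub> ?b i) F"
          by (rule W.M.finsum_insert) (use insert b \<open>i \<in> {..<vdim W}\<close> vs_closed(5)[OF vs(2)] in auto)
        then show ?case
          using insert b \<open>i \<in> {..<vdim W}\<close> by (simp add: vs_smult_laws[OF vs(2)])
      qed
      then show ?thesis by simp
    qed
  qed (use b vs_closed(5)[OF vs(2)] in \<open>auto intro!: W.M.finsum_closed\<close>)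
  also have "\<dots> = finsum W (\<lambda>j. finsum W (\<lambda>i. (coords W (?w j) $ i * c $ j) \<odot>\<^bsub>W\<^esub> ?b i) {..<vdim W}) {..<vdim V}"
  proof -
    have swap: "finsum W (\<lambda>i. finsum W (\<lambda>j. g i j) {..<m}) {..<n} = finsum W (\<lambda>j. finsum W (\<lambda>i. g i j) {..<n}) {..<m}"
      if "\<And>i j. i < n \<Longrightarrow> j < m \<Longrightarrow> g i j \<in> carrier W" for g and n m :: nat
      using that
    proof (induction n)
      case 0
      have "finsum W (\<lambda>j. \<zero>\<^bsub>W\<^esub>) {..<m} = \<zero>\<^bsub>W\<^esub>" by simp
      then show ?case by simp
    next
      case (Suc n)
      have "finsum W (\<lambda>i. finsum W (g i) {..<m}) {..<Suc n} =
          finsum W (g n) {..<m} \<oplus>\<^bsub>W\<^esub> finsum W (\<lambda>i. finsum W (g i) {..<m}) {..<n}"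
        unfolding lessThan_Suc
        by (rule W.M.finsum_insert) (use Suc.prems in \<open>auto intro!: W.M.finsum_closed\<close>)
      also have "\<dots> = finsum W (g n) {..<m} \<oplus>\<^bsub>W\<^esub> finsum W (\<lambda>j. finsum W (\<lambda>i. g i j) {..<n}) {..<m}"
        using Suc by simp
      also have "\<dots> = finsum W (\<lambda>j. g n j \<oplus>\<^bsub>W\<^esub> finsum W (\<lambda>i. g i j) {..<n}) {..<m}"
        by (rule W.M.finsum_addf[symmetric]) (use Suc.prems in \<open>auto intro!: W.M.finsum_closed\<close>)
      also have "\<dots> = finsum W (\<lambda>j. finsum W (\<lambda>i. g i j) {..<Suc n}) {..<m}"
        by (rule W.M.finsum_cong') (use Suc.prems in
            \<open>auto simp: lessThan_Suc intro!: W.M.finsum_closed W.M.finsum_insert[symmetric]\<close>)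
      finally show ?case .
    qed
    show ?thesis
      by (rule swap) (rule vs_closed(5)[OF vs(2) b])
  qed
  also have "\<dots> = finsum W (\<lambda>j. (c $ j) \<odot>\<^bsub>W\<^esub> ?w j) {..<vdim V}"
  proof (rule W.M.finsum_cong')
    show "finsum W (\<lambda>i. (coords W (?w j) $ i * c $ j) \<odot>\<^bsub>W\<^esub> ?b i) {..<vdim W} = (c $ j) \<odot>\<^bsub>W\<^esub> ?w j"
      if j: "j \<in> {..<vdim V}" for j
    proof -
      have "finsum W (\<lambda>i. (coords W (?w j) $ i * c $ j) \<odot>\<^bsub>W\<^esub> ?b i) {..<vdim W} =
        finsum W (\<lambda>i. (c $ j) \<odot>\<^bsub>W\<^esub> ((coords W (?w j) $ i) \<odot>\<^bsub>W\<^esub> ?b i)) {..<vdim W}"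
        by (rule W.M.finsum_cong') (use b vs_closed(5)[OF vs(2)] in
            \<open>auto simp: vs_smult_laws(2)[OF vs(2), symmetric] mult.commute\<close>)
      also have "\<dots> = (c $ j) \<odot>\<^bsub>W\<^esub> comb W (coords W (?w j))"
        unfolding comb_def
        using W.finsum_smult[of "c $ j" "\<lambda>i. (coords W (?w j) $ i) \<odot>\<^bsub>W\<^esub> ?b i" "{..<vdim W}"]
          b vs_closed(5)[OF vs(2)] by (simp add: class_ring_simps Pi_def)
      finally show ?thesis
        using coords(2)[OF vs(2) W w] j by simp
    qed
  qed (use w vs_closed(5)[OF vs(2)] in auto)
  also have "\<dots> = finsum W (\<lambda>j. f ((c $ j) \<odot>\<^bsub>V\<^esub> (chosen_basis V ! j))) {..<vdim V}"
    by (rule W.M.finsum_cong') (use chosen_basis_in[OF vs(1) V] lin_closed[OF f] lin_smult[OF f]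
        vs_closed(5)[OF vs(1)] in auto)
  also have "\<dots> = f (comb V c)"
    unfolding comb_def
    by (rule lin_finsum[OF f, symmetric]) (use chosen_basis_in[OF vs(1) V] vs_closed(5)[OF vs(1)] in auto)
  finally show ?thesis .
qed

section \<open>Grothendieck groups\<close>

lemma K0_gens_in:
  assumes "R \<subseteq> S \<times> S \<times> S"
  shows "{frag_of Y - frag_of X - frag_of Z | X Y Z. (X, Y, Z) \<in> R} \<subseteq> carrier (free_Abelian_group S)"
proof
  fix c assume "c \<in> {frag_of Y - frag_of X - frag_of Z | X Y Z. (X, Y, Z) \<in> R}"
  then obtain X Y Z where c: "c = frag_of Y - frag_of X - frag_of Z" "X \<in> S" "Y \<in> S" "Z \<in> S"
    using assms by auto
  have "Poly_Mapping.keys c \<subseteq> Poly_Mapping.keys (frag_of Y - frag_of X) \<union> Poly_Mapping.keys (frag_of Z)"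
    unfolding c by (rule keys_diff)
  also have "\<dots> \<subseteq> (Poly_Mapping.keys (frag_of Y) \<union> Poly_Mapping.keys (frag_of X)) \<union> Poly_Mapping.keys (frag_of Z)"
    using keys_diff[of "frag_of Y" "frag_of X"] by blast
  also have "\<dots> \<subseteq> S" using c by simp
  finally show "c \<in> carrier (free_Abelian_group S)" by simp
qed

text \<open>The relation subgroup in additive notation. In the free abelian group on S the abstract
  inverse is identified with negation for elements supported in S, hence the assumption on
  R.\<close>

lemma K0_rel_induct [consumes 2, case_names zero gen add uminus]:
  assumes R: "R \<subseteq> S \<times> S \<times> S" and c: "c \<in> K0_rel S R"
    and "Q 0" and "\<And>X Y Z. (X, Y, Z) \<in> R \<Longrightarrow> Q (frag_of Y - frag_of X - frag_of Z)"
    and "\<And>c d. Q c \<Longrightarrow> Q d \<Longrightarrow> Q (c + d)" and "\<And>c. Q c \<Longrightarrow> Q (- c)"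
  shows "Q c"
  using c unfolding K0_rel_def
proof (induction rule: generate.induct)
  case (inv h)
  then have "h \<in> carrier (free_Abelian_group S)"
    using K0_gens_in[OF R] by blast
  then have "inv\<^bsub>free_Abelian_group S\<^esub> h = - h"
    by (intro inv_free_Abelian_group) simp
  moreover have "Q h" using inv assms(4) by blast
  ultimately show ?case using assms(6)[of h] by simp
qed (use assms in auto)

lemma K0_rel_subgroup:
  assumes "R \<subseteq> S \<times> S \<times> S"
  shows "subgroup (K0_rel S R) (free_Abelian_group S)"
  unfolding K0_rel_def
  by (rule group.generate_is_subgroup[OF group_free_Abelian_group K0_gens_in[OF assms]])

lemma K0_rel_closed:
  assumes R: "R \<subseteq> S \<times> S \<times> S"
  shows "0 \<in> K0_rel S R"
    and "\<And>c d. c \<in> K0_rel S R \<Longrightarrow> d \<in> K0_rel S R \<Longrightarrow> c + d \<in> K0_rel S R"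
    and "\<And>c. c \<in> K0_rel S R \<Longrightarrow> - c \<in> K0_rel S R"
    and "\<And>c d. c \<in> K0_rel S R \<Longrightarrow> d \<in> K0_rel S R \<Longrightarrow> c - d \<in> K0_rel S R"
    and "\<And>X Y Z. (X, Y, Z) \<in> R \<Longrightarrow> frag_of Y - frag_of X - frag_of Z \<in> K0_rel S R"
    and "\<And>c. c \<in> K0_rel S R \<Longrightarrow> Poly_Mapping.keys c \<subseteq> S"
proof -
  note sg = K0_rel_subgroup[OF R]
  show z: "0 \<in> K0_rel S R"
    using subgroup.one_closed[OF sg] by simp
  show a: "\<And>c d. c \<in> K0_rel S R \<Longrightarrow> d \<in> K0_rel S R \<Longrightarrow> c + d \<in> K0_rel S R"
    using subgroup.m_closed[OF sg] by simp
  show k: "\<And>c. c \<in> K0_rel S R \<Longrightarrow> Poly_Mapping.keys c \<subseteq> S"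
    using subsetD[OF subgroup.subset[OF sg]] by (simp only: carrier_free_Abelian_group_iff)
  show u: "\<And>c. c \<in> K0_rel S R \<Longrightarrow> - c \<in> K0_rel S R"
    using subgroup.m_inv_closed[OF sg] k by (metis inv_free_Abelian_group)
  show "\<And>c d. c \<in> K0_rel S R \<Longrightarrow> d \<in> K0_rel S R \<Longrightarrow> c - d \<in> K0_rel S R"
    using a u by (simp only: diff_conv_add_uminus)
  show "\<And>X Y Z. (X, Y, Z) \<in> R \<Longrightarrow> frag_of Y - frag_of X - frag_of Z \<in> K0_rel S R"
    unfolding K0_rel_def by (intro generate.incl) blast
qed

lemma K0_coset_altdef: "K0_coset S R c = {h + c | h. h \<in> K0_rel S R}"
  by (auto simp: K0_coset_def r_coset_def)

lemma K0_coset_eq: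
  assumes R: "R \<subseteq> S \<times> S \<times> S"
  shows "K0_coset S R c = K0_coset S R d \<longleftrightarrow> c - d \<in> K0_rel S R"
proof -
  note e = K0_coset_altdef
  show ?thesis
  proof
    assume "K0_coset S R c = K0_coset S R d"
    moreover have "0 + c \<in> K0_coset S R c"
      using K0_rel_closed(1)[OF R] unfolding e by blast
    ultimately have "c \<in> K0_coset S R d" by simp
    then show "c - d \<in> K0_rel S R" unfolding e by auto
  next
    assume cd: "c - d \<in> K0_rel S R"
    have *: "K0_coset S R c \<subseteq> K0_coset S R d" if cd: "c - d \<in> K0_rel S R" for c d
    proof
      fix x assume "x \<in> K0_coset S R c"
      then obtain h where h: "h \<in> K0_rel S R" "x = h + c" unfolding e by auto
      then have "x = (h + (c - d)) + d" "h + (c - d) \<in> K0_rel S R"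
        using cd K0_rel_closed(2)[OF R] by simp_all
      then show "x \<in> K0_coset S R d" unfolding e by blast
    qed
    have "d - c \<in> K0_rel S R"
      using K0_rel_closed(3)[OF R cd] by simp
    then show "K0_coset S R c = K0_coset S R d"
      using * cd by blast
  qed
qed

lemma K0_coset_self:
  assumes "R \<subseteq> S \<times> S \<times> S" shows "c \<in> K0_coset S R c"
proof -
  have "c = 0 + c" by simp
  then show ?thesis
    unfolding K0_coset_altdef using K0_rel_closed(1)[OF assms] by blast
qed

lemma K0_coset_mem:
  assumes "R \<subseteq> S \<times> S \<times> S" "c \<in> K0_coset S R d"
  shows "K0_coset S R c = K0_coset S R d"
proof -
  obtain h where "h \<in> K0_rel S R" "c = h + d"
    using assms(2) unfolding K0_coset_altdef by blast
  then show ?thesis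
    by (simp add: K0_coset_eq[OF assms(1)])
qed

lemma K0_carrier: "carrier (K0 S R) = K0_coset S R ` {c. Poly_Mapping.keys c \<subseteq> S}"
  by (auto simp: K0_def FactGroup_def RCOSETS_def K0_coset_def)

lemma K0_normal:
  assumes "R \<subseteq> S \<times> S \<times> S"
  shows "K0_rel S R \<lhd> free_Abelian_group S"
  by (simp add: K0_rel_subgroup[OF assms] abelian_free_Abelian_group comm_group.normal_iff_subgroup)

lemma K0_comm_group:
  assumes "R \<subseteq> S \<times> S \<times> S"
  shows "comm_group (K0 S R)"
  unfolding K0_def
  by (rule comm_group.abelian_FactGroup[OF abelian_free_Abelian_group K0_rel_subgroup[OF assms]])

lemma K0_mult:
  assumes "R \<subseteq> S \<times> S \<times> S" "Poly_Mapping.keys c \<subseteq> S" "Poly_Mapping.keys d \<subseteq> S"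
  shows "K0_coset S R c \<otimes>\<^bsub>K0 S R\<^esub> K0_coset S R d = K0_coset S R (c + d)"
  using normal.rcos_sum[OF K0_normal[OF assms(1)], of c d] assms
  by (simp add: K0_def FactGroup_def K0_coset_def)

lemma K0_one: "R \<subseteq> S \<times> S \<times> S \<Longrightarrow> \<one>\<^bsub>K0 S R\<^esub> = K0_coset S R 0"
  by (auto simp: K0_def FactGroup_def K0_coset_def r_coset_def)

lemma K0_inv:
  assumes "R \<subseteq> S \<times> S \<times> S" "Poly_Mapping.keys c \<subseteq> S"
  shows "inv\<^bsub>K0 S R\<^esub> K0_coset S R c = K0_coset S R (- c)"
proof -
  interpret comm_group "K0 S R" by (rule K0_comm_group[OF assms(1)])
  show ?thesis
    by (rule inv_equality) (use assms in \<open>auto simp: K0_mult K0_one K0_carrier\<close>)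
qed

lemma K0_induct:
  assumes "Poly_Mapping.keys c \<subseteq> S" "Q 0" "\<And>x. x \<in> S \<Longrightarrow> Q (frag_of x)"
    "\<And>a b. Poly_Mapping.keys a \<subseteq> S \<Longrightarrow> Poly_Mapping.keys b \<subseteq> S \<Longrightarrow> Q a \<Longrightarrow> Q b \<Longrightarrow> Q (a - b)"
  shows "Q c"
proof -
  have "Q c \<and> Poly_Mapping.keys c \<subseteq> S"
    using assms(1)
  proof (induction rule: frag_induction)
    case zero
    then show ?case using assms by simp
  next
    case (one x)
    then show ?case using assms by simp
  next
    case (diff a b)
    then show ?case using assms keys_diff[of a b] by blast
  qed
  then show ?thesis by simp
qed

lemma frag_extend_keys:
  assumes "\<And>x. x \<in> S \<Longrightarrow> f x \<in> S'" "Poly_Mapping.keys c \<subseteq> S"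
  shows "Poly_Mapping.keys (frag_extend (\<lambda>x. frag_of (f x)) c) \<subseteq> S'"
  using keys_frag_extend[of "\<lambda>x. frag_of (f x)" c] assms by fastforce

text \<open>A map of generators that preserves the distinguished sequences induces a map of
  Grothendieck groups. It serves for the transfer of modules in both directions.\<close>

lemma K0_rel_map:
  assumes R: "R \<subseteq> S \<times> S \<times> S" and R': "R' \<subseteq> S' \<times> S' \<times> S'"
    and f: "\<And>X Y Z. (X, Y, Z) \<in> R \<Longrightarrow> (f X, f Y, f Z) \<in> R'" and c: "c \<in> K0_rel S R"
  shows "frag_extend (\<lambda>x. frag_of (f x)) c \<in> K0_rel S' R'"
  using R c
proof (induction rule: K0_rel_induct)
  case (gen X Y Z)
  then show ?case
    using K0_rel_closed(5)[OF R' f] by (simp add: frag_extend_diff)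
qed (use K0_rel_closed[OF R'] in \<open>auto simp: frag_extend_add frag_extend_minus\<close>)

text \<open>\<open>hom\<close> speaks only of products, so the value at x - y is found by cancelling
  the value at y in the target group.\<close>

lemma hom_coset_diff:
  assumes R: "R \<subseteq> S \<times> S \<times> S" "R' \<subseteq> S' \<times> S' \<times> S'" and h: "h \<in> hom (K0 S R) (K0 S' R')"
    and k: "Poly_Mapping.keys x \<subseteq> S" "Poly_Mapping.keys y \<subseteq> S"
    and t: "Poly_Mapping.keys t \<subseteq> S'" "h (K0_coset S R x) = K0_coset S' R' t"
    and s: "Poly_Mapping.keys s \<subseteq> S'" "h (K0_coset S R y) = K0_coset S' R' s"
  shows "h (K0_coset S R (x - y)) = K0_coset S' R' (t - s)"
proof -
  have kd: "Poly_Mapping.keys (x - y) \<subseteq> S" using keys_diff[of x y] k by blast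
  have kt: "Poly_Mapping.keys (t - s) \<subseteq> S'" using keys_diff[of t s] t s by blast
  interpret G: comm_group "K0 S' R'" by (rule K0_comm_group[OF R(2)])
  have cx: "K0_coset S R (x - y) \<in> carrier (K0 S R)" "K0_coset S R y \<in> carrier (K0 S R)"
    using kd k by (auto simp: K0_carrier)
  have "h (K0_coset S R (x - y)) \<otimes>\<^bsub>K0 S' R'\<^esub> h (K0_coset S R y) = h (K0_coset S R x)"
    using hom_mult[OF h cx] K0_mult[OF R(1) kd k(2)] by simp
  then have "h (K0_coset S R (x - y)) \<otimes>\<^bsub>K0 S' R'\<^esub> K0_coset S' R' s = K0_coset S' R' (t - s) \<otimes>\<^bsub>K0 S' R'\<^esub> K0_coset S' R' s"
    using K0_mult[OF R(2) kt s(1)] t s by simp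
  moreover have "h (K0_coset S R (x - y)) \<in> carrier (K0 S' R')" using hom_in_carrier[OF h cx(1)] .
  ultimately show ?thesis
    using kt s by (auto simp: K0_carrier)
qed

text \<open>Rewrites the powers in \<open>finite_rank\<close> as integer multiples, to which
  dimensions can be applied.\<close>

lemma K0_nat_pow:
  assumes R: "R \<subseteq> S \<times> S \<times> S" and c: "Poly_Mapping.keys c \<subseteq> S"
  shows "K0_coset S R c [^]\<^bsub>K0 S R\<^esub> (n::nat) = K0_coset S R (frag_cmul (int n) c)"
proof (induction n)
  case 0
  then show ?case using K0_one[OF R] by simp
next
  case (Suc n)
  have k: "Poly_Mapping.keys (frag_cmul (int n) c) \<subseteq> S" by (rule subset_trans[OF keys_cmul c])
  have "frag_cmul (int n) c + c = frag_cmul (int (Suc n)) c"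
    unfolding of_nat_Suc by (simp add: frag_cmul_distrib)
  then show ?case unfolding nat_pow_Suc Suc.IH K0_mult[OF R k c] by (rule arg_cong)
qed

section \<open>Linear categories\<close>

text \<open>Two-term biproducts with the four structure maps as arguments. Their equations are then
  plain identities instead of indexed sums, and the notion is visibly self-dual.\<close>

definition bip :: "('k, 'o, 'm, 'z) lincat_scheme \<Rightarrow> 'o \<Rightarrow> 'o \<Rightarrow> 'o \<Rightarrow> 'm \<Rightarrow> 'm \<Rightarrow> 'm \<Rightarrow> 'm \<Rightarrow> bool" where
  "bip C A B Y i j p q \<longleftrightarrow> A \<in> Obj C \<and> B \<in> Obj C \<and> Y \<in> Obj C \<and>
     i \<in> Mor C A Y \<and> j \<in> Mor C B Y \<and> p \<in> Mor C Y A \<and> q \<in> Mor C Y B \<and>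
     Comp C A Y A p i = Ident C A \<and> Comp C B Y B q j = Ident C B \<and>
     Comp C A Y B q i = \<zero>\<^bsub>Hom C A B\<^esub> \<and> Comp C B Y A p j = \<zero>\<^bsub>Hom C B A\<^esub> \<and>
     Comp C Y A Y i p \<oplus>\<^bsub>Hom C Y Y\<^esub> Comp C Y B Y j q = Ident C Y"

locale lincat =
  fixes C :: "('k::field, 'o, 'm, 'z) lincat_scheme"
  assumes linear: "linear_category C"
begin

lemma hom_vs [simp]: "X \<in> Obj C \<Longrightarrow> Y \<in> Obj C \<Longrightarrow> vspace (Hom C X Y)"
  using linear by (simp add: linear_category_def)

lemma id_in [simp]: "X \<in> Obj C \<Longrightarrow> Ident C X \<in> Mor C X X"
  using linear by (simp add: linear_category_def)

lemma comp_id [simp]: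
  assumes "X \<in> Obj C" "Y \<in> Obj C" "f \<in> Mor C X Y"
  shows "Comp C X Y Y (Ident C Y) f = f" "Comp C X X Y f (Ident C X) = f"
  using linear assms by (simp_all add: linear_category_def)

lemma comp_lin:
  assumes "X \<in> Obj C" "Y \<in> Obj C" "Z \<in> Obj C"
  shows "g \<in> Mor C Y Z \<Longrightarrow> lin (Hom C X Y) (Hom C X Z) (\<lambda>f. Comp C X Y Z g f)"
    "f \<in> Mor C X Y \<Longrightarrow> lin (Hom C Y Z) (Hom C X Z) (\<lambda>g. Comp C X Y Z g f)"
  using linear assms by (simp_all add: linear_category_def)

lemma comp_in [simp]:
  assumes "X \<in> Obj C" "Y \<in> Obj C" "Z \<in> Obj C" "f \<in> Mor C X Y" "g \<in> Mor C Y Z"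
  shows "Comp C X Y Z g f \<in> Mor C X Z"
  using lin_closed[OF comp_lin(1)] assms by blast

lemma assoc:
  assumes "W \<in> Obj C" "X \<in> Obj C" "Y \<in> Obj C" "Z \<in> Obj C"
    "f \<in> Mor C W X" "g \<in> Mor C X Y" "h \<in> Mor C Y Z"
  shows "Comp C W Y Z h (Comp C W X Y g f) = Comp C W X Z (Comp C X Y Z h g) f"
  using linear assms unfolding linear_category_def by blast

lemma zero_in [simp]: "X \<in> Obj C \<Longrightarrow> Y \<in> Obj C \<Longrightarrow> \<zero>\<^bsub>Hom C X Y\<^esub> \<in> Mor C X Y"
  by (simp add: vs_closed(1))

lemma add_in [simp]:
  "X \<in> Obj C \<Longrightarrow> Y \<in> Obj C \<Longrightarrow> f \<in> Mor C X Y \<Longrightarrow> g \<in> Mor C X Y \<Longrightarrow> f \<oplus>\<^bsub>Hom C X Y\<^esub> g \<in> Mor C X Y"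
  by (simp add: vs_closed(2))

lemma minus_in [simp]:
  "X \<in> Obj C \<Longrightarrow> Y \<in> Obj C \<Longrightarrow> f \<in> Mor C X Y \<Longrightarrow> g \<in> Mor C X Y \<Longrightarrow> f \<ominus>\<^bsub>Hom C X Y\<^esub> g \<in> Mor C X Y"
  by (simp add: vs_closed(3))

lemma comp_zero [simp]:
  assumes "X \<in> Obj C" "Y \<in> Obj C" "Z \<in> Obj C"
  shows "g \<in> Mor C Y Z \<Longrightarrow> Comp C X Y Z g \<zero>\<^bsub>Hom C X Y\<^esub> = \<zero>\<^bsub>Hom C X Z\<^esub>"
    "f \<in> Mor C X Y \<Longrightarrow> Comp C X Y Z \<zero>\<^bsub>Hom C Y Z\<^esub> f = \<zero>\<^bsub>Hom C X Z\<^esub>"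
  using lin_zero[OF comp_lin(1)[OF assms]] lin_zero[OF comp_lin(2)[OF assms]] by auto

lemma comp_add:
  assumes "X \<in> Obj C" "Y \<in> Obj C" "Z \<in> Obj C"
  shows "g \<in> Mor C Y Z \<Longrightarrow> f \<in> Mor C X Y \<Longrightarrow> f' \<in> Mor C X Y \<Longrightarrow>
      Comp C X Y Z g (f \<oplus>\<^bsub>Hom C X Y\<^esub> f') = Comp C X Y Z g f \<oplus>\<^bsub>Hom C X Z\<^esub> Comp C X Y Z g f'"
    "g \<in> Mor C Y Z \<Longrightarrow> g' \<in> Mor C Y Z \<Longrightarrow> f \<in> Mor C X Y \<Longrightarrow>
      Comp C X Y Z (g \<oplus>\<^bsub>Hom C Y Z\<^esub> g') f = Comp C X Y Z g f \<oplus>\<^bsub>Hom C X Z\<^esub> Comp C X Y Z g' f"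
  using lin_add[OF comp_lin(1)[OF assms]] lin_add[OF comp_lin(2)[OF assms]] by auto

lemma comp_minus:
  assumes "X \<in> Obj C" "Y \<in> Obj C" "Z \<in> Obj C"
  shows "g \<in> Mor C Y Z \<Longrightarrow> f \<in> Mor C X Y \<Longrightarrow> f' \<in> Mor C X Y \<Longrightarrow>
      Comp C X Y Z g (f \<ominus>\<^bsub>Hom C X Y\<^esub> f') = Comp C X Y Z g f \<ominus>\<^bsub>Hom C X Z\<^esub> Comp C X Y Z g f'"
    "g \<in> Mor C Y Z \<Longrightarrow> g' \<in> Mor C Y Z \<Longrightarrow> f \<in> Mor C X Y \<Longrightarrow>
      Comp C X Y Z (g \<ominus>\<^bsub>Hom C Y Z\<^esub> g') f = Comp C X Y Z g f \<ominus>\<^bsub>Hom C X Z\<^esub> Comp C X Y Z g' f"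
  using lin_minus[OF comp_lin(1)[OF assms]] lin_minus[OF comp_lin(2)[OF assms]] by auto

lemma iso_in: "iso_arrow C X Y f \<Longrightarrow> f \<in> Mor C X Y"
  by (simp add: iso_arrow_def)

lemma isoE:
  assumes "iso_arrow C X Y f"
  obtains g where "g \<in> Mor C Y X" "Comp C X Y X g f = Ident C X" "Comp C Y X Y f g = Ident C Y"
    "iso_arrow C Y X g"
  using assms unfolding iso_arrow_def by blast

lemma iso_id: "X \<in> Obj C \<Longrightarrow> iso_arrow C X X (Ident C X)"
  unfolding iso_arrow_def by (metis comp_id(1) id_in)

lemma iso_comp:
  assumes o: "X \<in> Obj C" "Y \<in> Obj C" "Z \<in> Obj C" and f: "iso_arrow C X Y f" and g: "iso_arrow C Y Z g"
  shows "iso_arrow C X Z (Comp C X Y Z g f)"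
proof -
  obtain f' where f': "f' \<in> Mor C Y X" "Comp C X Y X f' f = Ident C X" "Comp C Y X Y f f' = Ident C Y"
    using isoE[OF f] by metis
  obtain g' where g': "g' \<in> Mor C Z Y" "Comp C Y Z Y g' g = Ident C Y" "Comp C Z Y Z g g' = Ident C Z"
    using isoE[OF g] by metis
  note m = o iso_in[OF f] iso_in[OF g] f'(1) g'(1)
  have "Comp C X Z X (Comp C Z Y X f' g') (Comp C X Y Z g f) = Ident C X"
    using m f' g' by (simp add: assoc) (simp flip: assoc)
  moreover have "Comp C Z X Z (Comp C X Y Z g f) (Comp C Z Y X f' g') = Ident C Z"
    using m f' g' by (simp add: assoc) (simp flip: assoc)
  ultimately show ?thesis
    unfolding iso_arrow_def using m comp_in by blast
qed

lemma isomorphicE: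
  assumes "isomorphic C X Y"
  obtains f g where "X \<in> Obj C" "Y \<in> Obj C" "f \<in> Mor C X Y" "g \<in> Mor C Y X"
    "Comp C X Y X g f = Ident C X" "Comp C Y X Y f g = Ident C Y"
  using assms unfolding isomorphic_def iso_arrow_def by blast

lemma isomorphicI:
  assumes "X \<in> Obj C" "Y \<in> Obj C" "f \<in> Mor C X Y" "g \<in> Mor C Y X"
    "Comp C X Y X g f = Ident C X" "Comp C Y X Y f g = Ident C Y"
  shows "isomorphic C X Y"
  using assms unfolding isomorphic_def iso_arrow_def by blast

lemma isomorphic_refl: "X \<in> Obj C \<Longrightarrow> isomorphic C X X"
  using iso_id by (auto simp: isomorphic_def)

lemma isomorphic_sym: "isomorphic C X Y \<Longrightarrow> isomorphic C Y X"
  by (metis isomorphicE isomorphicI)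

lemma isomorphic_trans: "isomorphic C X Y \<Longrightarrow> isomorphic C Y Z \<Longrightarrow> isomorphic C X Z"
  by (meson isomorphic_def iso_comp)

lemma idem_iso_eq_id:
  assumes X: "X \<in> Obj C" and e: "iso_arrow C X X e" "Comp C X X X e e = e"
  shows "e = Ident C X"
proof -
  obtain g where g: "g \<in> Mor C X X" "Comp C X X X g e = Ident C X"
    using isoE[OF e(1)] by metis
  note m = X iso_in[OF e(1)] g(1)
  have "e = Comp C X X X (Comp C X X X g e) e"
    using m g by simp
  also have "\<dots> = Comp C X X X g (Comp C X X X e e)"
    using m by (simp add: assoc)
  finally show ?thesis using e(2) g(2) by simp
qed

lemma zero_objectD:
  assumes "zero_object C Z" "X \<in> Obj C"
  shows "f \<in> Mor C Z X \<Longrightarrow> f = \<zero>\<^bsub>Hom C Z X\<^esub>" "g \<in> Mor C X Z \<Longrightarrow> g = \<zero>\<^bsub>Hom C X Z\<^esub>"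
  using assms comp_id comp_zero unfolding zero_object_def by metis+

section \<open>Biproducts of two objects\<close>

lemma bip_sym: "bip C A B Y i j p q \<Longrightarrow> bip C B A Y j i q p"
  unfolding bip_def using vs_laws(11)[OF hom_vs] comp_in by metis

lemma biproduct_bip: "biproduct C [A, B] Y i p \<longleftrightarrow> bip C A B Y (i 0) (i 1) (p 0) (p 1)"
proof -
  have two: "{..<Suc (Suc 0)} = {0, 1}" by auto
  have all2: "(\<forall>j<Suc (Suc 0). Q j) \<longleftrightarrow> Q 0 \<and> Q (Suc 0)" for Q
    by (auto simp: less_Suc_eq)
  have "finsum (Hom C Y Y) (\<lambda>j. Comp C Y ([A, B] ! j) Y (i j) (p j)) {0, 1} =
    Comp C Y A Y (i 0) (p 0) \<oplus>\<^bsub>Hom C Y Y\<^esub> Comp C Y B Y (i 1) (p 1)"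
    if "A \<in> Obj C" "B \<in> Obj C" "Y \<in> Obj C" "i 0 \<in> Mor C A Y" "i 1 \<in> Mor C B Y"
      "p 0 \<in> Mor C Y A" "p 1 \<in> Mor C Y B"
  proof -
    interpret abelian_monoid "Hom C Y Y"
      using vspace_abelian_group[OF hom_vs[OF that(3,3)]] by (simp add: abelian_group_def)
    show ?thesis
      using that by (simp add: finsum_insert)
  qed
  then show ?thesis
    unfolding biproduct_def bip_def by (auto simp: two all2)
qed

lemma direct_sum2: "direct_sum_of C [A, B] Y \<longleftrightarrow> (\<exists>i j p q. bip C A B Y i j p q)"
proof
  assume "direct_sum_of C [A, B] Y"
  then show "\<exists>i j p q. bip C A B Y i j p q"
    unfolding direct_sum_of_def biproduct_bip by blast
next
  assume "\<exists>i j p q. bip C A B Y i j p q"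
  then obtain i j p q where "bip C A B Y i j p q" by blast
  then have "biproduct C [A, B] Y (\<lambda>n. if n = 0 then i else j) (\<lambda>n. if n = 0 then p else q)"
    unfolding biproduct_bip by simp
  then show "direct_sum_of C [A, B] Y"
    unfolding direct_sum_of_def by blast
qed

lemma direct_sum_nil: "direct_sum_of C [] Z \<longleftrightarrow> zero_object C Z"
proof -
  have "finsum (Hom C Z Z) f {} = \<zero>\<^bsub>Hom C Z Z\<^esub>" if "Z \<in> Obj C" for f :: "nat \<Rightarrow> 'm"
  proof -
    interpret abelian_monoid "Hom C Z Z"
      using vspace_abelian_group[OF hom_vs[OF that that]] by (simp add: abelian_group_def)
    show ?thesis by simp
  qed
  then show ?thesis
    by (auto simp: direct_sum_of_def biproduct_def zero_object_def)
qed

lemma direct_sum_single: "V \<in> Obj C \<Longrightarrow> direct_sum_of C [V] V"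
proof -
  assume V: "V \<in> Obj C"
  interpret abelian_monoid "Hom C V V"
    using vspace_abelian_group[OF hom_vs[OF V V]] by (simp add: abelian_group_def)
  have "biproduct C [V] V (\<lambda>_. Ident C V) (\<lambda>_. Ident C V)"
    unfolding biproduct_def using V by (auto simp: lessThan_Suc)
  then show ?thesis by (auto simp: direct_sum_of_def)
qed

lemma bip_zero:
  assumes "X \<in> Obj C" "zero_object C Z"
  shows "bip C X Z X (Ident C X) \<zero>\<^bsub>Hom C Z X\<^esub> (Ident C X) \<zero>\<^bsub>Hom C X Z\<^esub>"
  using assms vs_laws(2)[OF hom_vs] by (simp add: bip_def zero_object_def)

lemma bip_iso:
  assumes "bip C A B Y i j p q" "isomorphic C Y Y'"
  shows "\<exists>i j p q. bip C A B Y' i j p q"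
proof -
  obtain f g where m: "Y \<in> Obj C" "Y' \<in> Obj C" "f \<in> Mor C Y Y'" "g \<in> Mor C Y' Y"
    and fg: "Comp C Y Y' Y g f = Ident C Y" "Comp C Y' Y Y' f g = Ident C Y'"
    using isomorphicE[OF assms(2)] by metis
  have b: "A \<in> Obj C" "B \<in> Obj C" "i \<in> Mor C A Y" "j \<in> Mor C B Y" "p \<in> Mor C Y A" "q \<in> Mor C Y B"
    using assms(1) by (auto simp: bip_def)
  \<comment> \<open>The middle factor g f cancels, so the composites of the new projections with the
    new injections equal the old ones.\<close>
  have c: "Comp C V Y' W (Comp C Y' Y W r g) (Comp C V Y Y' f s) = Comp C V Y W r s"
    if "V \<in> Obj C" "W \<in> Obj C" "s \<in> Mor C V Y" "r \<in> Mor C Y W" for V W r s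
  proof -
    have "Comp C V Y' W (Comp C Y' Y W r g) (Comp C V Y Y' f s) =
      Comp C V Y W (Comp C Y Y' W (Comp C Y' Y W r g) f) s"
      using that m by (simp add: assoc)
    moreover have "Comp C Y Y' W (Comp C Y' Y W r g) f = Comp C Y Y W r (Comp C Y Y' Y g f)"
      using that m(1-4) by (simp add: assoc)
    ultimately show ?thesis using that m fg by simp
  qed
  have d: "Comp C Y' V Y' (Comp C V Y Y' f s) (Comp C Y' Y V r g) =
      Comp C Y' Y Y' f (Comp C Y' Y Y (Comp C Y V Y s r) g)"
    if "V \<in> Obj C" "s \<in> Mor C V Y" "r \<in> Mor C Y V" for V r s
    using that m by (simp add: assoc)
  have "bip C A B Y' (Comp C A Y Y' f i) (Comp C B Y Y' f j) (Comp C Y' Y A p g) (Comp C Y' Y B q g)"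
    unfolding bip_def
  proof (intro conjI)
    show "Comp C Y' A Y' (Comp C A Y Y' f i) (Comp C Y' Y A p g) \<oplus>\<^bsub>Hom C Y' Y'\<^esub>
      Comp C Y' B Y' (Comp C B Y Y' f j) (Comp C Y' Y B q g) = Ident C Y'"
    proof -
      have "Comp C Y' Y Y' f (Comp C Y' Y Y (Comp C Y A Y i p \<oplus>\<^bsub>Hom C Y Y\<^esub> Comp C Y B Y j q) g) = Ident C Y'"
        using assms(1) m fg by (simp add: bip_def)
      then show ?thesis
        using b m by (simp add: d comp_add)
    qed
  qed (use assms(1) b m c in \<open>auto simp: bip_def\<close>)
  then show ?thesis by blast
qed

lemma iso_direct_sum_zero:
  assumes "isomorphic C X Y" "zero_object C Z"
  shows "direct_sum_of C [X, Z] Y"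
  using bip_iso[OF bip_zero assms(1)] assms unfolding direct_sum2 by (simp add: isomorphic_def)

section \<open>Local endomorphism rings and splitting of idempotents\<close>

lemma local_iso:
  assumes "local_endo C X" "isomorphic C X Y"
  shows "local_endo C Y"
proof -
  obtain f g where m: "X \<in> Obj C" "Y \<in> Obj C" "f \<in> Mor C X Y" "g \<in> Mor C Y X"
    and fg: "Comp C X Y X g f = Ident C X" "Comp C Y X Y f g = Ident C Y"
    using isomorphicE[OF assms(2)] by metis
  let ?c = "\<lambda>a. Comp C X Y X g (Comp C X Y Y a f)"
  have i: "iso_arrow C X Y f" "iso_arrow C Y X g"
    using m fg by (auto simp: iso_arrow_def)
  \<comment> \<open>Conjugating a by f and g and then back recovers a. So conjugation not only
    preserves sums and isomorphisms but also reflects isomorphisms, and locality passes from X to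
    Y.\<close>
  have bk: "Comp C Y X Y f (Comp C Y X X (?c a) g) = a" if "a \<in> Mor C Y Y" for a
  proof -
    have "Comp C Y X Y f (Comp C Y X X (?c a) g) =
      Comp C Y Y Y (Comp C Y X Y f g) (Comp C Y Y Y a (Comp C Y X Y f g))"
      using m that by (simp add: assoc del: comp_id)
    then show ?thesis using m that fg by simp
  qed
  have iff: "iso_arrow C X X (?c a) \<longleftrightarrow> iso_arrow C Y Y a" if "a \<in> Mor C Y Y" for a
  proof
    assume "iso_arrow C X X (?c a)"
    then have "iso_arrow C Y Y (Comp C Y X Y f (Comp C Y X X (?c a) g))"
      using i m iso_comp by blast
    then show "iso_arrow C Y Y a" using bk[OF that] by simp
  next
    assume "iso_arrow C Y Y a"
    then show "iso_arrow C X X (?c a)"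
      using i m iso_comp by blast
  qed
  show ?thesis
    unfolding local_endo_def
  proof (intro conjI ballI impI)
    show "Y \<in> Obj C" by fact
    show "\<not> zero_object C Y"
    proof
      assume z: "zero_object C Y"
      have "Ident C X = \<zero>\<^bsub>Hom C X X\<^esub>"
        using fg(1) m zero_objectD(2)[OF z m(1) m(3)] by (metis comp_zero(1))
      then show False
        using assms(1) m by (auto simp: local_endo_def zero_object_def)
    qed
    fix a b assume a: "a \<in> Mor C Y Y" "b \<in> Mor C Y Y" and ab: "iso_arrow C Y Y (a \<oplus>\<^bsub>Hom C Y Y\<^esub> b)"
    have "?c (a \<oplus>\<^bsub>Hom C Y Y\<^esub> b) = ?c a \<oplus>\<^bsub>Hom C X X\<^esub> ?c b"
      using a m by (simp add: comp_add)
    then have "iso_arrow C X X (?c a \<oplus>\<^bsub>Hom C X X\<^esub> ?c b)"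
      using iff[of "a \<oplus>\<^bsub>Hom C Y Y\<^esub> b"] a m ab by simp
    then have "iso_arrow C X X (?c a) \<or> iso_arrow C X X (?c b)"
      using assms(1) a m by (simp add: local_endo_def)
    then show "iso_arrow C Y Y a \<or> iso_arrow C Y Y b"
      using iff a by blast
  qed
qed

lemma local_complement:
  assumes "local_endo C X" "e \<in> Mor C X X" "\<not> iso_arrow C X X e"
  shows "iso_arrow C X X (Ident C X \<ominus>\<^bsub>Hom C X X\<^esub> e)"
proof -
  have X: "X \<in> Obj C" using assms by (simp add: local_endo_def)
  have "iso_arrow C X X ((Ident C X \<ominus>\<^bsub>Hom C X X\<^esub> e) \<oplus>\<^bsub>Hom C X X\<^esub> e)"
    using vs_laws(8)[OF hom_vs[OF X X] id_in[OF X] assms(2)] iso_id[OF X] by simp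
  then show ?thesis
    using assms X by (auto simp: local_endo_def)
qed

lemma idem_complement:
  assumes X: "X \<in> Obj C" and e: "e \<in> Mor C X X" "Comp C X X X e e = e"
  shows "Comp C X X X (Ident C X \<ominus>\<^bsub>Hom C X X\<^esub> e) (Ident C X \<ominus>\<^bsub>Hom C X X\<^esub> e) = Ident C X \<ominus>\<^bsub>Hom C X X\<^esub> e"
    "Comp C X X X (Ident C X \<ominus>\<^bsub>Hom C X X\<^esub> e) e = \<zero>\<^bsub>Hom C X X\<^esub>"
    "Comp C X X X e (Ident C X \<ominus>\<^bsub>Hom C X X\<^esub> e) = \<zero>\<^bsub>Hom C X X\<^esub>"
proof -
  note v = hom_vs[OF X X]
  show 1: "Comp C X X X (Ident C X \<ominus>\<^bsub>Hom C X X\<^esub> e) e = \<zero>\<^bsub>Hom C X X\<^esub>"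
    and "Comp C X X X e (Ident C X \<ominus>\<^bsub>Hom C X X\<^esub> e) = \<zero>\<^bsub>Hom C X X\<^esub>"
    using X e vs_laws(3)[OF v] by (simp_all add: comp_minus)
  have "Comp C X X X (Ident C X \<ominus>\<^bsub>Hom C X X\<^esub> e) (Ident C X \<ominus>\<^bsub>Hom C X X\<^esub> e) =
    Comp C X X X (Ident C X \<ominus>\<^bsub>Hom C X X\<^esub> e) (Ident C X) \<ominus>\<^bsub>Hom C X X\<^esub> Comp C X X X (Ident C X \<ominus>\<^bsub>Hom C X X\<^esub> e) e"
    using X e by (intro comp_minus(1)) auto
  also have "\<dots> = Ident C X \<ominus>\<^bsub>Hom C X X\<^esub> e"
    using 1 X e vs_laws(4)[OF v] by simp
  finally show "Comp C X X X (Ident C X \<ominus>\<^bsub>Hom C X X\<^esub> e) (Ident C X \<ominus>\<^bsub>Hom C X X\<^esub> e) = Ident C X \<ominus>\<^bsub>Hom C X X\<^esub> e" .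
qed

text \<open>An invertible idempotent is the identity. If e is not invertible, then 1 - e is, and
  being idempotent it is the identity; multiplying by e gives e = 0.\<close>

lemma local_idem:
  assumes "local_endo C X" "e \<in> Mor C X X" "Comp C X X X e e = e"
  shows "e = Ident C X \<or> e = \<zero>\<^bsub>Hom C X X\<^esub>"
proof -
  have X: "X \<in> Obj C" using assms by (simp add: local_endo_def)
  show ?thesis
  proof (cases "iso_arrow C X X e")
    case True
    then show ?thesis using idem_iso_eq_id X assms by blast
  next
    case False
    then have 1: "Ident C X \<ominus>\<^bsub>Hom C X X\<^esub> e = Ident C X"
      using idem_iso_eq_id X local_complement[OF assms(1,2)] idem_complement(1)[OF X assms(2,3)] by blast
    have "Comp C X X X (Ident C X \<ominus>\<^bsub>Hom C X X\<^esub> e) e = \<zero>\<^bsub>Hom C X X\<^esub>"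
      by (rule idem_complement(2)[OF X assms(2,3)])
    then show ?thesis using 1 X assms(2) by simp
  qed
qed

lemma bip_idem:
  assumes "bip C A B Y i j p q"
  shows "Comp C Y A Y i p \<in> Mor C Y Y" "Comp C Y Y Y (Comp C Y A Y i p) (Comp C Y A Y i p) = Comp C Y A Y i p"
    "Comp C Y A Y i p = \<zero>\<^bsub>Hom C Y Y\<^esub> \<Longrightarrow> zero_object C A"
    "Comp C Y A Y i p = Ident C Y \<Longrightarrow> zero_object C B"
proof -
  have b: "A \<in> Obj C" "B \<in> Obj C" "Y \<in> Obj C" "i \<in> Mor C A Y" "j \<in> Mor C B Y" "p \<in> Mor C Y A" "q \<in> Mor C Y B"
    and e: "Comp C A Y A p i = Ident C A" "Comp C B Y B q j = Ident C B" "Comp C A Y B q i = \<zero>\<^bsub>Hom C A B\<^esub>"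
    using assms by (auto simp: bip_def)
  show "Comp C Y A Y i p \<in> Mor C Y Y" using b by simp
  have "Comp C Y Y Y (Comp C Y A Y i p) (Comp C Y A Y i p) = Comp C Y A Y i (Comp C Y A A (Comp C A Y A p i) p)"
    using b by (simp add: assoc del: comp_id)
  then show "Comp C Y Y Y (Comp C Y A Y i p) (Comp C Y A Y i p) = Comp C Y A Y i p"
    using b e by simp
  have "Ident C A = Comp C A Y A p (Comp C A Y Y (Comp C Y A Y i p) i)"
    using b e by (simp flip: assoc)
  then show "Comp C Y A Y i p = \<zero>\<^bsub>Hom C Y Y\<^esub> \<Longrightarrow> zero_object C A"
    using b by (simp add: zero_object_def)
  have "Comp C B Y B (Comp C Y Y B q (Comp C Y A Y i p)) j = \<zero>\<^bsub>Hom C B B\<^esub>"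
    using b e by (simp add: assoc)
  then show "Comp C Y A Y i p = Ident C Y \<Longrightarrow> zero_object C B"
    using b e by (simp add: zero_object_def)
qed

lemma local_indecomposable:
  assumes "local_endo C X"
  shows "indecomposable C X"
  unfolding indecomposable_def
proof (intro conjI allI impI)
  show "X \<in> Obj C" "\<not> zero_object C X"
    using assms by (auto simp: local_endo_def)
  fix A B assume "direct_sum_of C [A, B] X"
  then obtain i j p q where b: "bip C A B X i j p q" unfolding direct_sum2 by blast
  show "zero_object C A \<or> zero_object C B"
    using local_idem[OF assms bip_idem(1,2)[OF b]] bip_idem(3,4)[OF b] by blast
qed

text \<open>Invertibility of fh makes f a split epimorphism with some section k. The idempotent kf
  of V is 1 or 0 because the endomorphism ring of V is local, and 0 would force X = 0.\<close>

lemma local_retract_iso: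
  assumes V: "local_endo C V" and X: "local_endo C X" and f: "f \<in> Mor C V X" and h: "h \<in> Mor C X V"
    and fh: "iso_arrow C X X (Comp C X V X f h)"
  shows "iso_arrow C V X f"
proof -
  have o: "V \<in> Obj C" "X \<in> Obj C" using V X by (auto simp: local_endo_def)
  obtain u where u: "u \<in> Mor C X X" "Comp C X X X (Comp C X V X f h) u = Ident C X"
    using isoE[OF fh] by metis
  define k where "k = Comp C X X V h u"
  have k: "k \<in> Mor C X V" "Comp C X V X f k = Ident C X"
    using o f h u by (simp_all add: k_def assoc)
  let ?e = "Comp C V X V k f"
  have "Comp C V V V ?e ?e = Comp C V X V k (Comp C V X X (Comp C X V X f k) f)"
    using o f k(1) by (simp add: assoc del: comp_id)
  then have e: "?e \<in> Mor C V V" "Comp C V V V ?e ?e = ?e"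
    using o f k by simp_all
  show ?thesis
  proof (cases "?e = Ident C V")
    case True
    then show ?thesis using f k by (auto simp: iso_arrow_def)
  next
    case False
    then have z: "?e = \<zero>\<^bsub>Hom C V V\<^esub>" using local_idem[OF V e] by simp
    have "Ident C X = Comp C X V X (Comp C V V X f ?e) k"
    proof -
      have "Comp C X V X (Comp C V V X f ?e) k = Comp C X X X (Comp C X V X f k) (Comp C X V X f k)"
        using o f k(1) by (simp add: assoc del: comp_id)
      then show ?thesis using k o by simp
    qed
    then have "zero_object C X" using z o f k by (simp add: zero_object_def)
    then show ?thesis using X by (simp add: local_endo_def)
  qed
qed

text \<open>The complement B is obtained by splitting the idempotent 1 - ip; this is where
  idempotent completeness produces an object.\<close>

lemma retract_bip:
  assumes ic: "idempotent_complete C" and o: "A \<in> Obj C" "X \<in> Obj C"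
    and m: "i \<in> Mor C A X" "p \<in> Mor C X A" and e: "Comp C A X A p i = Ident C A"
  obtains B j q where "bip C A B X i j p q"
proof -
  let ?e = "Comp C X A X i p"
  note v = hom_vs[OF o(2,2)]
  have "Comp C X X X ?e ?e = Comp C X A X i (Comp C X A A (Comp C A X A p i) p)"
    using o m by (simp add: assoc del: comp_id)
  then have ee: "?e \<in> Mor C X X" "Comp C X X X ?e ?e = ?e"
    using o m e by simp_all
  let ?c = "Ident C X \<ominus>\<^bsub>Hom C X X\<^esub> ?e"
  have c: "?c \<in> Mor C X X" using o m by simp
  obtain B r s where B: "B \<in> Obj C" "r \<in> Mor C X B" "s \<in> Mor C B X"
    "Comp C X B X s r = ?c" "Comp C B X B r s = Ident C B"
    using ic o(2) c idem_complement(1)[OF o(2) ee] unfolding idempotent_complete_def by blast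
  have ci: "Comp C A X X ?c i = \<zero>\<^bsub>Hom C A X\<^esub>"
  proof -
    have "Comp C A X X ?c i = Comp C A X X (Ident C X) i \<ominus>\<^bsub>Hom C A X\<^esub> Comp C A X X ?e i"
      using o m by (intro comp_minus(2)) auto
    also have "Comp C A X X ?e i = i" using o m e by (simp flip: assoc)
    finally show ?thesis using o m vs_laws(3)[OF hom_vs[OF o(1,2)]] by simp
  qed
  have pc: "Comp C X X A p ?c = \<zero>\<^bsub>Hom C X A\<^esub>"
  proof -
    have "Comp C X X A p ?c = Comp C X X A p (Ident C X) \<ominus>\<^bsub>Hom C X A\<^esub> Comp C X X A p ?e"
      using o m by (intro comp_minus(1)) auto
    also have "Comp C X X A p ?e = p" using o m e by (simp add: assoc)
    finally show ?thesis using o m vs_laws(3)[OF hom_vs[OF o(2,1)]] by simp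
  qed
  have "Comp C A X B r i = Comp C A X B (Comp C X B B (Comp C B X B r s) r) i"
    using B o m by simp
  also have "\<dots> = Comp C A X B r (Comp C A X X (Comp C X B X s r) i)"
    using B(1-3) o m by (simp add: assoc del: comp_id)
  finally have ri: "Comp C A X B r i = \<zero>\<^bsub>Hom C A B\<^esub>"
    using B o ci by simp
  have "Comp C B X A p s = Comp C B X A p (Comp C B B X s (Comp C B X B r s))"
    using B o m by simp
  also have "\<dots> = Comp C B X A (Comp C X X A p (Comp C X B X s r)) s"
    using B(1-3) o m by (simp add: assoc del: comp_id)
  finally have ps: "Comp C B X A p s = \<zero>\<^bsub>Hom C B A\<^esub>"
    using B o pc by simp
  have "?e \<oplus>\<^bsub>Hom C X X\<^esub> Comp C X B X s r = Ident C X"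
    using vs_laws(9)[OF v id_in[OF o(2)] ee(1)] B(4) by simp
  then have "bip C A B X i s p r"
    using o m e B ri ps by (simp add: bip_def)
  then show thesis by (rule that)
qed

lemma bip_zero_iso:
  assumes "bip C A B X i j p q" "zero_object C B"
  shows "iso_arrow C A X i"
proof -
  have b: "A \<in> Obj C" "B \<in> Obj C" "X \<in> Obj C" "i \<in> Mor C A X" "j \<in> Mor C B X" "p \<in> Mor C X A" "q \<in> Mor C X B"
    and e: "Comp C A X A p i = Ident C A" "Comp C X A X i p \<oplus>\<^bsub>Hom C X X\<^esub> Comp C X B X j q = Ident C X"
    using assms(1) by (auto simp: bip_def)
  have "Comp C X B X j q = \<zero>\<^bsub>Hom C X X\<^esub>"
    using zero_objectD(1)[OF assms(2) b(3) b(5)] b by simp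
  then have "Comp C X A X i p = Ident C X"
    using e(2) b vs_laws(2)[OF hom_vs] by simp
  then show ?thesis using b e by (auto simp: iso_arrow_def)
qed

lemma biproductD:
  assumes "biproduct C Xs Y i p" "k < length Xs"
  shows "Y \<in> Obj C" "Xs ! k \<in> Obj C" "i k \<in> Mor C (Xs ! k) Y" "p k \<in> Mor C Y (Xs ! k)"
    "Comp C (Xs ! k) Y (Xs ! k) (p k) (i k) = Ident C (Xs ! k)"
  using assms by (auto simp: biproduct_def)

text \<open>The identity of a biproduct is the sum of the idempotents \<open>i k\<close> after
  \<open>p k\<close>. With F the action on a fixed element, this reduces vanishing of extensions and
  membership in submodules to the summands.\<close>

lemma biproduct_lin:
  assumes b: "biproduct C Xs Y i p" and l: "lin (Hom C Y Y) W F" and S: "subspace class_ring S W"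
    and F: "\<And>k. k < length Xs \<Longrightarrow> F (Comp C Y (Xs ! k) Y (i k) (p k)) \<in> S"
  shows "F (Ident C Y) \<in> S"
proof -
  have Y: "Y \<in> Obj C" using b by (simp add: biproduct_def)
  have "F (Ident C Y) = F (finsum (Hom C Y Y) (\<lambda>j. Comp C Y (Xs ! j) Y (i j) (p j)) {..<length Xs})"
    using b by (simp add: biproduct_def)
  also have "\<dots> = finsum W (\<lambda>j. F (Comp C Y (Xs ! j) Y (i j) (p j))) {..<length Xs}"
    by (rule lin_finsum[OF l]) (use biproductD[OF b] Y in auto)
  also have "\<dots> \<in> S"
  proof -
    interpret W: abelian_monoid W
      using vspace_abelian_group[OF lin_vspace(2)[OF l]] by (simp add: abelian_group_def)
    have "finsum W g A \<in> S" if "finite A" "\<And>a. a \<in> A \<Longrightarrow> g a \<in> S" for g and A :: "nat set"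
      using that
    proof induction
      case empty
      then show ?case using subspaceD(3)[OF S] by simp
    next
      case (insert x F)
      have "g \<in> F \<rightarrow> carrier W" "g x \<in> carrier W"
        using insert.prems subspaceD(2)[OF S] by auto
      then show ?case
        using insert subspaceD(4)[OF S] by simp
    qed
    from this[OF finite_lessThan] show ?thesis using F by simp
  qed
  finally show ?thesis .
qed

lemma subspace_zero: "vspace V \<Longrightarrow> subspace class_ring {\<zero>\<^bsub>V\<^esub>} V"
  by (rule subspaceI) (auto simp: vs_closed vs_laws vs_smult_laws(4)[OF _ vs_closed(1)])

text \<open>\<open>krull_schmidt\<close> provides a local summand of X; idempotent completeness
  gives it a complement, which vanishes because X is indecomposable.\<close>

lemma indecomposable_local:
  assumes ks: "krull_schmidt C" and ic: "idempotent_complete C" and ind: "indecomposable C X"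
  shows "local_endo C X"
proof -
  have X: "X \<in> Obj C" "\<not> zero_object C X" using ind by (auto simp: indecomposable_def)
  obtain Xs i p where b: "biproduct C Xs X i p" and l: "\<forall>Y\<in>set Xs. local_endo C Y"
    using ks X unfolding krull_schmidt_def direct_sum_of_def by blast
  have "length Xs \<noteq> 0"
    using X direct_sum_nil b by (auto simp: direct_sum_of_def)
  then have k: "0 < length Xs" by simp
  have lA: "local_endo C (Xs ! 0)" using l k by simp
  obtain B j q where bb: "bip C (Xs ! 0) B X (i 0) j (p 0) q"
    using retract_bip[OF ic biproductD(2,1,3,4,5)[OF b k]] by blast
  then have "zero_object C B"
    using ind lA unfolding indecomposable_def direct_sum2 local_endo_def by blast
  then have "isomorphic C (Xs ! 0) X"
    using bip_zero_iso[OF bb] bb by (auto simp: isomorphic_def bip_def)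
  then show ?thesis using local_iso[OF lA] by blast
qed

end

section \<open>Extriangulated categories\<close>

text \<open>The additive structure is phrased through \<open>bip\<close> and zero objects.
  \<open>ET4\<close> is supplied separately when passing to the opposite category, where it becomes
  \<open>ET4_op\<close>.\<close>

locale extri = lincat C for C :: "('k::field, 'o, 'm, 'e) extricat" +
  assumes bip_ex: "A \<in> Obj C \<Longrightarrow> B \<in> Obj C \<Longrightarrow> \<exists>Y i j p q. bip C A B Y i j p q"
    and zero_ex: "\<exists>Z. zero_object C Z"
    and ext: "ext_bifunctor C"
    and realiz: "realization C"
    and split_real: "bip C A X Y i j p q \<Longrightarrow> (Y, i, q) \<in> Real C X A \<zero>\<^bsub>Ext C X A\<^esub>"
    and et3: "ET3 C" and et3op: "ET3_op C" and et4op: "ET4_op C"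
begin

lemma ext_vs [simp]: "X \<in> Obj C \<Longrightarrow> A \<in> Obj C \<Longrightarrow> vspace (Ext C X A)"
  using ext by (simp add: ext_bifunctor_def)

lemma ext_zero_in [simp]: "X \<in> Obj C \<Longrightarrow> A \<in> Obj C \<Longrightarrow> \<zero>\<^bsub>Ext C X A\<^esub> \<in> Exts C X A"
  by (simp add: vs_closed(1))

lemma push_lin:
  assumes "X \<in> Obj C" "A \<in> Obj C" "A' \<in> Obj C"
  shows "a \<in> Mor C A A' \<Longrightarrow> lin (Ext C X A) (Ext C X A') (Push C X A A' a)"
    "\<delta> \<in> Exts C X A \<Longrightarrow> lin (Hom C A A') (Ext C X A') (\<lambda>a. Push C X A A' a \<delta>)"
  using ext assms by (simp_all add: ext_bifunctor_def)

lemma pull_lin: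
  assumes "X' \<in> Obj C" "X \<in> Obj C" "A \<in> Obj C"
  shows "c \<in> Mor C X' X \<Longrightarrow> lin (Ext C X A) (Ext C X' A) (Pull C X' X A c)"
    "\<delta> \<in> Exts C X A \<Longrightarrow> lin (Hom C X' X) (Ext C X' A) (\<lambda>c. Pull C X' X A c \<delta>)"
  using ext assms by (simp_all add: ext_bifunctor_def)

lemma push_in [simp]:
  "X \<in> Obj C \<Longrightarrow> A \<in> Obj C \<Longrightarrow> A' \<in> Obj C \<Longrightarrow> a \<in> Mor C A A' \<Longrightarrow> \<delta> \<in> Exts C X A \<Longrightarrow>
    Push C X A A' a \<delta> \<in> Exts C X A'"
  using lin_closed[OF push_lin(1)] by blast

lemma pull_in [simp]:
  "X' \<in> Obj C \<Longrightarrow> X \<in> Obj C \<Longrightarrow> A \<in> Obj C \<Longrightarrow> c \<in> Mor C X' X \<Longrightarrow> \<delta> \<in> Exts C X A \<Longrightarrow>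
    Pull C X' X A c \<delta> \<in> Exts C X' A"
  using lin_closed[OF pull_lin(1)] by blast

lemma push_zero [simp]:
  assumes "X \<in> Obj C" "A \<in> Obj C" "A' \<in> Obj C"
  shows "a \<in> Mor C A A' \<Longrightarrow> Push C X A A' a \<zero>\<^bsub>Ext C X A\<^esub> = \<zero>\<^bsub>Ext C X A'\<^esub>"
    "\<delta> \<in> Exts C X A \<Longrightarrow> Push C X A A' \<zero>\<^bsub>Hom C A A'\<^esub> \<delta> = \<zero>\<^bsub>Ext C X A'\<^esub>"
  using lin_zero[OF push_lin(1)[OF assms]] lin_zero[OF push_lin(2)[OF assms]] by auto

lemma pull_zero [simp]:
  assumes "X' \<in> Obj C" "X \<in> Obj C" "A \<in> Obj C"
  shows "c \<in> Mor C X' X \<Longrightarrow> Pull C X' X A c \<zero>\<^bsub>Ext C X A\<^esub> = \<zero>\<^bsub>Ext C X' A\<^esub>"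
    "\<delta> \<in> Exts C X A \<Longrightarrow> Pull C X' X A \<zero>\<^bsub>Hom C X' X\<^esub> \<delta> = \<zero>\<^bsub>Ext C X' A\<^esub>"
  using lin_zero[OF pull_lin(1)[OF assms]] lin_zero[OF pull_lin(2)[OF assms]] by auto

lemma ext_id [simp]:
  assumes "X \<in> Obj C" "A \<in> Obj C" "\<delta> \<in> Exts C X A"
  shows "Push C X A A (Ident C A) \<delta> = \<delta>" "Pull C X X A (Ident C X) \<delta> = \<delta>"
  using ext assms by (simp_all add: ext_bifunctor_def)

lemma push_comp:
  assumes "X \<in> Obj C" "A \<in> Obj C" "A' \<in> Obj C" "A'' \<in> Obj C" "\<delta> \<in> Exts C X A" "a \<in> Mor C A A'" "a' \<in> Mor C A' A''"
  shows "Push C X A A'' (Comp C A A' A'' a' a) \<delta> = Push C X A' A'' a' (Push C X A A' a \<delta>)"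
  by (rule ext[unfolded ext_bifunctor_def, THEN conjunct2, THEN conjunct2, THEN conjunct2, THEN conjunct2, THEN conjunct1, rule_format, OF assms])

lemma pull_comp:
  assumes "X'' \<in> Obj C" "X' \<in> Obj C" "X \<in> Obj C" "A \<in> Obj C" "\<delta> \<in> Exts C X A" "c \<in> Mor C X' X" "c' \<in> Mor C X'' X'"
  shows "Pull C X'' X A (Comp C X'' X' X c c') \<delta> = Pull C X'' X' A c' (Pull C X' X A c \<delta>)"
  by (rule ext[unfolded ext_bifunctor_def, THEN conjunct2, THEN conjunct2, THEN conjunct2, THEN conjunct2, THEN conjunct2, THEN conjunct1, rule_format, OF assms])

lemma push_pull:
  assumes "X' \<in> Obj C" "X \<in> Obj C" "A \<in> Obj C" "A' \<in> Obj C" "\<delta> \<in> Exts C X A" "a \<in> Mor C A A'" "c \<in> Mor C X' X"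
  shows "Push C X' A A' a (Pull C X' X A c \<delta>) = Pull C X' X A' c (Push C X A A' a \<delta>)"
  by (rule ext[unfolded ext_bifunctor_def, THEN conjunct2, THEN conjunct2, THEN conjunct2, THEN conjunct2, THEN conjunct2, THEN conjunct2, rule_format, OF assms])

lemma realize:
  assumes "X \<in> Obj C" "A \<in> Obj C" "\<delta> \<in> Exts C X A"
  obtains B x y where "(B, x, y) \<in> Real C X A \<delta>"
proof -
  obtain s where s: "sequence C A X s" "Real C X A \<delta> = {s'. seq_equiv C A X s s'}"
    using realiz assms unfolding realization_def by blast
  obtain B x y where sB: "s = (B, x, y)" by (cases s)
  then have "seq_equiv C A X s s"
    using s assms iso_id[of B] by (auto simp: seq_equiv_def sequence_def intro!: exI[of _ "Ident C B"])
  then show thesis using s sB that by blast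
qed

lemma real_in:
  assumes "X \<in> Obj C" "A \<in> Obj C" "\<delta> \<in> Exts C X A" "(B, x, y) \<in> Real C X A \<delta>"
  shows "B \<in> Obj C" "x \<in> Mor C A B" "y \<in> Mor C B X"
proof -
  obtain s where "Real C X A \<delta> = {s'. seq_equiv C A X s s'}"
    using realiz assms unfolding realization_def by blast
  then have "sequence C A X (B, x, y)"
    using assms by (auto simp: seq_equiv_def)
  then show "B \<in> Obj C" "x \<in> Mor C A B" "y \<in> Mor C B X"
    by (auto simp: sequence_def)
qed

lemma real_iso:
  assumes o: "X \<in> Obj C" "A \<in> Obj C" "\<delta> \<in> Exts C X A"
    and "(B, x, y) \<in> Real C X A \<delta>" "(B', x', y') \<in> Real C X A \<delta>"
  shows "isomorphic C B B'"
proof -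
  obtain s where s: "Real C X A \<delta> = {s'. seq_equiv C A X s s'}"
    using realiz o unfolding realization_def by blast
  obtain D u v where "s = (D, u, v)" by (cases s)
  then have "isomorphic C D B" "isomorphic C D B'"
    using s assms real_in[OF o assms(4)] real_in[OF o assms(5)]
    by (auto simp: seq_equiv_def sequence_def isomorphic_def)
  then show ?thesis using isomorphic_sym isomorphic_trans by blast
qed

lemma real_morphism:
  assumes "X \<in> Obj C" "A \<in> Obj C" "\<delta> \<in> Exts C X A" "X' \<in> Obj C" "A' \<in> Obj C" "\<delta>' \<in> Exts C X' A'"
    and "(B, x, y) \<in> Real C X A \<delta>" "(B', x', y') \<in> Real C X' A' \<delta>'"
    and "a \<in> Mor C A A'" "c \<in> Mor C X X'" "Push C X A A' a \<delta> = Pull C X X' A' c \<delta>'"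
  obtains b where "b \<in> Mor C B B'" "Comp C A B B' b x = Comp C A A' B' x' a"
    "Comp C B B' X' y' b = Comp C B X X' c y"
proof -
  have "ext_morphism C X A \<delta> X' A' \<delta>' a c"
    using assms by (simp add: ext_morphism_def)
  moreover have r: "\<And>X A \<delta> X' A' \<delta>' B x y B' x' y' a c. X \<in> Obj C \<Longrightarrow> A \<in> Obj C \<Longrightarrow> \<delta> \<in> Exts C X A \<Longrightarrow>
      X' \<in> Obj C \<Longrightarrow> A' \<in> Obj C \<Longrightarrow> \<delta>' \<in> Exts C X' A' \<Longrightarrow>
      (B, x, y) \<in> Real C X A \<delta> \<and> (B', x', y') \<in> Real C X' A' \<delta>' \<and>
          ext_morphism C X A \<delta> X' A' \<delta>' a c \<Longrightarrow>
          (\<exists>b\<in>Mor C B B'. Comp C A B B' b x = Comp C A A' B' x' a \<and>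
                         Comp C B B' X' y' b = Comp C B X X' c y)"
    using realiz unfolding realization_def by presburger
  ultimately show thesis
    using that r[OF assms(1-6), of B x y B' x' y' a c] assms(7,8) by blast
qed

lemma et3D:
  assumes "X \<in> Obj C" "A \<in> Obj C" "\<delta> \<in> Exts C X A" "X' \<in> Obj C" "A' \<in> Obj C" "\<delta>' \<in> Exts C X' A'"
    and "(B, x, y) \<in> Real C X A \<delta>" "(B', x', y') \<in> Real C X' A' \<delta>'"
    and "a \<in> Mor C A A'" "b \<in> Mor C B B'" "Comp C A B B' b x = Comp C A A' B' x' a"
  obtains c where "c \<in> Mor C X X'" "Push C X A A' a \<delta> = Pull C X X' A' c \<delta>'"
    "Comp C B B' X' y' b = Comp C B X X' c y"
  using et3[unfolded ET3_def, rule_format, OF assms(1-6) conjI[OF assms(7,8)] assms(9-11)]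
  by (auto simp: ext_morphism_def)

lemma et3opD:
  assumes "X \<in> Obj C" "A \<in> Obj C" "\<delta> \<in> Exts C X A" "X' \<in> Obj C" "A' \<in> Obj C" "\<delta>' \<in> Exts C X' A'"
    and "(B, x, y) \<in> Real C X A \<delta>" "(B', x', y') \<in> Real C X' A' \<delta>'"
    and "b \<in> Mor C B B'" "c \<in> Mor C X X'" "Comp C B B' X' y' b = Comp C B X X' c y"
  obtains a where "a \<in> Mor C A A'" "Push C X A A' a \<delta> = Pull C X X' A' c \<delta>'"
    "Comp C A B B' b x = Comp C A A' B' x' a"
  using et3op[unfolded ET3_op_def, rule_format, OF assms(1-6) conjI[OF assms(7,8)] assms(9-11)]
  by (auto simp: ext_morphism_def)

section \<open>Exact sequences attached to an extension\<close>

context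
  fixes X A \<delta> B x y
  assumes o: "X \<in> Obj C" "A \<in> Obj C" "\<delta> \<in> Exts C X A" and r: "(B, x, y) \<in> Real C X A \<delta>"
begin

text \<open>The pair (w, 1) is a morphism from \<delta> to the split extension of X by A'. It is
  realised by a map from B to the biproduct, whose component at A' extends w along x.\<close>

lemma push_zero_factor:
  assumes "A' \<in> Obj C" "w \<in> Mor C A A'" "Push C X A A' w \<delta> = \<zero>\<^bsub>Ext C X A'\<^esub>"
  obtains b where "b \<in> Mor C B A'" "Comp C A B A' b x = w"
proof -
  note m = real_in[OF o r]
  obtain Y i j p q where b: "bip C A' X Y i j p q"
    using bip_ex[OF assms(1) o(1)] by blast
  note bm = b[unfolded bip_def]
  obtain b' where "b' \<in> Mor C B Y" "Comp C A B Y b' x = Comp C A A' Y i w"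
    by (rule real_morphism[OF o o(1) assms(1) _ r split_real[OF b] assms(2) id_in[OF o(1)]])
      (use assms o in auto)
  then have "Comp C A B A' (Comp C B Y A' p b') x = w"
    using bm o m assms by (simp flip: assoc) (simp add: assoc)
  then show thesis
    using that[of "Comp C B Y A' p b'"] bm m \<open>b' \<in> Mor C B Y\<close> by simp
qed

text \<open>Dually, (1, f) is a morphism from the split extension of X' by A to \<delta>, and the
  restriction of the middle map to X' lifts f.\<close>

lemma pull_zero_factor:
  assumes "X' \<in> Obj C" "f \<in> Mor C X' X" "Pull C X' X A f \<delta> = \<zero>\<^bsub>Ext C X' A\<^esub>"
  obtains b where "b \<in> Mor C X' B" "Comp C X' B X y b = f"
proof -
  note m = real_in[OF o r]
  obtain Y i j p q where b: "bip C A X' Y i j p q"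
    using bip_ex[OF o(2) assms(1)] by blast
  note bm = b[unfolded bip_def]
  obtain b' where "b' \<in> Mor C Y B" "Comp C Y B X y b' = Comp C Y X' X f q"
    by (rule real_morphism[OF assms(1) o(2) _ o split_real[OF b] r id_in[OF o(2)] assms(2)])
      (use assms o in auto)
  then have "Comp C X' B X y (Comp C X' Y B b' j) = f"
    using bm o m assms by (simp add: assoc) (simp flip: assoc)
  then show thesis
    using that[of "Comp C X' Y B b' j"] bm m \<open>b' \<in> Mor C Y B\<close> by simp
qed

text \<open>\<open>ET3_op\<close> is applied to the maps 1 and y from the sequence 0 -> B -> B to
  the given one. It provides a map from 0 to A, and the pushout of the zero extension along it is
  the pullback of \<delta> along y.\<close>

lemma pull_deflation: "Pull C B X A y \<delta> = \<zero>\<^bsub>Ext C B A\<^esub>"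
proof -
  note m = real_in[OF o r]
  obtain Z where Z: "zero_object C Z" using zero_ex by blast
  have Zo: "Z \<in> Obj C" using Z by (simp add: zero_object_def)
  note z = split_real[OF bip_sym[OF bip_zero[OF m(1) Z]]]
  obtain a where "a \<in> Mor C Z A" "Push C B Z A a \<zero>\<^bsub>Ext C B Z\<^esub> = Pull C B X A y \<delta>"
    by (rule et3opD[OF m(1) Zo _ o z r id_in[OF m(1)] m(3)]) (use m o Zo in auto)
  then show ?thesis using m o Zo by simp
qed

text \<open>Exactness of Hom(V, X) -> Ext(V, A) -> Ext(V, B) in the middle. As the pushout along x
  vanishes, x extends over the middle term of \<delta>', and \<open>ET3\<close> completes this to a
  morphism of extensions.\<close>

lemma push_inflation_zero:
  assumes V: "V \<in> Obj C" "\<delta>' \<in> Exts C V A" and z: "Push C V A B x \<delta>' = \<zero>\<^bsub>Ext C V B\<^esub>"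
  obtains c where "c \<in> Mor C V X" "\<delta>' = Pull C V X A c \<delta>"
proof -
  note m = real_in[OF o r]
  obtain D u v where D: "(D, u, v) \<in> Real C V A \<delta>'"
    using realize[OF V(1) o(2) V(2)] .
  obtain b' where b': "b' \<in> Mor C D B" "Comp C A D B b' u = x"
    using extri.push_zero_factor[OF extri_axioms V(1) o(2) V(2) D m(1,2) z] by blast
  obtain c where "c \<in> Mor C V X" "Push C V A A (Ident C A) \<delta>' = Pull C V X A c \<delta>"
    by (rule et3D[OF V(1) o(2) V(2) o D r id_in[OF o(2)] b'(1)]) (use m o b' in auto)
  then show thesis using that V o by simp
qed

text \<open>The difference \<open>n\<close> to the identity factors through \<open>x\<close> and is killed by \<open>x\<close>, so that it squares to zero.\<close>

lemma unipotent_iso: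
  assumes \<phi>: "\<phi> \<in> Mor C A A" and x\<phi>: "Comp C A A B x \<phi> = x" and p: "Push C X A A \<phi> \<delta> = \<delta>"
  shows "iso_arrow C A A \<phi>"
proof -
  note m = real_in[OF o r]
  note v = hom_vs[OF o(2,2)]
  let ?n = "\<phi> \<ominus>\<^bsub>Hom C A A\<^esub> Ident C A"
  have n: "?n \<in> Mor C A A" using \<phi> o by simp
  have "Push C X A A ?n \<delta> = \<zero>\<^bsub>Ext C X A\<^esub>"
    using lin_minus[OF push_lin(2)[OF o(1,2,2,3)] \<phi> id_in[OF o(2)]] p o
    by (simp add: vs_laws(3)[OF ext_vs])
  then obtain s where s: "s \<in> Mor C B A" "Comp C A B A s x = ?n"
    using push_zero_factor[OF o(2) n] by blast
  have xn: "Comp C A A B x ?n = \<zero>\<^bsub>Hom C A B\<^esub>"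
    using o m \<phi> x\<phi> by (simp add: comp_minus vs_laws(3)[OF hom_vs])
  have "Comp C A A A ?n ?n = Comp C A A A (Comp C A B A s x) ?n" using s by simp
  also have "\<dots> = Comp C A B A s (Comp C A A B x ?n)"
    using o m s(1) n by (simp add: assoc)
  finally have nn: "Comp C A A A ?n ?n = \<zero>\<^bsub>Hom C A A\<^esub>"
    using xn o m s(1) by simp
  have \<phi>n: "\<phi> = ?n \<oplus>\<^bsub>Hom C A A\<^esub> Ident C A"
    using vs_laws(8)[OF v \<phi> id_in[OF o(2)]] by simp
  have a: "Comp C A A A ?n \<phi> = ?n" "Comp C A A A \<phi> ?n = ?n"
  proof -
    have "Comp C A A A ?n \<phi> = Comp C A A A ?n (?n \<oplus>\<^bsub>Hom C A A\<^esub> Ident C A)" using \<phi>n by simp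
    also have "\<dots> = Comp C A A A ?n ?n \<oplus>\<^bsub>Hom C A A\<^esub> ?n"
      using o n by (simp add: comp_add)
    finally show "Comp C A A A ?n \<phi> = ?n" using nn n vs_laws(1)[OF v] by simp
    have "Comp C A A A \<phi> ?n = Comp C A A A (?n \<oplus>\<^bsub>Hom C A A\<^esub> Ident C A) ?n" using \<phi>n by simp
    also have "\<dots> = Comp C A A A ?n ?n \<oplus>\<^bsub>Hom C A A\<^esub> ?n"
      using o n by (simp add: comp_add)
    finally show "Comp C A A A \<phi> ?n = ?n" using nn n vs_laws(1)[OF v] by simp
  qed
  have sub: "\<phi> \<ominus>\<^bsub>Hom C A A\<^esub> ?n = Ident C A"
  proof -
    have "\<phi> \<ominus>\<^bsub>Hom C A A\<^esub> ?n = (Ident C A \<oplus>\<^bsub>Hom C A A\<^esub> ?n) \<ominus>\<^bsub>Hom C A A\<^esub> ?n"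
      using \<phi>n vs_laws(11)[OF v n id_in[OF o(2)]] by simp
    then show ?thesis using vs_laws(10)[OF v id_in[OF o(2)] n] by simp
  qed
  \<comment> \<open>With n n = 0, the inverse of 1 + n is 1 - n.\<close>
  let ?g = "Ident C A \<ominus>\<^bsub>Hom C A A\<^esub> ?n"
  have "Comp C A A A ?g \<phi> = \<phi> \<ominus>\<^bsub>Hom C A A\<^esub> ?n" "Comp C A A A \<phi> ?g = \<phi> \<ominus>\<^bsub>Hom C A A\<^esub> ?n"
    using o n \<phi> a by (simp_all add: comp_minus(1)[of A A A \<phi> "Ident C A" ?n] comp_minus(2)[of A A A "Ident C A" ?n \<phi>])
  then show ?thesis
    using sub \<phi> n o unfolding iso_arrow_def by (metis id_in minus_in)
qed

end

section \<open>Schanuel's lemma\<close>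

lemma iso_of_composites:
  assumes o: "A \<in> Obj C" "B \<in> Obj C" and a: "a \<in> Mor C A B" "b \<in> Mor C B A"
    and i: "iso_arrow C A A (Comp C A B A b a)" "iso_arrow C B B (Comp C B A B a b)"
  shows "isomorphic C A B"
proof -
  obtain u where u: "u \<in> Mor C A A" "Comp C A A A u (Comp C A B A b a) = Ident C A"
    using isoE[OF i(1)] by metis
  obtain v where v: "v \<in> Mor C B B" "Comp C B B B (Comp C B A B a b) v = Ident C B"
    using isoE[OF i(2)] by metis
  let ?l = "Comp C B A A u b" and ?r = "Comp C B B A b v"
  have l: "Comp C A B A ?l a = Ident C A" "?l \<in> Mor C B A"
    using o a u by (simp_all add: assoc)
  have r: "Comp C B A B a ?r = Ident C B" "?r \<in> Mor C B A"
    using o a v by (simp_all add: assoc)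
  have "?l = Comp C B B A ?l (Comp C B A B a ?r)"
    using o l(2) r(1) by simp
  also have "\<dots> = Comp C B A A (Comp C A B A ?l a) ?r"
    by (rule assoc) (use o a l(2) r(2) in auto)
  also have "\<dots> = ?r" using o l(1) r(2) by simp
  finally show ?thesis
    using o a l r by (intro isomorphicI[of A B a ?l]) auto
qed

text \<open>An inflation need not be a kernel, so no universal property determines the first term.
  \<open>ET3_op\<close> yields maps both ways; their composites fix the extension and commute with
  the inflation, so \<open>unipotent_iso\<close> makes them invertible.\<close>

lemma same_deflation_iso:
  assumes X: "X \<in> Obj C" and E: "E \<in> Obj C" "\<delta> \<in> Exts C X E" "(A, x, y) \<in> Real C X E \<delta>"
    and E': "E' \<in> Obj C" "\<delta>' \<in> Exts C X E'" "(A, x', y) \<in> Real C X E' \<delta>'"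
  shows "isomorphic C E E'"
proof -
  note m = real_in[OF X E] real_in[OF X E']
  obtain a where a: "a \<in> Mor C E E'" "Push C X E E' a \<delta> = \<delta>'" "Comp C E E' A x' a = x"
    using et3opD[OF X E(1,2) X E'(1,2) E(3) E'(3) id_in[OF m(1)] id_in[OF X]] X E E' m by auto
  obtain b where b: "b \<in> Mor C E' E" "Push C X E' E b \<delta>' = \<delta>" "Comp C E' E A x b = x'"
    using et3opD[OF X E'(1,2) X E(1,2) E'(3) E(3) id_in[OF m(1)] id_in[OF X]] X E E' m by auto
  have "iso_arrow C E E (Comp C E E' E b a)"
    using a b X E(1,2) E'(1,2) m
    by (intro unipotent_iso[OF X E]) (simp_all add: push_comp assoc)
  moreover have "iso_arrow C E' E' (Comp C E' E E' a b)"
    using a b X E(1,2) E'(1,2) m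
    by (intro unipotent_iso[OF X E']) (simp_all add: push_comp assoc)
  ultimately show ?thesis
    using iso_of_composites E E' a b by blast
qed

lemma zero_ext_sum:
  assumes "X \<in> Obj C" "A \<in> Obj C" "(E, d, e) \<in> Real C X A \<zero>\<^bsub>Ext C X A\<^esub>"
  shows "direct_sum_of C [A, X] E"
proof -
  obtain Y i j p q where b: "bip C A X Y i j p q"
    using bip_ex[OF assms(2,1)] by blast
  have "isomorphic C Y E"
    by (rule real_iso[OF assms(1,2) _ split_real[OF b] assms(3)]) (use assms in auto)
  then show ?thesis
    unfolding direct_sum2 using bip_iso[OF b] by blast
qed

text \<open>The automorphism of Y determined by h turns the projection p into p + hq. Hence p + hq
  is again a split deflation, realising the zero extension of A by B.\<close>

lemma bip_shear:
  assumes b: "bip C A B Y i j p q" and h: "h \<in> Mor C B A"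
  shows "bip C B A Y (j \<ominus>\<^bsub>Hom C B Y\<^esub> Comp C B A Y i h) i q (p \<oplus>\<^bsub>Hom C Y A\<^esub> Comp C Y B A h q)"
proof -
  have m: "A \<in> Obj C" "B \<in> Obj C" "Y \<in> Obj C" "i \<in> Mor C A Y" "j \<in> Mor C B Y" "p \<in> Mor C Y A" "q \<in> Mor C Y B"
    and e: "Comp C A Y A p i = Ident C A" "Comp C B Y B q j = Ident C B"
     "Comp C A Y B q i = \<zero>\<^bsub>Hom C A B\<^esub>" "Comp C B Y A p j = \<zero>\<^bsub>Hom C B A\<^esub>"
     "Comp C Y A Y i p \<oplus>\<^bsub>Hom C Y Y\<^esub> Comp C Y B Y j q = Ident C Y"
    using b by (auto simp: bip_def)
  let ?j = "j \<ominus>\<^bsub>Hom C B Y\<^esub> Comp C B A Y i h" and ?p = "p \<oplus>\<^bsub>Hom C Y A\<^esub> Comp C Y B A h q"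
  have qih: "Comp C B Y B q (Comp C B A Y i h) = \<zero>\<^bsub>Hom C B B\<^esub>"
    using m e h by (simp add: assoc)
  have pih: "Comp C B Y A p (Comp C B A Y i h) = h"
    using m e h by (simp add: assoc)
  have 1: "Comp C B Y B q ?j = Ident C B"
    using m h e qih by (simp add: comp_minus vs_laws(4)[OF hom_vs])
  have 2: "Comp C A Y A ?p i = Ident C A"
    using m h e by (simp add: comp_add assoc[symmetric] vs_laws(2)[OF hom_vs])
  have 3: "Comp C B Y A ?p ?j = \<zero>\<^bsub>Hom C B A\<^esub>"
  proof -
    have "Comp C B Y A ?p ?j = Comp C B Y A p ?j \<oplus>\<^bsub>Hom C B A\<^esub> Comp C B B A h (Comp C B Y B q ?j)"
      using m h by (simp add: comp_add assoc)
    also have "Comp C B Y A p ?j = \<zero>\<^bsub>Hom C B A\<^esub> \<ominus>\<^bsub>Hom C B A\<^esub> h"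
      using m h e pih by (simp add: comp_minus)
    finally show ?thesis
      using 1 m h vs_laws(8)[OF hom_vs[OF m(2,1)] zero_in[OF m(2,1)] h] by simp
  qed
  have 4: "Comp C Y B Y ?j q \<oplus>\<^bsub>Hom C Y Y\<^esub> Comp C Y A Y i ?p = Ident C Y"
  proof -
    note v = hom_vs[OF m(3,3)]
    let ?ihq = "Comp C Y A Y i (Comp C Y B A h q)"
    have ihq: "?ihq \<in> Mor C Y Y" using m h by simp
    have "Comp C Y B Y ?j q = Comp C Y B Y j q \<ominus>\<^bsub>Hom C Y Y\<^esub> ?ihq"
      using m h by (simp add: comp_minus assoc)
    moreover have "Comp C Y A Y i ?p = ?ihq \<oplus>\<^bsub>Hom C Y Y\<^esub> Comp C Y A Y i p"
      using m h vs_laws(11)[OF v] by (simp add: comp_add)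
    ultimately have "Comp C Y B Y ?j q \<oplus>\<^bsub>Hom C Y Y\<^esub> Comp C Y A Y i ?p =
      (Comp C Y B Y j q \<ominus>\<^bsub>Hom C Y Y\<^esub> ?ihq) \<oplus>\<^bsub>Hom C Y Y\<^esub> (?ihq \<oplus>\<^bsub>Hom C Y Y\<^esub> Comp C Y A Y i p)"
      by simp
    also have "\<dots> = (Comp C Y B Y j q \<ominus>\<^bsub>Hom C Y Y\<^esub> ?ihq \<oplus>\<^bsub>Hom C Y Y\<^esub> ?ihq) \<oplus>\<^bsub>Hom C Y Y\<^esub> Comp C Y A Y i p"
      by (rule vs_assoc[OF v, symmetric]) (use m ihq in auto)
    also have "\<dots> = Ident C Y"
      using m ihq e vs_laws(8)[OF v _ ihq] vs_laws(11)[OF v] by simp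
    finally show ?thesis .
  qed
  show ?thesis
    unfolding bip_def using m h e 1 2 3 4 by simp
qed

text \<open>The part of \<open>ET4_op\<close> about composites: the first term E of a composite of
  deflations is an extension of F by D, with class pulled back from \<delta> along g'.\<close>

lemma compose_deflations:
  assumes "A \<in> Obj C" "B \<in> Obj C" "X \<in> Obj C" "D \<in> Obj C" "F \<in> Obj C"
    "\<delta> \<in> Exts C B D" "\<delta>' \<in> Exts C X F" "(A, f', f) \<in> Real C B D \<delta>" "(B, g', g) \<in> Real C X F \<delta>'"
  obtains E \<delta>'' h d e where "E \<in> Obj C" "\<delta>'' \<in> Exts C X E" "(A, h, Comp C A B X g f) \<in> Real C X E \<delta>''"
    "(E, d, e) \<in> Real C F D (Pull C F B D g' \<delta>)"
proof -
  note * = et4op[unfolded ET4_op_def, rule_format, OF assms(1-7) conjI[OF assms(8,9)]]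
  show thesis
    using that * by (elim bexE conjE) metis
qed

text \<open>The map (y, y') from the sum of R and R' to X is a sheared projection to R followed by
  y, so its first term is an extension of K by R'. The class of that extension is a pullback of
  zero, so it splits. Exchanging the roles describes the same first term by R and K'.\<close>

lemma schanuel:
  assumes X: "X \<in> Obj C" and K: "K \<in> Obj C" "\<delta> \<in> Exts C X K" "(R, x, y) \<in> Real C X K \<delta>"
    and K': "K' \<in> Obj C" "\<delta>' \<in> Exts C X K'" "(R', x', y') \<in> Real C X K' \<delta>'"
    and h: "h \<in> Mor C R' R" "Comp C R' R X y h = y'" and h': "h' \<in> Mor C R R'" "Comp C R R' X y' h' = y"
  obtains E E' where "direct_sum_of C [R', K] E" "direct_sum_of C [R, K'] E'" "isomorphic C E E'"
proof -
  note m = real_in[OF X K] real_in[OF X K']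
  obtain Y i j p q where b: "bip C R R' Y i j p q"
    using bip_ex[OF m(1,4)] by blast
  have bm: "Y \<in> Obj C" "p \<in> Mor C Y R" "q \<in> Mor C Y R'" using b by (auto simp: bip_def)
  obtain E \<delta>1 u d e where E: "E \<in> Obj C" "\<delta>1 \<in> Exts C X E"
    "(Y, u, Comp C Y R X y (p \<oplus>\<^bsub>Hom C Y R\<^esub> Comp C Y R' R h q)) \<in> Real C X E \<delta>1"
    "(E, d, e) \<in> Real C K R' (Pull C K R R' x \<zero>\<^bsub>Ext C R R'\<^esub>)"
    by (rule compose_deflations[OF bm(1) m(1) X m(4) K(1) ext_zero_in[OF m(1,4)] K(2) split_real[OF bip_shear[OF b h(1)]] K(3)])
  obtain E' \<delta>2 u' d' e' where E': "E' \<in> Obj C" "\<delta>2 \<in> Exts C X E'"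
    "(Y, u', Comp C Y R' X y' (q \<oplus>\<^bsub>Hom C Y R'\<^esub> Comp C Y R R' h' p)) \<in> Real C X E' \<delta>2"
    "(E', d', e') \<in> Real C K' R (Pull C K' R' R x' \<zero>\<^bsub>Ext C R' R\<^esub>)"
    by (rule compose_deflations[OF bm(1) m(4) X m(1) K'(1) ext_zero_in[OF m(4,1)] K'(2)
          split_real[OF bip_shear[OF bip_sym[OF b] h'(1)]] K'(3)])
  \<comment> \<open>Both composite deflations are the sum of yp and y'q, so
    \<open>same_deflation_iso\<close> applies to them.\<close>
  have "Comp C Y R X y (p \<oplus>\<^bsub>Hom C Y R\<^esub> Comp C Y R' R h q) = Comp C Y R X y p \<oplus>\<^bsub>Hom C Y X\<^esub> Comp C Y R' X y' q"
    using X m bm h by (simp add: comp_add assoc)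
  moreover have "Comp C Y R' X y' (q \<oplus>\<^bsub>Hom C Y R'\<^esub> Comp C Y R R' h' p) = Comp C Y R' X y' q \<oplus>\<^bsub>Hom C Y X\<^esub> Comp C Y R X y p"
    using X m bm h' by (simp add: comp_add assoc)
  ultimately have "isomorphic C E E'"
    using same_deflation_iso[OF X E(1-3) E'(1-2)] E'(3) vs_laws(11)[OF hom_vs[OF bm(1) X]] X m bm by simp
  moreover have "direct_sum_of C [R', K] E" "direct_sum_of C [R, K'] E'"
    using zero_ext_sum E(4) E'(4) m K(1) K'(1) by simp_all
  ultimately show thesis using that by blast
qed

end

subsection \<open>Index and coindex\<close>

lemma split_seqs_sub: "split_seqs C T \<subseteq> T \<times> T \<times> T"
  by (auto simp: split_seqs_def)

lemma classT_diff:
  assumes "X \<in> T" "Y \<in> T"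
  shows "classT C T X \<otimes>\<^bsub>K0T C T\<^esub> inv\<^bsub>K0T C T\<^esub> classT C T Y = K0_coset T (split_seqs C T) (frag_of X - frag_of Y)"
  using assms K0_inv[OF split_seqs_sub[of C T], of "frag_of Y"]
    K0_mult[OF split_seqs_sub[of C T], of "frag_of X" "- frag_of Y"]
  by (simp add: classT_def)

text \<open>The defining relations mention only direct sums. With Z zero, both X and Y are sums of X
  and Z, and subtracting the two relations leaves [X] - [Y].\<close>

lemma (in lincat) K0T_iso:
  assumes "X \<in> T" "Y \<in> T" "Z \<in> T" "zero_object C Z" "isomorphic C X Y"
  shows "frag_of X - frag_of Y \<in> K0_rel T (split_seqs C T)"
proof -
  have "X \<in> Obj C" using assms by (simp add: isomorphic_def)
  then have "(X, X, Z) \<in> split_seqs C T" and "(X, Y, Z) \<in> split_seqs C T"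
    using assms iso_direct_sum_zero[of X X Z] iso_direct_sum_zero[of X Y Z] isomorphic_refl[of X]
    unfolding split_seqs_def by blast+
  then have "(frag_of X - frag_of X - frag_of Z) - (frag_of Y - frag_of X - frag_of Z) \<in> K0_rel T (split_seqs C T)"
    by (intro K0_rel_closed(4)[OF split_seqs_sub] K0_rel_closed(5)[OF split_seqs_sub])
  then show ?thesis by simp
qed

text \<open>One of the two halves of cluster tilting. The other half is this locale for the opposite
  category, so statements about left approximations and the coindex are obtained by duality.\<close>

locale tilt = extri +
  fixes T
  assumes orth: "T = {X \<in> Obj C. \<forall>U\<in>T. Exts C U X = {\<zero>\<^bsub>Ext C U X\<^esub>}}"
    and approx: "X \<in> Obj C \<Longrightarrow> \<exists>U f. right_approx C T U X f \<and> deflation C U X f"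
begin

lemma T_obj [simp]: "X \<in> T \<Longrightarrow> X \<in> Obj C"
  using orth by blast

lemma T_ext: "U \<in> T \<Longrightarrow> X \<in> T \<Longrightarrow> \<delta> \<in> Exts C U X \<Longrightarrow> \<delta> = \<zero>\<^bsub>Ext C U X\<^esub>"
  using orth by blast

lemma T_I: "X \<in> Obj C \<Longrightarrow> (\<And>U \<delta>. U \<in> T \<Longrightarrow> \<delta> \<in> Exts C U X \<Longrightarrow> \<delta> = \<zero>\<^bsub>Ext C U X\<^esub>) \<Longrightarrow> X \<in> T"
  using orth ext_zero_in T_obj by blast

text \<open>An extension of U by Z is its own pushout along the identity of Z, hence a sum of
  pushouts that pass through the summands, where they vanish.\<close>

lemma T_list_sum:
  assumes "direct_sum_of C Xs Z" "set Xs \<subseteq> T"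
  shows "Z \<in> T"
proof -
  obtain i p where b: "biproduct C Xs Z i p" using assms by (auto simp: direct_sum_of_def)
  then have Z: "Z \<in> Obj C" by (simp add: biproduct_def)
  show ?thesis
  proof (rule T_I[OF Z])
    fix U \<delta> assume U: "U \<in> T" and \<delta>: "\<delta> \<in> Exts C U Z"
    have "Push C U Z Z (Ident C Z) \<delta> \<in> {\<zero>\<^bsub>Ext C U Z\<^esub>}"
    proof (rule biproduct_lin[OF b])
      show "lin (Hom C Z Z) (Ext C U Z) (\<lambda>f. Push C U Z Z f \<delta>)"
        by (rule push_lin) (use U Z \<delta> in auto)
      show "subspace class_ring {\<zero>\<^bsub>Ext C U Z\<^esub>} (Ext C U Z)"
        by (rule subspace_zero) (use U Z in auto)
      fix k assume k: "k < length Xs"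
      note d = biproductD[OF b k]
      have X: "Xs ! k \<in> T" using assms k by auto
      have "Push C U Z (Xs ! k) (p k) \<delta> = \<zero>\<^bsub>Ext C U (Xs ! k)\<^esub>"
        by (rule T_ext) (use U X Z \<delta> d in auto)
      then show "Push C U Z Z (Comp C Z (Xs ! k) Z (i k) (p k)) \<delta> \<in> {\<zero>\<^bsub>Ext C U Z\<^esub>}"
        using U Z \<delta> d by (simp add: push_comp)
    qed
    then show "\<delta> = \<zero>\<^bsub>Ext C U Z\<^esub>" using U Z \<delta> by simp
  qed
qed

lemma T_retract:
  assumes "Y \<in> T" "A \<in> Obj C" "i \<in> Mor C A Y" "p \<in> Mor C Y A" "Comp C A Y A p i = Ident C A"
  shows "A \<in> T"
proof (rule T_I[OF assms(2)])
  fix U \<delta> assume U: "U \<in> T" and \<delta>: "\<delta> \<in> Exts C U A"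
  have "Push C U A Y i \<delta> = \<zero>\<^bsub>Ext C U Y\<^esub>"
    by (rule T_ext) (use U \<delta> assms in auto)
  then have "Push C U A A (Comp C A Y A p i) \<delta> = \<zero>\<^bsub>Ext C U A\<^esub>"
    using assms(1-4) U \<delta> by (simp add: push_comp)
  then show "\<delta> = \<zero>\<^bsub>Ext C U A\<^esub>" using assms U \<delta> by simp
qed

lemma T_iso: "X \<in> T \<Longrightarrow> isomorphic C X Y \<Longrightarrow> Y \<in> T"
proof -
  assume X: "X \<in> T" and "isomorphic C X Y"
  then obtain f g where "Y \<in> Obj C" "f \<in> Mor C X Y" "g \<in> Mor C Y X" "Comp C Y X Y f g = Ident C Y"
    using isomorphicE by metis
  then show "Y \<in> T" using T_retract[OF X] by blast
qed

lemma T_sum2: "A \<in> T \<Longrightarrow> B \<in> T \<Longrightarrow> direct_sum_of C [A, B] Y \<Longrightarrow> Y \<in> T"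
  by (rule T_list_sum) auto

lemma T_zero: "zero_object C Z \<Longrightarrow> Z \<in> T"
  using T_list_sum[of "[]" Z] direct_sum_nil by simp

lemma frag_iso: "X \<in> T \<Longrightarrow> isomorphic C X Y \<Longrightarrow> frag_of X - frag_of Y \<in> K0_rel T (split_seqs C T)"
  using K0T_iso[of X T Y] T_iso T_zero zero_ex by blast

lemma factor_through_deflation:
  assumes o: "X \<in> Obj C" "K \<in> T" "\<delta> \<in> Exts C X K" "(R, x, y) \<in> Real C X K \<delta>"
    and V: "V \<in> T" "f \<in> Mor C V X"
  obtains h where "h \<in> Mor C V R" "Comp C V R X y h = f"
proof -
  have "Pull C V X K f \<delta> = \<zero>\<^bsub>Ext C V K\<^esub>"
    by (rule T_ext) (use o V in auto)
  then show thesis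
    using pull_zero_factor[OF o(1) _ o(3,4) _ V(2)] o V that T_obj by blast
qed

text \<open>Maps from T lift along deflations with first term in T, because Ext vanishes on T. The
  two resolutions therefore map to each other, and Schanuel's lemma gives [R'] + [K] = [R] +
  [K'].\<close>

lemma index_unique:
  assumes c: "conflation C K x R y X" "conflation C K' x' R' y' X" and T: "K \<in> T" "R \<in> T" "K' \<in> T" "R' \<in> T"
  shows "K0_coset T (split_seqs C T) (frag_of R - frag_of K) = K0_coset T (split_seqs C T) (frag_of R' - frag_of K')"
proof -
  obtain \<delta> \<delta>' where X: "X \<in> Obj C" and d: "\<delta> \<in> Exts C X K" "(R, x, y) \<in> Real C X K \<delta>"
    and d': "\<delta>' \<in> Exts C X K'" "(R', x', y') \<in> Real C X K' \<delta>'"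
    using c unfolding conflation_def by blast
  note m = real_in[OF X T_obj[OF T(1)] d] real_in[OF X T_obj[OF T(3)] d']
  obtain h where h: "h \<in> Mor C R' R" "Comp C R' R X y h = y'"
    by (rule factor_through_deflation[OF X T(1) d T(4) m(6)])
  obtain h' where h': "h' \<in> Mor C R R'" "Comp C R R' X y' h' = y"
    by (rule factor_through_deflation[OF X T(3) d' T(2) m(3)])
  obtain E E' where E: "direct_sum_of C [R', K] E" "direct_sum_of C [R, K'] E'" "isomorphic C E E'"
    by (rule schanuel[OF X T_obj[OF T(1)] d T_obj[OF T(3)] d' h h'])
  have ET: "E \<in> T" "E' \<in> T" using T_sum2 E T by blast+
  let ?N = "K0_rel T (split_seqs C T)"
  have "frag_of E - frag_of R' - frag_of K \<in> ?N" "frag_of E' - frag_of R - frag_of K' \<in> ?N"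
  proof -
    have "(R', E, K) \<in> split_seqs C T"
      using E ET T by (auto simp: split_seqs_def)
    then show "frag_of E - frag_of R' - frag_of K \<in> ?N"
      by (rule K0_rel_closed(5)[OF split_seqs_sub])
    have "(R, E', K') \<in> split_seqs C T"
      using E ET T by (auto simp: split_seqs_def)
    then show "frag_of E' - frag_of R - frag_of K' \<in> ?N"
      by (rule K0_rel_closed(5)[OF split_seqs_sub])
  qed
  moreover have "frag_of E - frag_of E' \<in> ?N" by (rule frag_iso[OF ET(1) E(3)])
  ultimately have "(frag_of E - frag_of R' - frag_of K) - (frag_of E' - frag_of R - frag_of K') - (frag_of E - frag_of E') \<in> ?N"
    using K0_rel_closed(4)[OF split_seqs_sub[of C T]] by presburger
  then show ?thesis
    unfolding K0_coset_eq[OF split_seqs_sub] by (simp add: algebra_simps)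
qed

lemma resolution:
  assumes X: "X \<in> Obj C"
  obtains K x R y where "K \<in> T" "R \<in> T" "conflation C K x R y X"
proof -
  obtain R y where ra: "right_approx C T R X y" and de: "deflation C R X y"
    using approx[OF X] by blast
  obtain K x where c: "conflation C K x R y X"
    using de by (auto simp: deflation_def)
  obtain \<delta> where K: "K \<in> Obj C" and d: "\<delta> \<in> Exts C X K" "(R, x, y) \<in> Real C X K \<delta>"
    using c unfolding conflation_def by blast
  note m = real_in[OF X K d]
  have R: "R \<in> T" using ra by (simp add: right_approx_def)
  \<comment> \<open>An extension of U by K dies in Ext(U, R), so it is the pullback of \<delta>
    along some map U -> X. That map factors through the approximation y, and the pullback of
    \<delta> along y is zero.\<close>
  have "K \<in> T"
  proof (rule T_I[OF K])
    fix U \<epsilon> assume U: "U \<in> T" and e: "\<epsilon> \<in> Exts C U K"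
    have "Push C U K R x \<epsilon> = \<zero>\<^bsub>Ext C U R\<^esub>"
      by (rule T_ext) (use U R K e m in auto)
    then obtain f where f: "f \<in> Mor C U X" "\<epsilon> = Pull C U X K f \<delta>"
      using push_inflation_zero[OF X K d T_obj[OF U] e] by blast
    obtain h where h: "h \<in> Mor C U R" "f = Comp C U R X y h"
      using ra U f(1) unfolding right_approx_def by metis
    have "\<epsilon> = Pull C U R K h (Pull C R X K y \<delta>)"
      using f h U X K d m by (simp add: pull_comp)
    then show "\<epsilon> = \<zero>\<^bsub>Ext C U K\<^esub>"
      using pull_deflation[OF X K d] U K m h by simp
  qed
  then show thesis using that R c by blast
qed

lemma index_eq:
  assumes "conflation C K x R y X" "K \<in> T" "R \<in> T"
  shows "index C T X = K0_coset T (split_seqs C T) (frag_of R - frag_of K)"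
  unfolding index_def
proof (rule the_equality)
  show "\<exists>Ka\<in>T. \<exists>Ra\<in>T. \<exists>x y. conflation C Ka x Ra y X \<and>
      K0_coset T (split_seqs C T) (frag_of R - frag_of K) = classT C T Ra \<otimes>\<^bsub>K0T C T\<^esub> inv\<^bsub>K0T C T\<^esub> classT C T Ka"
    using assms classT_diff[OF assms(3,2), of C] by blast
  fix v assume "\<exists>K\<in>T. \<exists>R\<in>T. \<exists>x y. conflation C K x R y X \<and>
      v = classT C T R \<otimes>\<^bsub>K0T C T\<^esub> inv\<^bsub>K0T C T\<^esub> classT C T K"
  then obtain K' R' x' y' where "K' \<in> T" "R' \<in> T" "conflation C K' x' R' y' X"
    "v = classT C T R' \<otimes>\<^bsub>K0T C T\<^esub> inv\<^bsub>K0T C T\<^esub> classT C T K'" by blast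
  then show "v = K0_coset T (split_seqs C T) (frag_of R - frag_of K)"
    using index_unique[of K x R y X K' x' R' y'] assms classT_diff[of R' T K' C] by metis
qed

end

section \<open>Duality: the opposite category\<close>

definition opcat :: "('k, 'o, 'm, 'e) extricat \<Rightarrow> ('k, 'o, 'm, 'e) extricat" where
  "opcat C = \<lparr>Obj = Obj C, Hom = (\<lambda>X Y. Hom C Y X), Ident = Ident C,
     Comp = (\<lambda>X Y Z g f. Comp C Z Y X f g), Ext = (\<lambda>X A. Ext C A X),
     Push = (\<lambda>X A A' a. Pull C A' A X a), Pull = (\<lambda>X' X A c. Push C A X X' c),
     Real = (\<lambda>X A \<delta>. {(B, x, y). (B, y, x) \<in> Real C A X \<delta>})\<rparr>"

lemma opcat_simps [simp]:
  "Obj (opcat C) = Obj C" "Hom (opcat C) X Y = Hom C Y X" "Ident (opcat C) = Ident C"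
  "Comp (opcat C) X Y Z g f = Comp C Z Y X f g" "Ext (opcat C) X A = Ext C A X"
  "Push (opcat C) X A A' a = Pull C A' A X a" "Pull (opcat C) X' X A c = Push C A X X' c"
  "(B, x, y) \<in> Real (opcat C) X A \<delta> \<longleftrightarrow> (B, y, x) \<in> Real C A X \<delta>"
  by (simp_all add: opcat_def)

lemma iso_arrow_opcat: "iso_arrow (opcat C) X Y f \<longleftrightarrow> iso_arrow C Y X f"
  by (auto simp: iso_arrow_def)

lemma conflation_opcat: "conflation (opcat C) A x B y X \<longleftrightarrow> conflation C X y B x A"
  by (auto simp: conflation_def)

context extri
begin

lemma lincat_opcat: "lincat (opcat C)"
proof
  show "linear_category (opcat C)"
    unfolding linear_category_def opcat_simps
    using assoc comp_lin by auto
qed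

lemma bip_opcat: "bip (opcat C) A B Y i j p q \<longleftrightarrow> bip C A B Y p q i j"
  unfolding bip_def by auto

lemma split_seqs_opcat: "split_seqs (opcat C) T = split_seqs C T"
proof -
  interpret op: lincat "opcat C" by (rule lincat_opcat)
  show ?thesis
    unfolding split_seqs_def op.direct_sum2 direct_sum2 bip_opcat by blast
qed

lemma seq_equiv_sym:
  assumes o: "A \<in> Obj C" "X \<in> Obj C" and e: "seq_equiv C A X (B, x, y) (B', x', y')"
  shows "seq_equiv C A X (B', x', y') (B, x, y)"
proof -
  obtain b where s: "B \<in> Obj C" "x \<in> Mor C A B" "y \<in> Mor C B X" "B' \<in> Obj C" "x' \<in> Mor C A B'" "y' \<in> Mor C B' X"
    and b: "iso_arrow C B B' b" "Comp C A B B' b x = x'" "Comp C B B' X y' b = y"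
    using e by (auto simp: seq_equiv_def sequence_def)
  obtain g where g: "g \<in> Mor C B' B" "Comp C B B' B g b = Ident C B" "Comp C B' B B' b g = Ident C B'"
    "iso_arrow C B' B g"
    using isoE[OF b(1)] by metis
  note bm = iso_in[OF b(1)]
  have "Comp C A B' B g x' = x"
    using s(1-3) g bm o s(4) by (simp add: b(2)[symmetric] assoc)
  moreover have "Comp C B' B X y g = y'"
    using s(1,4,6) g bm o by (simp add: b(3)[symmetric] assoc[symmetric])
  ultimately show ?thesis using s g by (auto simp: seq_equiv_def sequence_def)
qed

text \<open>Passing to the opposite category reverses the comparison isomorphism b, so the symmetry
  of the equivalence of sequences enters.\<close>

lemma seq_equiv_opcat:
  assumes o: "A \<in> Obj C" "X \<in> Obj C"
  shows "seq_equiv (opcat C) X A (B, y, x) (B', y', x') \<longleftrightarrow> seq_equiv C A X (B, x, y) (B', x', y')"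
proof -
  have "seq_equiv (opcat C) X A (B, y, x) (B', y', x') \<longleftrightarrow> seq_equiv C A X (B', x', y') (B, x, y)"
    unfolding seq_equiv_def sequence_def prod.case opcat_simps iso_arrow_opcat by blast
  then show ?thesis using seq_equiv_sym[OF o] by blast
qed

lemma ext_morphism_opcat: "ext_morphism (opcat C) X A \<delta> X' A' \<delta>' a c \<longleftrightarrow> ext_morphism C A' X' \<delta>' A X \<delta> c a"
  unfolding ext_morphism_def by auto

text \<open>The axioms occur in dual pairs, so each axiom of the opposite category is the partner
  axiom of C. Objects are unchanged, and so are the split sequences, so T and the group
  \<open>K0T\<close> need no translation.\<close>

lemma extri_opcat:
  assumes et4: "ET4 C"
  shows "extri (opcat C)"
proof -
  interpret op: lincat "opcat C" by (rule lincat_opcat)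
  show ?thesis
  proof
    show "\<exists>Y i j p q. bip (opcat C) A B Y i j p q" if "A \<in> Obj (opcat C)" "B \<in> Obj (opcat C)" for A B
      using bip_ex[of A B] that unfolding bip_opcat opcat_simps by blast
    show "\<exists>Z. zero_object (opcat C) Z"
      using zero_ex by (simp add: zero_object_def)
    show "ext_bifunctor (opcat C)"
      unfolding ext_bifunctor_def opcat_simps
      by (intro conjI ballI) (simp_all add: push_lin pull_lin push_comp pull_comp push_pull)
    show "realization (opcat C)"
      unfolding realization_def opcat_simps ext_morphism_opcat
    proof (intro conjI ballI allI impI)
      fix X A \<delta> assume o: "X \<in> Obj C" "A \<in> Obj C" "\<delta> \<in> Exts C A X"
      obtain s where s: "sequence C X A s" "Real C A X \<delta> = {s'. seq_equiv C X A s s'}"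
        using realiz o unfolding realization_def by blast
      obtain B x y where sB: "s = (B, x, y)" by (cases s)
      have "Real (opcat C) X A \<delta> = {s'. seq_equiv (opcat C) A X (B, y, x) s'}"
      proof (rule Set.set_eqI)
        fix t :: "'o \<times> 'm \<times> 'm"
        obtain B' y' x' where t: "t = (B', y', x')" by (cases t)
        show "t \<in> Real (opcat C) X A \<delta> \<longleftrightarrow> t \<in> {s'. seq_equiv (opcat C) A X (B, y, x) s'}"
          unfolding t opcat_simps mem_Collect_eq seq_equiv_opcat[OF o(1,2)] s(2) sB by blast
      qed
      moreover have "sequence (opcat C) A X (B, y, x)"
        using s(1) by (simp add: sB sequence_def)
      ultimately show "\<exists>s. sequence (opcat C) A X s \<and> Real (opcat C) X A \<delta> = {s'. seq_equiv (opcat C) A X s s'}"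
        by blast
    next
      fix X A \<delta> X' A' \<delta>' B x y B' x' y' a c
      assume o: "X \<in> Obj C" "A \<in> Obj C" "\<delta> \<in> Exts C A X" "X' \<in> Obj C" "A' \<in> Obj C" "\<delta>' \<in> Exts C A' X'"
        and r: "(B, y, x) \<in> Real C A X \<delta> \<and> (B', y', x') \<in> Real C A' X' \<delta>' \<and> ext_morphism C A' X' \<delta>' A X \<delta> c a"
      obtain b where "b \<in> Mor C B' B" "Comp C X' B' B b y' = Comp C X' X B y c" "Comp C B' B A x b = Comp C B' A' A a x'"
        using real_morphism[OF o(5,4,6,2,1,3), of B' y' x' B y x c a] r by (auto simp: ext_morphism_def)
      then show "\<exists>b\<in>Mor C B' B. Comp C B' B A x b = Comp C B' A' A a x' \<and> Comp C X' B' B b y' = Comp C X' X B y c"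
        by blast
    qed
    show "(Y, i, q) \<in> Real (opcat C) X A \<zero>\<^bsub>Ext (opcat C) X A\<^esub>" if "bip (opcat C) A X Y i j p q" for A X Y i j p q
      using split_real[OF bip_sym] that unfolding bip_opcat opcat_simps by blast
    show "ET3 (opcat C)"
      unfolding ET3_def opcat_simps ext_morphism_opcat
    proof (intro ballI allI impI)
      fix X A \<delta> X' A' \<delta>' B x y B' x' y' a b
      assume o: "X \<in> Obj C" "A \<in> Obj C" "\<delta> \<in> Exts C A X" "X' \<in> Obj C" "A' \<in> Obj C" "\<delta>' \<in> Exts C A' X'"
        and r: "(B, y, x) \<in> Real C A X \<delta> \<and> (B', y', x') \<in> Real C A' X' \<delta>'"
        and m: "a \<in> Mor C A' A" "b \<in> Mor C B' B" "Comp C B' B A x b = Comp C B' A' A a x'"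
      obtain c where "c \<in> Mor C X' X" "Push C A' X' X c \<delta>' = Pull C A' A X a \<delta>" "Comp C X' B' B b y' = Comp C X' X B y c"
        by (rule et3opD[OF o(5,4,6,2,1,3) conjunct2[OF r] conjunct1[OF r] m(2,1,3)])
      then show "\<exists>c. ext_morphism C A' X' \<delta>' A X \<delta> c a \<and> Comp C X' B' B b y' = Comp C X' X B y c"
        using m by (auto simp: ext_morphism_def)
    qed
    show "ET3_op (opcat C)"
      unfolding ET3_op_def opcat_simps ext_morphism_opcat
    proof (intro ballI allI impI)
      fix X A \<delta> X' A' \<delta>' B x y B' x' y' b c
      assume o: "X \<in> Obj C" "A \<in> Obj C" "\<delta> \<in> Exts C A X" "X' \<in> Obj C" "A' \<in> Obj C" "\<delta>' \<in> Exts C A' X'"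
        and r: "(B, y, x) \<in> Real C A X \<delta> \<and> (B', y', x') \<in> Real C A' X' \<delta>'"
        and m: "b \<in> Mor C B' B" "c \<in> Mor C X' X" "Comp C X' B' B b y' = Comp C X' X B y c"
      obtain a where "a \<in> Mor C A' A" "Push C A' X' X c \<delta>' = Pull C A' A X a \<delta>" "Comp C B' B A x b = Comp C B' A' A a x'"
        by (rule et3D[OF o(5,4,6,2,1,3) conjunct2[OF r] conjunct1[OF r] m(2,1,3)])
      then show "\<exists>a. ext_morphism C A' X' \<delta>' A X \<delta> c a \<and> Comp C B' B A x b = Comp C B' A' A a x'"
        using m by (auto simp: ext_morphism_def)
    qed
    show "ET4_op (opcat C)"
      unfolding ET4_op_def opcat_simps
    proof (intro ballI allI impI)
      fix A B X D F \<delta> \<delta>' f f' g g'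
      assume o: "A \<in> Obj C" "B \<in> Obj C" "X \<in> Obj C" "D \<in> Obj C" "F \<in> Obj C"
        and d: "\<delta> \<in> Exts C D B" "\<delta>' \<in> Exts C F X"
        and r: "(A, f, f') \<in> Real C D B \<delta> \<and> (B, g, g') \<in> Real C F X \<delta>'"
      show "\<exists>E\<in>Obj C. \<exists>\<delta>''\<in>Exts C E X. \<exists>h'\<in>Mor C A E. \<exists>h\<in>Mor C X A. \<exists>d\<in>Mor C E D. \<exists>e\<in>Mor C F E.
             h = Comp C X B A f g \<and> Comp C B A E h' f = Comp C B F E e g' \<and> Comp C A E D d h' = f' \<and>
             (A, h, h') \<in> Real C E X \<delta>'' \<and> (E, e, d) \<in> Real C D F (Push C D B F g' \<delta>) \<and>
             Pull C F E X e \<delta>'' = \<delta>' \<and> Pull C E D B d \<delta> = Push C E X B g \<delta>''"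
        using et4[unfolded ET4_def, rule_format, OF o(3,2,1,5,4) d(2,1), of g g' f f'] r
        by (elim bexE conjE) (metis r)
    qed
  qed
qed

end

section \<open>Quotient categories\<close>

lemma set_addI: "a \<in> A \<Longrightarrow> b \<in> B \<Longrightarrow> a \<oplus>\<^bsub>V\<^esub> b \<in> set_add V A B"
  by (auto simp: set_add_defs)

lemma set_add_mono: "B \<subseteq> B' \<Longrightarrow> set_add V A B \<subseteq> set_add V A B'"
  by (auto simp: set_add_defs)

context
  fixes V :: "('k::field, 'v) module" and W :: "'v set"
  assumes W: "subspace class_ring W V"
begin

private lemma V: "vspace V" and WV: "W \<subseteq> carrier V"
  using subspaceD[OF W] by auto

lemma coset_def: "a_r_coset V W v = {w \<oplus>\<^bsub>V\<^esub> v | w. w \<in> W}"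
  by (auto simp: a_r_coset_def' )

lemma coset_eq:
  assumes v: "v \<in> carrier V" and u: "u \<in> carrier V"
  shows "a_r_coset V W v = a_r_coset V W u \<longleftrightarrow> v \<ominus>\<^bsub>V\<^esub> u \<in> W"
proof -
  have sub: "a_r_coset V W v \<subseteq> a_r_coset V W u" if vu: "v \<ominus>\<^bsub>V\<^esub> u \<in> W" "v \<in> carrier V" "u \<in> carrier V" for v u
  proof
    fix x assume "x \<in> a_r_coset V W v"
    then obtain w where w: "w \<in> W" "x = w \<oplus>\<^bsub>V\<^esub> v" unfolding coset_def by blast
    have "w \<oplus>\<^bsub>V\<^esub> (v \<ominus>\<^bsub>V\<^esub> u) \<oplus>\<^bsub>V\<^esub> u = w \<oplus>\<^bsub>V\<^esub> (v \<ominus>\<^bsub>V\<^esub> u \<oplus>\<^bsub>V\<^esub> u)"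
      by (rule vs_assoc[OF V]) (use w WV vu vs_closed[OF V] in auto)
    also have "\<dots> = x" using vs_laws(8)[OF V vu(2,3)] w by simp
    finally have "x = w \<oplus>\<^bsub>V\<^esub> (v \<ominus>\<^bsub>V\<^esub> u) \<oplus>\<^bsub>V\<^esub> u" by simp
    moreover have "w \<oplus>\<^bsub>V\<^esub> (v \<ominus>\<^bsub>V\<^esub> u) \<in> W" using subspaceD(4)[OF W] w vu by blast
    ultimately show "x \<in> a_r_coset V W u" unfolding coset_def by blast
  qed
  have self: "v \<in> a_r_coset V W v" if "v \<in> carrier V" for v
    unfolding coset_def using vs_laws(1)[OF V that] subspaceD(3)[OF W] by force
  show ?thesis
  proof
    assume "a_r_coset V W v = a_r_coset V W u"
    then have "v \<in> a_r_coset V W u" using self[OF v] by simp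
    then obtain w where "w \<in> W" "v = w \<oplus>\<^bsub>V\<^esub> u" unfolding coset_def by blast
    then show "v \<ominus>\<^bsub>V\<^esub> u \<in> W" using vs_laws(10)[OF V _ u] WV by auto
  next
    assume vu: "v \<ominus>\<^bsub>V\<^esub> u \<in> W"
    have "u \<ominus>\<^bsub>V\<^esub> v = (-1) \<odot>\<^bsub>V\<^esub> (v \<ominus>\<^bsub>V\<^esub> u)"
    proof -
      interpret abelian_group V by (rule vspace_abelian_group[OF V])
      have "\<ominus>\<^bsub>V\<^esub> (v \<ominus>\<^bsub>V\<^esub> u) = u \<ominus>\<^bsub>V\<^esub> v"
        using v u by (simp add: a_minus_def minus_add a_comm)
      then show ?thesis using vs_laws(7)[OF V, of "v \<ominus>\<^bsub>V\<^esub> u"] v u by simp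
    qed
    then have "u \<ominus>\<^bsub>V\<^esub> v \<in> W" using subspaceD(5)[OF W vu] by simp
    then show "a_r_coset V W v = a_r_coset V W u" using sub vu v u by blast
  qed
qed

lemma coset_self: "v \<in> carrier V \<Longrightarrow> v \<in> a_r_coset V W v"
  unfolding coset_def using vs_laws(1)[OF V] subspaceD(3)[OF W] by force

lemma coset_mem:
  assumes v: "v \<in> carrier V" and u: "u \<in> a_r_coset V W v"
  shows "u \<in> carrier V" "a_r_coset V W u = a_r_coset V W v" "u \<ominus>\<^bsub>V\<^esub> v \<in> W"
proof -
  obtain w where w: "w \<in> W" "u = w \<oplus>\<^bsub>V\<^esub> v" using u unfolding coset_def by blast
  then show c: "u \<in> carrier V" using WV v vs_closed(2)[OF V] by auto
  show d: "u \<ominus>\<^bsub>V\<^esub> v \<in> W" using vs_laws(10)[OF V _ v] w WV by auto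
  then show "a_r_coset V W u = a_r_coset V W v" using coset_eq c v by blast
qed

lemma coset_memI: "v \<in> carrier V \<Longrightarrow> u \<in> carrier V \<Longrightarrow> u \<ominus>\<^bsub>V\<^esub> v \<in> W \<Longrightarrow> u \<in> a_r_coset V W v"
  using coset_eq coset_self by blast

lemma coset_zero: "a_r_coset V W \<zero>\<^bsub>V\<^esub> = W"
proof -
  have "a_r_coset V W \<zero>\<^bsub>V\<^esub> = {w | w. w \<in> W}"
    unfolding coset_def using vs_laws(2)[OF V] WV by (metis subsetD)
  then show ?thesis by simp
qed

lemma coset_add:
  assumes v: "v \<in> carrier V" "u \<in> carrier V"
  shows "set_add V (a_r_coset V W v) (a_r_coset V W u) = a_r_coset V W (v \<oplus>\<^bsub>V\<^esub> u)"
proof -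
  interpret abelian_group V by (rule vspace_abelian_group[OF V])
  have e: "(w \<oplus>\<^bsub>V\<^esub> v) \<oplus>\<^bsub>V\<^esub> (w' \<oplus>\<^bsub>V\<^esub> u) = (w \<oplus>\<^bsub>V\<^esub> w') \<oplus>\<^bsub>V\<^esub> (v \<oplus>\<^bsub>V\<^esub> u)" if "w \<in> W" "w' \<in> W" for w w'
    using that WV v by (simp add: a_ac subset_iff)
  show ?thesis
  proof
    show "set_add V (a_r_coset V W v) (a_r_coset V W u) \<subseteq> a_r_coset V W (v \<oplus>\<^bsub>V\<^esub> u)"
      unfolding set_add_defs coset_def using e subspaceD(4)[OF W] by auto
    show "a_r_coset V W (v \<oplus>\<^bsub>V\<^esub> u) \<subseteq> set_add V (a_r_coset V W v) (a_r_coset V W u)"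
    proof
      fix x assume "x \<in> a_r_coset V W (v \<oplus>\<^bsub>V\<^esub> u)"
      then obtain w where w: "w \<in> W" "x = w \<oplus>\<^bsub>V\<^esub> (v \<oplus>\<^bsub>V\<^esub> u)" unfolding coset_def by blast
      then have "x = (w \<oplus>\<^bsub>V\<^esub> v) \<oplus>\<^bsub>V\<^esub> u" using WV v by (simp add: a_assoc subset_iff)
      moreover have "w \<oplus>\<^bsub>V\<^esub> v \<in> a_r_coset V W v" using w unfolding coset_def by blast
      ultimately show "x \<in> set_add V (a_r_coset V W v) (a_r_coset V W u)"
        unfolding set_add_defs using coset_self[OF v(2)] by auto
    qed
  qed
qed

text \<open>The scalar may be 0, and then the image of the coset is only the zero vector; adding W
  restores a full coset.\<close>

lemma coset_smult:
  assumes v: "v \<in> carrier V"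
  shows "set_add V W ((\<lambda>v. c \<odot>\<^bsub>V\<^esub> v) ` a_r_coset V W v) = a_r_coset V W (c \<odot>\<^bsub>V\<^esub> v)"
proof -
  have cv: "c \<odot>\<^bsub>V\<^esub> v \<in> carrier V" using vs_closed(5)[OF V v] .
  have sub: "(\<lambda>v. c \<odot>\<^bsub>V\<^esub> v) ` a_r_coset V W v \<subseteq> a_r_coset V W (c \<odot>\<^bsub>V\<^esub> v)"
    unfolding coset_def using vs_smult_laws(3)[OF V _ v] WV subspaceD(5)[OF W] by (force simp: subset_iff)
  show ?thesis
  proof
    have "set_add V W ((\<lambda>v. c \<odot>\<^bsub>V\<^esub> v) ` a_r_coset V W v) \<subseteq> set_add V W (a_r_coset V W (c \<odot>\<^bsub>V\<^esub> v))"
      using sub unfolding set_add_defs by blast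
    also have "\<dots> = a_r_coset V W (c \<odot>\<^bsub>V\<^esub> v)"
      using coset_add[OF vs_closed(1)[OF V] cv] coset_zero vs_laws(1)[OF V cv] by simp
    finally show "set_add V W ((\<lambda>v. c \<odot>\<^bsub>V\<^esub> v) ` a_r_coset V W v) \<subseteq> a_r_coset V W (c \<odot>\<^bsub>V\<^esub> v)" .
    show "a_r_coset V W (c \<odot>\<^bsub>V\<^esub> v) \<subseteq> set_add V W ((\<lambda>v. c \<odot>\<^bsub>V\<^esub> v) ` a_r_coset V W v)"
      unfolding set_add_defs coset_def[of "c \<odot>\<^bsub>V\<^esub> v"] using coset_self[OF v] by auto
  qed
qed

lemma quot_carrier: "carrier (quot_module V W) = a_r_coset V W ` carrier V"
  by (auto simp: quot_module_def A_RCOSETS_def')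

lemma quot_module_ops:
  assumes "v \<in> carrier V"
  shows "u \<in> carrier V \<Longrightarrow> a_r_coset V W v \<oplus>\<^bsub>quot_module V W\<^esub> a_r_coset V W u = a_r_coset V W (v \<oplus>\<^bsub>V\<^esub> u)"
    "c \<odot>\<^bsub>quot_module V W\<^esub> a_r_coset V W v = a_r_coset V W (c \<odot>\<^bsub>V\<^esub> v)"
    "\<zero>\<^bsub>quot_module V W\<^esub> = W"
  using coset_add coset_smult assms by (simp_all add: quot_module_def)

lemma quot_vspace: "vspace (quot_module V W)"
proof (rule vspaceI)
  interpret V: abelian_group V by (rule vspace_abelian_group[OF V])
  note q = quot_module_ops
  show "abelian_group (quot_module V W)"
  proof (rule abelian_groupI)
    fix x y assume "x \<in> carrier (quot_module V W)" "y \<in> carrier (quot_module V W)"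
    then obtain v u where x: "x = a_r_coset V W v" "v \<in> carrier V" "y = a_r_coset V W u" "u \<in> carrier V"
      unfolding quot_carrier by blast
    show "x \<oplus>\<^bsub>quot_module V W\<^esub> y \<in> carrier (quot_module V W)"
      using x q by (simp add: quot_carrier)
    show "x \<oplus>\<^bsub>quot_module V W\<^esub> y = y \<oplus>\<^bsub>quot_module V W\<^esub> x"
      using x q by (simp add: V.a_comm)
    fix z assume "z \<in> carrier (quot_module V W)"
    then obtain t where z: "z = a_r_coset V W t" "t \<in> carrier V"
      unfolding quot_carrier by blast
    show "x \<oplus>\<^bsub>quot_module V W\<^esub> y \<oplus>\<^bsub>quot_module V W\<^esub> z = x \<oplus>\<^bsub>quot_module V W\<^esub> (y \<oplus>\<^bsub>quot_module V W\<^esub> z)"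
      using x z q by (simp add: V.a_assoc)
  next
    show "\<zero>\<^bsub>quot_module V W\<^esub> \<in> carrier (quot_module V W)"
      using coset_zero q(3)[OF V.zero_closed] by (auto simp: quot_carrier)
    fix x assume "x \<in> carrier (quot_module V W)"
    then obtain v where x: "x = a_r_coset V W v" "v \<in> carrier V"
      unfolding quot_carrier by blast
    have z: "\<zero>\<^bsub>quot_module V W\<^esub> = a_r_coset V W \<zero>\<^bsub>V\<^esub>"
      using coset_zero q(3)[OF V.zero_closed] by simp
    show "\<zero>\<^bsub>quot_module V W\<^esub> \<oplus>\<^bsub>quot_module V W\<^esub> x = x"
      using q(1)[OF V.zero_closed x(2)] x by (simp only: z V.l_zero)
    show "\<exists>y\<in>carrier (quot_module V W). y \<oplus>\<^bsub>quot_module V W\<^esub> x = \<zero>\<^bsub>quot_module V W\<^esub>"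
      by (rule bexI[of _ "a_r_coset V W (\<ominus>\<^bsub>V\<^esub> v)"]) (use x z q V.l_neg in \<open>auto simp: quot_carrier\<close>)
  qed
next
  note q = quot_module_ops
  fix x assume "x \<in> carrier (quot_module V W)"
  then obtain v where x: "x = a_r_coset V W v" "v \<in> carrier V"
    unfolding quot_carrier by blast
  note c = vs_closed[OF V]
  show "a \<odot>\<^bsub>quot_module V W\<^esub> x \<in> carrier (quot_module V W)" for a
    using x q c by (simp add: quot_carrier)
  show "(a + b) \<odot>\<^bsub>quot_module V W\<^esub> x = a \<odot>\<^bsub>quot_module V W\<^esub> x \<oplus>\<^bsub>quot_module V W\<^esub> b \<odot>\<^bsub>quot_module V W\<^esub> x" for a b
    using x q c by (simp add: vs_smult_laws[OF V])
  show "(a * b) \<odot>\<^bsub>quot_module V W\<^esub> x = a \<odot>\<^bsub>quot_module V W\<^esub> (b \<odot>\<^bsub>quot_module V W\<^esub> x)" for a b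
    using x q c by (simp add: vs_smult_laws[OF V])
  show "1 \<odot>\<^bsub>quot_module V W\<^esub> x = x"
    using x q by (simp add: vs_laws[OF V])
  fix y assume "y \<in> carrier (quot_module V W)"
  then obtain u where y: "y = a_r_coset V W u" "u \<in> carrier V"
    unfolding quot_carrier by blast
  show "a \<odot>\<^bsub>quot_module V W\<^esub> (x \<oplus>\<^bsub>quot_module V W\<^esub> y) =
      a \<odot>\<^bsub>quot_module V W\<^esub> x \<oplus>\<^bsub>quot_module V W\<^esub> a \<odot>\<^bsub>quot_module V W\<^esub> y" for a
    using x y q c by (simp add: vs_smult_laws[OF V])
qed

lemma coset_lin: "lin V (quot_module V W) (a_r_coset V W)"
  by (rule linI[OF V quot_vspace]) (use quot_module_ops in \<open>auto simp: quot_carrier\<close>)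

end

section \<open>Categories modulo the morphisms through a subcategory\<close>

locale quot = lincat C for C :: "('k::field, 'o, 'm, 'z) lincat_scheme" +
  fixes P :: "'o set"
  assumes P_obj [simp]: "Q \<in> P \<Longrightarrow> Q \<in> Obj C"
    and P_ne: "P \<noteq> {}"
    and P_sum: "Q \<in> P \<Longrightarrow> Q' \<in> P \<Longrightarrow> \<exists>Y\<in>P. \<exists>i j p q. bip C Q Q' Y i j p q"
begin

abbreviation fac where "fac X Y \<equiv> factoring C P X Y"

lemma facI: "Q \<in> P \<Longrightarrow> a \<in> Mor C X Q \<Longrightarrow> b \<in> Mor C Q Y \<Longrightarrow> Comp C X Q Y b a \<in> fac X Y"
  unfolding factoring_def by blast

lemma facE:
  assumes "f \<in> fac X Y"
  obtains Q a b where "Q \<in> P" "a \<in> Mor C X Q" "b \<in> Mor C Q Y" "f = Comp C X Q Y b a"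
  using assms unfolding factoring_def by blast

lemma fac_in: "X \<in> Obj C \<Longrightarrow> Y \<in> Obj C \<Longrightarrow> f \<in> fac X Y \<Longrightarrow> f \<in> Mor C X Y"
  by (erule facE) simp

lemma fac_comp:
  assumes "X \<in> Obj C" "Y \<in> Obj C" "Z \<in> Obj C"
  shows "f \<in> fac X Y \<Longrightarrow> g \<in> Mor C Y Z \<Longrightarrow> Comp C X Y Z g f \<in> fac X Z"
    "f \<in> Mor C X Y \<Longrightarrow> g \<in> fac Y Z \<Longrightarrow> Comp C X Y Z g f \<in> fac X Z"
proof -
  assume f: "f \<in> fac X Y" and g: "g \<in> Mor C Y Z"
  obtain Q a b where q: "Q \<in> P" "a \<in> Mor C X Q" "b \<in> Mor C Q Y" "f = Comp C X Q Y b a"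
    using facE[OF f] .
  then have "Comp C X Y Z g f = Comp C X Q Z (Comp C Q Y Z g b) a"
    using assms g by (simp add: assoc)
  then show "Comp C X Y Z g f \<in> fac X Z" using q g assms by (simp add: facI)
next
  assume f: "f \<in> Mor C X Y" and g: "g \<in> fac Y Z"
  obtain Q a b where q: "Q \<in> P" "a \<in> Mor C Y Q" "b \<in> Mor C Q Z" "g = Comp C Y Q Z b a"
    using facE[OF g] .
  then have "Comp C X Y Z g f = Comp C X Q Z b (Comp C X Y Q a f)"
    using assms f by (simp add: assoc)
  then show "Comp C X Y Z g f \<in> fac X Z" using q f assms by (simp add: facI)
qed

text \<open>If f factors through Q and g through R, then f + g factors through the biproduct of Q
  and R, which \<open>P_sum\<close> places in P.\<close>

lemma fac_subspace:
  assumes o: "X \<in> Obj C" "Y \<in> Obj C"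
  shows "subspace class_ring (fac X Y) (Hom C X Y)"
proof (rule subspaceI[OF hom_vs[OF o]])
  show "fac X Y \<subseteq> Mor C X Y" using fac_in o by blast
  obtain Q where Q: "Q \<in> P" using P_ne by blast
  show "\<zero>\<^bsub>Hom C X Y\<^esub> \<in> fac X Y"
    using facI[OF Q zero_in[OF o(1)] zero_in[OF _ o(2)]] Q o by simp
  show "c \<odot>\<^bsub>Hom C X Y\<^esub> f \<in> fac X Y" if f: "f \<in> fac X Y" for c f
  proof -
    obtain Q a b where q: "Q \<in> P" "a \<in> Mor C X Q" "b \<in> Mor C Q Y" "f = Comp C X Q Y b a"
      using facE[OF f] .
    then have "c \<odot>\<^bsub>Hom C X Y\<^esub> f = Comp C X Q Y (c \<odot>\<^bsub>Hom C Q Y\<^esub> b) a"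
      using lin_smult[OF comp_lin(2)] o by simp
    then show ?thesis using q facI[OF q(1,2)] vs_closed(5)[OF hom_vs] o by simp
  qed
  show "f \<oplus>\<^bsub>Hom C X Y\<^esub> g \<in> fac X Y" if f: "f \<in> fac X Y" and g: "g \<in> fac X Y" for f g
  proof -
    obtain Q a b where q: "Q \<in> P" "a \<in> Mor C X Q" "b \<in> Mor C Q Y" "f = Comp C X Q Y b a"
      using facE[OF f] .
    obtain R c d where r: "R \<in> P" "c \<in> Mor C X R" "d \<in> Mor C R Y" "g = Comp C X R Y d c"
      using facE[OF g] .
    obtain S i j p s where S: "S \<in> P" "bip C Q R S i j p s" using P_sum[OF q(1) r(1)] by blast
    note b = S(2)[unfolded bip_def]
    \<comment> \<open>The column with entries a and c, followed by the row with entries b and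
      d.\<close>
    let ?u = "Comp C X Q S i a \<oplus>\<^bsub>Hom C X S\<^esub> Comp C X R S j c"
    let ?w = "Comp C S Q Y b p \<oplus>\<^bsub>Hom C S Y\<^esub> Comp C S R Y d s"
    have u: "?u \<in> Mor C X S" and w: "?w \<in> Mor C S Y" using q r b o by simp_all
    have wi: "Comp C Q S Y ?w i = b" "Comp C R S Y ?w j = d"
      using q r b o by (simp_all add: comp_add assoc[symmetric] vs_laws[OF hom_vs])
    have "Comp C X S Y ?w ?u = Comp C X S Y ?w (Comp C X Q S i a) \<oplus>\<^bsub>Hom C X Y\<^esub> Comp C X S Y ?w (Comp C X R S j c)"
      using q r b o w by (intro comp_add) auto
    also have "Comp C X S Y ?w (Comp C X Q S i a) = Comp C X Q Y (Comp C Q S Y ?w i) a"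
      using q b o w by (intro assoc) auto
    also have "Comp C X S Y ?w (Comp C X R S j c) = Comp C X R Y (Comp C R S Y ?w j) c"
      using r b o w by (intro assoc) auto
    finally have "Comp C X S Y ?w ?u = f \<oplus>\<^bsub>Hom C X Y\<^esub> g"
      using wi q r by simp
    then show ?thesis using facI[OF S(1) u w] by simp
  qed
qed

abbreviation qc where "qc X Y \<equiv> quot_class C P X Y"

lemma qc_eq:
  assumes "X \<in> Obj C" "Y \<in> Obj C" "f \<in> Mor C X Y" "g \<in> Mor C X Y"
  shows "qc X Y f = qc X Y g \<longleftrightarrow> f \<ominus>\<^bsub>Hom C X Y\<^esub> g \<in> fac X Y"
  unfolding quot_class_def using coset_eq[OF fac_subspace] assms by simp

lemma qc_zero_iff:
  assumes "X \<in> Obj C" "Y \<in> Obj C" "f \<in> Mor C X Y"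
  shows "qc X Y f = qc X Y \<zero>\<^bsub>Hom C X Y\<^esub> \<longleftrightarrow> f \<in> fac X Y"
  using qc_eq[OF assms zero_in] assms vs_laws(4)[OF hom_vs] by simp

lemma qc_self: "X \<in> Obj C \<Longrightarrow> Y \<in> Obj C \<Longrightarrow> f \<in> Mor C X Y \<Longrightarrow> f \<in> qc X Y f"
  unfolding quot_class_def using coset_self[OF fac_subspace] by simp

lemma qc_mem:
  assumes "X \<in> Obj C" "Y \<in> Obj C" "f \<in> Mor C X Y" "g \<in> qc X Y f"
  shows "g \<in> Mor C X Y" "qc X Y g = qc X Y f" "g \<ominus>\<^bsub>Hom C X Y\<^esub> f \<in> fac X Y"
  using coset_mem[OF fac_subspace, of X Y f g] assms unfolding quot_class_def by auto

lemma quot_Hom: "Hom (quot_cat C P) X Y = quot_module (Hom C X Y) (fac X Y)"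
  by (simp add: quot_cat_def)

lemma quot_mor:
  assumes "X \<in> Obj C" "Y \<in> Obj C"
  shows "Mor (quot_cat C P) X Y = qc X Y ` Mor C X Y"
  unfolding quot_Hom quot_carrier[OF fac_subspace[OF assms]] by (simp add: quot_class_def)

lemma qc_lin:
  assumes "X \<in> Obj C" "Y \<in> Obj C"
  shows "lin (Hom C X Y) (Hom (quot_cat C P) X Y) (qc X Y)"
  unfolding quot_Hom quot_class_def using coset_lin[OF fac_subspace[OF assms]] by simp

text \<open>The composites of representatives need not form a full coset. They lie in the class of
  gf and include gf itself, so adding the ideal gives exactly that class.\<close>

lemma quot_comp:
  assumes o: "X \<in> Obj C" "Y \<in> Obj C" "Z \<in> Obj C" and f: "f \<in> Mor C X Y" and g: "g \<in> Mor C Y Z"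
  shows "Comp (quot_cat C P) X Y Z (qc Y Z g) (qc X Y f) = qc X Z (Comp C X Y Z g f)"
proof -
  let ?S = "{Comp C X Y Z g' f' | g' f'. g' \<in> qc Y Z g \<and> f' \<in> qc X Y f}"
  have sub: "?S \<subseteq> qc X Z (Comp C X Y Z g f)"
  proof
    fix x assume "x \<in> ?S"
    then obtain g' f' where x: "x = Comp C X Y Z g' f'" and g': "g' \<in> qc Y Z g" and f': "f' \<in> qc X Y f"
      by blast
    note G = qc_mem[OF o(2,3) g g'] and F = qc_mem[OF o(1,2) f f']
    \<comment> \<open>The identity g'f' - gf = (g' - g)f' + g(f' - f), each summand of which lies in
      the ideal.\<close>
    have "Comp C X Y Z (g' \<ominus>\<^bsub>Hom C Y Z\<^esub> g) f' \<oplus>\<^bsub>Hom C X Z\<^esub> Comp C X Y Z g (f' \<ominus>\<^bsub>Hom C X Y\<^esub> f) \<in> fac X Z"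
      using o f g G F by (intro subspaceD(4)[OF fac_subspace[OF o(1,3)]] fac_comp) auto
    moreover have "Comp C X Y Z (g' \<ominus>\<^bsub>Hom C Y Z\<^esub> g) f' \<oplus>\<^bsub>Hom C X Z\<^esub> Comp C X Y Z g (f' \<ominus>\<^bsub>Hom C X Y\<^esub> f) =
       x \<ominus>\<^bsub>Hom C X Z\<^esub> Comp C X Y Z g f"
    proof -
      interpret abelian_group "Hom C X Z" by (rule vspace_abelian_group[OF hom_vs[OF o(1,3)]])
      have t: "(a \<ominus>\<^bsub>Hom C X Z\<^esub> b) \<oplus>\<^bsub>Hom C X Z\<^esub> (b \<ominus>\<^bsub>Hom C X Z\<^esub> c) = a \<ominus>\<^bsub>Hom C X Z\<^esub> c"
        if "a \<in> Mor C X Z" "b \<in> Mor C X Z" "c \<in> Mor C X Z" for a b c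
        using that by (simp add: a_minus_def a_assoc r_neg2 l_neg r_neg1)
      have "Comp C X Y Z (g' \<ominus>\<^bsub>Hom C Y Z\<^esub> g) f' = Comp C X Y Z g' f' \<ominus>\<^bsub>Hom C X Z\<^esub> Comp C X Y Z g f'"
        by (rule comp_minus(2)[OF o G(1) g F(1)])
      moreover have "Comp C X Y Z g (f' \<ominus>\<^bsub>Hom C X Y\<^esub> f) = Comp C X Y Z g f' \<ominus>\<^bsub>Hom C X Z\<^esub> Comp C X Y Z g f"
        by (rule comp_minus(1)[OF o g F(1) f])
      ultimately show ?thesis
        unfolding x using t o f g G F by simp
    qed
    ultimately have "x \<ominus>\<^bsub>Hom C X Z\<^esub> Comp C X Y Z g f \<in> fac X Z" by simp
    then show "x \<in> qc X Z (Comp C X Y Z g f)"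
      unfolding quot_class_def using o f g G F x by (intro coset_memI[OF fac_subspace]) auto
  qed
  have gf: "Comp C X Y Z g f \<in> ?S" using qc_self[OF o(1,2) f] qc_self[OF o(2,3) g] by blast
  have c: "Comp C X Y Z g f \<in> Mor C X Z" using o f g by simp
  have "set_add (Hom C X Z) (fac X Z) ?S = qc X Z (Comp C X Y Z g f)"
  proof
    have "set_add (Hom C X Z) (fac X Z) ?S \<subseteq> set_add (Hom C X Z) (fac X Z) (qc X Z (Comp C X Y Z g f))"
      by (rule set_add_mono[OF sub])
    also have "\<dots> = qc X Z (Comp C X Y Z g f)"
      using coset_add[OF fac_subspace[OF o(1,3)] zero_in[OF o(1,3)] c] coset_zero[OF fac_subspace[OF o(1,3)]]
        vs_laws(1)[OF hom_vs[OF o(1,3)] c] by (simp add: quot_class_def)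
    finally show "set_add (Hom C X Z) (fac X Z) ?S \<subseteq> qc X Z (Comp C X Y Z g f)" .
    show "qc X Z (Comp C X Y Z g f) \<subseteq> set_add (Hom C X Z) (fac X Z) ?S"
    proof
      fix x assume "x \<in> qc X Z (Comp C X Y Z g f)"
      then obtain w where "w \<in> fac X Z" "x = w \<oplus>\<^bsub>Hom C X Z\<^esub> Comp C X Y Z g f"
        unfolding quot_class_def coset_def[OF fac_subspace[OF o(1,3)]] by blast
      then show "x \<in> set_add (Hom C X Z) (fac X Z) ?S"
        using set_addI[OF _ gf] by blast
    qed
  qed
  then show ?thesis by (simp add: quot_cat_def)
qed

lemma quot_id: "Ident (quot_cat C P) X = qc X X (Ident C X)"
  by (simp add: quot_cat_def)

lemma quot_obj: "Obj (quot_cat C P) = Obj C"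
  by (simp add: quot_cat_def)

lemma quot_zero: "X \<in> Obj C \<Longrightarrow> Y \<in> Obj C \<Longrightarrow> \<zero>\<^bsub>Hom (quot_cat C P) X Y\<^esub> = qc X Y \<zero>\<^bsub>Hom C X Y\<^esub>"
  using lin_zero[OF qc_lin] by metis

lemma quot_add:
  "X \<in> Obj C \<Longrightarrow> Y \<in> Obj C \<Longrightarrow> f \<in> Mor C X Y \<Longrightarrow> g \<in> Mor C X Y \<Longrightarrow>
    qc X Y f \<oplus>\<^bsub>Hom (quot_cat C P) X Y\<^esub> qc X Y g = qc X Y (f \<oplus>\<^bsub>Hom C X Y\<^esub> g)"
  using lin_add[OF qc_lin] by metis

lemma quot_smult:
  "X \<in> Obj C \<Longrightarrow> Y \<in> Obj C \<Longrightarrow> f \<in> Mor C X Y \<Longrightarrow>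
    c \<odot>\<^bsub>Hom (quot_cat C P) X Y\<^esub> qc X Y f = qc X Y (c \<odot>\<^bsub>Hom C X Y\<^esub> f)"
  using lin_smult[OF qc_lin] by metis

lemma quot_linear: "linear_category (quot_cat C P)"
  unfolding linear_category_def quot_obj
proof (intro conjI ballI)
  fix X Y assume o: "X \<in> Obj C" "Y \<in> Obj C"
  show v: "vspace (Hom (quot_cat C P) X Y)"
    using lin_vspace(2)[OF qc_lin[OF o]] .
  show "Ident (quot_cat C P) X \<in> Mor (quot_cat C P) X X"
    using o by (auto simp: quot_mor quot_id)
  fix f assume "f \<in> Mor (quot_cat C P) X Y"
  then obtain f' where f: "f = qc X Y f'" "f' \<in> Mor C X Y"
    using quot_mor[OF o] by blast
  show "Comp (quot_cat C P) X Y Y (Ident (quot_cat C P) Y) f = f"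
    "Comp (quot_cat C P) X X Y f (Ident (quot_cat C P) X) = f"
    using f o by (simp_all add: quot_id quot_comp)
next
  fix X Y Z assume o: "X \<in> Obj C" "Y \<in> Obj C" "Z \<in> Obj C"
  have v: "vspace (Hom (quot_cat C P) A B)" if "A \<in> Obj C" "B \<in> Obj C" for A B
    using lin_vspace(2)[OF qc_lin[OF that]] .
  show "lin (Hom (quot_cat C P) X Y) (Hom (quot_cat C P) X Z) (\<lambda>f. Comp (quot_cat C P) X Y Z g f)"
    if g: "g \<in> Mor (quot_cat C P) Y Z" for g
  proof -
    obtain g' where g': "g = qc Y Z g'" "g' \<in> Mor C Y Z" using g quot_mor o by auto
    show ?thesis
      by (rule linI[OF v[OF o(1,2)] v[OF o(1,3)]])
        (use o g' in \<open>auto simp: quot_mor quot_comp quot_add quot_smult comp_add lin_smult[OF comp_lin(1)]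
          vs_closed(5)[OF hom_vs]\<close>)
  qed
  show "lin (Hom (quot_cat C P) Y Z) (Hom (quot_cat C P) X Z) (\<lambda>g. Comp (quot_cat C P) X Y Z g f)"
    if f: "f \<in> Mor (quot_cat C P) X Y" for f
  proof -
    obtain f' where f': "f = qc X Y f'" "f' \<in> Mor C X Y" using f quot_mor o by auto
    show ?thesis
      by (rule linI[OF v[OF o(2,3)] v[OF o(1,3)]])
        (use o f' in \<open>auto simp: quot_mor quot_comp quot_add quot_smult comp_add lin_smult[OF comp_lin(2)]
          vs_closed(5)[OF hom_vs]\<close>)
  qed
next
  fix W X Y Z f g h
  assume o: "W \<in> Obj C" "X \<in> Obj C" "Y \<in> Obj C" "Z \<in> Obj C"
    and m: "f \<in> Mor (quot_cat C P) W X" "g \<in> Mor (quot_cat C P) X Y" "h \<in> Mor (quot_cat C P) Y Z"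
  obtain f' g' h' where r: "f = qc W X f'" "g = qc X Y g'" "h = qc Y Z h'"
    and m': "f' \<in> Mor C W X" "g' \<in> Mor C X Y" "h' \<in> Mor C Y Z"
    using m quot_mor o by auto
  show "Comp (quot_cat C P) W Y Z h (Comp (quot_cat C P) W X Y g f) =
      Comp (quot_cat C P) W X Z (Comp (quot_cat C P) X Y Z h g) f"
    unfolding r using o m' by (simp add: quot_comp assoc)
qed

lemma qc_iso:
  assumes "X \<in> Obj C" "Y \<in> Obj C" "iso_arrow C X Y f"
  shows "iso_arrow (quot_cat C P) X Y (qc X Y f)"
proof -
  obtain g where g: "g \<in> Mor C Y X" "Comp C X Y X g f = Ident C X" "Comp C Y X Y f g = Ident C Y"
    using isoE[OF assms(3)] by metis
  then show ?thesis
    unfolding iso_arrow_def using assms iso_in[OF assms(3)]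
    by (intro conjI bexI[of _ "qc Y X g"]) (auto simp: quot_mor quot_comp quot_id)
qed

lemma qc_bip:
  assumes "bip C A B Y i j p q"
  shows "bip (quot_cat C P) A B Y (qc A Y i) (qc B Y j) (qc Y A p) (qc Y B q)"
  using assms unfolding bip_def
  by (simp add: quot_obj quot_mor quot_comp quot_id quot_zero quot_add)

end

section \<open>Cluster-tilting subcategories\<close>

lemma extriangulated_extri:
  assumes "extriangulated C" shows "extri C"
proof -
  interpret lincat C
    using assms by unfold_locales (simp add: extriangulated_def additive_category_def)
  have ds: "\<exists>Y. direct_sum_of C Xs Y" if "set Xs \<subseteq> Obj C" for Xs
    using assms that by (simp add: extriangulated_def additive_category_def)
  show ?thesis
  proof
    show "\<exists>Y i j p q. bip C A B Y i j p q" if "A \<in> Obj C" "B \<in> Obj C" for A B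
      using ds[of "[A, B]"] that direct_sum2 by simp
    show "\<exists>Z. zero_object C Z"
      using ds[of "[]"] direct_sum_nil by simp
    show "(Y, i, q) \<in> Real C X A \<zero>\<^bsub>Ext C X A\<^esub>" if b: "bip C A X Y i j p q" for A X Y i j p q
    proof -
      have "biproduct C [A, X] Y (\<lambda>n. if n = 0 then i else j) (\<lambda>n. if n = 0 then p else q)"
        unfolding biproduct_bip using b by simp
      moreover have "\<And>A X Y i p. biproduct C [A, X] Y i p \<Longrightarrow> (Y, i 0, p 1) \<in> Real C X A \<zero>\<^bsub>Ext C X A\<^esub>"
        using assms by (simp add: extriangulated_def additive_realization_def)
      ultimately show ?thesis by fastforce
    qed
  qed (use assms in \<open>simp_all add: extriangulated_def additive_realization_def\<close>)
qed

text \<open>The induced map on V/W is evaluated at an arbitrary representative. The application is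
  to the connecting map from Hom to Ext, with W the morphisms through projectives.\<close>

lemma findim_factor:
  assumes \<phi>: "lin V U \<phi>" and surj: "\<phi> ` carrier V = carrier U" and W: "subspace class_ring W V"
    and z: "\<And>w. w \<in> W \<Longrightarrow> \<phi> w = \<zero>\<^bsub>U\<^esub>" and fd: "findim (quot_module V W)"
  shows "findim U"
proof -
  let ?\<psi> = "\<lambda>F. \<phi> (SOME v. v \<in> F)"
  note vs = lin_vspace[OF \<phi>]
  have eq: "?\<psi> (a_r_coset V W v) = \<phi> v" if v: "v \<in> carrier V" for v
  proof -
    let ?u = "SOME u. u \<in> a_r_coset V W v"
    have "?u \<in> a_r_coset V W v" using coset_self[OF W v] by (rule someI)
    note u = coset_mem[OF W v this]
    have "\<phi> ?u \<ominus>\<^bsub>U\<^esub> \<phi> v = \<zero>\<^bsub>U\<^esub>"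
      using z[OF u(3)] lin_minus[OF \<phi> u(1) v] by simp
    then show ?thesis
      using vs_laws(12)[OF vs(2)] lin_closed[OF \<phi>] u(1) v by simp
  qed
  have "lin (quot_module V W) U ?\<psi>"
    by (rule linI[OF quot_vspace[OF W] vs(2)])
      (use eq quot_module_ops[OF W] vs_closed[OF vs(1)] lin_closed[OF \<phi>] lin_add[OF \<phi>] lin_smult[OF \<phi>] in
        \<open>auto simp: quot_carrier[OF W]\<close>)
  moreover have "?\<psi> ` carrier (quot_module V W) = carrier U"
    unfolding surj[symmetric] quot_carrier[OF W] image_image using eq by (intro image_cong) auto
  ultimately show ?thesis using findim_surj fd by blast
qed

locale clust =
  fixes C :: "('k::field, 'o, 'm, 'e) extricat" and T :: "'o set"
  assumes ex: "extriangulated C" and ic: "idempotent_complete C" and fr: "frobenius C"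
    and hf: "X \<in> Obj C \<Longrightarrow> Y \<in> Obj C \<Longrightarrow> findim (Hom (stable C) X Y)"
    and ks: "krull_schmidt C" and ct: "cluster_tilting C T" and mm: "maximally_mutable C T"

sublocale clust \<subseteq> tilt C T
proof -
  interpret extri C by (rule extriangulated_extri[OF ex])
  show "tilt C T"
    by unfold_locales (use ct in \<open>simp_all add: cluster_tilting_def\<close>)
qed

context clust
begin

lemma op_tilt: "tilt (opcat C) T"
proof -
  interpret op: extri "opcat C"
    using extri_opcat ex by (simp add: extriangulated_def)
  have o2: "T = {X \<in> Obj C. \<forall>U\<in>T. Exts C X U = {\<zero>\<^bsub>Ext C X U\<^esub>}}"
    using ct by (simp add: cluster_tilting_def)
  show ?thesis
  proof
    show "T = {X \<in> Obj (opcat C). \<forall>U\<in>T. Exts (opcat C) U X = {\<zero>\<^bsub>Ext (opcat C) U X\<^esub>}}"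
      using o2 by simp
    fix X assume X: "X \<in> Obj (opcat C)"
    then obtain U f where "left_approx C T X U f" "inflation C X U f"
      using ct by (auto simp: cluster_tilting_def)
    then have "right_approx (opcat C) T U X f" "deflation (opcat C) U X f"
      by (auto simp: left_approx_def right_approx_def inflation_def deflation_def conflation_opcat)
    then show "\<exists>U f. right_approx (opcat C) T U X f \<and> deflation (opcat C) U X f" by blast
  qed
qed

lemma coindex_opcat: "coindex C T X = index (opcat C) T X"
  unfolding coindex_def index_def conflation_opcat classT_def split_seqs_opcat
  by (intro arg_cong[where f = The] HOL.ext) blast

lemma coindex_eq:
  assumes "conflation C X x L y D" "L \<in> T" "D \<in> T"
  shows "coindex C T X = K0_coset T (split_seqs C T) (frag_of L - frag_of D)"
  using tilt.index_eq[OF op_tilt, of D y L x X] assms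
  unfolding conflation_opcat coindex_opcat split_seqs_opcat by blast

lemma coresolution:
  assumes "X \<in> Obj C"
  obtains D y L x where "D \<in> T" "L \<in> T" "conflation C X x L y D"
proof -
  obtain K x R y where "K \<in> T" "R \<in> T" "conflation (opcat C) K x R y X"
    by (rule tilt.resolution[OF op_tilt, of X]) (use assms in simp_all)
  then show thesis using that unfolding conflation_opcat by blast
qed

lemma T_ext_left:
  assumes "X \<in> Obj C" "\<And>U \<delta>. U \<in> T \<Longrightarrow> \<delta> \<in> Exts C X U \<Longrightarrow> \<delta> = \<zero>\<^bsub>Ext C X U\<^esub>"
  shows "X \<in> T"
  using tilt.T_I[OF op_tilt, of X] assms by simp

lemma proj_T: "Q \<in> projectives C \<Longrightarrow> Q \<in> T"
  by (rule T_ext_left) (auto simp: projectives_def)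

lemma proj_obj: "Q \<in> projectives C \<Longrightarrow> Q \<in> Obj C"
  by (simp add: projectives_def)

lemma proj_ext: "Q \<in> projectives C \<Longrightarrow> X \<in> Obj C \<Longrightarrow> \<delta> \<in> Exts C Q X \<Longrightarrow> \<delta> = \<zero>\<^bsub>Ext C Q X\<^esub>"
  by (auto simp: projectives_def)

lemma proj_sum:
  assumes b: "bip C Q Q' Y i j p q" and P: "Q \<in> projectives C" "Q' \<in> projectives C"
  shows "Y \<in> projectives C"
proof -
  have m: "Q \<in> Obj C" "Q' \<in> Obj C" "Y \<in> Obj C" "i \<in> Mor C Q Y" "j \<in> Mor C Q' Y" "p \<in> Mor C Y Q" "q \<in> Mor C Y Q'"
    and e: "Comp C Y Q Y i p \<oplus>\<^bsub>Hom C Y Y\<^esub> Comp C Y Q' Y j q = Ident C Y"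
    using b by (auto simp: bip_def)
  have "\<delta> = \<zero>\<^bsub>Ext C Y X\<^esub>" if X: "X \<in> Obj C" and d: "\<delta> \<in> Exts C Y X" for X \<delta>
  proof -
    have "\<delta> = Pull C Y Y X (Comp C Y Q Y i p \<oplus>\<^bsub>Hom C Y Y\<^esub> Comp C Y Q' Y j q) \<delta>"
      using e m X d by simp
    also have "\<dots> = Pull C Y Y X (Comp C Y Q Y i p) \<delta> \<oplus>\<^bsub>Ext C Y X\<^esub> Pull C Y Y X (Comp C Y Q' Y j q) \<delta>"
      by (rule lin_add[OF pull_lin(2)]) (use m X d in auto)
    also have "Pull C Y Y X (Comp C Y Q Y i p) \<delta> = Pull C Y Q X p (Pull C Q Y X i \<delta>)"
      using m X d by (simp add: pull_comp)
    also have "Pull C Q Y X i \<delta> = \<zero>\<^bsub>Ext C Q X\<^esub>"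
      by (rule proj_ext) (use m X d P in auto)
    also have "Pull C Y Y X (Comp C Y Q' Y j q) \<delta> = Pull C Y Q' X q (Pull C Q' Y X j \<delta>)"
      using m X d by (simp add: pull_comp)
    also have "Pull C Q' Y X j \<delta> = \<zero>\<^bsub>Ext C Q' X\<^esub>"
      by (rule proj_ext) (use m X d P in auto)
    finally show ?thesis using m X vs_laws(1)[OF ext_vs] by simp
  qed
  then show ?thesis using m by (auto simp: projectives_def)
qed

lemma quot_proj: "quot C (projectives C)"
proof
  show "Q \<in> Obj C" if "Q \<in> projectives C" for Q using that by (rule proj_obj)
  obtain Z where "zero_object C Z" using zero_ex by blast
  then show "projectives C \<noteq> {}"
    using fr unfolding frobenius_def zero_object_def by blast
  fix Q Q' assume "Q \<in> projectives C" "Q' \<in> projectives C"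
  then show "\<exists>Y\<in>projectives C. \<exists>i j p q. bip C Q Q' Y i j p q"
    using bip_ex[OF proj_obj proj_obj] proj_sum by meson
qed

text \<open>An inflation from X to an injective I makes Ext(Y, X) a quotient of Hom(Y, S), because
  Ext(Y, I) = 0. The connecting map kills morphisms through projectives, so it factors through a
  stable Hom space, which is finite-dimensional.\<close>

lemma ext_findim:
  assumes Y: "Y \<in> Obj C" and X: "X \<in> Obj C"
  shows "findim (Ext C Y X)"
proof -
  interpret q: quot C "projectives C" by (rule quot_proj)
  obtain I x where I: "I \<in> injectives C" "inflation C X I x"
    using fr X unfolding frobenius_def by blast
  then obtain y S \<delta> where S: "S \<in> Obj C" and d: "\<delta> \<in> Exts C S X" "(I, x, y) \<in> Real C S X \<delta>"
    unfolding inflation_def conflation_def by blast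
  note m = real_in[OF S X d]
  have l: "lin (Hom C Y S) (Ext C Y X) (\<lambda>c. Pull C Y S X c \<delta>)"
    by (rule pull_lin) (use S X Y d in auto)
  have surj: "(\<lambda>c. Pull C Y S X c \<delta>) ` carrier (Hom C Y S) = Exts C Y X"
  proof
    show "(\<lambda>c. Pull C Y S X c \<delta>) ` carrier (Hom C Y S) \<subseteq> Exts C Y X"
      using S X Y d by auto
    show "Exts C Y X \<subseteq> (\<lambda>c. Pull C Y S X c \<delta>) ` carrier (Hom C Y S)"
    proof
      fix \<epsilon> assume e: "\<epsilon> \<in> Exts C Y X"
      have "Push C Y X I x \<epsilon> \<in> Exts C Y I" using X Y e m by simp
      then have "Push C Y X I x \<epsilon> = \<zero>\<^bsub>Ext C Y I\<^esub>"
        using I(1) Y by (auto simp: injectives_def)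
      then obtain c where "c \<in> Mor C Y S" "\<epsilon> = Pull C Y S X c \<delta>"
        using push_inflation_zero[OF S X d Y e] by blast
      then show "\<epsilon> \<in> (\<lambda>c. Pull C Y S X c \<delta>) ` carrier (Hom C Y S)" by blast
    qed
  qed
  have z: "Pull C Y S X f \<delta> = \<zero>\<^bsub>Ext C Y X\<^esub>" if f: "f \<in> factoring C (projectives C) Y S" for f
  proof -
    obtain Q a b where q: "Q \<in> projectives C" "a \<in> Mor C Y Q" "b \<in> Mor C Q S" "f = Comp C Y Q S b a"
      using q.facE[OF f] .
    have "Pull C Q S X b \<delta> = \<zero>\<^bsub>Ext C Q X\<^esub>"
      by (rule proj_ext[OF q(1) X]) (use q X S d proj_obj in auto)
    then show ?thesis
      using q X Y S d proj_obj[OF q(1)] by (simp add: pull_comp)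
  qed
  show ?thesis
    by (rule findim_factor[OF l surj q.fac_subspace[OF Y S] z])
      (use hf[OF Y S] in \<open>simp_all add: stable_def partial_stab_def q.quot_Hom\<close>)
qed

text \<open>The map (y, c) from the sum of R and V to U is a composite of two deflations: the direct
  sum of y and the identity of V, available because realisations are additive, and the split
  deflation (1, c).\<close>

lemma deflation_add:
  assumes U: "U \<in> Obj C" and K: "K \<in> Obj C" "\<delta> \<in> Exts C U K" "(R, x, y) \<in> Real C U K \<delta>"
    and V: "V \<in> Obj C" "c \<in> Mor C V U"
  obtains Y i j p q K' \<delta>' x' where "bip C R V Y i j p q" "K' \<in> Obj C" "\<delta>' \<in> Exts C U K'"
    "(Y, x', Comp C Y R U y p \<oplus>\<^bsub>Hom C Y U\<^esub> Comp C Y V U c q) \<in> Real C U K' \<delta>'"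
proof -
  note m = real_in[OF U K]
  obtain Z where Z: "zero_object C Z" using zero_ex by blast
  have Zo: "Z \<in> Obj C" using Z by (simp add: zero_object_def)
  obtain Y i j p q where Y: "bip C R V Y i j p q" using bip_ex[OF m(1) V(1)] by blast
  obtain W k l r s where W: "bip C U V W k l r s" using bip_ex[OF U V(1)] by blast
  have Ym: "Y \<in> Obj C" "i \<in> Mor C R Y" "j \<in> Mor C V Y" "p \<in> Mor C Y R" "q \<in> Mor C Y V"
    using Y by (auto simp: bip_def)
  have Wm: "W \<in> Obj C" "k \<in> Mor C U W" "l \<in> Mor C V W" "r \<in> Mor C W U" "s \<in> Mor C W V"
    "Comp C U W U r k = Ident C U" "Comp C V W V s l = Ident C V"
    "Comp C U W V s k = \<zero>\<^bsub>Hom C U V\<^esub>" "Comp C V W U r l = \<zero>\<^bsub>Hom C V U\<^esub>"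
    using W by (auto simp: bip_def)
  \<comment> \<open>The sequence 0 -> V -> V, to be added to the given one.\<close>
  note z = split_real[OF bip_sym[OF bip_zero[OF V(1) Z]]]
  let ?f = "\<lambda>a b n::nat. if n = 0 then a else b"
  have bb: "biproduct C [K, Z] K (?f (Ident C K) \<zero>\<^bsub>Hom C Z K\<^esub>) (?f (Ident C K) \<zero>\<^bsub>Hom C K Z\<^esub>)"
    "biproduct C [R, V] Y (?f i j) (?f p q)" "biproduct C [U, V] W (?f k l) (?f r s)"
    unfolding biproduct_bip using bip_zero[OF K(1) Z] Y W by simp_all
  define g where "g = Comp C Y U W k (Comp C Y R U y p) \<oplus>\<^bsub>Hom C Y W\<^esub> Comp C Y V W l q"
  have diag: "diag_mor C [R, V] Y (?f p q) [U, V] W (?f k l) (\<lambda>n. [y, Ident C V] ! n) = g"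
  proof -
    interpret abelian_monoid "Hom C Y W"
      using vspace_abelian_group[OF hom_vs[OF Ym(1) Wm(1)]] by (simp add: abelian_group_def)
    have "{..<length [R, V]} = {0, 1}" by auto
    then show ?thesis
      unfolding diag_mor_def g_def using m Ym Wm(1-5) U V by (simp add: finsum_insert)
  qed
  have ar: "additive_realization C" using ex by (simp add: extriangulated_def)
  define \<epsilon> where "\<epsilon> = Push C W K K (Ident C K) (Pull C W U K r \<delta>) \<oplus>\<^bsub>Ext C W K\<^esub>
    Push C W Z K \<zero>\<^bsub>Hom C Z K\<^esub> (Pull C W V Z s \<zero>\<^bsub>Ext C V Z\<^esub>)"
  have e: "\<epsilon> \<in> Exts C W K"
    unfolding \<epsilon>_def using Wm(1-5) K Zo U V by (intro vs_closed(2)[OF ext_vs]) auto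
  obtain u where u: "(Y, u, g) \<in> Real C W K \<epsilon>"
    using ar[unfolded additive_realization_def, THEN conjunct2, THEN conjunct2, rule_format,
        OF U K(1,2) V(1) Zo ext_zero_in[OF V(1) Zo] conjI[OF K(3) conjI[OF z conjI[OF bb(1) conjI[OF bb(2,3)]]]]]
    unfolding diag \<epsilon>_def by auto
  obtain K' \<delta>' x' where K': "K' \<in> Obj C" "\<delta>' \<in> Exts C U K'"
    "(Y, x', Comp C Y W U (r \<oplus>\<^bsub>Hom C W U\<^esub> Comp C W V U c s) g) \<in> Real C U K' \<delta>'"
    using compose_deflations[OF Ym(1) Wm(1) U K(1) V(1) e ext_zero_in[OF U V(1)] u
        split_real[OF bip_shear[OF W V(2)]]] by blast
  have "Comp C Y W U (r \<oplus>\<^bsub>Hom C W U\<^esub> Comp C W V U c s) g = Comp C Y R U y p \<oplus>\<^bsub>Hom C Y U\<^esub> Comp C Y V U c q"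
  proof -
    let ?h = "r \<oplus>\<^bsub>Hom C W U\<^esub> Comp C W V U c s"
    have h: "?h \<in> Mor C W U" using U V Wm by simp
    have hk: "Comp C U W U ?h k = Ident C U"
      using U V Wm by (simp add: comp_add assoc[symmetric] vs_laws(2)[OF hom_vs])
    have hl: "Comp C V W U ?h l = c"
      using U V Wm by (simp add: comp_add assoc[symmetric] vs_laws(1)[OF hom_vs])
    have "Comp C Y W U ?h g = Comp C Y W U ?h (Comp C Y U W k (Comp C Y R U y p)) \<oplus>\<^bsub>Hom C Y U\<^esub>
        Comp C Y W U ?h (Comp C Y V W l q)"
      unfolding g_def using U V Wm(1-5) Ym m h by (intro comp_add(1)) auto
    also have "Comp C Y W U ?h (Comp C Y U W k (Comp C Y R U y p)) = Comp C Y U U (Comp C U W U ?h k) (Comp C Y R U y p)"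
      by (rule assoc) (use U V Wm(1-5) Ym m h in auto)
    also have "Comp C Y W U ?h (Comp C Y V W l q) = Comp C Y V U (Comp C V W U ?h l) q"
      by (rule assoc) (use U V Wm(1-5) Ym m h in auto)
    finally show ?thesis using hk hl U V Ym m by simp
  qed
  then show thesis using that[OF Y K'(1,2)] K'(3) by simp
qed

section \<open>Right almost split deflations\<close>

lemma without_mem:
  assumes "V \<in> T" "indecomposable C V" "\<not> isomorphic C V U"
  shows "V \<in> without C T U"
proof -
  have V: "V \<in> Obj C" using assms by simp
  obtain Z where Z: "zero_object C Z" using zero_ex by blast
  have "direct_sum_of C [V, Z] V"
    using iso_direct_sum_zero[OF isomorphic_refl[OF V] Z] .
  then show ?thesis
    unfolding without_def add_closure_def
    using assms direct_sum_single[OF V] by (intro CollectI exI[of _ "[V]"] exI[of _ Z] exI[of _ V]) auto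
qed

lemma without_sub: "without C T U \<subseteq> T"
proof
  fix X assume "X \<in> without C T U"
  then obtain Xs Y Z where X: "set Xs \<subseteq> T" "direct_sum_of C Xs Z" "direct_sum_of C [X, Y] Z"
    unfolding without_def add_closure_def by blast
  then obtain i j p q where "bip C X Y Z i j p q" unfolding direct_sum2 by blast
  then show "X \<in> T"
    using T_list_sum[OF X(2,1)] T_retract[of Z X i p] by (auto simp: bip_def)
qed

lemma T_decomp:
  assumes "V \<in> T"
  obtains Xs i p where "biproduct C Xs V i p" "\<forall>Y\<in>set Xs. local_endo C Y \<and> Y \<in> T"
proof -
  obtain Xs i p where b: "biproduct C Xs V i p" and l: "\<forall>Y\<in>set Xs. local_endo C Y"
    using ks assms T_obj unfolding krull_schmidt_def direct_sum_of_def by blast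
  have "Y \<in> T" if Y: "Y \<in> set Xs" for Y
  proof -
    obtain k where k: "k < length Xs" "Y = Xs ! k" using Y by (auto simp: in_set_conv_nth)
    show ?thesis
      using T_retract[OF assms biproductD(2,3,4,5)[OF b k(1)]] k by simp
  qed
  then show thesis using that b l by blast
qed

lemma ind_local: "indecomposable C X \<Longrightarrow> local_endo C X"
  by (rule indecomposable_local[OF ks ic])

text \<open>Unlike in the definition of mutation, R only has to lie in T and may contain copies of
  U. This is the room needed to adjoin endomorphisms of U to the deflation.\<close>

definition approx_seq where
  "approx_seq U K \<delta> R x y \<longleftrightarrow> K \<in> Obj C \<and> \<delta> \<in> Exts C U K \<and> (R, x, y) \<in> Real C U K \<delta> \<and> R \<in> T \<and>
     \<not> split_deflation C R U y \<and> (\<forall>V\<in>without C T U. \<forall>f\<in>Mor C V U. \<exists>h\<in>Mor C V R. Comp C V R U y h = f)"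

text \<open>Since Ext(V, R) = 0, the space Ext(V, K) is the cokernel of composition with y on maps
  from V: every class is a pullback of \<delta>, and the zero class corresponds to the maps that
  lift along y.\<close>

lemma approx_seq_pull:
  assumes a: "approx_seq U K \<delta> R x y" and U: "U \<in> T" and V: "V \<in> T"
  shows "\<epsilon> \<in> Exts C V K \<Longrightarrow> \<exists>f\<in>Mor C V U. \<epsilon> = Pull C V U K f \<delta>"
    and "f \<in> Mor C V U \<Longrightarrow> Pull C V U K f \<delta> = \<zero>\<^bsub>Ext C V K\<^esub> \<longleftrightarrow> (\<exists>h\<in>Mor C V R. Comp C V R U y h = f)"
proof -
  have o: "U \<in> Obj C" "K \<in> Obj C" "\<delta> \<in> Exts C U K" "(R, x, y) \<in> Real C U K \<delta>" and R: "R \<in> T"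
    using a U by (auto simp: approx_seq_def)
  note m = real_in[OF o] and Vo = T_obj[OF V]
  show "\<exists>f\<in>Mor C V U. \<epsilon> = Pull C V U K f \<delta>" if e: "\<epsilon> \<in> Exts C V K"
  proof -
    have "Push C V K R x \<epsilon> = \<zero>\<^bsub>Ext C V R\<^esub>"
      by (rule T_ext[OF V R]) (use e m o Vo in auto)
    then show ?thesis
      using push_inflation_zero[OF o Vo e] by blast
  qed
  show "Pull C V U K f \<delta> = \<zero>\<^bsub>Ext C V K\<^esub> \<longleftrightarrow> (\<exists>h\<in>Mor C V R. Comp C V R U y h = f)" if f: "f \<in> Mor C V U"
  proof
    assume "Pull C V U K f \<delta> = \<zero>\<^bsub>Ext C V K\<^esub>"
    then show "\<exists>h\<in>Mor C V R. Comp C V R U y h = f"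
      using pull_zero_factor[OF o Vo f] by blast
  next
    assume "\<exists>h\<in>Mor C V R. Comp C V R U y h = f"
    then obtain h where h: "h \<in> Mor C V R" "f = Comp C V R U y h" by blast
    then show "Pull C V U K f \<delta> = \<zero>\<^bsub>Ext C V K\<^esub>"
      using pull_deflation[OF o] m o Vo by (simp add: pull_comp)
  qed
qed

text \<open>If a non-isomorphism \<open>c\<close> of \<open>U\<close> does not factor through the deflation \<open>y\<close>, then \<open>(y, c)\<close> is
  again a non-split deflation, and its kernel has smaller \<open>Ext\<close>.\<close>

lemma approx_seq_step:
  assumes a: "approx_seq U K \<delta> R x y" and U: "U \<in> T" "local_endo C U"
    and c: "c \<in> Mor C U U" "\<not> iso_arrow C U U c" "Pull C U U K c \<delta> \<noteq> \<zero>\<^bsub>Ext C U K\<^esub>"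
  obtains K' \<delta>' R' x' y' where "approx_seq U K' \<delta>' R' x' y'" "vdim (Ext C U K') < vdim (Ext C U K)"
proof -
  have o: "U \<in> Obj C" "K \<in> Obj C" "\<delta> \<in> Exts C U K" "(R, x, y) \<in> Real C U K \<delta>" and R: "R \<in> T"
    and ns: "\<not> split_deflation C R U y"
    and fac: "\<And>V f. V \<in> without C T U \<Longrightarrow> f \<in> Mor C V U \<Longrightarrow> \<exists>h\<in>Mor C V R. Comp C V R U y h = f"
    using a U by (auto simp: approx_seq_def)
  note m = real_in[OF o]
  obtain Y i j p q K' \<delta>' x' where Y: "bip C R U Y i j p q" and K': "K' \<in> Obj C" "\<delta>' \<in> Exts C U K'"
    "(Y, x', Comp C Y R U y p \<oplus>\<^bsub>Hom C Y U\<^esub> Comp C Y U U c q) \<in> Real C U K' \<delta>'"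
    using deflation_add[OF o o(1) c(1)] by metis
  let ?y = "Comp C Y R U y p \<oplus>\<^bsub>Hom C Y U\<^esub> Comp C Y U U c q"
  note m' = real_in[OF o(1) K']
  have Ym: "Y \<in> Obj C" "i \<in> Mor C R Y" "j \<in> Mor C U Y" "p \<in> Mor C Y R" "q \<in> Mor C Y U"
    and Ye: "Comp C R Y R p i = Ident C R" "Comp C U Y U q j = Ident C U"
      "Comp C R Y U q i = \<zero>\<^bsub>Hom C R U\<^esub>" "Comp C U Y R p j = \<zero>\<^bsub>Hom C U R\<^esub>"
    using Y by (auto simp: bip_def)
  have yi: "Comp C R Y U ?y i = y" and yj: "Comp C U Y U ?y j = c"
    using o(1) m Ym Ye c by (simp_all add: comp_add assoc[symmetric] vs_laws[OF hom_vs])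
  have YT: "Y \<in> T" using T_sum2[OF R U(1)] Y direct_sum2 by blast
  have ns': "\<not> split_deflation C Y U ?y"
  proof
    assume "split_deflation C Y U ?y"
    then obtain s where s: "s \<in> Mor C U Y" "Comp C U Y U ?y s = Ident C U"
      by (auto simp: split_deflation_def)
    let ?a = "Comp C U R U y (Comp C U Y R p s)" and ?b = "Comp C U U U c (Comp C U Y U q s)"
    have ab: "?a \<in> Mor C U U" "?b \<in> Mor C U U" using o(1) m Ym s(1) c by simp_all
    \<comment> \<open>A section of (y, c) writes the identity as the sum of an endomorphism through
      y and one through c. One of them is invertible: the former would split y, the latter would
      make c invertible.\<close>
    have "?a \<oplus>\<^bsub>Hom C U U\<^esub> ?b = Ident C U"
      using s o(1) m Ym c by (simp add: comp_add assoc)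
    then have "iso_arrow C U U ?a \<or> iso_arrow C U U ?b"
      using U(2) iso_id[OF o(1)] ab by (simp add: local_endo_def)
    then show False
    proof
      assume "iso_arrow C U U ?a"
      then obtain g where g: "g \<in> Mor C U U" "Comp C U U U ?a g = Ident C U"
        using isoE by metis
      then have "Comp C U R U y (Comp C U U R (Comp C U Y R p s) g) = Ident C U"
        using o(1) m Ym s(1) by (simp add: assoc)
      then have "split_deflation C R U y"
        unfolding split_deflation_def using o(1) m Ym s(1) g by (intro bexI) auto
      then show False using ns by simp
    next
      assume "iso_arrow C U U ?b"
      then have "iso_arrow C U U c"
        using local_retract_iso[OF U(2,2) c(1), of "Comp C U Y U q s"] o(1) Ym s by simp
      then show False using c by simp
    qed
  qed
  have fac': "\<exists>h\<in>Mor C V Y. Comp C V Y U ?y h = f" if V: "V \<in> without C T U" and f: "f \<in> Mor C V U" for V f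
  proof -
    have Vo: "V \<in> Obj C" using V without_sub T_obj by blast
    obtain h where h: "h \<in> Mor C V R" "Comp C V R U y h = f" using fac[OF V f] by blast
    have "Comp C V Y U ?y (Comp C V R Y i h) = Comp C V R U (Comp C R Y U ?y i) h"
      by (rule assoc) (use Vo m Ym o(1) h m' in auto)
    then show ?thesis using yi h Vo m Ym by (intro bexI[of _ "Comp C V R Y i h"]) auto
  qed
  have as': "approx_seq U K' \<delta>' Y x' ?y"
    unfolding approx_seq_def using K' YT ns' fac' by blast
  \<comment> \<open>The inclusion of R into the sum of R and U induces a map of first terms that
    carries \<delta> to \<delta>'.\<close>
  obtain u where u: "u \<in> Mor C K K'" "Push C U K K' u \<delta> = Pull C U U K' (Ident C U) \<delta>'"
    by (rule et3opD[OF o(1-3) o(1) K'(1,2) o(4) K'(3) Ym(2) id_in[OF o(1)]]) (use yi o(1) m in auto)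
  have u2: "Push C U K K' u \<delta> = \<delta>'" using u o(1) K' by simp
  have up: "Push C U K K' u (Pull C U U K f \<delta>) = Pull C U U K' f \<delta>'" if "f \<in> Mor C U U" for f
    using push_pull[OF o(1) o(1) o(2) K'(1) o(3) u(1) that] u2 by simp
  have l: "lin (Ext C U K) (Ext C U K') (Push C U K K' u)"
    by (rule push_lin) (use o K' u in auto)
  have surj: "Push C U K K' u ` Exts C U K = Exts C U K'"
  proof
    show "Push C U K K' u ` Exts C U K \<subseteq> Exts C U K'" using lin_closed[OF l] by blast
    show "Exts C U K' \<subseteq> Push C U K K' u ` Exts C U K"
    proof
      fix \<epsilon> assume "\<epsilon> \<in> Exts C U K'"
      then obtain f where f: "f \<in> Mor C U U" "\<epsilon> = Pull C U U K' f \<delta>'"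
        using approx_seq_pull(1)[OF as' U(1) U(1)] by blast
      then have "\<epsilon> = Push C U K K' u (Pull C U U K f \<delta>)" using up by simp
      moreover have "Pull C U U K f \<delta> \<in> Exts C U K" using f o by simp
      ultimately show "\<epsilon> \<in> Push C U K K' u ` Exts C U K" by blast
    qed
  qed
  let ?N = "{v \<in> Exts C U K. Push C U K K' u v = \<zero>\<^bsub>Ext C U K'\<^esub>}"
  note kd = kernel_vdim[OF l ext_findim[OF o(1,2)] surj]
  \<comment> \<open>Since c lifts along (y, c), its class dies in Ext(U, K'). It was nonzero in
    Ext(U, K), so the surjection between the two spaces has a nonzero kernel and the dimension
    drops.\<close>
  have "Pull C U U K' c \<delta>' = \<zero>\<^bsub>Ext C U K'\<^esub>"
    using approx_seq_pull(2)[OF as' U(1) U(1) c(1)] yj Ym by blast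
  then have "Pull C U U K c \<delta> \<in> ?N" using up[OF c(1)] c o by simp
  then have "?N \<noteq> {\<zero>\<^bsub>Ext C U K\<^esub>}" using c(3) by blast
  then have "vdim (Ext C U K\<lparr>carrier := ?N\<rparr>) \<noteq> 0"
    using vdim_zero_iff[OF subspace_vspace[OF kd(2)] findim_subspace[OF ext_findim[OF o(1,2)] kd(2)]] by simp
  then show thesis using that[OF as'] kd(1) by simp
qed

lemma approx_seq_mutable:
  assumes U: "U \<in> T" "indecomposable C U" "U \<notin> projectives C"
  obtains K \<delta> R x y where "approx_seq U K \<delta> R x y"
proof -
  have "mutable C T U" using mm U by (simp add: maximally_mutable_def)
  then obtain U' Up x y where c: "conflation C U' x Up y U" "\<not> split_deflation C Up U y"
    "right_approx C (without C T U) Up U y"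
    unfolding mutable_def by blast
  then obtain \<delta> where "U' \<in> Obj C" "\<delta> \<in> Exts C U U'" "(Up, x, y) \<in> Real C U U' \<delta>"
    unfolding conflation_def by blast
  then have "approx_seq U U' \<delta> Up x y"
    using c without_sub unfolding approx_seq_def right_approx_def by blast
  then show thesis by (rule that)
qed

text \<open>On T, \<open>Efun C K\<close> is generated by \<delta>, and the maps V -> U annihilating
  \<delta> are exactly those that are not split epimorphisms. For U with local endomorphism ring it
  is therefore the quotient of Hom(-, U) by its radical.\<close>

definition simple_at where
  "simple_at U K \<delta> \<longleftrightarrow> K \<in> Obj C \<and> \<delta> \<in> Exts C U K \<and>
     (\<forall>V\<in>T. \<forall>\<epsilon>\<in>Exts C V K. \<exists>f\<in>Mor C V U. \<epsilon> = Pull C V U K f \<delta>) \<and>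
     (\<forall>V\<in>T. \<forall>f\<in>Mor C V U. Pull C V U K f \<delta> = \<zero>\<^bsub>Ext C V K\<^esub> \<longleftrightarrow>
       (\<forall>h\<in>Mor C U V. \<not> iso_arrow C U U (Comp C U V U f h)))"

text \<open>The simple module with top at \<open>U\<close> is $\mathsf{E}^{\mathcal T}K$ for the kernel \<open>K\<close> of a
  right almost split map to \<open>U\<close>.\<close>

lemma simple_ext:
  assumes U: "U \<in> T" "indecomposable C U" "U \<notin> projectives C"
  shows "\<exists>K \<delta>. simple_at U K \<delta>"
proof -
  have lU: "local_endo C U" by (rule ind_local[OF U(2)])
  let ?P = "\<lambda>n. \<exists>K \<delta> R x y. approx_seq U K \<delta> R x y \<and> vdim (Ext C U K) = n"
  have "\<exists>n. ?P n" using approx_seq_mutable[OF U] by metis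
  \<comment> \<open>With Ext(U, K) of minimal dimension, \<open>approx_seq_step\<close> forces every
    non-isomorphism of U to annihilate \<delta>.\<close>
  then obtain n where n: "?P n" "\<And>n'. n' < n \<Longrightarrow> \<not> ?P n'"
    using exists_least_iff[of ?P] by metis
  obtain K \<delta> R x y where a: "approx_seq U K \<delta> R x y" and nK: "vdim (Ext C U K) = n" using n(1) by blast
  have o: "U \<in> Obj C" "K \<in> Obj C" "\<delta> \<in> Exts C U K" "(R, x, y) \<in> Real C U K \<delta>" and R: "R \<in> T"
    and ns: "\<not> split_deflation C R U y"
    and fac: "\<And>V f. V \<in> without C T U \<Longrightarrow> f \<in> Mor C V U \<Longrightarrow> \<exists>h\<in>Mor C V R. Comp C V R U y h = f"
    using a U by (auto simp: approx_seq_def)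
  note m = real_in[OF o]
  have rad: "Pull C U U K c \<delta> = \<zero>\<^bsub>Ext C U K\<^esub>" if c: "c \<in> Mor C U U" "\<not> iso_arrow C U U c" for c
  proof (rule ccontr)
    assume nz: "Pull C U U K c \<delta> \<noteq> \<zero>\<^bsub>Ext C U K\<^esub>"
    obtain K' \<delta>' R' x' y' where "approx_seq U K' \<delta>' R' x' y'" "vdim (Ext C U K') < vdim (Ext C U K)"
      by (rule approx_seq_step[OF a U(1) lU c nz])
    then show False using n(2) nK by blast
  qed
  have zero_iff: "Pull C V U K f \<delta> = \<zero>\<^bsub>Ext C V K\<^esub> \<longleftrightarrow> (\<forall>h\<in>Mor C U V. \<not> iso_arrow C U U (Comp C U V U f h))"
    if V: "V \<in> T" and f: "f \<in> Mor C V U" for V f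
  proof
    assume z: "Pull C V U K f \<delta> = \<zero>\<^bsub>Ext C V K\<^esub>"
    then obtain b where b: "b \<in> Mor C V R" "f = Comp C V R U y b"
      using approx_seq_pull(2)[OF a U(1) V f] by blast
    show "\<forall>h\<in>Mor C U V. \<not> iso_arrow C U U (Comp C U V U f h)"
    proof (intro ballI notI)
      fix h assume h: "h \<in> Mor C U V" and i: "iso_arrow C U U (Comp C U V U f h)"
      obtain g where g: "g \<in> Mor C U U" "Comp C U U U (Comp C U V U f h) g = Ident C U"
        using isoE[OF i] by metis
      have "Comp C U R U y (Comp C U V R b (Comp C U U V h g)) = Ident C U"
        using g b h m o(1) V by (simp add: assoc)
      then have "split_deflation C R U y"
        unfolding split_deflation_def using o(1) m V b(1) h g(1) by (intro bexI) auto
      then show False using ns by simp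
    qed
  next
    assume nh: "\<forall>h\<in>Mor C U V. \<not> iso_arrow C U U (Comp C U V U f h)"
    \<comment> \<open>The vanishing is checked on the indecomposable summands of V. Those not
      isomorphic to U lie in \<open>without C T U\<close>, from where maps lift along y; on a copy
      of U the component of f corresponds to a non-isomorphism of U.\<close>
    obtain Xs i p where b: "biproduct C Xs V i p" and Xs: "\<forall>Y\<in>set Xs. local_endo C Y \<and> Y \<in> T"
      using T_decomp[OF V] by blast
    let ?\<epsilon> = "Pull C V U K f \<delta>"
    have e: "?\<epsilon> \<in> Exts C V K" using f o V by simp
    have "Pull C V V K (Ident C V) ?\<epsilon> \<in> {\<zero>\<^bsub>Ext C V K\<^esub>}"
    proof (rule biproduct_lin[OF b])
      show "lin (Hom C V V) (Ext C V K) (\<lambda>c. Pull C V V K c ?\<epsilon>)"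
        by (rule pull_lin) (use V o e in auto)
      show "subspace class_ring {\<zero>\<^bsub>Ext C V K\<^esub>} (Ext C V K)"
        by (rule subspace_zero) (use V o in auto)
      fix k assume k: "k < length Xs"
      note d = biproductD[OF b k]
      have X: "local_endo C (Xs ! k)" "Xs ! k \<in> T" using Xs k by auto
      let ?g = "Comp C (Xs ! k) V U f (i k)"
      have g: "?g \<in> Mor C (Xs ! k) U" using d f o(1) by simp
      have "Pull C (Xs ! k) U K ?g \<delta> = \<zero>\<^bsub>Ext C (Xs ! k) K\<^esub>"
      proof (cases "isomorphic C (Xs ! k) U")
        case False
        then have "Xs ! k \<in> without C T U"
          using without_mem X local_indecomposable by blast
        then show ?thesis
          using approx_seq_pull(2)[OF a U(1) X(2) g] fac[OF _ g] by blast
      next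
        case True
        then obtain \<theta> \<theta>' where t: "\<theta> \<in> Mor C U (Xs ! k)" "\<theta>' \<in> Mor C (Xs ! k) U"
          "Comp C (Xs ! k) U (Xs ! k) \<theta> \<theta>' = Ident C (Xs ! k)"
          using isomorphicE[OF isomorphic_sym[OF True]] by metis
        have "\<not> iso_arrow C U U (Comp C U V U f (Comp C U (Xs ! k) V (i k) \<theta>))"
          using nh t d o(1) by simp
        then have "\<not> iso_arrow C U U (Comp C U (Xs ! k) U ?g \<theta>)"
          using t d o(1) f by (simp add: assoc)
        then have z: "Pull C U U K (Comp C U (Xs ! k) U ?g \<theta>) \<delta> = \<zero>\<^bsub>Ext C U K\<^esub>"
          using rad t d o(1) g by simp
        have "?g = Comp C (Xs ! k) U U (Comp C U (Xs ! k) U ?g \<theta>) \<theta>'"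
          using assoc[of "Xs ! k" U "Xs ! k" U \<theta>' \<theta> ?g] t d(1,2) o(1) g by simp
        then have "Pull C (Xs ! k) U K ?g \<delta> = Pull C (Xs ! k) U K (Comp C (Xs ! k) U U (Comp C U (Xs ! k) U ?g \<theta>) \<theta>') \<delta>"
          by simp
        also have "\<dots> = Pull C (Xs ! k) U K \<theta>' (Pull C U U K (Comp C U (Xs ! k) U ?g \<theta>) \<delta>)"
          by (rule pull_comp) (use t d(1,2) o(1-3) g in auto)
        finally show ?thesis using z t d(2) o(1,2) by simp
      qed
      then have "Pull C (Xs ! k) V K (i k) ?\<epsilon> = \<zero>\<^bsub>Ext C (Xs ! k) K\<^esub>"
        using d(1-4) f o(1-3) by (simp add: pull_comp)
      then show "Pull C V V K (Comp C V (Xs ! k) V (i k) (p k)) ?\<epsilon> \<in> {\<zero>\<^bsub>Ext C V K\<^esub>}"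
        using pull_comp[OF d(1) d(2) d(1) o(2) e d(3) d(4)] d(1-4) o(2) by simp
    qed
    then show "Pull C V U K f \<delta> = \<zero>\<^bsub>Ext C V K\<^esub>" using e V o by simp
  qed
  have "simple_at U K \<delta>"
    unfolding simple_at_def by (intro conjI ballI o(2,3) approx_seq_pull(1)[OF a U(1)] zero_iff)
  then show ?thesis by blast
qed

end

section \<open>Modules\<close>

lemma finite_support_mono:
  assumes "\<exists>J. finite J \<and> (\<forall>X\<in>T. Q X \<and> A X \<longrightarrow> (\<exists>Y\<in>J. I X Y))" and "\<And>X. X \<in> T \<Longrightarrow> B X \<Longrightarrow> A X"
  shows "\<exists>J. finite J \<and> (\<forall>X\<in>T. Q X \<and> B X \<longrightarrow> (\<exists>Y\<in>J. I X Y))"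
  using assms by metis

lemma fd_seqs_sub: "fd_exact_seqs \<iota> C T \<subseteq> fd_modules \<iota> C T \<times> fd_modules \<iota> C T \<times> fd_modules \<iota> C T"
  by (auto simp: fd_exact_seqs_def)

lemma coords_lin:
  fixes V :: "('k::field, 'v) module"
  assumes V: "vspace V" and fd: "findim V"
  shows "lin V (module_vec TYPE('k) (vdim V)) (coords V)"
    "bij_betw (coords V) (carrier V) (carrier_vec (vdim V))"
    "c \<in> carrier_vec (vdim V) \<Longrightarrow> coords V (comb V c) = c"
proof -
  note co = coords[OF V fd] and cl = lin_comb_map[OF V fd] and ci = comb_inj[OF V fd]
  have cc: "coords V (comb V c) = c" if "c \<in> carrier_vec (vdim V)" for c
    using ci[OF co(1) that] co(2) lin_closed[OF cl] that by (simp add: module_vec_simps)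
  show "c \<in> carrier_vec (vdim V) \<Longrightarrow> coords V (comb V c) = c" by (rule cc)
  show "lin V (module_vec TYPE('k) (vdim V)) (coords V)"
  proof (rule linI[OF V vspace_vec])
    show "coords V v \<in> carrier (module_vec TYPE('k) (vdim V))" if "v \<in> carrier V" for v
      using co(1)[OF that] by (simp add: module_vec_simps)
    show "coords V (v \<oplus>\<^bsub>V\<^esub> w) = coords V v \<oplus>\<^bsub>module_vec TYPE('k) (vdim V)\<^esub> coords V w"
      if "v \<in> carrier V" "w \<in> carrier V" for v w
      using lin_add[OF cl, of "coords V v" "coords V w"] co that cc[of "coords V v + coords V w"]
      by (simp add: module_vec_simps)
    show "coords V (c \<odot>\<^bsub>V\<^esub> v) = c \<odot>\<^bsub>module_vec TYPE('k) (vdim V)\<^esub> coords V v" if "v \<in> carrier V" for c v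
      using lin_smult[OF cl, of "coords V v" c] co that cc[of "c \<cdot>\<^sub>v coords V v"]
      by (simp add: module_vec_simps)
  qed
  show "bij_betw (coords V) (carrier V) (carrier_vec (vdim V))"
    by (rule bij_betwI[where g = "comb V"])
      (use co cc lin_closed[OF cl] in \<open>auto simp: module_vec_simps\<close>)
qed

context
  fixes \<iota> :: "'k::field \<Rightarrow> 'f::field" and C :: "('k, 'o, 'm, 'z) lincat_scheme" and T
    and M :: "('f, 'o, 'm, 'v) tmod"
  assumes M: "T_module \<iota> C T M"
begin

lemma TM_vs: "X \<in> T \<Longrightarrow> vspace (mval M X)"
  using M by (simp add: T_module_def)

lemma TM_lin: "X \<in> T \<Longrightarrow> Y \<in> T \<Longrightarrow> f \<in> Mor C X Y \<Longrightarrow> lin (mval M Y) (mval M X) (mact M X Y f)"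
  using M by (simp add: T_module_def)

lemma TM_id: "X \<in> T \<Longrightarrow> v \<in> mcar M X \<Longrightarrow> mact M X X (Ident C X) v = v"
  using M by (simp add: T_module_def)

lemma TM_comp: "X \<in> T \<Longrightarrow> Y \<in> T \<Longrightarrow> Z \<in> T \<Longrightarrow> f \<in> Mor C X Y \<Longrightarrow> g \<in> Mor C Y Z \<Longrightarrow> v \<in> mcar M Z \<Longrightarrow>
    mact M X Z (Comp C X Y Z g f) v = mact M X Y f (mact M Y Z g v)"
  using M by (simp add: T_module_def)

lemma TM_add: "X \<in> T \<Longrightarrow> Y \<in> T \<Longrightarrow> f \<in> Mor C X Y \<Longrightarrow> g \<in> Mor C X Y \<Longrightarrow> v \<in> mcar M Y \<Longrightarrow>
    mact M X Y (f \<oplus>\<^bsub>Hom C X Y\<^esub> g) v = mact M X Y f v \<oplus>\<^bsub>mval M X\<^esub> mact M X Y g v"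
  using M by (simp add: T_module_def)

lemma TM_smult: "X \<in> T \<Longrightarrow> Y \<in> T \<Longrightarrow> f \<in> Mor C X Y \<Longrightarrow> v \<in> mcar M Y \<Longrightarrow>
    mact M X Y (c \<odot>\<^bsub>Hom C X Y\<^esub> f) v = \<iota> c \<odot>\<^bsub>mval M X\<^esub> mact M X Y f v"
  using M by (simp add: T_module_def)

lemma TM_in: "X \<in> T \<Longrightarrow> Y \<in> T \<Longrightarrow> f \<in> Mor C X Y \<Longrightarrow> v \<in> mcar M Y \<Longrightarrow> mact M X Y f v \<in> mcar M X"
  using lin_closed[OF TM_lin] by blast

lemma restrict_T_module:
  assumes W: "T_submodule C T M W"
  shows "T_module \<iota> C T (restrict_mod M W)"
proof -
  have sub: "subspace class_ring (W X) (mval M X)" if "X \<in> T" for X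
    using W that by (simp add: T_submodule_def)
  note s = subspaceD[OF sub]
  have act: "mact M X Y f v \<in> W X" if "X \<in> T" "Y \<in> T" "f \<in> Mor C X Y" "v \<in> W Y" for X Y f v
    using W that unfolding T_submodule_def by blast
  have m: "v \<in> mcar M X" if "X \<in> T" "v \<in> W X" for X v
    using s(2)[OF that(1)] that(2) by blast
  have l: "lin (mval M Y\<lparr>carrier := W Y\<rparr>) (mval M X\<lparr>carrier := W X\<rparr>) (mact M X Y f)"
    if o: "X \<in> T" "Y \<in> T" "f \<in> Mor C X Y" for X Y f
    by (rule linI) (use o act subspace_vspace[OF sub] m[OF o(2)] in
        \<open>auto simp: lin_add[OF TM_lin[OF o]] lin_smult[OF TM_lin[OF o]]\<close>)
  show ?thesis
    unfolding T_module_def restrict_mod_def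
    using subspace_vspace[OF sub] l TM_id TM_comp TM_add TM_smult m by simp
qed

text \<open>The laws of N hold after applying the injective natural maps h, hence they hold in
  N.\<close>

lemma transport_T_module:
  fixes N :: "('f, 'o, 'm, 'w) tmod"
  assumes vs: "\<And>X. X \<in> T \<Longrightarrow> vspace (mval N X)"
    and act: "\<And>X Y f v. X \<in> T \<Longrightarrow> Y \<in> T \<Longrightarrow> f \<in> Mor C X Y \<Longrightarrow> v \<in> mcar N Y \<Longrightarrow> mact N X Y f v \<in> mcar N X"
    and h: "\<And>X. X \<in> T \<Longrightarrow> lin (mval N X) (mval M X) (h X)" "\<And>X. X \<in> T \<Longrightarrow> inj_on (h X) (mcar N X)"
    and nat: "\<And>X Y f v. X \<in> T \<Longrightarrow> Y \<in> T \<Longrightarrow> f \<in> Mor C X Y \<Longrightarrow> v \<in> mcar N Y \<Longrightarrow>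
      h X (mact N X Y f v) = mact M X Y f (h Y v)"
    and C: "lincat C" "T \<subseteq> Obj C"
  shows "T_module \<iota> C T N"
proof -
  interpret lincat C by (rule C)
  have o: "X \<in> Obj C" if "X \<in> T" for X using that C by blast
  have eq: "v = w" if "h X v = h X w" "X \<in> T" "v \<in> mcar N X" "w \<in> mcar N X" for X v w
    using h(2)[OF that(2)] that by (auto dest: inj_onD)
  note hc = lin_closed[OF h(1)] and ha = lin_add[OF h(1)] and hs = lin_smult[OF h(1)] and vc = vs_closed[OF vs]
  have l: "lin (mval N Y) (mval N X) (mact N X Y f)" if a: "X \<in> T" "Y \<in> T" "f \<in> Mor C X Y" for X Y f
  proof (rule linI[OF vs[OF a(2)] vs[OF a(1)]])
    show "mact N X Y f v \<in> mcar N X" if "v \<in> mcar N Y" for v using act a that by blast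
    show "mact N X Y f (v \<oplus>\<^bsub>mval N Y\<^esub> w) = mact N X Y f v \<oplus>\<^bsub>mval N X\<^esub> mact N X Y f w"
      if "v \<in> mcar N Y" "w \<in> mcar N Y" for v w
      by (rule eq) (use a that act hc vc in \<open>auto simp: nat ha lin_add[OF TM_lin]\<close>)
    show "mact N X Y f (c \<odot>\<^bsub>mval N Y\<^esub> v) = c \<odot>\<^bsub>mval N X\<^esub> mact N X Y f v" if "v \<in> mcar N Y" for c v
      by (rule eq) (use a that act hc vc in \<open>auto simp: nat hs lin_smult[OF TM_lin]\<close>)
  qed
  show ?thesis
    unfolding T_module_def
  proof (intro conjI ballI allI)
    fix X Y f assume a: "X \<in> T" "Y \<in> T" "f \<in> Mor C X Y"
    show "mact N X Y (f \<oplus>\<^bsub>Hom C X Y\<^esub> g) v = mact N X Y f v \<oplus>\<^bsub>mval N X\<^esub> mact N X Y g v"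
      if "g \<in> Mor C X Y" "v \<in> mcar N Y" for g v
      by (rule eq) (use a that act hc vc o in \<open>auto simp: nat ha TM_add\<close>)
    show "mact N X Y (c \<odot>\<^bsub>Hom C X Y\<^esub> f) v = \<iota> c \<odot>\<^bsub>mval N X\<^esub> mact N X Y f v" if "v \<in> mcar N Y" for c v
      by (rule eq) (use a that act hc vc o vs_closed(5)[OF hom_vs] in \<open>auto simp: nat hs TM_smult\<close>)
    show "mact N X Z (Comp C X Y Z g f) v = mact N X Y f (mact N Y Z g v)"
      if "Z \<in> T" "g \<in> Mor C Y Z" "v \<in> mcar N Z" for Z g v
      by (rule eq) (use a that act hc vc o in \<open>auto simp: nat TM_comp\<close>)
  next
    fix X v assume a: "X \<in> T" "v \<in> mcar N X"
    show "mact N X X (Ident C X) v = v"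
      by (rule eq) (use a act hc o in \<open>auto simp: nat TM_id\<close>)
  qed (use vs l in auto)
qed

end

lemma restrict_simps [simp]:
  "mval (restrict_mod M W) X = (mval M X)\<lparr>carrier := W X\<rparr>" "mact (restrict_mod M W) = mact M"
  by (simp_all add: restrict_mod_def)

context
  fixes \<iota> :: "'k::field \<Rightarrow> 'f::field" and C :: "('k, 'o, 'm, 'e) extricat" and T
    and M :: "('f, 'o, 'm, 'v) tmod"
  assumes M: "fd_module \<iota> C T M"
begin

lemma fd_T_module: "T_module \<iota> C T M"
  using M by (simp add: fd_module_def)

lemma fd_findim: "X \<in> T \<Longrightarrow> findim (mval M X)"
  using M by (simp add: fd_module_def)

lemma restrict_fd:
  assumes W: "T_submodule C T M W"
  shows "fd_module \<iota> C T (restrict_mod M W)"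
proof -
  have sub: "subspace class_ring (W X) (mval M X)" if "X \<in> T" for X
    using W that by (simp add: T_submodule_def)
  have z: "W X = {\<zero>\<^bsub>mval M X\<^esub>}" if "X \<in> T" "mcar M X = {\<zero>\<^bsub>mval M X\<^esub>}" for X
    using subspaceD(2,3)[OF sub[OF that(1)]] that(2) by blast
  have s: "\<exists>J. finite J \<and> (\<forall>X\<in>T. indecomposable C X \<and> mcar M X \<noteq> {\<zero>\<^bsub>mval M X\<^esub>} \<longrightarrow> (\<exists>Y\<in>J. isomorphic C X Y))"
    "\<forall>X\<in>T \<inter> projectives C. mcar M X = {\<zero>\<^bsub>mval M X\<^esub>}"
    using M by (simp_all add: fd_module_def)
  have J: "\<exists>J. finite J \<and> (\<forall>X\<in>T. indecomposable C X \<and> W X \<noteq> {\<zero>\<^bsub>mval M X\<^esub>} \<longrightarrow> (\<exists>Y\<in>J. isomorphic C X Y))"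
    by (rule finite_support_mono[OF s(1)]) (use z in blast)
  show ?thesis
    unfolding fd_module_def
  proof (intro conjI ballI)
    show "mcar (restrict_mod M W) X = {\<zero>\<^bsub>mval (restrict_mod M W) X\<^esub>}" if "X \<in> T \<inter> projectives C" for X
      using z s(2) that by simp
    show "findim (mval (restrict_mod M W) X)" if "X \<in> T" for X
      using findim_subspace[OF fd_findim sub] that by simp
  qed (use restrict_T_module[OF fd_T_module W] J in simp_all)
qed

lemma transport_fd:
  fixes N :: "('f, 'o, 'm, 'w) tmod"
  assumes N: "T_module \<iota> C T N"
    and h: "\<And>X. X \<in> T \<Longrightarrow> lin (mval N X) (mval M X) (h X)" "\<And>X. X \<in> T \<Longrightarrow> inj_on (h X) (mcar N X)"
  shows "fd_module \<iota> C T N"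
proof -
  have z: "mcar N X = {\<zero>\<^bsub>mval N X\<^esub>}" if X: "X \<in> T" and "mcar M X = {\<zero>\<^bsub>mval M X\<^esub>}" for X
  proof -
    have "v = \<zero>\<^bsub>mval N X\<^esub>" if v: "v \<in> mcar N X" for v
      using inj_onD[OF h(2)[OF X] _ v vs_closed(1)[OF TM_vs[OF N X]]] lin_closed[OF h(1)[OF X] v] lin_zero[OF h(1)[OF X]]
        \<open>mcar M X = {\<zero>\<^bsub>mval M X\<^esub>}\<close> by simp
    then show ?thesis using vs_closed(1)[OF TM_vs[OF N X]] by blast
  qed
  have s: "\<exists>J. finite J \<and> (\<forall>X\<in>T. indecomposable C X \<and> mcar M X \<noteq> {\<zero>\<^bsub>mval M X\<^esub>} \<longrightarrow> (\<exists>Y\<in>J. isomorphic C X Y))"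
    "\<forall>X\<in>T \<inter> projectives C. mcar M X = {\<zero>\<^bsub>mval M X\<^esub>}"
    using M by (simp_all add: fd_module_def)
  have J: "\<exists>J. finite J \<and> (\<forall>X\<in>T. indecomposable C X \<and> mcar N X \<noteq> {\<zero>\<^bsub>mval N X\<^esub>} \<longrightarrow> (\<exists>Y\<in>J. isomorphic C X Y))"
    by (rule finite_support_mono[OF s(1)]) (use z in blast)
  show ?thesis
    unfolding fd_module_def
  proof (intro conjI ballI)
    show "mcar N X = {\<zero>\<^bsub>mval N X\<^esub>}" if "X \<in> T \<inter> projectives C" for X
      using z s(2) that by blast
    show "findim (mval N X)" if "X \<in> T" for X
      using findim_inj[OF h(1)[OF that] fd_findim[OF that] h(2)[OF that]] .
  qed (use N J in auto)
qed

lemma zero_submodule: "T_submodule C T M (\<lambda>X. {\<zero>\<^bsub>mval M X\<^esub>})"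
  unfolding T_submodule_def
proof (intro conjI ballI)
  fix X assume X: "X \<in> T"
  note v = TM_vs[OF fd_T_module X]
  show "subspace class_ring {\<zero>\<^bsub>mval M X\<^esub>} (mval M X)"
    by (rule subspaceI[OF v]) (use vs_closed[OF v] vs_laws[OF v] vs_smult_laws(4)[OF v] in auto)
  fix Y f assume "Y \<in> T" "f \<in> Mor C X Y"
  then show "mact M X Y f ` {\<zero>\<^bsub>mval M Y\<^esub>} \<subseteq> {\<zero>\<^bsub>mval M X\<^esub>}"
    using lin_zero[OF TM_lin[OF fd_T_module X]] by simp
qed

end

text \<open>As for \<open>K0T_iso\<close>: the zero module Z gives the relations [M] = [Z] + [N] and
  [Z] = [Z] + [Z].\<close>

lemma K0_fd_iso:
  assumes M: "M \<in> fd_modules \<iota> C T" and N: "N \<in> fd_modules \<iota> C T"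
    and h: "T_module_hom C T M N h" "\<And>X. X \<in> T \<Longrightarrow> bij_betw (h X) (mcar M X) (mcar N X)"
  shows "frag_of M - frag_of N \<in> K0_rel (fd_modules \<iota> C T) (fd_exact_seqs \<iota> C T)"
proof -
  have M': "fd_module \<iota> C T M" and N': "fd_module \<iota> C T N"
    using M N by (simp_all add: fd_modules_def)
  define Z where "Z = restrict_mod M (\<lambda>X. {\<zero>\<^bsub>mval M X\<^esub>})"
  have Z: "Z \<in> fd_modules \<iota> C T"
    unfolding Z_def fd_modules_def using restrict_fd[OF M' zero_submodule[OF M']] by simp
  have Zz: "mcar Z X = {\<zero>\<^bsub>mval M X\<^esub>}" "\<zero>\<^bsub>mval Z X\<^esub> = \<zero>\<^bsub>mval M X\<^esub>" for X
    by (simp_all add: Z_def)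
  note vM = TM_vs[OF fd_T_module[OF M']] and vN = TM_vs[OF fd_T_module[OF N']]
  have vZ: "vspace (mval Z X)" if "X \<in> T" for X
    using Z that TM_vs[OF fd_T_module] by (auto simp: fd_modules_def)
  have lh: "lin (mval M X) (mval N X) (h X)" if "X \<in> T" for X
    using h(1) that by (simp add: T_module_hom_def)
  have id: "T_module_hom C T Z M (\<lambda>X v. v)" "T_module_hom C T Z Z (\<lambda>X v. v)"
    unfolding T_module_hom_def Z_def using vM vZ
    by (auto intro!: linI simp: Z_def vs_closed vs_laws vs_smult_laws(4)[OF _ vs_closed(1)])
  have hz: "h X v = \<zero>\<^bsub>mval N X\<^esub> \<longleftrightarrow> v = \<zero>\<^bsub>mval M X\<^esub>" if "X \<in> T" "v \<in> mcar M X" for X v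
    using h(2)[OF that(1)] that(2) lin_zero[OF lh[OF that(1)]] vs_closed(1)[OF vM[OF that(1)]]
    by (metis bij_betw_inv_into_left)
  have "short_exact C T Z M N"
    unfolding short_exact_def
    by (intro exI[of _ "\<lambda>X v. v"] exI[of _ h] conjI ballI id(1) h(1))
      (use hz h(2) vs_closed(1)[OF vM] in \<open>auto simp: Zz bij_betw_def\<close>)
  then have 1: "frag_of M - frag_of Z - frag_of N \<in> K0_rel (fd_modules \<iota> C T) (fd_exact_seqs \<iota> C T)"
    using M N Z by (intro K0_rel_closed(5)[OF fd_seqs_sub]) (simp add: fd_exact_seqs_def)
  have "short_exact C T Z Z Z"
    unfolding short_exact_def
    by (intro exI[of _ "\<lambda>X v. v"] exI[of _ "\<lambda>X v. v"] conjI ballI id(2)) (auto simp: Zz)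
  then have 2: "frag_of Z - frag_of Z - frag_of Z \<in> K0_rel (fd_modules \<iota> C T) (fd_exact_seqs \<iota> C T)"
    using Z by (intro K0_rel_closed(5)[OF fd_seqs_sub]) (simp add: fd_exact_seqs_def)
  show ?thesis
    using K0_rel_closed(4)[OF fd_seqs_sub 1 2] by simp
qed

subsection \<open>Dimensions\<close>

text \<open>The dimension at X, extended additively. \<open>frag_extend\<close> takes values in free
  abelian groups, so the integers are represented as the free abelian group on
  \<open>()\<close>.\<close>

definition dimf :: "'o \<Rightarrow> (('f::field, 'o, 'm, 'f vec) tmod \<Rightarrow>\<^sub>0 int) \<Rightarrow> int" where
  "dimf X c = Poly_Mapping.lookup (frag_extend (\<lambda>L. frag_cmul (int (vdim (mval L X))) (frag_of ())) c) ()"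

lemma dimf_simps [simp]:
  "dimf X 0 = 0" "dimf X (frag_of M) = int (vdim (mval M X))" "dimf X (- c) = - dimf X c"
  "dimf X (c + d) = dimf X c + dimf X d" "dimf X (c - d) = dimf X c - dimf X d"
  by (simp_all add: dimf_def frag_extend_minus frag_extend_add frag_extend_diff lookup_add lookup_minus)

lemma dimf_rel:
  assumes c: "c \<in> K0_rel (fd_modules \<iota> C T) (fd_exact_seqs \<iota> C T)" and X: "X \<in> T"
  shows "dimf X c = 0"
  using fd_seqs_sub c
proof (induction rule: K0_rel_induct)
  case (gen L M N)
  then have fd: "fd_module \<iota> C T M" and "short_exact C T L M N"
    by (auto simp: fd_exact_seqs_def fd_modules_def)
  then obtain h g where hg: "T_module_hom C T L M h" "T_module_hom C T M N g"
    "\<forall>X\<in>T. inj_on (h X) (mcar L X) \<and> g X ` mcar M X = mcar N X \<and>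
           h X ` mcar L X = {v \<in> mcar M X. g X v = \<zero>\<^bsub>mval N X\<^esub>}"
    unfolding short_exact_def by (elim exE conjE)
  note ex = bspec[OF hg(3) X]
  have "vdim (mval M X) = vdim (mval L X) + vdim (mval N X)"
    by (rule vdim_exact[OF _ _ fd_findim[OF fd X] conjunct1[OF ex] conjunct1[OF conjunct2[OF ex]] conjunct2[OF conjunct2[OF ex]]]) (use hg(1,2) X in \<open>auto simp: T_module_hom_def\<close>)
  then show ?case by simp
qed simp_all

lemma dimf_coset:
  assumes "K0fd_coset \<iota> C T c = K0fd_coset \<iota> C T d" "X \<in> T"
  shows "dimf X c = dimf X d"
  using assms dimf_rel[of "c - d" \<iota> C T X] by (simp add: K0_coset_eq[OF fd_seqs_sub])

lemma base_change_simps [simp]: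
  "mval (base_change (\<iota> :: 'k::field \<Rightarrow> 'f::field) M) X = module_vec TYPE('f) (vdim (mval M X))"
  by (simp add: base_change_def)

lemma dimf_base_change:
  "dimf X (frag_extend (\<lambda>L. frag_of (base_change \<iota> L)) c) = dimf X c"
  by (rule K0_induct[where S = UNIV]) (auto simp: frag_extend_diff vdim_vec)

text \<open>\<open>comb\<close> and \<open>coords\<close> are mutually inverse isomorphisms between
  M and \<open>base_change id M\<close>. So \<open>class_fd\<close> is indeed the class of M,
  although the generators of the group are only the modules with values of type
  \<open>vec\<close>.\<close>

lemma base_change_id:
  fixes C :: "('k::field, 'o, 'm, 'e) extricat" and M :: "('k, 'o, 'm, 'v) tmod"
  assumes M: "T_module id C T M" and fd: "\<And>X. X \<in> T \<Longrightarrow> findim (mval M X)" and C: "lincat C" "T \<subseteq> Obj C"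
  shows "T_module id C T (base_change id M)"
    and "T_module_hom C T M (base_change id M) (\<lambda>X. coords (mval M X))"
    and "T_module_hom C T (base_change id M) M (\<lambda>X. comb (mval M X))"
    and "fd_module id C T M \<Longrightarrow> fd_module id C T (base_change id M)"
proof -
  note vs = TM_vs[OF M]
  have act: "mact (base_change id M) X Y f v \<in> mcar (base_change id M) X"
    if "X \<in> T" "Y \<in> T" "f \<in> Mor C X Y" "v \<in> mcar (base_change id M) Y" for X Y f v
    using that mult_mat_vec_carrier[OF mat_carrier] by (simp add: base_change_def module_vec_simps)
  have nat: "comb (mval M X) (mact (base_change id M) X Y f v) = mact M X Y f (comb (mval M Y) v)"
    if "X \<in> T" "Y \<in> T" "f \<in> Mor C X Y" "v \<in> mcar (base_change id M) Y" for X Y f v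
    using matrix_of_lin[OF TM_lin[OF M that(1-3)] fd[OF that(2)] fd[OF that(1)], of v] that(4)
    by (simp add: base_change_def module_vec_simps)
  have l: "lin (mval (base_change id M) X) (mval M X) (comb (mval M X))"
    "inj_on (comb (mval M X)) (mcar (base_change id M) X)" if "X \<in> T" for X
    using lin_comb_map[OF vs[OF that] fd[OF that]] comb_bij[OF vs[OF that] fd[OF that]]
    by (auto simp: bij_betw_def module_vec_simps)
  show T: "T_module id C T (base_change id M)"
    by (rule transport_T_module[OF M _ act l nat C]) (simp add: vspace_vec)
  show "T_module_hom C T (base_change id M) M (\<lambda>X. comb (mval M X))"
    using l nat by (simp add: T_module_hom_def)
  show "T_module_hom C T M (base_change id M) (\<lambda>X. coords (mval M X))"
    unfolding T_module_hom_def
  proof (intro conjI ballI)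
    fix X assume X: "X \<in> T"
    show "lin (mval M X) (mval (base_change id M) X) (coords (mval M X))"
      using coords_lin(1)[OF vs[OF X] fd[OF X]] by simp
    fix Y f v assume a: "Y \<in> T" "f \<in> Mor C X Y" "v \<in> mcar M Y"
    note cY = coords[OF vs[OF a(1)] fd[OF a(1)] a(3)]
    have c: "coords (mval M Y) v \<in> mcar (base_change id M) Y"
      using cY by (simp add: module_vec_simps)
    have "comb (mval M X) (mact (base_change id M) X Y f (coords (mval M Y) v)) = mact M X Y f v"
      using nat[OF X a(1,2) c] cY by simp
    then show "coords (mval M X) (mact M X Y f v) = mact (base_change id M) X Y f (coords (mval M Y) v)"
      using coords_lin(3)[OF vs[OF X] fd[OF X]] act[OF X a(1,2) c] by (metis base_change_simps module_vec_simps(3))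
  qed
  show "fd_module id C T (base_change id M)" if "fd_module id C T M"
    by (rule transport_fd[OF that T l])
qed

lemma vs_diffs:
  fixes V :: "('k::field, 'v) module"
  assumes V: "vspace V" and a: "a \<in> carrier V" "b \<in> carrier V" "c \<in> carrier V"
  shows "d \<in> carrier V \<Longrightarrow> (a \<oplus>\<^bsub>V\<^esub> b) \<ominus>\<^bsub>V\<^esub> (c \<oplus>\<^bsub>V\<^esub> d) = (a \<ominus>\<^bsub>V\<^esub> c) \<oplus>\<^bsub>V\<^esub> (b \<ominus>\<^bsub>V\<^esub> d)"
    "x \<odot>\<^bsub>V\<^esub> (a \<ominus>\<^bsub>V\<^esub> b) = x \<odot>\<^bsub>V\<^esub> a \<ominus>\<^bsub>V\<^esub> x \<odot>\<^bsub>V\<^esub> b"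
    "(a \<ominus>\<^bsub>V\<^esub> b) \<ominus>\<^bsub>V\<^esub> (a \<ominus>\<^bsub>V\<^esub> c) = c \<ominus>\<^bsub>V\<^esub> b"
proof -
  interpret abelian_group V by (rule vspace_abelian_group[OF V])
  show "d \<in> carrier V \<Longrightarrow> (a \<oplus>\<^bsub>V\<^esub> b) \<ominus>\<^bsub>V\<^esub> (c \<oplus>\<^bsub>V\<^esub> d) = (a \<ominus>\<^bsub>V\<^esub> c) \<oplus>\<^bsub>V\<^esub> (b \<ominus>\<^bsub>V\<^esub> d)"
    using a by (simp add: a_minus_def minus_add a_ac)
  have "x \<odot>\<^bsub>V\<^esub> (\<ominus>\<^bsub>V\<^esub> b) = \<ominus>\<^bsub>V\<^esub> (x \<odot>\<^bsub>V\<^esub> b)"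
    using vs_laws(7)[OF V] vs_smult_laws(2)[OF V a(2)] a vs_closed(5)[OF V]
    by (metis mult.commute)
  then show "x \<odot>\<^bsub>V\<^esub> (a \<ominus>\<^bsub>V\<^esub> b) = x \<odot>\<^bsub>V\<^esub> a \<ominus>\<^bsub>V\<^esub> x \<odot>\<^bsub>V\<^esub> b"
    using a vs_smult_laws(3)[OF V a(1), of "\<ominus>\<^bsub>V\<^esub> b"] by (simp add: a_minus_def)
  have "(a \<oplus>\<^bsub>V\<^esub> \<ominus>\<^bsub>V\<^esub> b) \<oplus>\<^bsub>V\<^esub> (\<ominus>\<^bsub>V\<^esub> a \<oplus>\<^bsub>V\<^esub> c) = (a \<oplus>\<^bsub>V\<^esub> \<ominus>\<^bsub>V\<^esub> a) \<oplus>\<^bsub>V\<^esub> (c \<oplus>\<^bsub>V\<^esub> \<ominus>\<^bsub>V\<^esub> b)"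
    using a by (simp add: a_ac)
  then show "(a \<ominus>\<^bsub>V\<^esub> b) \<ominus>\<^bsub>V\<^esub> (a \<ominus>\<^bsub>V\<^esub> c) = c \<ominus>\<^bsub>V\<^esub> b"
    using a by (simp add: a_minus_def minus_add r_neg)
qed

context clust
begin

lemma T_sub: "T \<subseteq> Obj C"
  using T_obj by blast

lemma Efun_simps [simp]: "mval (Efun C K) X = Ext C X K" "mact (Efun C K) X Y f \<delta> = Pull C X Y K f \<delta>"
  by (simp_all add: Efun_def)

lemma Efun_T_module:
  assumes "K \<in> Obj C" shows "T_module id C T (Efun C K)"
proof -
  have l: "lin (Ext C Y K) (Ext C X K) (mact (Efun C K) X Y f)" if a: "X \<in> T" "Y \<in> T" "f \<in> Mor C X Y" for X Y f
    using lin_cong[OF pull_lin(1)[OF T_obj[OF a(1)] T_obj[OF a(2)] assms a(3)]] by simp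
  have c: "Pull C X Z K (Comp C X Y Z g f) v = Pull C X Y K f (Pull C Y Z K g v)"
    if "X \<in> T" "Y \<in> T" "f \<in> Mor C X Y" "Z \<in> T" "g \<in> Mor C Y Z" "v \<in> Exts C Z K" for X Y Z f g v
    by (rule pull_comp) (use that assms in auto)
  have a: "Pull C X Y K (f \<oplus>\<^bsub>Hom C X Y\<^esub> g) v = Pull C X Y K f v \<oplus>\<^bsub>Ext C X K\<^esub> Pull C X Y K g v"
    if "X \<in> T" "Y \<in> T" "f \<in> Mor C X Y" "g \<in> Mor C X Y" "v \<in> Exts C Y K" for X Y f g v
    by (rule lin_add[OF pull_lin(2)]) (use that assms in auto)
  have s: "Pull C X Y K (c \<odot>\<^bsub>Hom C X Y\<^esub> f) v = c \<odot>\<^bsub>Ext C X K\<^esub> Pull C X Y K f v"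
    if "X \<in> T" "Y \<in> T" "f \<in> Mor C X Y" "v \<in> Exts C Y K" for X Y f c v
    by (rule lin_smult[OF pull_lin(2)]) (use that assms in auto)
  show ?thesis
    unfolding T_module_def using l c a s assms by simp
qed

subsection \<open>Simple modules\<close>

definition simple_object where
  "simple_object U = (SOME K. \<exists>\<delta>. simple_at U K \<delta>)"

lemma simple_objectE:
  assumes "U \<in> T" "local_endo C U" "U \<notin> projectives C"
  obtains \<delta> where "simple_at U (simple_object U) \<delta>"
proof -
  have "\<exists>K \<delta>. simple_at U K \<delta>"
    by (rule simple_ext[OF assms(1) local_indecomposable[OF assms(2)] assms(3)])
  then have "\<exists>\<delta>. simple_at U (simple_object U) \<delta>"
    unfolding simple_object_def by (rule someI_ex)
  then show thesis using that by blast
qed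

text \<open>A nonzero class over V is the pullback of the generator along some f: V -> U that is a
  split epimorphism, and between objects with local endomorphism rings such an f is
  invertible.\<close>

lemma simple_at_support:
  assumes s: "simple_at U K \<delta>" and U: "U \<in> T" "local_endo C U" and V: "V \<in> T" "local_endo C V"
    and nz: "Exts C V K \<noteq> {\<zero>\<^bsub>Ext C V K\<^esub>}"
  shows "isomorphic C V U"
proof -
  have K: "K \<in> Obj C" using s by (simp add: simple_at_def)
  obtain \<epsilon> where e: "\<epsilon> \<in> Exts C V K" "\<epsilon> \<noteq> \<zero>\<^bsub>Ext C V K\<^esub>"
    using nz ext_zero_in[of V K] V K T_obj by blast
  obtain f where f: "f \<in> Mor C V U" "\<epsilon> = Pull C V U K f \<delta>"
    using s V(1) e(1) unfolding simple_at_def by blast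
  then obtain h where "h \<in> Mor C U V" "iso_arrow C U U (Comp C U V U f h)"
    using s V(1) e(2) unfolding simple_at_def by blast
  then have "iso_arrow C V U f"
    using local_retract_iso[OF V(2) U(2) f(1)] by blast
  then show ?thesis using U V by (auto simp: isomorphic_def)
qed

lemma simple_at_nonzero:
  assumes s: "simple_at U K \<delta>" and U: "U \<in> T"
  shows "Exts C U K \<noteq> {\<zero>\<^bsub>Ext C U K\<^esub>}"
proof -
  have K: "K \<in> Obj C" "\<delta> \<in> Exts C U K" using s by (simp_all add: simple_at_def)
  have "iso_arrow C U U (Comp C U U U (Ident C U) (Ident C U))"
    using iso_id[of U] U by simp
  then have "Pull C U U K (Ident C U) \<delta> \<noteq> \<zero>\<^bsub>Ext C U K\<^esub>"
    using s U id_in[of U] T_obj[of U] unfolding simple_at_def by blast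
  then show ?thesis using K U by auto
qed

lemma simple_at_fd:
  assumes s: "simple_at U K \<delta>" and U: "U \<in> T" "local_endo C U"
  shows "fd_module id C T (Efun C K)"
proof -
  have K: "K \<in> Obj C" using s by (simp add: simple_at_def)
  show ?thesis
    unfolding fd_module_def
  proof (intro conjI ballI)
    show "T_module id C T (Efun C K)" by (rule Efun_T_module[OF K])
    show "mcar (Efun C K) X = {\<zero>\<^bsub>mval (Efun C K) X\<^esub>}" if "X \<in> T \<inter> projectives C" for X
      using that K by (simp add: projectives_def)
    show "findim (mval (Efun C K) X)" if "X \<in> T" for X
      using ext_findim K that by simp
    show "\<exists>J. finite J \<and> (\<forall>X\<in>T. indecomposable C X \<and> mcar (Efun C K) X \<noteq> {\<zero>\<^bsub>mval (Efun C K) X\<^esub>} \<longrightarrow>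
        (\<exists>Y\<in>J. isomorphic C X Y))"
      using simple_at_support[OF s U] ind_local by (intro exI[of _ "{U}"]) auto
  qed
qed

text \<open>A canonical choice in each isomorphism class: isomorphic objects define the same
  predicate, so \<open>SOME\<close> returns the same object for both.\<close>

definition rep where "rep U = (SOME V. isomorphic C U V)"

definition reps where "reps = {U \<in> T. local_endo C U \<and> U \<notin> projectives C \<and> rep U = U}"

lemma rep_iso: "U \<in> Obj C \<Longrightarrow> isomorphic C U (rep U)"
  unfolding rep_def using isomorphic_refl by (rule someI)

lemma rep_cong: "isomorphic C U V \<Longrightarrow> rep U = rep V"
proof -
  assume i: "isomorphic C U V"
  have e: "isomorphic C U W = isomorphic C V W" for W
    using isomorphic_trans[OF i, of W] isomorphic_trans[OF isomorphic_sym[OF i], of W] by blast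
  show ?thesis unfolding rep_def by (intro arg_cong[where f = Eps] HOL.ext) (rule e)
qed

lemma rep_rep: "U \<in> Obj C \<Longrightarrow> rep (rep U) = rep U"
  using rep_cong[OF rep_iso] by simp

abbreviation simple_mod where "simple_mod U \<equiv> base_change id (Efun C (simple_object U))"

lemma simple_mod_fd:
  assumes "U \<in> reps"
  shows "simple_mod U \<in> fd_modules id C T" "fd_module id C T (Efun C (simple_object U))"
    "simple_object U \<in> Obj C"
proof -
  have U: "U \<in> T" "local_endo C U" "U \<notin> projectives C" using assms by (auto simp: reps_def)
  obtain \<delta> where s: "simple_at U (simple_object U) \<delta>" using simple_objectE[OF U] .
  show fd: "fd_module id C T (Efun C (simple_object U))" by (rule simple_at_fd[OF s U(1,2)])
  then show "simple_mod U \<in> fd_modules id C T"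
    unfolding fd_modules_def
    using base_change_id(4)[OF fd_T_module[OF fd] fd_findim[OF fd] lincat_axioms T_sub] by simp
  show "simple_object U \<in> Obj C" using s by (simp add: simple_at_def)
qed

text \<open>The support of a simple module is a single isomorphism class, and distinct members of
  \<open>reps\<close> are not isomorphic.\<close>

lemma simple_mod_dim:
  assumes "U \<in> reps" "V \<in> reps"
  shows "vdim (mval (simple_mod V) U) = 0 \<longleftrightarrow> U \<noteq> V"
proof -
  have U: "U \<in> T" "local_endo C U" "rep U = U" using assms by (auto simp: reps_def)
  have V: "V \<in> T" "local_endo C V" "V \<notin> projectives C" "rep V = V" using assms by (auto simp: reps_def)
  obtain \<delta> where s: "simple_at V (simple_object V) \<delta>" using simple_objectE[OF V(1-3)] .
  have K: "simple_object V \<in> Obj C" using s by (simp add: simple_at_def)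
  have "vdim (mval (simple_mod V) U) = 0 \<longleftrightarrow> Exts C U (simple_object V) = {\<zero>\<^bsub>Ext C U (simple_object V)\<^esub>}"
    using vdim_zero_iff[OF ext_vs ext_findim] U K by (simp add: vdim_vec)
  also have "\<dots> \<longleftrightarrow> U \<noteq> V"
    using simple_at_support[OF s V(1,2) U(1,2)] simple_at_nonzero[OF s V(1)] rep_cong[of U V] U(3) V(4) by auto
  finally show ?thesis .
qed

subsection \<open>Finite length\<close>

text \<open>Acting by the two inverse isomorphisms in turn returns m; so if the image of m at Y lay
  in W, then m would lie in W as well.\<close>

lemma sub_transfer:
  assumes M: "T_module id C T M" and W: "T_submodule C T M W" "T_submodule C T M W'"
    and X: "X \<in> T" "m \<in> W' X" "m \<notin> W X" and g: "isomorphic C X Y"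
  shows "\<exists>m\<in>W' Y. m \<notin> W Y"
proof -
  obtain f g where fg: "f \<in> Mor C X Y" "g \<in> Mor C Y X" "Comp C X Y X g f = Ident C X"
    using isomorphicE[OF g] by metis
  have Y: "Y \<in> T" using T_iso[OF X(1) g] .
  have m: "m \<in> mcar M X"
    using W(2) X subspaceD(2) unfolding T_submodule_def by blast
  have "mact M X Y f (mact M Y X g m) = m"
    using TM_comp[OF M X(1) Y X(1) fg(1,2) m] fg(3) TM_id[OF M X(1) m] by simp
  moreover have "mact M X Y f v \<in> W X" if "v \<in> W Y" for v
    using W(1) X Y fg(1) that unfolding T_submodule_def by blast
  moreover have "mact M Y X g m \<in> W' Y"
    using W(2) X Y fg(2) unfolding T_submodule_def by blast
  ultimately show ?thesis using X(3) by force
qed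

text \<open>The element m is the sum of its images under the idempotents of a decomposition of X. If
  its components at all local summands lay in W, then so would m.\<close>

lemma sub_detect:
  assumes M: "T_module id C T M" and W: "T_submodule C T M W" "T_submodule C T M W'"
    and X: "X \<in> T" "m \<in> W' X" "m \<notin> W X"
  obtains Y v where "Y \<in> T" "local_endo C Y" "rep Y = Y" "v \<in> W' Y" "v \<notin> W Y"
proof -
  obtain Xs i p where b: "biproduct C Xs X i p" and Xs: "\<forall>Y\<in>set Xs. local_endo C Y \<and> Y \<in> T"
    using T_decomp[OF X(1)] by blast
  have sub: "subspace class_ring (W X) (mval M X)" using W X by (simp add: T_submodule_def)
  have m: "m \<in> mcar M X"
    using W(2) X subspaceD(2) unfolding T_submodule_def by blast
  have "\<exists>k<length Xs. mact M (Xs ! k) X (i k) m \<notin> W (Xs ! k)"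
  proof (rule ccontr)
    assume n: "\<not> ?thesis"
    have "mact M X X (Ident C X) m \<in> W X"
    proof (rule biproduct_lin[OF b _ sub])
      show "lin (Hom C X X) (mval M X) (\<lambda>f. mact M X X f m)"
        by (rule linI) (use X m TM_vs[OF M] TM_in[OF M] TM_add[OF M] TM_smult[OF M] in auto)
      fix k assume k: "k < length Xs"
      note d = biproductD[OF b k]
      have Xk: "Xs ! k \<in> T" using Xs k by simp
      have "mact M (Xs ! k) X (i k) m \<in> W (Xs ! k)" using n k by blast
      then have "mact M X (Xs ! k) (p k) (mact M (Xs ! k) X (i k) m) \<in> W X"
        using W(1) X(1) Xk d(4) unfolding T_submodule_def by blast
      then show "mact M X X (Comp C X (Xs ! k) X (i k) (p k)) m \<in> W X"
        using TM_comp[OF M X(1) Xk X(1) d(4) d(3) m] by simp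
    qed
    then show False using TM_id[OF M X(1) m] X(3) by simp
  qed
  then obtain k where k: "k < length Xs" "mact M (Xs ! k) X (i k) m \<notin> W (Xs ! k)" by blast
  let ?Y = "Xs ! k"
  have Y: "?Y \<in> T" "local_endo C ?Y" using Xs k by simp_all
  have "mact M ?Y X (i k) m \<in> W' ?Y"
    using W(2) X Y biproductD(3)[OF b k(1)] unfolding T_submodule_def by blast
  then obtain v where v: "v \<in> W' (rep ?Y)" "v \<notin> W (rep ?Y)"
    using sub_transfer[OF M W Y(1) _ k(2) rep_iso] Y by auto
  have i: "isomorphic C ?Y (rep ?Y)" using rep_iso Y by simp
  show thesis
    using that[OF T_iso[OF Y(1) i] local_iso[OF Y(2) i] rep_rep v] Y by simp
qed

lemma full_submodule: "T_module id C T M \<Longrightarrow> T_submodule C T M (mcar M)"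
  unfolding T_submodule_def
proof (intro conjI ballI)
  assume M: "T_module id C T M"
  show "subspace class_ring (mcar M X) (mval M X)" if "X \<in> T" for X
    by (rule subspaceI[OF TM_vs[OF M that]]) (use vs_closed[OF TM_vs[OF M that]] in auto)
  show "mact M X Y f ` mcar M Y \<subseteq> mcar M X" if "X \<in> T" "Y \<in> T" "f \<in> Mor C X Y" for X Y f
    using TM_in[OF M that] by blast
qed

definition supp :: "('f, 'o, 'm, 'v) tmod \<Rightarrow> 'o set" where
  "supp M = {U \<in> reps. mcar M U \<noteq> {\<zero>\<^bsub>mval M U\<^esub>}}"

lemma finite_supp:
  assumes "fd_module \<iota> C T M"
  shows "finite (supp M)"
proof -
  obtain J where J: "finite J" "\<forall>X\<in>T. indecomposable C X \<and> mcar M X \<noteq> {\<zero>\<^bsub>mval M X\<^esub>} \<longrightarrow> (\<exists>Y\<in>J. isomorphic C X Y)"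
    using assms unfolding fd_module_def by (elim exE conjE)
  have "supp M \<subseteq> rep ` J"
  proof
    fix U assume "U \<in> supp M"
    then have U: "U \<in> T" "local_endo C U" "rep U = U" "mcar M U \<noteq> {\<zero>\<^bsub>mval M U\<^esub>}"
      by (auto simp: supp_def reps_def)
    then obtain Y where "Y \<in> J" "isomorphic C U Y" using J(2) local_indecomposable by blast
    then show "U \<in> rep ` J" using U(3) rep_cong[of U Y] by auto
  qed
  then show ?thesis using J(1) finite_subset by blast
qed

text \<open>Total dimension over the finitely many representatives where M is nonzero. It plays the
  role of length: by \<open>dsum_strict\<close> it is strictly monotone on submodules of a
  finite-dimensional module.\<close>

definition dsum :: "('f::field, 'o, 'm, 'v) tmod \<Rightarrow> ('o \<Rightarrow> 'v set) \<Rightarrow> nat" where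
  "dsum M W = (\<Sum>U\<in>supp M. vdim (mval M U\<lparr>carrier := W U\<rparr>))"

context
  fixes M :: "('k, 'o, 'm, 'v) tmod"
  assumes M: "fd_module id C T M"
begin

private lemma TM: "T_module id C T M"
  by (rule fd_T_module[OF M])

lemma sub_detect_supp:
  assumes W: "T_submodule C T M W" "T_submodule C T M W'" and X: "X \<in> T" "m \<in> W' X" "m \<notin> W X"
  obtains Y v where "Y \<in> supp M" "v \<in> W' Y" "v \<notin> W Y"
proof -
  obtain Y v where Y: "Y \<in> T" "local_endo C Y" "rep Y = Y" "v \<in> W' Y" "v \<notin> W Y"
    using sub_detect[OF TM W X] .
  have "v \<in> mcar M Y"
    using W(2) Y subspaceD(2) unfolding T_submodule_def by blast
  moreover have "v \<noteq> \<zero>\<^bsub>mval M Y\<^esub>"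
    using W(1) Y subspaceD(3) unfolding T_submodule_def by blast
  ultimately have nz: "mcar M Y \<noteq> {\<zero>\<^bsub>mval M Y\<^esub>}" by blast
  then have "Y \<notin> projectives C" using M Y(1) by (auto simp: fd_module_def)
  then have "Y \<in> supp M" using Y nz by (simp add: supp_def reps_def)
  then show thesis using that Y by blast
qed

text \<open>A proper inclusion is visible at some representative in the support, and there the
  dimensions differ because a subspace of full dimension is the whole space.\<close>

lemma dsum_strict:
  assumes W: "T_submodule C T M W" "T_submodule C T M W'" and le: "\<And>X. X \<in> T \<Longrightarrow> W X \<subseteq> W' X"
    and X: "X \<in> T" "m \<in> W' X" "m \<notin> W X"
  shows "dsum M W < dsum M W'"
proof -
  obtain Y v where Y: "Y \<in> supp M" "v \<in> W' Y" "v \<notin> W Y"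
    using sub_detect_supp[OF W X] .
  have s: "subspace class_ring (W U) (mval M U\<lparr>carrier := W' U\<rparr>)" "findim (mval M U\<lparr>carrier := W' U\<rparr>)"
    if "U \<in> T" for U
  proof -
    have w: "subspace class_ring (W U) (mval M U)" "subspace class_ring (W' U) (mval M U)"
      using W that by (simp_all add: T_submodule_def)
    show "subspace class_ring (W U) (mval M U\<lparr>carrier := W' U\<rparr>)"
      by (rule subspaceI[OF subspace_vspace[OF w(2)]]) (use subspaceD[OF w(1)] le[OF that] in auto)
    show "findim (mval M U\<lparr>carrier := W' U\<rparr>)" by (rule findim_subspace[OF fd_findim[OF M that] w(2)])
  qed
  have T: "U \<in> T" if "U \<in> supp M" for U using that by (simp add: supp_def reps_def)
  have "vdim (mval M U\<lparr>carrier := W U\<rparr>) \<le> vdim (mval M U\<lparr>carrier := W' U\<rparr>)" if "U \<in> supp M" for U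
    using vdim_subspace_le[OF s(2,1)[OF T[OF that]]] by simp
  moreover have "vdim (mval M Y\<lparr>carrier := W Y\<rparr>) \<noteq> vdim (mval M Y\<lparr>carrier := W' Y\<rparr>)"
    using vdim_subspace_eq[OF s(2,1)[OF T[OF Y(1)]]] Y by auto
  ultimately show ?thesis
    unfolding dsum_def using Y(1) finite_supp[OF M] by (intro sum_strict_mono_ex1) (auto intro: le_neq_trans)
qed

text \<open>The image of the map Hom(-, Y) -> M that sends f to its action on w is the submodule
  generated by w; adding it to N gives \<open>N'\<close>.\<close>

lemma add_cyclic:
  assumes N: "T_submodule C T M N" and Y: "Y \<in> T" and w: "w \<in> mcar M Y"
  defines "N' \<equiv> \<lambda>X. {n \<oplus>\<^bsub>mval M X\<^esub> mact M X Y f w | n f. n \<in> N X \<and> f \<in> Mor C X Y}"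
  shows "T_submodule C T M N'" "\<And>X. X \<in> T \<Longrightarrow> N X \<subseteq> N' X" "w \<in> N' Y"
proof -
  have sN: "subspace class_ring (N X) (mval M X)" if "X \<in> T" for X using N that by (simp add: T_submodule_def)
  note v = TM_vs[OF TM] and s = subspaceD[OF sN] and ti = TM_in[OF TM _ Y _ w]
  have I: "n \<oplus>\<^bsub>mval M X\<^esub> mact M X Y f w \<in> N' X" if "n \<in> N X" "f \<in> Mor C X Y" for X n f
    unfolding N'_def using that by blast
  have E: "\<exists>n f. n \<in> N X \<and> f \<in> Mor C X Y \<and> x = n \<oplus>\<^bsub>mval M X\<^esub> mact M X Y f w" if "x \<in> N' X" for X x
    using that unfolding N'_def by blast
  have z: "mact M X Y \<zero>\<^bsub>Hom C X Y\<^esub> w = \<zero>\<^bsub>mval M X\<^esub>" if X: "X \<in> T" for X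
    using TM_smult[OF TM X Y zero_in w, of 0] X Y v[OF X] ti[OF X zero_in]
    by (simp add: vs_laws(5)[OF hom_vs] vs_laws(5)[OF v])
  show sub: "N X \<subseteq> N' X" if X: "X \<in> T" for X
  proof
    fix n assume n: "n \<in> N X"
    have "n \<oplus>\<^bsub>mval M X\<^esub> mact M X Y \<zero>\<^bsub>Hom C X Y\<^esub> w = n"
      using z[OF X] vs_laws(2)[OF v[OF X]] s(2)[OF X] n by auto
    then show "n \<in> N' X" using I[OF n zero_in] X Y by (metis T_obj)
  qed
  have "\<zero>\<^bsub>mval M Y\<^esub> \<oplus>\<^bsub>mval M Y\<^esub> mact M Y Y (Ident C Y) w = w"
    using TM_id[OF TM Y w] vs_laws(1)[OF v[OF Y] w] by simp
  then show "w \<in> N' Y" using I[OF s(3)[OF Y] id_in] Y by (metis T_obj)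
  show "T_submodule C T M N'"
    unfolding T_submodule_def
  proof (intro conjI ballI)
    fix X assume X: "X \<in> T"
    have in1: "n \<in> mcar M X" if "n \<in> N X" for n using s(2)[OF X] that by blast
    show "subspace class_ring (N' X) (mval M X)"
    proof (rule subspaceI[OF v[OF X]])
      show "N' X \<subseteq> mcar M X"
        unfolding N'_def using in1 ti[OF X] vs_closed(2)[OF v[OF X]] by auto
      show "\<zero>\<^bsub>mval M X\<^esub> \<in> N' X" using sub[OF X] s(3)[OF X] by blast
      fix x assume "x \<in> N' X"
      then obtain n f where x: "n \<in> N X" "f \<in> Mor C X Y" "x = n \<oplus>\<^bsub>mval M X\<^esub> mact M X Y f w" using E by blast
      have "c \<odot>\<^bsub>mval M X\<^esub> x = c \<odot>\<^bsub>mval M X\<^esub> n \<oplus>\<^bsub>mval M X\<^esub> mact M X Y (c \<odot>\<^bsub>Hom C X Y\<^esub> f) w" for c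
        using x in1 ti[OF X] TM_smult[OF TM X Y x(2) w] by (simp add: vs_smult_laws(3)[OF v[OF X]])
      then show "c \<odot>\<^bsub>mval M X\<^esub> x \<in> N' X" for c
        using I[OF s(5)[OF X x(1)] vs_closed(5)[OF hom_vs x(2)]] X Y by simp
      fix y assume "y \<in> N' X"
      then obtain n' f' where y: "n' \<in> N X" "f' \<in> Mor C X Y" "y = n' \<oplus>\<^bsub>mval M X\<^esub> mact M X Y f' w" using E by blast
      have "x \<oplus>\<^bsub>mval M X\<^esub> y = (n \<oplus>\<^bsub>mval M X\<^esub> n') \<oplus>\<^bsub>mval M X\<^esub> mact M X Y (f \<oplus>\<^bsub>Hom C X Y\<^esub> f') w"
      proof -
        interpret abelian_group "mval M X" by (rule vspace_abelian_group[OF v[OF X]])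
        show ?thesis
          unfolding x y TM_add[OF TM X Y x(2) y(2) w] using x y in1 ti[OF X] by (simp add: a_ac)
      qed
      then show "x \<oplus>\<^bsub>mval M X\<^esub> y \<in> N' X"
        using I[OF s(4)[OF X x(1) y(1)] add_in[OF _ _ x(2) y(2)]] X Y by simp
    qed
    fix X' f assume a: "X' \<in> T" "f \<in> Mor C X X'"
    show "mact M X X' f ` N' X' \<subseteq> N' X"
    proof
      fix x assume "x \<in> mact M X X' f ` N' X'"
      then obtain n g where x: "n \<in> N X'" "g \<in> Mor C X' Y" "x = mact M X X' f (n \<oplus>\<^bsub>mval M X'\<^esub> mact M X' Y g w)"
        using E by blast
      have nm: "n \<in> mcar M X'" using s(2)[OF a(1)] x(1) by blast
      have "x = mact M X X' f n \<oplus>\<^bsub>mval M X\<^esub> mact M X X' f (mact M X' Y g w)"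
        unfolding x by (rule lin_add[OF TM_lin[OF TM X a] nm ti[OF a(1) x(2)]])
      also have "mact M X X' f (mact M X' Y g w) = mact M X Y (Comp C X X' Y g f) w"
        by (rule TM_comp[OF TM X a(1) Y a(2) x(2) w, symmetric])
      finally have "x = mact M X X' f n \<oplus>\<^bsub>mval M X\<^esub> mact M X Y (Comp C X X' Y g f) w" .
      moreover have "mact M X X' f n \<in> N X"
        using N X a x(1) unfolding T_submodule_def by blast
      ultimately show "x \<in> N' X"
        using I[of _ X "Comp C X X' Y g f"] X a Y x by simp
    qed
  qed
qed

text \<open>N is a proper submodule of greatest total dimension. Adjoining any further element w to
  it yields all of M, which is the last conclusion.\<close>

lemma maximal_submodule:
  assumes nz: "X \<in> T" "mcar M X \<noteq> {\<zero>\<^bsub>mval M X\<^esub>}"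
  obtains N where "T_submodule C T M N" "\<exists>X\<in>T. \<exists>m\<in>mcar M X. m \<notin> N X"
    "\<And>Y w X m. Y \<in> T \<Longrightarrow> w \<in> mcar M Y \<Longrightarrow> w \<notin> N Y \<Longrightarrow> X \<in> T \<Longrightarrow> m \<in> mcar M X \<Longrightarrow>
      \<exists>n\<in>N X. \<exists>f\<in>Mor C X Y. m = n \<oplus>\<^bsub>mval M X\<^esub> mact M X Y f w"
proof -
  let ?P = "\<lambda>N. T_submodule C T M N \<and> (\<exists>X\<in>T. \<exists>m\<in>mcar M X. m \<notin> N X)"
  have full: "T_submodule C T M (mcar M)" by (rule full_submodule[OF TM])
  have bound: "dsum M N < dsum M (mcar M)" if P: "?P N" for N
  proof -
    obtain X m where X: "X \<in> T" "m \<in> mcar M X" "m \<notin> N X" using P by blast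
    have "N X \<subseteq> mcar M X" if "X \<in> T" for X
      using conjunct1[OF P] that subspaceD(2) unfolding T_submodule_def by blast
    then show ?thesis by (rule dsum_strict[OF conjunct1[OF P] full _ X])
  qed
  have P0: "?P (\<lambda>X. {\<zero>\<^bsub>mval M X\<^esub>})"
    using zero_submodule[OF M] nz vs_closed(1)[OF TM_vs[OF TM nz(1)]] by blast
  have "\<exists>N. ?P N \<and> (\<forall>N'. ?P N' \<longrightarrow> dsum M N' \<le> dsum M N)"
    by (rule ex_has_greatest_nat[where P = ?P and f = "dsum M" and b = "dsum M (mcar M)", OF P0])
      (intro allI impI less_imp_le bound)
  then obtain N where "?P N \<and> (\<forall>N'. ?P N' \<longrightarrow> dsum M N' \<le> dsum M N)" by (rule exE)
  then have N: "?P N" and Nmax: "\<forall>N'. ?P N' \<longrightarrow> dsum M N' \<le> dsum M N"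
    by (rule conjunct1, rule conjunct2)
  show thesis
  proof (rule that[of N])
    show "T_submodule C T M N" by (rule conjunct1[OF N])
    show "\<exists>X\<in>T. \<exists>m\<in>mcar M X. m \<notin> N X" by (rule conjunct2[OF N])
    fix Y w X m assume Y: "Y \<in> T" "w \<in> mcar M Y" "w \<notin> N Y" and X: "X \<in> T" "m \<in> mcar M X"
    define N' where "N' = (\<lambda>X. {n \<oplus>\<^bsub>mval M X\<^esub> mact M X Y f w | n f. n \<in> N X \<and> f \<in> Mor C X Y})"
    have N': "T_submodule C T M N'" "\<And>X. X \<in> T \<Longrightarrow> N X \<subseteq> N' X" "w \<in> N' Y"
      using add_cyclic[OF conjunct1[OF N] Y(1,2)] unfolding N'_def by blast+
    have "dsum M N < dsum M N'"
      by (rule dsum_strict[OF conjunct1[OF N] N'(1,2) Y(1) N'(3) Y(3)])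
    then have "\<not> ?P N'" using Nmax[rule_format, of N'] by linarith
    then have "m \<in> N' X" using N'(1) X by blast
    then show "\<exists>n\<in>N X. \<exists>f\<in>Mor C X Y. m = n \<oplus>\<^bsub>mval M X\<^esub> mact M X Y f w"
      unfolding N'_def by blast
  qed
qed

text \<open>For v in M(U) outside a maximal submodule N, every m is congruent modulo N to the action
  of some f on v. Sending m to the pullback of \<delta> along f identifies M/N with the simple
  module at U, once the annihilator of v modulo N is known to be that of \<delta>.\<close>

lemma simple_quotient:
  assumes nz: "X0 \<in> T" "mcar M X0 \<noteq> {\<zero>\<^bsub>mval M X0\<^esub>}"
  obtains U N where "U \<in> reps" "T_submodule C T M N" "\<exists>X\<in>T. \<exists>m\<in>mcar M X. m \<notin> N X"
    "short_exact C T (restrict_mod M N) M (simple_mod U)"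
proof -
  obtain N where N: "T_submodule C T M N" "\<exists>X\<in>T. \<exists>m\<in>mcar M X. m \<notin> N X"
    and mx: "\<And>Y w X m. Y \<in> T \<Longrightarrow> w \<in> mcar M Y \<Longrightarrow> w \<notin> N Y \<Longrightarrow> X \<in> T \<Longrightarrow> m \<in> mcar M X \<Longrightarrow>
      \<exists>n\<in>N X. \<exists>f\<in>Mor C X Y. m = n \<oplus>\<^bsub>mval M X\<^esub> mact M X Y f w"
    using maximal_submodule[OF nz] by metis
  have full: "T_submodule C T M (mcar M)" by (rule full_submodule[OF TM])
  obtain U v where Us: "U \<in> supp M" and v: "v \<in> mcar M U" "v \<notin> N U"
    using N(2) sub_detect_supp[OF N(1) full] by blast
  have UR: "U \<in> reps" using Us by (simp add: supp_def)
  have U: "U \<in> T" "local_endo C U" "U \<notin> projectives C" using UR by (auto simp: reps_def)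
  let ?K = "simple_object U"
  obtain \<delta> where sa: "simple_at U ?K \<delta>" using simple_objectE[OF U] .
  have K: "?K \<in> Obj C" "\<delta> \<in> Exts C U ?K"
    and Kgen: "\<And>V \<epsilon>. V \<in> T \<Longrightarrow> \<epsilon> \<in> Exts C V ?K \<Longrightarrow> \<exists>f\<in>Mor C V U. \<epsilon> = Pull C V U ?K f \<delta>"
    and Kz: "\<And>V f. V \<in> T \<Longrightarrow> f \<in> Mor C V U \<Longrightarrow> Pull C V U ?K f \<delta> = \<zero>\<^bsub>Ext C V ?K\<^esub> \<longleftrightarrow>
       (\<forall>h\<in>Mor C U V. \<not> iso_arrow C U U (Comp C U V U f h))"
    using sa by (simp_all add: simple_at_def)
  have sN: "subspace class_ring (N X) (mval M X)" if "X \<in> T" for X using N(1) that by (simp add: T_submodule_def)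
  have actN: "mact M X Y f n \<in> N X" if "X \<in> T" "Y \<in> T" "f \<in> Mor C X Y" "n \<in> N Y" for X Y f n
    using N(1) that unfolding T_submodule_def by blast
  note vs = TM_vs[OF TM] and s = subspaceD[OF sN] and ti = TM_in[OF TM]
  have iso_v: "mact M U U e v \<notin> N U" if e: "iso_arrow C U U e" for e
  proof
    assume ev: "mact M U U e v \<in> N U"
    obtain g where g: "g \<in> Mor C U U" "Comp C U U U e g = Ident C U" using isoE[OF e] by metis
    have "mact M U U g (mact M U U e v) = v"
      using TM_comp[OF TM U(1) U(1) U(1) g(1) iso_in[OF e] v(1)] g(2) TM_id[OF TM U(1) v(1)] by simp
    then show False using actN[OF U(1) U(1) g(1) ev] v(2) by simp
  qed
  have crit: "mact M X U f v \<in> N X \<longleftrightarrow> Pull C X U ?K f \<delta> = \<zero>\<^bsub>Ext C X ?K\<^esub>" if X: "X \<in> T" and f: "f \<in> Mor C X U" for X f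
  proof
    assume fv: "mact M X U f v \<in> N X"
    have "\<not> iso_arrow C U U (Comp C U X U f h)" if h: "h \<in> Mor C U X" for h
      using iso_v actN[OF U(1) X h fv] TM_comp[OF TM U(1) X U(1) h f v(1)] by metis
    then show "Pull C X U ?K f \<delta> = \<zero>\<^bsub>Ext C X ?K\<^esub>" using Kz[OF X f] by blast
  next
    assume z: "Pull C X U ?K f \<delta> = \<zero>\<^bsub>Ext C X ?K\<^esub>"
    show "mact M X U f v \<in> N X"
    proof (rule ccontr)
      assume fv: "mact M X U f v \<notin> N X"
      obtain n h where n: "n \<in> N U" and h: "h \<in> Mor C U X" and e: "v = n \<oplus>\<^bsub>mval M U\<^esub> mact M U X h (mact M X U f v)"
        using mx[OF X ti[OF X U(1) f v(1)] fv U(1) v(1)] by blast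
      have ni: "\<not> iso_arrow C U U (Comp C U X U f h)" using z Kz[OF X f] h by blast
      have fh: "Comp C U X U f h \<in> Mor C U U" using U X f h by simp
      \<comment> \<open>Acting on v, the endomorphism 1 - fh gives n, an element of N. As fh is not
        invertible, 1 - fh is, so v itself would lie in N.\<close>
      have i: "iso_arrow C U U (Ident C U \<ominus>\<^bsub>Hom C U U\<^esub> Comp C U X U f h)"
        by (rule local_complement[OF U(2) fh ni])
      have l: "lin (Hom C U U) (mval M U) (\<lambda>f. mact M U U f v)"
        by (rule linI) (use U v ti vs TM_add[OF TM] TM_smult[OF TM] in auto)
      have "mact M U U (Ident C U \<ominus>\<^bsub>Hom C U U\<^esub> Comp C U X U f h) v = v \<ominus>\<^bsub>mval M U\<^esub> mact M U X h (mact M X U f v)"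
        using lin_minus[OF l id_in fh] U v TM_id[OF TM U(1) v(1)] TM_comp[OF TM U(1) X U(1) h f v(1)] by simp
      also have "\<dots> = n"
        using e vs_laws(10)[OF vs[OF U(1)], of n "mact M U X h (mact M X U f v)"] s(2)[OF U(1)] n
          ti[OF U(1) X h ti[OF X U(1) f v(1)]] by auto
      finally show False using iso_v[OF i] n by simp
    qed
  qed
  define g where "g X m = Pull C X U ?K (SOME f. f \<in> Mor C X U \<and> m \<ominus>\<^bsub>mval M X\<^esub> mact M X U f v \<in> N X) \<delta>" for X m
  have ex: "\<exists>f. f \<in> Mor C X U \<and> m \<ominus>\<^bsub>mval M X\<^esub> mact M X U f v \<in> N X" if X: "X \<in> T" and m: "m \<in> mcar M X" for X m
  proof -
    obtain n f where n: "n \<in> N X" and f: "f \<in> Mor C X U" and e: "m = n \<oplus>\<^bsub>mval M X\<^esub> mact M X U f v"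
      using mx[OF U(1) v X m] by blast
    have "m \<ominus>\<^bsub>mval M X\<^esub> mact M X U f v = n"
      unfolding e by (rule vs_laws(10)[OF vs[OF X]]) (use s(2)[OF X] n ti[OF X U(1) f v(1)] in auto)
    then show ?thesis using n f by auto
  qed
  have geq: "g X m = Pull C X U ?K f \<delta>"
    if X: "X \<in> T" and m: "m \<in> mcar M X" and f: "f \<in> Mor C X U" "m \<ominus>\<^bsub>mval M X\<^esub> mact M X U f v \<in> N X" for X m f
  proof -
    define f' where "f' = (SOME f. f \<in> Mor C X U \<and> m \<ominus>\<^bsub>mval M X\<^esub> mact M X U f v \<in> N X)"
    have f': "f' \<in> Mor C X U" "m \<ominus>\<^bsub>mval M X\<^esub> mact M X U f' v \<in> N X"
      unfolding f'_def using someI_ex[OF ex[OF X m]] by blast+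
    have l: "lin (Hom C X U) (mval M X) (\<lambda>f. mact M X U f v)"
      by (rule linI) (use U X v ti vs TM_add[OF TM] TM_smult[OF TM] in auto)
    \<comment> \<open>Two choices f and f' for m differ by a map that sends v into N and hence
      annihilates \<delta>; the value at m does not depend on the choice.\<close>
    have "mact M X U (f' \<ominus>\<^bsub>Hom C X U\<^esub> f) v = mact M X U f' v \<ominus>\<^bsub>mval M X\<^esub> mact M X U f v"
      by (rule lin_minus[OF l f'(1) f(1)])
    also have "\<dots> = (m \<ominus>\<^bsub>mval M X\<^esub> mact M X U f v) \<ominus>\<^bsub>mval M X\<^esub> (m \<ominus>\<^bsub>mval M X\<^esub> mact M X U f' v)"
      by (rule vs_diffs(3)[OF vs[OF X] m, symmetric]) (use ti[OF X U(1) _ v(1)] f f' in auto)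
    also have "\<dots> \<in> N X" by (rule s(6)[OF X f(2) f'(2)])
    finally have "Pull C X U ?K (f' \<ominus>\<^bsub>Hom C X U\<^esub> f) \<delta> = \<zero>\<^bsub>Ext C X ?K\<^esub>"
      using crit[OF X, of "f' \<ominus>\<^bsub>Hom C X U\<^esub> f"] f f' X U by simp
    moreover have "Pull C X U ?K (f' \<ominus>\<^bsub>Hom C X U\<^esub> f) \<delta> = Pull C X U ?K f' \<delta> \<ominus>\<^bsub>Ext C X ?K\<^esub> Pull C X U ?K f \<delta>"
      by (rule lin_minus[OF pull_lin(2)]) (use X U K f f' in auto)
    ultimately have "Pull C X U ?K f' \<delta> = Pull C X U ?K f \<delta>"
      using vs_laws(12)[OF ext_vs] X U K f f' by simp
    then show ?thesis unfolding g_def f'_def[symmetric] .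
  qed
  have glin: "lin (mval M X) (Ext C X ?K) (g X)" if X: "X \<in> T" for X
  proof (rule linI[OF vs[OF X] ext_vs[OF T_obj[OF X] K(1)]])
    fix m assume m: "m \<in> mcar M X"
    obtain f where f: "f \<in> Mor C X U" "m \<ominus>\<^bsub>mval M X\<^esub> mact M X U f v \<in> N X" using ex[OF X m] by blast
    note tf = ti[OF X U(1) f(1) v(1)]
    show "g X m \<in> Exts C X ?K" using geq[OF X m f] X U K f by simp
    have "c \<odot>\<^bsub>mval M X\<^esub> m \<ominus>\<^bsub>mval M X\<^esub> mact M X U (c \<odot>\<^bsub>Hom C X U\<^esub> f) v = c \<odot>\<^bsub>mval M X\<^esub> (m \<ominus>\<^bsub>mval M X\<^esub> mact M X U f v)" for c
      using TM_smult[OF TM X U(1) f(1) v(1)] vs_diffs(2)[OF vs[OF X] m tf tf] by simp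
    then have "g X (c \<odot>\<^bsub>mval M X\<^esub> m) = Pull C X U ?K (c \<odot>\<^bsub>Hom C X U\<^esub> f) \<delta>" for c
      using geq[OF X vs_closed(5)[OF vs[OF X] m] vs_closed(5)[OF hom_vs f(1)]] s(5)[OF X f(2)] X U by simp
    then show "g X (c \<odot>\<^bsub>mval M X\<^esub> m) = c \<odot>\<^bsub>Ext C X ?K\<^esub> g X m" for c
      using geq[OF X m f] lin_smult[OF pull_lin(2)[OF T_obj[OF X] T_obj[OF U(1)] K] f(1)] by simp
    fix m' assume m': "m' \<in> mcar M X"
    obtain f' where f': "f' \<in> Mor C X U" "m' \<ominus>\<^bsub>mval M X\<^esub> mact M X U f' v \<in> N X" using ex[OF X m'] by blast
    have "(m \<oplus>\<^bsub>mval M X\<^esub> m') \<ominus>\<^bsub>mval M X\<^esub> mact M X U (f \<oplus>\<^bsub>Hom C X U\<^esub> f') v =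
        (m \<ominus>\<^bsub>mval M X\<^esub> mact M X U f v) \<oplus>\<^bsub>mval M X\<^esub> (m' \<ominus>\<^bsub>mval M X\<^esub> mact M X U f' v)"
      using TM_add[OF TM X U(1) f(1) f'(1) v(1)] vs_diffs(1)[OF vs[OF X] m m' tf ti[OF X U(1) f'(1) v(1)]] by simp
    then have "g X (m \<oplus>\<^bsub>mval M X\<^esub> m') = Pull C X U ?K (f \<oplus>\<^bsub>Hom C X U\<^esub> f') \<delta>"
      using geq[OF X vs_closed(2)[OF vs[OF X] m m'] add_in[OF _ _ f(1) f'(1)]] s(4)[OF X f(2) f'(2)] X U by simp
    then show "g X (m \<oplus>\<^bsub>mval M X\<^esub> m') = g X m \<oplus>\<^bsub>Ext C X ?K\<^esub> g X m'"
      using geq[OF X m f] geq[OF X m' f'] lin_add[OF pull_lin(2)[OF T_obj[OF X] T_obj[OF U(1)] K] f(1) f'(1)] by simp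
  qed
  have gsurj: "g X ` mcar M X = Exts C X ?K" if X: "X \<in> T" for X
  proof
    show "g X ` mcar M X \<subseteq> Exts C X ?K" using lin_closed[OF glin[OF X]] by blast
    show "Exts C X ?K \<subseteq> g X ` mcar M X"
    proof
      fix \<epsilon> assume "\<epsilon> \<in> Exts C X ?K"
      then obtain f where f: "f \<in> Mor C X U" "\<epsilon> = Pull C X U ?K f \<delta>" using Kgen[OF X] by blast
      note tf = ti[OF X U(1) f(1) v(1)]
      have "g X (mact M X U f v) = \<epsilon>"
        using geq[OF X tf f(1)] f(2) vs_laws(3)[OF vs[OF X] tf] s(3)[OF X] by simp
      then show "\<epsilon> \<in> g X ` mcar M X" using tf by blast
    qed
  qed
  have gker: "g X m = \<zero>\<^bsub>Ext C X ?K\<^esub> \<longleftrightarrow> m \<in> N X" if X: "X \<in> T" and m: "m \<in> mcar M X" for X m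
  proof -
    obtain f where f: "f \<in> Mor C X U" "m \<ominus>\<^bsub>mval M X\<^esub> mact M X U f v \<in> N X" using ex[OF X m] by blast
    note tf = ti[OF X U(1) f(1) v(1)]
    have "mact M X U f v \<in> N X \<longleftrightarrow> m \<in> N X"
    proof
      assume "mact M X U f v \<in> N X"
      from s(4)[OF X f(2) this] show "m \<in> N X" using vs_laws(8)[OF vs[OF X] m tf] by simp
    next
      assume "m \<in> N X"
      from s(6)[OF X this f(2)] show "mact M X U f v \<in> N X"
        using vs_diffs(3)[OF vs[OF X] m vs_closed(1)[OF vs[OF X]] tf] vs_laws(4)[OF vs[OF X]] m tf by simp
    qed
    then show ?thesis using geq[OF X m f] crit[OF X f(1)] by simp
  qed
  have gnat: "g X (mact M X Y a m) = Pull C X Y ?K a (g Y m)"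
    if X: "X \<in> T" and Y: "Y \<in> T" and a: "a \<in> Mor C X Y" and m: "m \<in> mcar M Y" for X Y a m
  proof -
    obtain f where f: "f \<in> Mor C Y U" "m \<ominus>\<^bsub>mval M Y\<^esub> mact M Y U f v \<in> N Y" using ex[OF Y m] by blast
    note tf = ti[OF Y U(1) f(1) v(1)]
    have fa: "Comp C X Y U f a \<in> Mor C X U" using X Y U f a by simp
    have "mact M X Y a m \<ominus>\<^bsub>mval M X\<^esub> mact M X U (Comp C X Y U f a) v = mact M X Y a (m \<ominus>\<^bsub>mval M Y\<^esub> mact M Y U f v)"
      using TM_comp[OF TM X Y U(1) a f(1) v(1)] lin_minus[OF TM_lin[OF TM X Y a] m tf] by simp
    then have "g X (mact M X Y a m) = Pull C X U ?K (Comp C X Y U f a) \<delta>"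
      using geq[OF X ti[OF X Y a m] fa] actN[OF X Y a f(2)] by simp
    also have "\<dots> = Pull C X Y ?K a (Pull C Y U ?K f \<delta>)"
      by (rule pull_comp) (use X Y U K a f in auto)
    finally show ?thesis using geq[OF Y m f] by simp
  qed
  note fdE = simple_mod_fd(2)[OF UR]
  note bc = base_change_id[OF fd_T_module[OF fdE] fd_findim[OF fdE] lincat_axioms T_sub]
  let ?co = "\<lambda>X. coords (Ext C X ?K)"
  have colin: "lin (Ext C X ?K) (mval (simple_mod U) X) (?co X)"
    and cobij: "bij_betw (?co X) (Exts C X ?K) (mcar (simple_mod U) X)" if "X \<in> T" for X
    using coords_lin(1,2)[OF ext_vs[OF T_obj[OF that] K(1)] ext_findim[OF T_obj[OF that] K(1)]]
    by (simp_all add: module_vec_simps)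
  have hom: "T_module_hom C T M (simple_mod U) (\<lambda>X m. ?co X (g X m))"
    unfolding T_module_hom_def
  proof (intro conjI ballI)
    fix X assume X: "X \<in> T"
    show "lin (mval M X) (mval (simple_mod U) X) (\<lambda>m. ?co X (g X m))"
      by (rule lin_comp[OF glin[OF X] colin[OF X]])
    fix Y f m assume a: "Y \<in> T" "f \<in> Mor C X Y" "m \<in> mcar M Y"
    show "?co X (g X (mact M X Y f m)) = mact (simple_mod U) X Y f (?co Y (g Y m))"
      using bc(2) X a gnat[OF X a] lin_closed[OF glin[OF a(1)] a(3)] by (simp add: T_module_hom_def)
  qed
  have inc: "T_module_hom C T (restrict_mod M N) M (\<lambda>X m. m)"
    unfolding T_module_hom_def
  proof (intro conjI ballI)
    fix X assume X: "X \<in> T"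
    show "lin (mval (restrict_mod M N) X) (mval M X) (\<lambda>m. m)"
      by (rule linI) (use vs[OF X] subspace_vspace[OF sN[OF X]] s(2)[OF X] in auto)
  qed simp
  have "short_exact C T (restrict_mod M N) M (simple_mod U)"
    unfolding short_exact_def
  proof (intro exI conjI ballI)
    show "T_module_hom C T (restrict_mod M N) M (\<lambda>X m. m)" by (rule inc)
    show "T_module_hom C T M (simple_mod U) (\<lambda>X m. ?co X (g X m))" by (rule hom)
    fix X assume X: "X \<in> T"
    show "inj_on (\<lambda>m. m) (mcar (restrict_mod M N) X)" by simp
    show "(\<lambda>m. ?co X (g X m)) ` mcar M X = mcar (simple_mod U) X"
      using gsurj[OF X] cobij[OF X] unfolding bij_betw_def by (metis image_image)
    have "?co X (g X m) = \<zero>\<^bsub>mval (simple_mod U) X\<^esub> \<longleftrightarrow> g X m = \<zero>\<^bsub>Ext C X ?K\<^esub>" if "m \<in> mcar M X" for m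
      using bij_betw_imp_inj_on[OF cobij[OF X]] lin_zero[OF colin[OF X]] lin_closed[OF glin[OF X] that]
        ext_zero_in[OF T_obj[OF X] K(1)] by (metis inj_onD)
    then show "(\<lambda>m. m) ` mcar (restrict_mod M N) X = {m \<in> mcar M X. ?co X (g X m) = \<zero>\<^bsub>mval (simple_mod U) X\<^esub>}"
      using gker[OF X] s(2)[OF X] by auto
  qed
  then show thesis using that[OF UR N] by blast
qed

end

end

context clust
begin

subsection \<open>Classes of finite-dimensional modules\<close>

abbreviation simple_sum where "simple_sum n \<equiv> frag_extend (\<lambda>U. frag_of (simple_mod U)) n"

abbreviation fd_rel where "fd_rel \<equiv> K0_rel (fd_modules id C T) (fd_exact_seqs id C T)"

text \<open>A nonzero module has some \<open>simple_mod U\<close> as a quotient, and the kernel has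
  smaller total dimension, so induction applies.\<close>

lemma generation:
  assumes "M \<in> fd_modules id C T"
  shows "\<exists>n. Poly_Mapping.keys n \<subseteq> reps \<and> frag_of M - simple_sum n \<in> fd_rel"
  using assms
proof (induction "dsum M (mcar M)" arbitrary: M rule: less_induct)
  case less
  have M: "fd_module id C T M" using less.prems by (simp add: fd_modules_def)
  note TM = fd_T_module[OF M]
  note cl = K0_rel_closed[OF fd_seqs_sub[of id C T]]
  show ?case
  proof (cases "\<exists>X\<in>T. mcar M X \<noteq> {\<zero>\<^bsub>mval M X\<^esub>}")
    case False
    have id: "T_module_hom C T M M (\<lambda>X v. v)"
      unfolding T_module_hom_def using TM_vs[OF TM] by (auto intro!: linI simp: vs_closed)
    \<comment> \<open>All values of M are zero, so M -> M -> M is exact and -[M] is a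
      relation.\<close>
    have "short_exact C T M M M"
      unfolding short_exact_def
      by (intro exI[of _ "\<lambda>X v. v"] conjI ballI id) (use False in auto)
    then have "frag_of M - frag_of M - frag_of M \<in> fd_rel"
      using less.prems by (intro cl(5)) (simp add: fd_exact_seqs_def)
    then have "frag_of M \<in> fd_rel" using cl(3) by fastforce
    then show ?thesis by (intro exI[of _ 0]) simp
  next
    case True
    then obtain X0 where X0: "X0 \<in> T" "mcar M X0 \<noteq> {\<zero>\<^bsub>mval M X0\<^esub>}" by blast
    obtain U N where U: "U \<in> reps" and N: "T_submodule C T M N" "\<exists>X\<in>T. \<exists>m\<in>mcar M X. m \<notin> N X"
      and se: "short_exact C T (restrict_mod M N) M (simple_mod U)"
      using simple_quotient[OF M X0] .
    let ?L = "restrict_mod M N"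
    have L: "?L \<in> fd_modules id C T"
      unfolding fd_modules_def using restrict_fd[OF M N(1)] by simp
    have NM: "N X \<subseteq> mcar M X" "\<zero>\<^bsub>mval M X\<^esub> \<in> N X" if "X \<in> T" for X
      using N(1) that subspaceD(2,3) unfolding T_submodule_def by blast+
    obtain X m where X: "X \<in> T" "m \<in> mcar M X" "m \<notin> N X" using N(2) by blast
    have rT: "U \<in> T" if "U \<in> reps" for U using that by (simp add: reps_def)
    have sub: "supp ?L \<subseteq> supp M"
      using NM rT unfolding supp_def by fastforce
    \<comment> \<open>As a module of its own, the submodule is measured over its own support, which
      may be smaller than that of M.\<close>
    have "dsum ?L (mcar ?L) = (\<Sum>U\<in>supp ?L. vdim (mval M U\<lparr>carrier := N U\<rparr>))"
      by (simp add: dsum_def)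
    also have "\<dots> \<le> dsum M N"
      unfolding dsum_def by (rule sum_mono2[OF finite_supp[OF M] sub]) simp
    also have "\<dots> < dsum M (mcar M)"
      by (rule dsum_strict[OF M N(1) full_submodule[OF TM] NM(1) X])
    finally obtain n where n: "Poly_Mapping.keys n \<subseteq> reps" "frag_of ?L - simple_sum n \<in> fd_rel"
      using less.hyps[OF _ L] by blast
    have "frag_of M - frag_of ?L - frag_of (simple_mod U) \<in> fd_rel"
      using less.prems L simple_mod_fd(1)[OF U] se by (intro cl(5)) (simp add: fd_exact_seqs_def)
    from cl(2)[OF this n(2)]
    have "frag_of M - simple_sum (n + frag_of U) \<in> fd_rel"
      by (simp add: frag_extend_add algebra_simps)
    moreover have "Poly_Mapping.keys (n + frag_of U) \<subseteq> reps"
      using Poly_Mapping.keys_add[of n "frag_of U"] n(1) U by auto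
    ultimately show ?thesis by blast
  qed
qed

lemma generation_frag:
  assumes "Poly_Mapping.keys c \<subseteq> fd_modules id C T"
  shows "\<exists>n. Poly_Mapping.keys n \<subseteq> reps \<and> c - simple_sum n \<in> fd_rel"
  using assms
proof (induction c rule: K0_induct[consumes 1, case_names zero single diff])
  case zero
  then show ?case
    using K0_rel_closed(1)[OF fd_seqs_sub] by (intro exI[of _ 0]) simp
next
  case (single M)
  then show ?case by (rule generation)
next
  case (diff a b)
  then obtain n m where n: "Poly_Mapping.keys n \<subseteq> reps" "a - simple_sum n \<in> fd_rel"
    and m: "Poly_Mapping.keys m \<subseteq> reps" "b - simple_sum m \<in> fd_rel" by blast
  have "(a - b) - simple_sum (n - m) \<in> fd_rel"
    using K0_rel_closed(4)[OF fd_seqs_sub n(2) m(2)] by (simp add: frag_extend_diff algebra_simps)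
  moreover have "Poly_Mapping.keys (n - m) \<subseteq> reps" using keys_diff[of n m] n m by blast
  ultimately show ?case by blast
qed

text \<open>The matrix of dimensions of the simple modules is diagonal. Its entries need not be 1,
  since the endomorphism ring of a simple module may be larger than the ground field.\<close>

lemma dimf_simple_sum:
  assumes U: "U \<in> reps" and n: "Poly_Mapping.keys n \<subseteq> reps"
  shows "dimf U (simple_sum n) = Poly_Mapping.lookup n U * int (vdim (mval (simple_mod U) U))"
  using n
proof (induction n rule: K0_induct[consumes 1, case_names zero single diff])
  case (single V)
  have 1: "dimf U (simple_sum (frag_of V)) = int (vdim (mval (simple_mod V) U))"
    by (simp only: frag_extend_of dimf_simps(2))
  show ?case
  proof (cases "U = V")
    case True
    then show ?thesis unfolding 1 by (simp only: lookup_single when_def True) simp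
  next
    case False
    then have "vdim (mval (simple_mod V) U) = 0" using simple_mod_dim[OF U single] by blast
    then show ?thesis unfolding 1 using False by (simp only: lookup_single when_def) simp
  qed
next
  case (diff a b)
  then show ?case by (simp add: frag_extend_diff lookup_minus left_diff_distrib)
qed simp

text \<open>Modulo relations, c is a combination of simple modules, and its dimension at U is the
  coefficient at U times a positive integer. So bounded dimensions bound the coefficients, and the
  coefficients vanish off J.\<close>

lemma finite_classes:
  assumes J: "finite J"
  shows "finite (K0fd_coset id C T ` {c. Poly_Mapping.keys c \<subseteq> fd_modules id C T \<and>
    (\<forall>U\<in>reps - J. dimf U c = 0) \<and> (\<forall>U\<in>reps \<inter> J. 0 \<le> dimf U c \<and> dimf U c \<le> b U)})"
    (is "finite (?co ` ?S)")
proof -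
  let ?N = "{n. Poly_Mapping.keys n \<subseteq> reps \<inter> J \<and> (\<forall>U\<in>reps \<inter> J. Poly_Mapping.lookup n U \<in> {0..b U})}"
  have "finite ?N"
  proof (rule finite_imageD)
    have "(\<lambda>n. restrict (Poly_Mapping.lookup n) (reps \<inter> J)) ` ?N \<subseteq> (\<Pi>\<^sub>E U\<in>reps \<inter> J. {0..b U})"
      by (rule image_subsetI) (simp add: restrict_PiE_iff)
    moreover have "finite (\<Pi>\<^sub>E U\<in>reps \<inter> J. {0..b U})"
      using J by (intro finite_PiE) auto
    ultimately show "finite ((\<lambda>n. restrict (Poly_Mapping.lookup n) (reps \<inter> J)) ` ?N)"
      by (rule finite_subset)
    show "inj_on (\<lambda>n. restrict (Poly_Mapping.lookup n) (reps \<inter> J)) ?N"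
    proof (rule inj_onI, rule poly_mapping_eqI)
      fix n m U assume n: "n \<in> ?N" and m: "m \<in> ?N"
        and e: "restrict (Poly_Mapping.lookup n) (reps \<inter> J) = restrict (Poly_Mapping.lookup m) (reps \<inter> J)"
      show "Poly_Mapping.lookup n U = Poly_Mapping.lookup m U"
      proof (cases "U \<in> reps \<inter> J")
        case True
        then show ?thesis using fun_cong[OF e, of U] by simp
      next
        case False
        then have "U \<notin> Poly_Mapping.keys n" "U \<notin> Poly_Mapping.keys m" using n m by blast+
        then show ?thesis by (simp add: in_keys_iff)
      qed
    qed
  qed
  note fin = this
  have sub: "?co ` ?S \<subseteq> (\<lambda>n. ?co (simple_sum n)) ` ?N"
  proof
    fix \<xi> assume "\<xi> \<in> ?co ` ?S"
    then obtain c where c: "\<xi> = ?co c" and cS: "c \<in> ?S" by (rule imageE)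
    from cS have ck: "Poly_Mapping.keys c \<subseteq> fd_modules id C T" and c0: "\<forall>U\<in>reps - J. dimf U c = 0"
      and cb: "\<forall>U\<in>reps \<inter> J. 0 \<le> dimf U c \<and> dimf U c \<le> b U"
      by (auto simp only: mem_Collect_eq)
    obtain n where n: "Poly_Mapping.keys n \<subseteq> reps" "c - simple_sum n \<in> fd_rel"
      using generation_frag[OF ck] by blast
    define d where "d U = int (vdim (mval (simple_mod U) U))" for U
    have dc: "dimf U c = Poly_Mapping.lookup n U * d U" and dpos: "d U > 0" if U: "U \<in> reps" for U
    proof -
      have "dimf U (c - simple_sum n) = 0" using dimf_rel[OF n(2)] U by (simp add: reps_def)
      then have "dimf U c = dimf U (simple_sum n)" by (simp only: dimf_simps(5) right_minus_eq)
      then show "dimf U c = Poly_Mapping.lookup n U * d U"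
        unfolding d_def dimf_simple_sum[OF U n(1)] .
      have "vdim (mval (simple_mod U) U) \<noteq> 0" using simple_mod_dim[OF U U] by blast
      then show "d U > 0" unfolding d_def by linarith
    qed
    have "Poly_Mapping.keys n \<subseteq> reps \<inter> J"
    proof
      fix U assume U: "U \<in> Poly_Mapping.keys n"
      then have "U \<in> reps" "Poly_Mapping.lookup n U \<noteq> 0" using n(1) by (auto simp: in_keys_iff)
      then have "dimf U c \<noteq> 0" using dc[of U] dpos[of U] by simp
      then show "U \<in> reps \<inter> J" using c0 \<open>U \<in> reps\<close> by blast
    qed
    moreover have "Poly_Mapping.lookup n U \<in> {0..b U}" if U: "U \<in> reps \<inter> J" for U
    proof -
      have e: "dimf U c = Poly_Mapping.lookup n U * d U" and p: "d U > 0" using dc[of U] dpos[of U] U by blast+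
      have r: "0 \<le> dimf U c" "dimf U c \<le> b U" using cb U by blast+
      have z: "0 \<le> Poly_Mapping.lookup n U"
        using r(1) p unfolding e by (simp add: zero_le_mult_iff)
      have "Poly_Mapping.lookup n U * 1 \<le> Poly_Mapping.lookup n U * d U"
        using p z by (intro mult_left_mono) auto
      then show ?thesis using r(2) z unfolding e by simp
    qed
    ultimately have "n \<in> ?N" by blast
    moreover have "\<xi> = ?co (simple_sum n)"
      unfolding c K0_coset_eq[OF fd_seqs_sub] by (rule n(2))
    ultimately show "\<xi> \<in> (\<lambda>n. ?co (simple_sum n)) ` ?N" by (intro image_eqI)
  qed
  show ?thesis by (rule finite_subset[OF sub finite_imageI[OF fin]])
qed

end

section \<open>Partial stabilisation\<close>

locale clustP = clust C T for C :: "('k::field, 'o, 'm, 'e) extricat" and T :: "'o set" +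
  fixes P :: "'o set"
  assumes Pac: "additively_closed C P" and Ppi: "P \<subseteq> projectives C \<inter> injectives C"

sublocale clustP \<subseteq> quot C P
proof
  have ac: "add_closure C P = P" and PO: "P \<subseteq> Obj C" using Pac by (simp_all add: additively_closed_def)
  have I: "X \<in> P" if "set Xs \<subseteq> P" "direct_sum_of C Xs Z" "direct_sum_of C [X, Y] Z" for X Xs Y Z
  proof -
    have "X \<in> add_closure C P"
      unfolding add_closure_def by (intro CollectI exI conjI) (rule that)+
    then show ?thesis using ac by simp
  qed
  \<comment> \<open>The zero object is the sum of the empty list, so it lies in every additively
    closed class; this makes P nonempty.\<close>
  obtain Z where Z: "zero_object C Z" using zero_ex by blast
  have "direct_sum_of C [Z, Z] Z"
    by (rule iso_direct_sum_zero[OF isomorphic_refl Z]) (use Z in \<open>simp add: zero_object_def\<close>)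
  then show "P \<noteq> {}" using I[of "[]" Z] direct_sum_nil Z by auto
  show "Q \<in> Obj C" if "Q \<in> P" for Q using that PO by blast
  fix Q Q' assume Q: "Q \<in> P" "Q' \<in> P"
  then obtain Y i j p q where b: "bip C Q Q' Y i j p q" using bip_ex[of Q Q'] PO by blast
  have "direct_sum_of C [Q, Q'] Y" unfolding direct_sum2 using b by blast
  moreover have "direct_sum_of C [Y, Z] Y"
    by (rule iso_direct_sum_zero[OF isomorphic_refl Z]) (use b in \<open>simp add: bip_def\<close>)
  ultimately have "Y \<in> P" using I[of "[Q, Q']" Y Y Z] Q by simp
  then show "\<exists>Y\<in>P. \<exists>i j p q. bip C Q Q' Y i j p q" using b by blast
qed

context clustP
begin

abbreviation D where "D \<equiv> partial_stab C P"

lemma D_simps [simp]: "Obj D = Obj C" "Ext D = Ext C"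
  by (simp_all add: partial_stab_def quot_cat_def)

lemma D_quot: "Hom D = Hom (quot_cat C P)" "Ident D = Ident (quot_cat C P)" "Comp D = Comp (quot_cat C P)"
  by (simp_all add: partial_stab_def)

lemma D_lincat: "lincat D"
  by (rule lincat.intro) (use quot_linear in \<open>simp add: linear_category_def D_quot quot_obj\<close>)

sublocale D: lincat "partial_stab C P"
  by (rule D_lincat)

lemma D_mor: "X \<in> Obj C \<Longrightarrow> Y \<in> Obj C \<Longrightarrow> Mor D X Y = qc X Y ` Mor C X Y"
  unfolding D_quot by (rule quot_mor)

lemma D_comp:
  "X \<in> Obj C \<Longrightarrow> Y \<in> Obj C \<Longrightarrow> Z \<in> Obj C \<Longrightarrow> f \<in> Mor C X Y \<Longrightarrow> g \<in> Mor C Y Z \<Longrightarrow>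
    Comp D X Y Z (qc Y Z g) (qc X Y f) = qc X Z (Comp C X Y Z g f)"
  unfolding D_quot by (rule quot_comp)

lemma D_id: "Ident D X = qc X X (Ident C X)"
  unfolding D_quot by (rule quot_id)

lemma D_zero: "X \<in> Obj C \<Longrightarrow> Y \<in> Obj C \<Longrightarrow> \<zero>\<^bsub>Hom D X Y\<^esub> = qc X Y \<zero>\<^bsub>Hom C X Y\<^esub>"
  unfolding D_quot by (rule quot_zero)

lemma D_add: "X \<in> Obj C \<Longrightarrow> Y \<in> Obj C \<Longrightarrow> f \<in> Mor C X Y \<Longrightarrow> g \<in> Mor C X Y \<Longrightarrow>
    qc X Y f \<oplus>\<^bsub>Hom D X Y\<^esub> qc X Y g = qc X Y (f \<oplus>\<^bsub>Hom C X Y\<^esub> g)"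
  unfolding D_quot by (rule quot_add)

lemma D_minus: "X \<in> Obj C \<Longrightarrow> Y \<in> Obj C \<Longrightarrow> f \<in> Mor C X Y \<Longrightarrow> g \<in> Mor C X Y \<Longrightarrow>
    qc X Y f \<ominus>\<^bsub>Hom D X Y\<^esub> qc X Y g = qc X Y (f \<ominus>\<^bsub>Hom C X Y\<^esub> g)"
  unfolding D_quot by (rule lin_minus[OF qc_lin, symmetric])

lemma D_smult: "X \<in> Obj C \<Longrightarrow> Y \<in> Obj C \<Longrightarrow> f \<in> Mor C X Y \<Longrightarrow>
    c \<odot>\<^bsub>Hom D X Y\<^esub> qc X Y f = qc X Y (c \<odot>\<^bsub>Hom C X Y\<^esub> f)"
  unfolding D_quot by (rule quot_smult)

lemma iso_arrow_D: "iso_arrow (quot_cat C P) X Y f \<longleftrightarrow> iso_arrow D X Y f"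
  by (simp add: iso_arrow_def D_quot)

lemma qc_iso_D: "X \<in> Obj C \<Longrightarrow> Y \<in> Obj C \<Longrightarrow> iso_arrow C X Y f \<Longrightarrow> iso_arrow D X Y (qc X Y f)"
  using qc_iso by (simp add: iso_arrow_D)

lemma isomorphic_D: "isomorphic C X Y \<Longrightarrow> isomorphic D X Y"
  unfolding isomorphic_def using qc_iso_D by auto

lemma bip_D: "bip C A B Y i j p q \<Longrightarrow> bip D A B Y (qc A Y i) (qc B Y j) (qc Y A p) (qc Y B q)"
proof -
  have "bip (quot_cat C P) A' B' Y' i' j' p' q' \<longleftrightarrow> bip D A' B' Y' i' j' p' q'" for A' B' Y' i' j' p' q'
    by (simp add: bip_def D_quot quot_obj)
  then show "bip C A B Y i j p q \<Longrightarrow> bip D A B Y (qc A Y i) (qc B Y j) (qc Y A p) (qc Y B q)"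
    using qc_bip[of A B Y i j p q] by blast
qed

lemma zero_object_D_iff: "X \<in> Obj C \<Longrightarrow> zero_object D X \<longleftrightarrow> Ident C X \<in> fac X X"
  using qc_zero_iff[of X X "Ident C X"] by (simp add: zero_object_def D_id D_zero)

lemma zero_object_D: "zero_object C Z \<Longrightarrow> zero_object D Z"
  by (simp add: zero_object_def D_id D_zero)

lemma some_rep:
  assumes "X \<in> Obj C" "Y \<in> Obj C" "f \<in> Mor C X Y"
  shows "(SOME g. g \<in> qc X Y f) \<in> Mor C X Y" "qc X Y (SOME g. g \<in> qc X Y f) = qc X Y f"
    "(SOME g. g \<in> qc X Y f) \<ominus>\<^bsub>Hom C X Y\<^esub> f \<in> fac X Y"
proof -
  have "(SOME g. g \<in> qc X Y f) \<in> qc X Y f" using qc_self[OF assms] by (rule someI)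
  then show "(SOME g. g \<in> qc X Y f) \<in> Mor C X Y" "qc X Y (SOME g. g \<in> qc X Y f) = qc X Y f"
    "(SOME g. g \<in> qc X Y f) \<ominus>\<^bsub>Hom C X Y\<^esub> f \<in> fac X Y"
    using qc_mem[OF assms] by auto
qed

text \<open>Two representatives differ by a morphism through some Q in P, and Ext(Q, A) = 0 as Q is
  projective. For \<open>push_class\<close> the argument is the same with Q injective.\<close>

lemma pull_class:
  assumes o: "X' \<in> Obj C" "X \<in> Obj C" "A \<in> Obj C" and c: "c \<in> Mor C X' X" and d: "\<delta> \<in> Exts C X A"
  shows "Pull C X' X A (SOME c'. c' \<in> qc X' X c) \<delta> = Pull C X' X A c \<delta>"
proof -
  let ?s = "SOME c'. c' \<in> qc X' X c"
  note s = some_rep[OF o(1,2) c]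
  obtain Q a b where q: "Q \<in> P" "a \<in> Mor C X' Q" "b \<in> Mor C Q X" "?s \<ominus>\<^bsub>Hom C X' X\<^esub> c = Comp C X' Q X b a"
    using facE[OF s(3)] .
  have "Pull C Q X A b \<delta> = \<zero>\<^bsub>Ext C Q A\<^esub>"
    by (rule proj_ext) (use q Ppi o d in auto)
  then have "Pull C X' X A (?s \<ominus>\<^bsub>Hom C X' X\<^esub> c) \<delta> = \<zero>\<^bsub>Ext C X' A\<^esub>"
    unfolding q(4) using q o d by (simp add: pull_comp)
  then have "Pull C X' X A ?s \<delta> \<ominus>\<^bsub>Ext C X' A\<^esub> Pull C X' X A c \<delta> = \<zero>\<^bsub>Ext C X' A\<^esub>"
    using lin_minus[OF pull_lin(2)[OF o d] s(1) c] by simp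
  then show ?thesis using vs_laws(12)[OF ext_vs[OF o(1,3)]] o c d s(1) by simp
qed

lemma push_class:
  assumes o: "X \<in> Obj C" "A \<in> Obj C" "A' \<in> Obj C" and c: "c \<in> Mor C A A'" and d: "\<delta> \<in> Exts C X A"
  shows "Push C X A A' (SOME c'. c' \<in> qc A A' c) \<delta> = Push C X A A' c \<delta>"
proof -
  let ?s = "SOME c'. c' \<in> qc A A' c"
  note s = some_rep[OF o(2,3) c]
  obtain Q a b where q: "Q \<in> P" "a \<in> Mor C A Q" "b \<in> Mor C Q A'" "?s \<ominus>\<^bsub>Hom C A A'\<^esub> c = Comp C A Q A' b a"
    using facE[OF s(3)] .
  have "Push C X A Q a \<delta> \<in> Exts C X Q" using q o d by simp
  then have "Push C X A Q a \<delta> = \<zero>\<^bsub>Ext C X Q\<^esub>"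
    using q(1) Ppi o(1) by (auto simp: injectives_def)
  then have "Push C X A A' (?s \<ominus>\<^bsub>Hom C A A'\<^esub> c) \<delta> = \<zero>\<^bsub>Ext C X A'\<^esub>"
    unfolding q(4) using q o d by (simp add: push_comp)
  then have "Push C X A A' ?s \<delta> \<ominus>\<^bsub>Ext C X A'\<^esub> Push C X A A' c \<delta> = \<zero>\<^bsub>Ext C X A'\<^esub>"
    using lin_minus[OF push_lin(2)[OF o d] s(1) c] by simp
  then show ?thesis using vs_laws(12)[OF ext_vs[OF o(1,3)]] o c d s(1) by simp
qed

lemma projectives_D: "projectives D = projectives C"
  by (simp add: projectives_def)

lemma P_T: "Q \<in> P \<Longrightarrow> Q \<in> T"
  using Ppi proj_T by blast

text \<open>Objects isomorphic in the quotient need not be isomorphic in C. But the composite fg and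
  the identity of Y have the same class, so they act equally on Ext, and every extension of U by Y
  is a pushout of one by X.\<close>

lemma T_iso_D:
  assumes X: "X \<in> T" and i: "isomorphic D X Y"
  shows "Y \<in> T"
proof -
  have Xo: "X \<in> Obj C" using X by simp
  obtain F G where Y: "Y \<in> Obj C" and FG: "F \<in> Mor D X Y" "G \<in> Mor D Y X" "Comp D Y X Y F G = Ident D Y"
    using D.isomorphicE[OF i] by (metis D_simps(1))
  obtain f g where f: "f \<in> Mor C X Y" "F = qc X Y f" and g: "g \<in> Mor C Y X" "G = qc Y X g"
    using FG D_mor[OF Xo Y] D_mor[OF Y Xo] by auto
  have fg: "Comp C Y X Y f g \<in> Mor C Y Y" using Xo Y f g by simp
  have e: "qc Y Y (Comp C Y X Y f g) = qc Y Y (Ident C Y)"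
    using FG(3) f g Xo Y by (simp add: D_comp D_id)
  show ?thesis
  proof (rule T_I[OF Y])
    fix U \<delta> assume U: "U \<in> T" and d: "\<delta> \<in> Exts C U Y"
    have Uo: "U \<in> Obj C" using U by simp
    have z: "Push C U Y X g \<delta> = \<zero>\<^bsub>Ext C U X\<^esub>"
      by (rule T_ext[OF U X]) (use U Xo Y g d in auto)
    have "\<delta> = Push C U Y Y (SOME c. c \<in> qc Y Y (Ident C Y)) \<delta>"
      using push_class[OF Uo Y Y id_in[OF Y] d] Uo Y d by simp
    also have "\<dots> = Push C U Y Y (Comp C Y X Y f g) \<delta>"
      unfolding e[symmetric] by (rule push_class[OF Uo Y Y fg d])
    also have "\<dots> = Push C U X Y f (Push C U Y X g \<delta>)"
      by (rule push_comp) (use Uo Xo Y f g d in auto)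
    finally show "\<delta> = \<zero>\<^bsub>Ext C U Y\<^esub>" using z Uo Xo Y f by simp
  qed
qed

subsection \<open>Index and coindex\<close>

abbreviation rel where "rel \<equiv> K0_rel T (split_seqs C T)"
abbreviation relD where "relD \<equiv> K0_rel T (split_seqs D T)"

lemma split_seqs_D: "split_seqs C T \<subseteq> split_seqs D T"
  unfolding split_seqs_def D.direct_sum2 direct_sum2 using bip_D by blast

lemma rel_mono: "c \<in> rel \<Longrightarrow> c \<in> relD"
  using split_seqs_sub
proof (induction rule: K0_rel_induct)
  case (gen X Y Z)
  then show ?case using K0_rel_closed(5)[OF split_seqs_sub[of D T]] split_seqs_D by blast
qed (rule K0_rel_closed[OF split_seqs_sub]; assumption?)+

lemma frag_iso_D: "X \<in> T \<Longrightarrow> isomorphic D X Y \<Longrightarrow> frag_of X - frag_of Y \<in> relD"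
  using D.K0T_iso[of X T Y] T_iso_D T_zero zero_object_D zero_ex by blast

lemma proj_coset: "proj_K0 C P T (K0_coset T (split_seqs C T) c) = K0_coset T (split_seqs D T) c"
proof -
  note cl = K0_rel_closed[OF split_seqs_sub[of D T]]
  have "proj_K0 C P T (K0_coset T (split_seqs C T) c) = {h + (r + c) | h r. h \<in> relD \<and> r \<in> rel}"
    unfolding proj_K0_def K0_coset_altdef set_mult_def by auto
  also have "\<dots> = {h + c | h. h \<in> relD}"
  proof
    show "{h + (r + c) | h r. h \<in> relD \<and> r \<in> rel} \<subseteq> {h + c | h. h \<in> relD}"
    proof
      fix x assume "x \<in> {h + (r + c) | h r. h \<in> relD \<and> r \<in> rel}"
      then obtain h r where x: "x = h + (r + c)" "h \<in> relD" "r \<in> rel" by blast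
      have "x = (h + r) + c" "h + r \<in> relD" using x cl(2)[OF x(2) rel_mono[OF x(3)]] by simp_all
      then show "x \<in> {h + c | h. h \<in> relD}" by blast
    qed
    show "{h + c | h. h \<in> relD} \<subseteq> {h + (r + c) | h r. h \<in> relD \<and> r \<in> rel}"
    proof
      fix x assume "x \<in> {h + c | h. h \<in> relD}"
      then obtain h where "x = h + (0 + c)" "h \<in> relD" by auto
      then show "x \<in> {h + (r + c) | h r. h \<in> relD \<and> r \<in> rel}"
        using K0_rel_closed(1)[OF split_seqs_sub[of C T]] by blast
    qed
  qed
  finally show ?thesis unfolding K0_coset_altdef .
qed

lemma conflation_to_D:
  assumes "conflation C A x B y X"
  shows "conflation D A (qc A B x) B (qc B X y) X"
proof -
  obtain \<delta> where o: "A \<in> Obj C" "X \<in> Obj C" "\<delta> \<in> Exts C X A" "(B, x, y) \<in> Real C X A \<delta>"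
    using assms unfolding conflation_def by blast
  note m = real_in[OF o(2,1,3,4)]
  have "seq_equiv (quot_cat C P) A X (B, qc A B x, qc B X y) (B, qc A B x, qc B X y)"
    unfolding seq_equiv_def sequence_def prod.case
    using o m by (auto simp: quot_obj quot_mor quot_comp intro!: exI[of _ "qc B B (Ident C B)"] qc_iso iso_id)
  then have "(B, qc A B x, qc B X y) \<in> Real D X A \<delta>"
    using o(4) by (auto simp: partial_stab_def)
  then show ?thesis using o by (auto simp: conflation_def)
qed

text \<open>Realisations in the quotient are images of those in C up to equivalence of sequences.
  The end terms stay the same; only the middle term changes, by an isomorphism of the
  quotient.\<close>

lemma conflation_from_D:
  assumes "conflation D A x B y X"
  obtains B0 x0 y0 where "conflation C A x0 B0 y0 X" "isomorphic D B0 B"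
proof -
  obtain \<delta> where o: "A \<in> Obj C" "X \<in> Obj C" "\<delta> \<in> Exts C X A" and r: "(B, x, y) \<in> Real D X A \<delta>"
    using assms unfolding conflation_def by auto
  obtain B0 x0 y0 where r0: "(B0, x0, y0) \<in> Real C X A \<delta>"
    and s: "seq_equiv (quot_cat C P) A X (B0, qc A B0 x0, qc B0 X y0) (B, x, y)"
    using r unfolding partial_stab_def by auto
  have "isomorphic D B0 B"
    using s unfolding seq_equiv_def sequence_def isomorphic_def prod.case iso_arrow_D by (auto simp: quot_obj)
  moreover have "conflation C A x0 B0 y0 X" using o r0 by (auto simp: conflation_def)
  ultimately show thesis using that by blast
qed

text \<open>A competing resolution in the quotient lifts to one in C with the same end terms and, by
  \<open>T_iso_D\<close>, with middle term in T. So uniqueness of the index in C gives uniqueness in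
  the quotient, up to the relation between isomorphic middle terms.\<close>

lemma index_D:
  assumes X: "X \<in> Obj C"
  shows "index D T X = proj_K0 C P T (index C T X)"
proof -
  obtain K x R y where T: "K \<in> T" "R \<in> T" and c: "conflation C K x R y X" using resolution[OF X] .
  have "index D T X = K0_coset T (split_seqs D T) (frag_of R - frag_of K)"
    unfolding index_def
  proof (rule the_equality)
    show "\<exists>Ka\<in>T. \<exists>Ra\<in>T. \<exists>x y. conflation D Ka x Ra y X \<and>
      K0_coset T (split_seqs D T) (frag_of R - frag_of K) = classT D T Ra \<otimes>\<^bsub>K0T D T\<^esub> inv\<^bsub>K0T D T\<^esub> classT D T Ka"
      using conflation_to_D[OF c] T classT_diff[OF T(2,1), of D] by blast
    fix v assume "\<exists>K\<in>T. \<exists>R\<in>T. \<exists>x y. conflation D K x R y X \<and>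
      v = classT D T R \<otimes>\<^bsub>K0T D T\<^esub> inv\<^bsub>K0T D T\<^esub> classT D T K"
    then obtain K' R' x' y' where T': "K' \<in> T" "R' \<in> T" and c': "conflation D K' x' R' y' X"
      and v: "v = classT D T R' \<otimes>\<^bsub>K0T D T\<^esub> inv\<^bsub>K0T D T\<^esub> classT D T K'" by blast
    obtain R0 x0 y0 where c0: "conflation C K' x0 R0 y0 X" and i: "isomorphic D R0 R'"
      using conflation_from_D[OF c'] .
    have R0: "R0 \<in> T" using T_iso_D[OF T'(2) D.isomorphic_sym[OF i]] .
    have "(frag_of R0 - frag_of K') - (frag_of R - frag_of K) \<in> relD"
      using index_unique[OF c0 c T'(1) R0 T] unfolding K0_coset_eq[OF split_seqs_sub] by (rule rel_mono)
    from K0_rel_closed(4)[OF split_seqs_sub this frag_iso_D[OF R0 i]]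
    have "(frag_of R' - frag_of K') - (frag_of R - frag_of K) \<in> relD" by (simp add: algebra_simps)
    then show "v = K0_coset T (split_seqs D T) (frag_of R - frag_of K)"
      unfolding v classT_diff[OF T'(2,1)] K0_coset_eq[OF split_seqs_sub] .
  qed
  then show ?thesis unfolding index_eq[OF c T] proj_coset .
qed

lemma coindex_D:
  assumes X: "X \<in> Obj C"
  shows "coindex D T X = proj_K0 C P T (coindex C T X)"
proof -
  obtain K y R x where T: "K \<in> T" "R \<in> T" and c: "conflation C X x R y K" using coresolution[OF X] .
  have "coindex D T X = K0_coset T (split_seqs D T) (frag_of R - frag_of K)"
    unfolding coindex_def
  proof (rule the_equality)
    show "\<exists>Ra\<in>T. \<exists>Ka\<in>T. \<exists>x y. conflation D X x Ra y Ka \<and>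
      K0_coset T (split_seqs D T) (frag_of R - frag_of K) = classT D T Ra \<otimes>\<^bsub>K0T D T\<^esub> inv\<^bsub>K0T D T\<^esub> classT D T Ka"
      using conflation_to_D[OF c] T classT_diff[OF T(2,1), of D] by blast
    fix v assume "\<exists>R\<in>T. \<exists>K\<in>T. \<exists>x y. conflation D X x R y K \<and>
      v = classT D T R \<otimes>\<^bsub>K0T D T\<^esub> inv\<^bsub>K0T D T\<^esub> classT D T K"
    then obtain R' K' x' y' where T': "K' \<in> T" "R' \<in> T" and c': "conflation D X x' R' y' K'"
      and v: "v = classT D T R' \<otimes>\<^bsub>K0T D T\<^esub> inv\<^bsub>K0T D T\<^esub> classT D T K'" by blast
    obtain R0 x0 y0 where c0: "conflation C X x0 R0 y0 K'" and i: "isomorphic D R0 R'"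
      using conflation_from_D[OF c'] .
    have R0: "R0 \<in> T" using T_iso_D[OF T'(2) D.isomorphic_sym[OF i]] .
    have "K0_coset T (split_seqs C T) (frag_of R0 - frag_of K') = K0_coset T (split_seqs C T) (frag_of R - frag_of K)"
      using coindex_eq[OF c0 R0 T'(1)] coindex_eq[OF c T(2,1)] by simp
    then have "(frag_of R0 - frag_of K') - (frag_of R - frag_of K) \<in> relD"
      unfolding K0_coset_eq[OF split_seqs_sub] by (rule rel_mono)
    from K0_rel_closed(4)[OF split_seqs_sub this frag_iso_D[OF R0 i]]
    have "(frag_of R' - frag_of K') - (frag_of R - frag_of K) \<in> relD" by (simp add: algebra_simps)
    then show "v = K0_coset T (split_seqs D T) (frag_of R - frag_of K)"
      unfolding v classT_diff[OF T'(2,1)] K0_coset_eq[OF split_seqs_sub] .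
  qed
  then show ?thesis unfolding coindex_eq[OF c T(2,1)] proj_coset .
qed

subsection \<open>Transfer of modules\<close>

text \<open>The idempotent of a decomposition in the quotient lifts to an endomorphism f of X that
  need not be idempotent. By locality f or 1 - f is invertible, so the idempotent is 1 or 0.\<close>

lemma local_indecomposable_D:
  assumes l: "local_endo C X" and nz: "\<not> zero_object D X"
  shows "indecomposable D X"
  unfolding indecomposable_def
proof (intro conjI allI impI)
  have X: "X \<in> Obj C" using l by (simp add: local_endo_def)
  then show "X \<in> Obj D" by simp
  show "\<not> zero_object D X" by fact
  fix A B assume "direct_sum_of D [A, B] X"
  then obtain i j p q where b: "bip D A B X i j p q" unfolding D.direct_sum2 by blast
  let ?e = "Comp D X A X i p"
  note e = D.bip_idem[OF b]
  have XD: "X \<in> Obj D" using X by simp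
  obtain f where f: "f \<in> Mor C X X" "?e = qc X X f" using e(1) D_mor[OF X X] by auto
  show "zero_object D A \<or> zero_object D B"
  proof (cases "iso_arrow C X X f")
    case True
    then have "iso_arrow D X X ?e" unfolding f(2) by (rule qc_iso_D[OF X X])
    then show ?thesis using D.idem_iso_eq_id[OF XD _ e(2)] e(4) by blast
  next
    case False
    have "qc X X (Ident C X \<ominus>\<^bsub>Hom C X X\<^esub> f) = Ident D X \<ominus>\<^bsub>Hom D X X\<^esub> ?e"
      unfolding f(2) D_id by (rule D_minus[OF X X id_in[OF X] f(1), symmetric])
    then have i: "iso_arrow D X X (Ident D X \<ominus>\<^bsub>Hom D X X\<^esub> ?e)"
      using qc_iso_D[OF X X local_complement[OF l f(1) False]] by simp
    note ic = D.idem_complement[OF XD e(1,2)]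
    have "Ident D X \<ominus>\<^bsub>Hom D X X\<^esub> ?e = Ident D X" by (rule D.idem_iso_eq_id[OF XD i ic(1)])
    then have "?e = \<zero>\<^bsub>Hom D X X\<^esub>" using ic(2) D.comp_id(1)[OF XD XD e(1)] by simp
    then show ?thesis using e(3) by blast
  qed
qed

text \<open>The composite gf is congruent to 1 modulo morphisms through P. If it were not
  invertible, then 1 - gf would be, and the identity of X would factor through P, so X would vanish
  in the quotient.\<close>

lemma isomorphic_lift:
  assumes X: "local_endo C X" and Y: "local_endo C Y" and nz: "\<not> zero_object D X" and i: "isomorphic D X Y"
  shows "isomorphic C X Y"
proof -
  have o: "X \<in> Obj C" "Y \<in> Obj C" using X Y by (auto simp: local_endo_def)
  obtain F G where FG: "F \<in> Mor D X Y" "G \<in> Mor D Y X" "Comp D X Y X G F = Ident D X"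
    using D.isomorphicE[OF i] by metis
  obtain f g where f: "f \<in> Mor C X Y" "F = qc X Y f" and g: "g \<in> Mor C Y X" "G = qc Y X g"
    using FG D_mor[OF o] D_mor[OF o(2,1)] by auto
  let ?c = "Comp C X Y X g f"
  have gf: "?c \<in> Mor C X X" using o f g by simp
  have "qc X X (Ident C X) = qc X X ?c" using FG(3) f g o by (simp add: D_comp D_id)
  then have d: "Ident C X \<ominus>\<^bsub>Hom C X X\<^esub> ?c \<in> fac X X"
    using qc_eq[OF o(1,1) id_in[OF o(1)] gf] by simp
  have "iso_arrow C X X ?c"
  proof (rule ccontr)
    assume "\<not> iso_arrow C X X ?c"
    then have "iso_arrow C X X (Ident C X \<ominus>\<^bsub>Hom C X X\<^esub> ?c)" by (rule local_complement[OF X gf])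
    then obtain u where u: "u \<in> Mor C X X" "Comp C X X X u (Ident C X \<ominus>\<^bsub>Hom C X X\<^esub> ?c) = Ident C X"
      using isoE by metis
    then have "Ident C X \<in> fac X X" using fac_comp(1)[OF o(1,1,1) d u(1)] by simp
    then show False using nz zero_object_D_iff[OF o(1)] by simp
  qed
  then have "iso_arrow C Y X g" by (rule local_retract_iso[OF Y X g(1) f(1)])
  then show ?thesis using o isomorphic_sym[of Y X] by (auto simp: isomorphic_def)
qed

text \<open>A class acts as an arbitrary representative does; by \<open>act_class\<close> the choice
  does not matter for modules in \<open>fd_module\<close>. In the other direction,
  \<open>pull_mod\<close> is restriction along the quotient functor.\<close>

definition push_mod :: "('f, 'o, 'm, 'v) tmod \<Rightarrow> ('f, 'o, 'm set, 'v) tmod" where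
  "push_mod M = \<lparr>mval = mval M, mact = (\<lambda>X Y F. mact M X Y (SOME f. f \<in> F))\<rparr>"

definition pull_mod :: "('f, 'o, 'm set, 'v) tmod \<Rightarrow> ('f, 'o, 'm, 'v) tmod" where
  "pull_mod M = \<lparr>mval = mval M, mact = (\<lambda>X Y f. mact M X Y (qc X Y f))\<rparr>"

lemma mod_simps [simp]:
  "mval (push_mod M) = mval M" "mact (push_mod M) X Y F = mact M X Y (SOME f. f \<in> F)"
  "mval (pull_mod N) = mval N" "mact (pull_mod N) X Y f = mact N X Y (qc X Y f)"
  by (simp_all add: push_mod_def pull_mod_def)

lemma push_mod_commute:
  "push_mod (base_change \<iota> M) = base_change \<iota> (push_mod M)" "pull_mod (base_change \<iota> N) = base_change \<iota> (pull_mod N)"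
  "push_mod (restrict_mod M W) = restrict_mod (push_mod M) W" "pull_mod (restrict_mod N W) = restrict_mod (pull_mod N) W"
  "push_mod (Efun C X) = Efun D X"
  by (simp_all add: push_mod_def pull_mod_def base_change_def restrict_mod_def Efun_def partial_stab_def)

text \<open>The difference of two representatives factors through some Q in P. Such a Q is a
  projective object of T, so M(Q) = 0.\<close>

lemma act_class:
  assumes M: "fd_module \<iota> C T M" and o: "X \<in> T" "Y \<in> T" and f: "f \<in> Mor C X Y" and v: "v \<in> mcar M Y"
  shows "mact M X Y (SOME g. g \<in> qc X Y f) v = mact M X Y f v"
proof -
  let ?s = "SOME g. g \<in> qc X Y f"
  note TM = fd_T_module[OF M]
  have oo: "X \<in> Obj C" "Y \<in> Obj C" using o by simp_all
  note s = some_rep[OF oo f]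
  obtain Q a b where q: "Q \<in> P" "a \<in> Mor C X Q" "b \<in> Mor C Q Y" "?s \<ominus>\<^bsub>Hom C X Y\<^esub> f = Comp C X Q Y b a"
    using facE[OF s(3)] .
  have Q: "Q \<in> T" "Q \<in> projectives C" using P_T[OF q(1)] Ppi q(1) by auto
  have "mact M Q Y b v = \<zero>\<^bsub>mval M Q\<^esub>"
    using TM_in[OF TM Q(1) o(2) q(3) v] M Q by (auto simp: fd_module_def)
  then have z: "mact M X Y (?s \<ominus>\<^bsub>Hom C X Y\<^esub> f) v = \<zero>\<^bsub>mval M X\<^esub>"
    unfolding q(4) using TM_comp[OF TM o(1) Q(1) o(2) q(2,3) v] lin_zero[OF TM_lin[OF TM o(1) Q(1) q(2)]] by simp
  have "?s = (?s \<ominus>\<^bsub>Hom C X Y\<^esub> f) \<oplus>\<^bsub>Hom C X Y\<^esub> f"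
    using vs_laws(8)[OF hom_vs[OF oo] s(1) f] by simp
  then have "mact M X Y ?s v = mact M X Y ((?s \<ominus>\<^bsub>Hom C X Y\<^esub> f) \<oplus>\<^bsub>Hom C X Y\<^esub> f) v" by simp
  also have "\<dots> = mact M X Y (?s \<ominus>\<^bsub>Hom C X Y\<^esub> f) v \<oplus>\<^bsub>mval M X\<^esub> mact M X Y f v"
    by (rule TM_add[OF TM o _ f v]) (use oo s(1) f in simp)
  finally show ?thesis
    using z vs_laws(1)[OF TM_vs[OF TM o(1)] TM_in[OF TM o f v]] by simp
qed

lemma push_T_module:
  assumes M: "fd_module \<iota> C T M"
  shows "T_module \<iota> D T (push_mod M)"
proof -
  note TM = fd_T_module[OF M]
  have l: "lin (mval M Y) (mval M X) (mact (push_mod M) X Y F)" if o: "X \<in> T" "Y \<in> T" and F: "F \<in> Mor D X Y" for X Y F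
  proof -
    obtain f where f: "f \<in> Mor C X Y" "F = qc X Y f" using F D_mor o by auto
    show ?thesis
      by (rule lin_cong[OF TM_lin[OF TM o f(1)]]) (simp add: f(2) act_class[OF M o f(1)])
  qed
  show ?thesis
    unfolding T_module_def mod_simps(1)
  proof (intro conjI ballI allI)
    fix X v assume o: "X \<in> T" and v: "v \<in> mcar M X"
    show "mact (push_mod M) X X (Ident D X) v = v"
      using act_class[OF M o o id_in v] TM_id[OF TM o v] o by (simp add: D_id)
  next
    fix X Y Z F G v assume o: "X \<in> T" "Y \<in> T" "Z \<in> T" and F: "F \<in> Mor D X Y" and G: "G \<in> Mor D Y Z" and v: "v \<in> mcar M Z"
    obtain f where f: "f \<in> Mor C X Y" "F = qc X Y f" using F D_mor o by auto
    obtain g where g: "g \<in> Mor C Y Z" "G = qc Y Z g" using G D_mor o by auto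
    have gf: "Comp C X Y Z g f \<in> Mor C X Z" using o f g by simp
    have FG: "Comp D X Y Z (qc Y Z g) (qc X Y f) = qc X Z (Comp C X Y Z g f)" using o f g by (simp add: D_comp)
    have gv: "mact M Y Z g v \<in> mcar M Y" by (rule TM_in[OF TM o(2,3) g(1) v])
    show "mact (push_mod M) X Z (Comp D X Y Z G F) v = mact (push_mod M) X Y F (mact (push_mod M) Y Z G v)"
      unfolding FG mod_simps act_class[OF M o(1,3) gf v] f(2) g(2) act_class[OF M o(2,3) g(1) v] act_class[OF M o(1,2) f(1) gv]
      by (rule TM_comp[OF TM o f(1) g(1) v])
  next
    fix X Y F G v assume o: "X \<in> T" "Y \<in> T" and F: "F \<in> Mor D X Y" and G: "G \<in> Mor D X Y" and v: "v \<in> mcar M Y"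
    obtain f where f: "f \<in> Mor C X Y" "F = qc X Y f" using F D_mor o by auto
    obtain g where g: "g \<in> Mor C X Y" "G = qc X Y g" using G D_mor o by auto
    have fg: "f \<oplus>\<^bsub>Hom C X Y\<^esub> g \<in> Mor C X Y" using o f g by simp
    have FG: "qc X Y f \<oplus>\<^bsub>Hom D X Y\<^esub> qc X Y g = qc X Y (f \<oplus>\<^bsub>Hom C X Y\<^esub> g)" using o f g by (simp add: D_add)
    show "mact (push_mod M) X Y (F \<oplus>\<^bsub>Hom D X Y\<^esub> G) v = mact (push_mod M) X Y F v \<oplus>\<^bsub>mval M X\<^esub> mact (push_mod M) X Y G v"
      unfolding FG mod_simps act_class[OF M o fg v] f(2) g(2) act_class[OF M o f(1) v] act_class[OF M o g(1) v]
      by (rule TM_add[OF TM o f(1) g(1) v])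
  next
    fix X Y F c v assume o: "X \<in> T" "Y \<in> T" and F: "F \<in> Mor D X Y" and v: "v \<in> mcar M Y"
    obtain f where f: "f \<in> Mor C X Y" "F = qc X Y f" using F D_mor o by auto
    have cf: "c \<odot>\<^bsub>Hom C X Y\<^esub> f \<in> Mor C X Y" using o f vs_closed(5)[OF hom_vs] by simp
    have cF: "c \<odot>\<^bsub>Hom D X Y\<^esub> qc X Y f = qc X Y (c \<odot>\<^bsub>Hom C X Y\<^esub> f)" using o f by (simp add: D_smult)
    show "mact (push_mod M) X Y (c \<odot>\<^bsub>Hom D X Y\<^esub> F) v = \<iota> c \<odot>\<^bsub>mval M X\<^esub> mact (push_mod M) X Y F v"
      unfolding cF mod_simps act_class[OF M o cf v] f(2) act_class[OF M o f(1) v]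
      by (rule TM_smult[OF TM o f(1) v])
  qed (use TM_vs[OF TM] l in auto)
qed

lemma pull_T_module:
  assumes N: "T_module \<iota> D T N"
  shows "T_module \<iota> C T (pull_mod N)"
proof -
  have q: "qc X Y f \<in> Mor D X Y" if "X \<in> T" "Y \<in> T" "f \<in> Mor C X Y" for X Y f
    using that D_mor by auto
  have l: "lin (mval N Y) (mval N X) (mact (pull_mod N) X Y f)" if "X \<in> T" "Y \<in> T" "f \<in> Mor C X Y" for X Y f
    by (rule lin_cong[OF TM_lin[OF N that(1,2) q[OF that]]]) simp
  show ?thesis
    unfolding T_module_def mod_simps(3)
  proof (intro conjI ballI allI)
    fix X v assume o: "X \<in> T" and v: "v \<in> mcar N X"
    show "mact (pull_mod N) X X (Ident C X) v = v"
      using TM_id[OF N o v] by (simp add: D_id)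
  next
    fix X Y Z f g v assume o: "X \<in> T" "Y \<in> T" "Z \<in> T" and f: "f \<in> Mor C X Y" and g: "g \<in> Mor C Y Z" and v: "v \<in> mcar N Z"
    show "mact (pull_mod N) X Z (Comp C X Y Z g f) v = mact (pull_mod N) X Y f (mact (pull_mod N) Y Z g v)"
      using TM_comp[OF N o q[OF o(1,2) f] q[OF o(2,3) g] v] o f g by (simp add: D_comp)
  next
    fix X Y f g v assume o: "X \<in> T" "Y \<in> T" and f: "f \<in> Mor C X Y" and g: "g \<in> Mor C X Y" and v: "v \<in> mcar N Y"
    show "mact (pull_mod N) X Y (f \<oplus>\<^bsub>Hom C X Y\<^esub> g) v = mact (pull_mod N) X Y f v \<oplus>\<^bsub>mval N X\<^esub> mact (pull_mod N) X Y g v"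
      using TM_add[OF N o q[OF o f] q[OF o g] v] o f g by (simp add: D_add)
  next
    fix X Y f c v assume o: "X \<in> T" "Y \<in> T" and f: "f \<in> Mor C X Y" and v: "v \<in> mcar N Y"
    show "mact (pull_mod N) X Y (c \<odot>\<^bsub>Hom C X Y\<^esub> f) v = \<iota> c \<odot>\<^bsub>mval N X\<^esub> mact (pull_mod N) X Y f v"
      using TM_smult[OF N o q[OF o f] v] o f by (simp add: D_smult)
  qed (use TM_vs[OF N] l in auto)
qed

text \<open>If M vanished on all local summands of X, the endomorphisms acting by zero on M(X) would
  form a subspace containing the idempotents of the decomposition, hence the identity.\<close>

lemma local_summand:
  assumes M: "T_module \<iota> C T M" and X: "X \<in> T" "mcar M X \<noteq> {\<zero>\<^bsub>mval M X\<^esub>}"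
  obtains Y i p where "Y \<in> T" "local_endo C Y" "i \<in> Mor C Y X" "p \<in> Mor C X Y" "Comp C Y X Y p i = Ident C Y"
    "mcar M Y \<noteq> {\<zero>\<^bsub>mval M Y\<^esub>}"
proof -
  obtain Xs i p where b: "biproduct C Xs X i p" and Xs: "\<forall>Y\<in>set Xs. local_endo C Y \<and> Y \<in> T"
    using T_decomp[OF X(1)] by blast
  have Xo: "X \<in> Obj C" using X by simp
  have "\<exists>k<length Xs. mcar M (Xs ! k) \<noteq> {\<zero>\<^bsub>mval M (Xs ! k)\<^esub>}"
  proof (rule ccontr)
    assume n: "\<not> ?thesis"
    let ?S = "{f \<in> Mor C X X. \<forall>v\<in>mcar M X. mact M X X f v = \<zero>\<^bsub>mval M X\<^esub>}"
    note v = TM_vs[OF M X(1)]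
    have zz: "\<zero>\<^bsub>mval M X\<^esub> \<oplus>\<^bsub>mval M X\<^esub> \<zero>\<^bsub>mval M X\<^esub> = \<zero>\<^bsub>mval M X\<^esub>"
      by (rule vs_laws(1)[OF v vs_closed(1)[OF v]])
    have z0: "mact M X X \<zero>\<^bsub>Hom C X X\<^esub> w = \<zero>\<^bsub>mval M X\<^esub>" if w: "w \<in> mcar M X" for w
    proof -
      let ?a = "mact M X X \<zero>\<^bsub>Hom C X X\<^esub> w"
      have a: "?a \<in> mcar M X" by (rule TM_in[OF M X(1) X(1) zero_in[OF Xo Xo] w])
      have "?a = ?a \<oplus>\<^bsub>mval M X\<^esub> ?a"
        using TM_add[OF M X(1) X(1) zero_in[OF Xo Xo] zero_in[OF Xo Xo] w]
          vs_laws(1)[OF hom_vs[OF Xo Xo] zero_in[OF Xo Xo]] by simp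
      then have "?a \<ominus>\<^bsub>mval M X\<^esub> ?a = ?a" using vs_laws(10)[OF v a a] by simp
      then show ?thesis using vs_laws(3)[OF v a] by simp
    qed
    have S: "subspace class_ring ?S (Hom C X X)"
      by (rule subspaceI[OF hom_vs[OF Xo Xo]])
        (use Xo z0 zz TM_add[OF M X(1) X(1)] TM_smult[OF M X(1) X(1)] vs_smult_laws(4)[OF v vs_closed(1)[OF v]]
          vs_closed(5)[OF hom_vs[OF Xo Xo]] in auto)
    have il: "lin (Hom C X X) (Hom C X X) (\<lambda>f. f)"
      by (rule linI) (use Xo vs_closed(5)[OF hom_vs[OF Xo Xo]] in auto)
    have "Ident C X \<in> ?S"
    proof (rule biproduct_lin[OF b il S])
      fix k assume k: "k < length Xs"
      note d = biproductD[OF b k]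
      have Y: "Xs ! k \<in> T" using Xs k by simp
      have "mact M X X (Comp C X (Xs ! k) X (i k) (p k)) w = \<zero>\<^bsub>mval M X\<^esub>" if w: "w \<in> mcar M X" for w
      proof -
        have "mact M (Xs ! k) X (i k) w = \<zero>\<^bsub>mval M (Xs ! k)\<^esub>"
          using TM_in[OF M Y X(1) d(3) w] n k by blast
        then show ?thesis
          using TM_comp[OF M X(1) Y X(1) d(4,3) w] lin_zero[OF TM_lin[OF M X(1) Y d(4)]] by simp
      qed
      then show "Comp C X (Xs ! k) X (i k) (p k) \<in> ?S" using d by simp
    qed
    then have "w = \<zero>\<^bsub>mval M X\<^esub>" if "w \<in> mcar M X" for w
      using that TM_id[OF M X(1) that] by auto
    then have "mcar M X = {\<zero>\<^bsub>mval M X\<^esub>}" using vs_closed(1)[OF v] by blast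
    then show False using X(2) by simp
  qed
  then obtain k where k: "k < length Xs" and nz: "mcar M (Xs ! k) \<noteq> {\<zero>\<^bsub>mval M (Xs ! k)\<^esub>}" by blast
  show thesis
    by (rule that[of "Xs ! k" "i k" "p k"]) (use Xs k nz biproductD[OF b k] in auto)
qed

lemma zero_module_of_zero_object:
  assumes M: "fd_module \<iota> C T M" and X: "X \<in> T" and z: "zero_object D X"
  shows "mcar M X = {\<zero>\<^bsub>mval M X\<^esub>}"
proof -
  have Xo: "X \<in> Obj C" using X by simp
  note TM = fd_T_module[OF M]
  obtain Q a b where q: "Q \<in> P" "a \<in> Mor C X Q" "b \<in> Mor C Q X" "Ident C X = Comp C X Q X b a"
    using z zero_object_D_iff[OF Xo] facE by metis
  have Q: "Q \<in> T" "Q \<in> projectives C" using P_T[OF q(1)] Ppi q(1) by auto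
  have "v = \<zero>\<^bsub>mval M X\<^esub>" if v: "v \<in> mcar M X" for v
  proof -
    have "mact M Q X b v = \<zero>\<^bsub>mval M Q\<^esub>"
      using TM_in[OF TM Q(1) X q(3) v] M Q by (auto simp: fd_module_def)
    then have "mact M X X (Comp C X Q X b a) v = \<zero>\<^bsub>mval M X\<^esub>"
      using TM_comp[OF TM X Q(1) X q(2,3) v] lin_zero[OF TM_lin[OF TM X Q(1) q(2)]] by simp
    then show ?thesis using TM_id[OF TM X v] q(4) by simp
  qed
  then show ?thesis using vs_closed(1)[OF TM_vs[OF TM X]] by blast
qed

text \<open>An object may become indecomposable only in the quotient, so the support condition needs
  an argument. A local summand A of X with M(A) nonzero survives in the quotient, so its complement
  vanishes there; A is covered by J, and so is X.\<close>

lemma push_fd: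
  assumes M: "fd_module \<iota> C T M"
  shows "fd_module \<iota> D T (push_mod M)"
proof -
  note TM = fd_T_module[OF M]
  obtain J where J: "finite J" and Js: "\<forall>X\<in>T. indecomposable C X \<and> mcar M X \<noteq> {\<zero>\<^bsub>mval M X\<^esub>} \<longrightarrow> (\<exists>Y\<in>J. isomorphic C X Y)"
    using M unfolding fd_module_def by (elim exE conjE)
  have s: "\<exists>Y\<in>J. isomorphic D X Y" if X: "X \<in> T" "indecomposable D X" "mcar M X \<noteq> {\<zero>\<^bsub>mval M X\<^esub>}" for X
  proof -
    obtain A i p where A: "A \<in> T" "local_endo C A" "i \<in> Mor C A X" "p \<in> Mor C X A" "Comp C A X A p i = Ident C A"
      "mcar M A \<noteq> {\<zero>\<^bsub>mval M A\<^esub>}"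
      using local_summand[OF TM X(1,3)] .
    obtain B j q where b: "bip C A B X i j p q"
      using retract_bip[OF ic T_obj[OF A(1)] T_obj[OF X(1)] A(3-5)] .
    note bD = bip_D[OF b]
    have "\<not> zero_object D A" using zero_module_of_zero_object[OF M A(1)] A(6) by blast
    moreover have "direct_sum_of D [A, B] X" unfolding D.direct_sum2 using bD by blast
    ultimately have "zero_object D B" using X(2) unfolding indecomposable_def by blast
    then have "isomorphic D A X"
      using D.bip_zero_iso[OF bD] A(1) X(1) by (auto simp: isomorphic_def)
    moreover obtain Y where Y: "Y \<in> J" "isomorphic C A Y"
      using Js A(1,6) local_indecomposable[OF A(2)] by blast
    ultimately show ?thesis
      using D.isomorphic_trans[OF D.isomorphic_sym isomorphic_D[OF Y(2)]] Y(1) by blast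
  qed
  show ?thesis
    unfolding fd_module_def mod_simps(1) projectives_D
  proof (intro conjI exI[of _ J] ballI impI)
    show "T_module \<iota> D T (push_mod M)" by (rule push_T_module[OF M])
    show "mcar M X = {\<zero>\<^bsub>mval M X\<^esub>}" if "X \<in> T \<inter> projectives C" for X
      using M that by (simp add: fd_module_def)
    show "findim (mval M X)" if "X \<in> T" for X by (rule fd_findim[OF M that])
    show "finite J" by (rule J)
    show "\<exists>Y\<in>J. isomorphic D X Y" if "X \<in> T" "indecomposable D X \<and> mcar M X \<noteq> {\<zero>\<^bsub>mval M X\<^esub>}" for X
      using s that by blast
  qed
qed

lemma pull_fd:
  assumes N: "fd_module \<iota> D T N"
  shows "fd_module \<iota> C T (pull_mod N)"
proof -
  note TN = fd_T_module[OF N]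
  obtain J where J: "finite J" and Js: "\<forall>X\<in>T. indecomposable D X \<and> mcar N X \<noteq> {\<zero>\<^bsub>mval N X\<^esub>} \<longrightarrow> (\<exists>Y\<in>J. isomorphic D X Y)"
    using N unfolding fd_module_def by (elim exE conjE)
  \<comment> \<open>J controls the support only up to isomorphism in the quotient. Each Y in J is
    replaced by one local object of C isomorphic to it there; isomorphisms between such objects lift
    to C by \<open>isomorphic_lift\<close>.\<close>
  let ?R = "\<lambda>Y X. X \<in> T \<and> local_endo C X \<and> \<not> zero_object D X \<and> isomorphic D X Y"
  have s: "\<exists>Y\<in>(\<lambda>Y. SOME X. ?R Y X) ` J. isomorphic C X Y"
    if X: "X \<in> T" "indecomposable C X" "mcar N X \<noteq> {\<zero>\<^bsub>mval N X\<^esub>}" for X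
  proof -
    have l: "local_endo C X" by (rule ind_local[OF X(2)])
    have nz: "\<not> zero_object D X"
    proof
      assume z: "zero_object D X"
      have XD: "X \<in> Obj D" using X by simp
      have "v = \<zero>\<^bsub>mval N X\<^esub>" if v: "v \<in> mcar N X" for v
      proof -
        have I: "Ident D X \<in> Mor D X X" by (rule D.id_in[OF XD])
        have e: "Ident D X \<oplus>\<^bsub>Hom D X X\<^esub> Ident D X = Ident D X"
          using z D.hom_vs[OF XD XD] I by (simp add: zero_object_def vs_laws(1))
        have "v = v \<oplus>\<^bsub>mval N X\<^esub> v"
          using TM_add[OF TN X(1) X(1) I I v] TM_id[OF TN X(1) v] e by simp
        then have "v \<ominus>\<^bsub>mval N X\<^esub> v = v" using vs_laws(10)[OF TM_vs[OF TN X(1)] v v] by simp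
        then show ?thesis using vs_laws(3)[OF TM_vs[OF TN X(1)] v] by simp
      qed
      then show False using X(3) vs_closed(1)[OF TM_vs[OF TN X(1)]] by blast
    qed
    obtain Y where Y: "Y \<in> J" "isomorphic D X Y"
      using Js X(1,3) local_indecomposable_D[OF l nz] by blast
    have "?R Y (SOME X. ?R Y X)" by (rule someI[of "?R Y" X]) (use X l nz Y in blast)
    then have "isomorphic C X (SOME X. ?R Y X)"
      using isomorphic_lift[OF l _ nz] D.isomorphic_trans[OF Y(2) D.isomorphic_sym] by blast
    then show ?thesis using Y(1) by blast
  qed
  show ?thesis
    unfolding fd_module_def mod_simps(3)
  proof (intro conjI exI[of _ "(\<lambda>Y. SOME X. ?R Y X) ` J"] ballI impI)
    show "T_module \<iota> C T (pull_mod N)" by (rule pull_T_module[OF TN])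
    show "mcar N X = {\<zero>\<^bsub>mval N X\<^esub>}" if "X \<in> T \<inter> projectives C" for X
      using N that by (simp add: fd_module_def projectives_D)
    show "findim (mval N X)" if "X \<in> T" for X by (rule fd_findim[OF N that])
    show "finite ((\<lambda>Y. SOME X. ?R Y X) ` J)" using J by simp
    show "\<exists>Y\<in>(\<lambda>Y. SOME X. ?R Y X) ` J. isomorphic C X Y"
      if "X \<in> T" "indecomposable C X \<and> mcar N X \<noteq> {\<zero>\<^bsub>mval N X\<^esub>}" for X
      using s that by blast
  qed
qed

end

context clustP
begin

subsection \<open>Transfer of Grothendieck groups\<close>

lemma hom_push:
  assumes h: "T_module_hom C T M N h"
  shows "T_module_hom D T (push_mod M) (push_mod N) h"
  unfolding T_module_hom_def mod_simps(1)
proof (intro conjI ballI)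
  fix X assume X: "X \<in> T"
  show "lin (mval M X) (mval N X) (h X)" using h X by (simp add: T_module_hom_def)
  fix Y F v assume Y: "Y \<in> T" and F: "F \<in> Mor D X Y" and v: "v \<in> mcar M Y"
  obtain f where f: "f \<in> Mor C X Y" "F = qc X Y f" using F D_mor X Y by auto
  have "(SOME g. g \<in> F) \<in> Mor C X Y" unfolding f(2) by (rule some_rep(1)) (use X Y f in auto)
  then show "h X (mact (push_mod M) X Y F v) = mact (push_mod N) X Y F (h Y v)"
    using h X Y v by (simp add: T_module_hom_def)
qed

lemma hom_pull:
  assumes h: "T_module_hom D T M N h"
  shows "T_module_hom C T (pull_mod M) (pull_mod N) h"
  unfolding T_module_hom_def mod_simps(3)
proof (intro conjI ballI)
  fix X assume X: "X \<in> T"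
  show "lin (mval M X) (mval N X) (h X)" using h X by (simp add: T_module_hom_def)
  fix Y f v assume Y: "Y \<in> T" and f: "f \<in> Mor C X Y" and v: "v \<in> mcar M Y"
  have "qc X Y f \<in> Mor D X Y" using D_mor X Y f by auto
  then show "h X (mact (pull_mod M) X Y f v) = mact (pull_mod N) X Y f (h Y v)"
    using h X Y v by (simp add: T_module_hom_def)
qed

lemma seqs_push:
  assumes "(L, M, N) \<in> fd_exact_seqs \<iota> C T"
  shows "(push_mod L, push_mod M, push_mod N) \<in> fd_exact_seqs \<iota> D T"
proof -
  have fd: "fd_module \<iota> C T L" "fd_module \<iota> C T M" "fd_module \<iota> C T N" and s: "short_exact C T L M N"
    using assms by (simp_all add: fd_exact_seqs_def fd_modules_def)
  obtain h g where hg: "T_module_hom C T L M h" "T_module_hom C T M N g"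
    "\<forall>X\<in>T. inj_on (h X) (mcar L X) \<and> g X ` mcar M X = mcar N X \<and>
           h X ` mcar L X = {v \<in> mcar M X. g X v = \<zero>\<^bsub>mval N X\<^esub>}"
    using s unfolding short_exact_def by (elim exE conjE)
  have "short_exact D T (push_mod L) (push_mod M) (push_mod N)"
    unfolding short_exact_def mod_simps(1)
    by (intro exI conjI) (rule hom_push[OF hg(1)], rule hom_push[OF hg(2)], rule hg(3))
  then show ?thesis using push_fd[OF fd(1)] push_fd[OF fd(2)] push_fd[OF fd(3)] by (simp add: fd_exact_seqs_def fd_modules_def)
qed

lemma seqs_pull:
  assumes "(L, M, N) \<in> fd_exact_seqs \<iota> D T"
  shows "(pull_mod L, pull_mod M, pull_mod N) \<in> fd_exact_seqs \<iota> C T"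
proof -
  have fd: "fd_module \<iota> D T L" "fd_module \<iota> D T M" "fd_module \<iota> D T N" and s: "short_exact D T L M N"
    using assms by (simp_all add: fd_exact_seqs_def fd_modules_def)
  obtain h g where hg: "T_module_hom D T L M h" "T_module_hom D T M N g"
    "\<forall>X\<in>T. inj_on (h X) (mcar L X) \<and> g X ` mcar M X = mcar N X \<and>
           h X ` mcar L X = {v \<in> mcar M X. g X v = \<zero>\<^bsub>mval N X\<^esub>}"
    using s unfolding short_exact_def by (elim exE conjE)
  have "short_exact C T (pull_mod L) (pull_mod M) (pull_mod N)"
    unfolding short_exact_def mod_simps(3)
    by (intro exI conjI) (rule hom_pull[OF hg(1)], rule hom_pull[OF hg(2)], rule hg(3))
  then show ?thesis using pull_fd[OF fd(1)] pull_fd[OF fd(2)] pull_fd[OF fd(3)] by (simp add: fd_exact_seqs_def fd_modules_def)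
qed

definition Phi :: "(('f, 'o, 'm, 'v) tmod \<Rightarrow>\<^sub>0 int) \<Rightarrow> (('f, 'o, 'm set, 'v) tmod \<Rightarrow>\<^sub>0 int)" where
  "Phi = frag_extend (\<lambda>M. frag_of (push_mod M))"

definition Psi :: "(('f, 'o, 'm set, 'v) tmod \<Rightarrow>\<^sub>0 int) \<Rightarrow> (('f, 'o, 'm, 'v) tmod \<Rightarrow>\<^sub>0 int)" where
  "Psi = frag_extend (\<lambda>M. frag_of (pull_mod M))"

lemma Phi_simps [simp]:
  "Phi 0 = 0" "Phi (frag_of M) = frag_of (push_mod M)" "Phi (c - d) = Phi c - Phi d"
  "Psi 0 = 0" "Psi (frag_of N) = frag_of (pull_mod N)" "Psi (c' - d') = Psi c' - Psi d'"
  by (simp_all add: Phi_def Psi_def frag_extend_diff)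

lemma Phi_keys: "Poly_Mapping.keys c \<subseteq> fd_modules \<iota> C T \<Longrightarrow> Poly_Mapping.keys (Phi c) \<subseteq> fd_modules \<iota> D T"
  unfolding Phi_def by (rule frag_extend_keys[of "fd_modules \<iota> C T"]) (auto simp: fd_modules_def push_fd)

lemma Psi_keys: "Poly_Mapping.keys c \<subseteq> fd_modules \<iota> D T \<Longrightarrow> Poly_Mapping.keys (Psi c) \<subseteq> fd_modules \<iota> C T"
  unfolding Psi_def by (rule frag_extend_keys[of "fd_modules \<iota> D T"]) (auto simp: fd_modules_def pull_fd)

lemma Phi_rel: "c \<in> K0_rel (fd_modules \<iota> C T) (fd_exact_seqs \<iota> C T) \<Longrightarrow> Phi c \<in> K0_rel (fd_modules \<iota> D T) (fd_exact_seqs \<iota> D T)"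
  unfolding Phi_def by (rule K0_rel_map[OF fd_seqs_sub fd_seqs_sub seqs_push])

lemma Psi_rel: "c \<in> K0_rel (fd_modules \<iota> D T) (fd_exact_seqs \<iota> D T) \<Longrightarrow> Psi c \<in> K0_rel (fd_modules \<iota> C T) (fd_exact_seqs \<iota> C T)"
  unfolding Psi_def by (rule K0_rel_map[OF fd_seqs_sub fd_seqs_sub seqs_pull])

text \<open>Modules that agree on T may differ as records, because their values and actions outside
  T are arbitrary. The identity maps make them isomorphic, so their classes agree.\<close>

lemma frag_agree:
  assumes M: "M \<in> fd_modules \<iota> C T" and N: "N \<in> fd_modules \<iota> C T"
    and e: "\<And>X. X \<in> T \<Longrightarrow> mval M X = mval N X"
    "\<And>X Y f v. X \<in> T \<Longrightarrow> Y \<in> T \<Longrightarrow> f \<in> Mor C X Y \<Longrightarrow> v \<in> mcar M Y \<Longrightarrow> mact M X Y f v = mact N X Y f v"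
  shows "frag_of M - frag_of N \<in> K0_rel (fd_modules \<iota> C T) (fd_exact_seqs \<iota> C T)"
proof (rule K0_fd_iso[OF M N])
  have vs: "vspace (mval N X)" if "X \<in> T" for X
    using TM_vs[OF fd_T_module that] N by (simp add: fd_modules_def)
  show "T_module_hom C T M N (\<lambda>X v. v)"
    unfolding T_module_hom_def using e vs by (auto intro!: linI simp: vs_closed)
  show "bij_betw (\<lambda>v. v) (mcar M X) (mcar N X)" if "X \<in> T" for X
    using e(1)[OF that] by (simp add: bij_betw_def)
qed

lemma frag_agree_D:
  assumes M: "M \<in> fd_modules \<iota> D T" and N: "N \<in> fd_modules \<iota> D T"
    and e: "\<And>X. X \<in> T \<Longrightarrow> mval M X = mval N X"
    "\<And>X Y f v. X \<in> T \<Longrightarrow> Y \<in> T \<Longrightarrow> f \<in> Mor D X Y \<Longrightarrow> v \<in> mcar M Y \<Longrightarrow> mact M X Y f v = mact N X Y f v"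
  shows "frag_of M - frag_of N \<in> K0_rel (fd_modules \<iota> D T) (fd_exact_seqs \<iota> D T)"
proof (rule K0_fd_iso[OF M N])
  have vs: "vspace (mval N X)" if "X \<in> T" for X
    using TM_vs[OF fd_T_module that] N by (simp add: fd_modules_def)
  show "T_module_hom D T M N (\<lambda>X v. v)"
    unfolding T_module_hom_def using e vs by (auto intro!: linI simp: vs_closed)
  show "bij_betw (\<lambda>v. v) (mcar M X) (mcar N X)" if "X \<in> T" for X
    using e(1)[OF that] by (simp add: bij_betw_def)
qed

lemma Psi_Phi:
  assumes "Poly_Mapping.keys c \<subseteq> fd_modules \<iota> C T"
  shows "Psi (Phi c) - c \<in> K0_rel (fd_modules \<iota> C T) (fd_exact_seqs \<iota> C T)"
  using assms
proof (induction c rule: K0_induct[consumes 1, case_names zero single diff])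
  case zero
  then show ?case using K0_rel_closed(1)[OF fd_seqs_sub] by simp
next
  case (single M)
  then have fd: "fd_module \<iota> C T M" by (simp add: fd_modules_def)
  have "frag_of (pull_mod (push_mod M)) - frag_of M \<in> K0_rel (fd_modules \<iota> C T) (fd_exact_seqs \<iota> C T)"
    by (rule frag_agree) (use fd pull_fd[OF push_fd[OF fd]] act_class[OF fd] in \<open>auto simp: fd_modules_def\<close>)
  then show ?case by simp
next
  case (diff a b)
  from K0_rel_closed(4)[OF fd_seqs_sub diff.IH] show ?case by (simp add: algebra_simps)
qed

lemma Phi_Psi:
  assumes "Poly_Mapping.keys c \<subseteq> fd_modules \<iota> D T"
  shows "Phi (Psi c) - c \<in> K0_rel (fd_modules \<iota> D T) (fd_exact_seqs \<iota> D T)"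
  using assms
proof (induction c rule: K0_induct[consumes 1, case_names zero single diff])
  case zero
  then show ?case using K0_rel_closed(1)[OF fd_seqs_sub] by simp
next
  case (single M)
  then have fd: "fd_module \<iota> D T M" by (simp add: fd_modules_def)
  have act: "mact (push_mod (pull_mod M)) X Y F v = mact M X Y F v" if o: "X \<in> T" "Y \<in> T" and F: "F \<in> Mor D X Y" for X Y F v
  proof -
    obtain f where f: "f \<in> Mor C X Y" "F = qc X Y f" using F D_mor o by auto
    show ?thesis using some_rep(2)[OF T_obj[OF o(1)] T_obj[OF o(2)] f(1)] by (simp add: f(2))
  qed
  have "frag_of (push_mod (pull_mod M)) - frag_of M \<in> K0_rel (fd_modules \<iota> D T) (fd_exact_seqs \<iota> D T)"
    by (rule frag_agree_D) (use fd push_fd[OF pull_fd[OF fd]] act in \<open>auto simp: fd_modules_def simp del: mod_simps(2,4)\<close>)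
  then show ?case by simp
next
  case (diff a b)
  from K0_rel_closed(4)[OF fd_seqs_sub diff.IH] show ?case by (simp add: algebra_simps)
qed

abbreviation bcx where "bcx \<equiv> frag_extend (\<lambda>L. frag_of (base_change to_ac L))"

lemma Phi_bcx: "Phi (bcx c) = bcx (Phi c)"
proof (induction c rule: K0_induct[OF subset_UNIV, case_names zero single diff])
  case zero
  show ?case by (simp only: Phi_simps frag_extend_0 frag_extend_of frag_extend_diff push_mod_commute)
next
  case (single M)
  show ?case by (simp only: Phi_simps frag_extend_0 frag_extend_of frag_extend_diff push_mod_commute)
next
  case (diff x y)
  then show ?case by (simp only: Phi_simps frag_extend_0 frag_extend_of frag_extend_diff push_mod_commute)
qed

lemma Psi_bcx: "Psi (bcx c) = bcx (Psi c)"
proof (induction c rule: K0_induct[OF subset_UNIV, case_names zero single diff])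
  case zero
  show ?case by (simp only: Phi_simps frag_extend_0 frag_extend_of frag_extend_diff push_mod_commute)
next
  case (single M)
  show ?case by (simp only: Phi_simps frag_extend_0 frag_extend_of frag_extend_diff push_mod_commute)
next
  case (diff x y)
  then show ?case by (simp only: Phi_simps frag_extend_0 frag_extend_of frag_extend_diff push_mod_commute)
qed

lemma dimf_Phi: "dimf X (Phi c) = dimf X c"
proof (induction c rule: K0_induct[OF subset_UNIV, case_names zero single diff])
  case zero
  show ?case by (simp only: Phi_simps dimf_simps mod_simps)
next
  case (single M)
  show ?case by (simp only: Phi_simps dimf_simps mod_simps)
next
  case (diff x y)
  then show ?case by (simp only: Phi_simps dimf_simps mod_simps)
qed

text \<open>\<open>Phi\<close> respects the relations, and \<open>Psi\<close> recovers c from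
  \<open>Phi c\<close> modulo relations; so \<open>Phi\<close> is well defined and injective on
  classes.\<close>

lemma coset_Phi_eq:
  assumes "Poly_Mapping.keys c \<subseteq> fd_modules \<iota> C T" "Poly_Mapping.keys d \<subseteq> fd_modules \<iota> C T"
  shows "K0fd_coset \<iota> D T (Phi c) = K0fd_coset \<iota> D T (Phi d) \<longleftrightarrow> K0fd_coset \<iota> C T c = K0fd_coset \<iota> C T d"
  unfolding K0_coset_eq[OF fd_seqs_sub]
proof
  assume "c - d \<in> K0_rel (fd_modules \<iota> C T) (fd_exact_seqs \<iota> C T)"
  from Phi_rel[OF this] show "Phi c - Phi d \<in> K0_rel (fd_modules \<iota> D T) (fd_exact_seqs \<iota> D T)" by simp
next
  note cl = K0_rel_closed(4)[OF fd_seqs_sub]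
  assume "Phi c - Phi d \<in> K0_rel (fd_modules \<iota> D T) (fd_exact_seqs \<iota> D T)"
  from Psi_rel[OF this] have 1: "Psi (Phi c) - Psi (Phi d) \<in> K0_rel (fd_modules \<iota> C T) (fd_exact_seqs \<iota> C T)" by simp
  from cl[OF cl[OF 1 Psi_Phi[OF assms(1)]]] K0_rel_closed(3)[OF fd_seqs_sub Psi_Phi[OF assms(2)]]
  have "(Psi (Phi c) - Psi (Phi d)) - (Psi (Phi c) - c) - (- (Psi (Phi d) - d)) \<in> K0_rel (fd_modules \<iota> C T) (fd_exact_seqs \<iota> C T)"
    by blast
  then show "c - d \<in> K0_rel (fd_modules \<iota> C T) (fd_exact_seqs \<iota> C T)" by (simp add: algebra_simps)
qed

subsection \<open>Grassmannians\<close>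

text \<open>\<open>Efun C X0\<close> may have infinite support, so \<open>act_class\<close> does not
  cover it. The matrices agree because the pullback of an extension does not depend on the
  representative of the morphism.\<close>

lemma bc_act_class:
  assumes X0: "X0 \<in> Obj C" and o: "X \<in> T" "Y \<in> T" and f: "f \<in> Mor C X Y"
  shows "mact (base_change \<iota> (Efun C X0)) X Y (SOME g. g \<in> qc X Y f) w = mact (base_change \<iota> (Efun C X0)) X Y f w"
proof -
  have "mat n (vdim (Ext C Y X0)) (\<lambda>(i, j). \<iota> (coords (Ext C X X0) (Pull C X Y X0 (SOME g. g \<in> qc X Y f) (chosen_basis (Ext C Y X0) ! j)) $ i)) =
    mat n (vdim (Ext C Y X0)) (\<lambda>(i, j). \<iota> (coords (Ext C X X0) (Pull C X Y X0 f (chosen_basis (Ext C Y X0) ! j)) $ i))" for n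
    by (rule eq_matI) (use pull_class[OF T_obj[OF o(1)] T_obj[OF o(2)] X0 f] chosen_basis_in[OF ext_vs ext_findim] o X0 in auto)
  then show ?thesis by (simp add: base_change_def)
qed

text \<open>The families W are literally the same on both sides: the modules have the same values,
  and a morphism of C acts on them as its class does.\<close>

lemma grass_points_D:
  assumes X0: "X0 \<in> Obj C" and c0: "Poly_Mapping.keys c0 \<subseteq> fd_modules id C T"
  shows "grass_points D T (Efun D X0) (K0fd_coset id D T (Phi c0)) = grass_points C T (Efun C X0) (K0fd_coset id C T c0)"
proof -
  let ?N = "base_change to_ac (Efun C X0)"
  have N': "base_change to_ac (Efun D X0) = push_mod ?N" by (simp add: push_mod_commute)
  have act: "mact ?N X Y (SOME g. g \<in> qc X Y f) w = mact ?N X Y f w" if "X \<in> T" "Y \<in> T" "f \<in> Mor C X Y" for X Y f w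
    by (rule bc_act_class[OF X0 that])
  have sub: "T_submodule D T (push_mod ?N) W \<longleftrightarrow> T_submodule C T ?N W" for W
  proof -
    have "(\<forall>F\<in>Mor D X Y. mact (push_mod ?N) X Y F ` W Y \<subseteq> W X) \<longleftrightarrow> (\<forall>f\<in>Mor C X Y. mact ?N X Y f ` W Y \<subseteq> W X)"
      if o: "X \<in> T" "Y \<in> T" for X Y
      unfolding D_mor[OF T_obj[OF o(1)] T_obj[OF o(2)]] mod_simps(2) ball_simps(9) using act[OF o] by (auto simp: image_subset_iff)
    then show ?thesis unfolding T_submodule_def mod_simps(1) by blast
  qed
  have agree: "frag_of (pull_mod (restrict_mod (push_mod ?N) W)) - frag_of (restrict_mod ?N W) \<in> K0_rel (fd_modules to_ac C T) (fd_exact_seqs to_ac C T)"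
    if "fd_module to_ac C T (pull_mod (restrict_mod (push_mod ?N) W))" "fd_module to_ac C T (restrict_mod ?N W)" for W
    by (rule frag_agree) (use that act in \<open>auto simp: fd_modules_def\<close>)
  \<comment> \<open>The ambient module may have infinite support, so \<open>restrict_fd\<close> does
    not apply to it. Instead the module laws are transported along identity maps from the
    pulled-back submodule.\<close>
  have fdC: "fd_module to_ac C T (restrict_mod ?N W)" if fd: "fd_module to_ac D T (restrict_mod (push_mod ?N) W)" for W
  proof -
    note pfd = pull_fd[OF fd]
    note pT = fd_T_module[OF pfd]
    have l: "lin (mval (restrict_mod ?N W) X) (mval (pull_mod (restrict_mod (push_mod ?N) W)) X) (\<lambda>v. v)" if "X \<in> T" for X
      by (rule linI) (use TM_vs[OF pT that] in auto)
    have T: "T_module to_ac C T (restrict_mod ?N W)"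
    proof (rule transport_T_module[OF pT _ _ l _ _ lincat_axioms T_sub])
      show "vspace (mval (restrict_mod ?N W) X)" if "X \<in> T" for X using TM_vs[OF pT that] by simp
      show "mact (restrict_mod ?N W) X Y f v \<in> mcar (restrict_mod ?N W) X"
        if "X \<in> T" "Y \<in> T" "f \<in> Mor C X Y" "v \<in> mcar (restrict_mod ?N W) Y" for X Y f v
        using TM_in[OF pT that(1-3), of v] that act[OF that(1-3)] by simp
    qed (use act in auto)
    show ?thesis by (rule transport_fd[OF pfd T l]) auto
  qed
  note eq = K0_coset_eq[OF fd_seqs_sub]
  show ?thesis
  proof
    show "grass_points C T (Efun C X0) (K0fd_coset id C T c0) \<subseteq> grass_points D T (Efun D X0) (K0fd_coset id D T (Phi c0))"
    proof
      fix W assume "W \<in> grass_points C T (Efun C X0) (K0fd_coset id C T c0)"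
      then obtain c where W: "T_submodule C T ?N W" "fd_module to_ac C T (restrict_mod ?N W)"
        and c: "c \<in> K0fd_coset id C T c0" "frag_of (restrict_mod ?N W) - bcx c \<in> K0_rel (fd_modules to_ac C T) (fd_exact_seqs to_ac C T)"
        unfolding grass_points_def eq by blast
      have "Phi c \<in> K0fd_coset id D T (Phi c0)"
      proof -
        have "c - c0 \<in> K0_rel (fd_modules id C T) (fd_exact_seqs id C T)"
          using K0_coset_mem[OF fd_seqs_sub c(1)] unfolding eq .
        from Phi_rel[OF this] have "K0fd_coset id D T (Phi c) = K0fd_coset id D T (Phi c0)" unfolding eq by simp
        then show ?thesis using K0_coset_self[OF fd_seqs_sub[of id D T], of "Phi c"] by (simp only:)
      qed
      moreover from Phi_rel[OF c(2)]
      have "frag_of (restrict_mod (push_mod ?N) W) - bcx (Phi c) \<in> K0_rel (fd_modules to_ac D T) (fd_exact_seqs to_ac D T)"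
        by (simp only: Phi_simps Phi_bcx push_mod_commute(3))
      moreover have "fd_module to_ac D T (restrict_mod (push_mod ?N) W)"
        using push_fd[OF W(2)] by (simp add: push_mod_commute(3))
      ultimately show "W \<in> grass_points D T (Efun D X0) (K0fd_coset id D T (Phi c0))"
        unfolding grass_points_def N' eq using sub W(1) by blast
    qed
    show "grass_points D T (Efun D X0) (K0fd_coset id D T (Phi c0)) \<subseteq> grass_points C T (Efun C X0) (K0fd_coset id C T c0)"
    proof
      fix W assume "W \<in> grass_points D T (Efun D X0) (K0fd_coset id D T (Phi c0))"
      then obtain c where W: "T_submodule D T (push_mod ?N) W" "fd_module to_ac D T (restrict_mod (push_mod ?N) W)"
        and c: "c \<in> K0fd_coset id D T (Phi c0)"
          "frag_of (restrict_mod (push_mod ?N) W) - bcx c \<in> K0_rel (fd_modules to_ac D T) (fd_exact_seqs to_ac D T)"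
        unfolding grass_points_def N' eq by blast
      have "Psi c \<in> K0fd_coset id C T c0"
      proof -
        have "c - Phi c0 \<in> K0_rel (fd_modules id D T) (fd_exact_seqs id D T)"
          using K0_coset_mem[OF fd_seqs_sub c(1)] unfolding eq .
        from Psi_rel[OF this] have "Psi c - Psi (Phi c0) \<in> K0_rel (fd_modules id C T) (fd_exact_seqs id C T)" by simp
        from K0_rel_closed(2)[OF fd_seqs_sub this Psi_Phi[OF c0]]
        have "K0fd_coset id C T (Psi c) = K0fd_coset id C T c0" unfolding eq by simp
        then show ?thesis using K0_coset_self[OF fd_seqs_sub[of id C T], of "Psi c"] by (simp only:)
      qed
      moreover have fd: "fd_module to_ac C T (restrict_mod ?N W)" by (rule fdC[OF W(2)])
      moreover have "frag_of (restrict_mod ?N W) - bcx (Psi c) \<in> K0_rel (fd_modules to_ac C T) (fd_exact_seqs to_ac C T)"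
      proof -
        from Psi_rel[OF c(2)] have "frag_of (pull_mod (restrict_mod (push_mod ?N) W)) - bcx (Psi c) \<in> K0_rel (fd_modules to_ac C T) (fd_exact_seqs to_ac C T)"
          by (simp only: Phi_simps Psi_bcx)
        from K0_rel_closed(4)[OF fd_seqs_sub this agree[OF pull_fd[OF W(2)] fd]] show ?thesis by simp
      qed
      ultimately show "W \<in> grass_points C T (Efun C X0) (K0fd_coset id C T c0)"
        unfolding grass_points_def eq using sub W(1) by blast
    qed
  qed
qed

lemma grassmannian_D:
  assumes X0: "X0 \<in> Obj C" and c0: "Poly_Mapping.keys c0 \<subseteq> fd_modules id C T"
  shows "grassmannian D T (Efun D X0) (K0fd_coset id D T (Phi c0)) = grassmannian C T (Efun C X0) (K0fd_coset id C T c0)"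
proof -
  let ?N = "base_change to_ac (Efun C X0)"
  have N': "base_change to_ac (Efun D X0) = push_mod ?N" by (simp add: push_mod_commute)
  have set: "{mact (push_mod ?N) X J F w | J F w. J \<in> set Js \<and> F \<in> Mor D X J \<and> w \<in> W J} =
      {mact ?N X J f w | J f w. J \<in> set Js \<and> f \<in> Mor C X J \<and> w \<in> W J}" (is "?A = ?B")
    if X: "X \<in> T" and Js: "set Js \<subseteq> T" for X Js and W :: "'o \<Rightarrow> 'k alg_closure vec set"
  proof
    show "?A \<subseteq> ?B"
    proof
      fix x assume "x \<in> ?A"
      then obtain J F w where x: "x = mact (push_mod ?N) X J F w" "J \<in> set Js" "F \<in> Mor D X J" "w \<in> W J" by blast
      have J: "J \<in> T" using x(2) Js by blast
      obtain f where f: "f \<in> Mor C X J" "F = qc X J f" using x(3) D_mor[OF T_obj[OF X] T_obj[OF J]] by blast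
      have "x = mact ?N X J f w" unfolding x(1) f(2) mod_simps(2) by (rule bc_act_class[OF X0 X J f(1)])
      then show "x \<in> ?B" using x f by blast
    qed
    show "?B \<subseteq> ?A"
    proof
      fix x assume "x \<in> ?B"
      then obtain J f w where x: "x = mact ?N X J f w" "J \<in> set Js" "f \<in> Mor C X J" "w \<in> W J" by blast
      have J: "J \<in> T" using x(2) Js by blast
      have "x = mact (push_mod ?N) X J (qc X J f) w"
        unfolding x(1) mod_simps(2) by (rule bc_act_class[OF X0 X J x(3), symmetric])
      moreover have "qc X J f \<in> Mor D X J" using x(3) D_mor[OF T_obj[OF X] T_obj[OF J]] by blast
      ultimately show "x \<in> ?A" using x by blast
    qed
  qed
  \<comment> \<open>The generating objects are an arbitrary choice. The predicates behind the two
    choices coincide, hence so do the lists, and with them the Pluecker coordinates.\<close>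
  have "generating_objects D T (Efun D X0) (K0fd_coset id D T (Phi c0)) = generating_objects C T (Efun C X0) (K0fd_coset id C T c0)"
    unfolding generating_objects_def grass_points_D[OF assms] N'
    by (intro arg_cong[where f = Eps] HOL.ext conj_cong ball_cong refl) (simp only: mod_simps(1) set)
  moreover have "mval (Efun D X0) = mval (Efun C X0)" by (simp add: Efun_def)
  ultimately show ?thesis
    unfolding grassmannian_def grass_points_D[OF assms] by simp
qed

subsection \<open>The homomorphisms \<open>\<beta>\<close>\<close>

lemma index_frag:
  assumes "X \<in> Obj C"
  obtains t where "Poly_Mapping.keys t \<subseteq> T" "index C T X = K0_coset T (split_seqs C T) t"
proof -
  obtain K x R y where T: "K \<in> T" "R \<in> T" and c: "conflation C K x R y X" using resolution[OF assms] .
  have "Poly_Mapping.keys (frag_of R - frag_of K) \<subseteq> T"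
    using keys_diff[of "frag_of R" "frag_of K"] T by auto
  then show thesis using that index_eq[OF c T] by blast
qed

lemma coindex_frag:
  assumes "X \<in> Obj C"
  obtains t where "Poly_Mapping.keys t \<subseteq> T" "coindex C T X = K0_coset T (split_seqs C T) t"
proof -
  obtain K x R y where T: "K \<in> T" "R \<in> T" and c: "conflation C X y R x K" using coresolution[OF assms] .
  have "Poly_Mapping.keys (frag_of R - frag_of K) \<subseteq> T"
    using keys_diff[of "frag_of R" "frag_of K"] T by auto
  then show thesis using that coindex_eq[OF c T(2,1)] by blast
qed

context
  fixes \<beta> \<beta>'
  assumes b: "is_beta C T \<beta>" and b': "is_beta D T \<beta>'"
begin

private lemma bhom: "\<beta> \<in> hom (K0fd id C T) (K0T C T)"
  using b by (simp add: is_beta_def)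

private lemma bhom': "\<beta>' \<in> hom (K0fd id D T) (K0T D T)"
  using b' by (simp add: is_beta_def)

lemma beta_frag:
  assumes "Poly_Mapping.keys c \<subseteq> fd_modules id C T"
  obtains t where "Poly_Mapping.keys t \<subseteq> T" "\<beta> (K0fd_coset id C T c) = K0_coset T (split_seqs C T) t"
proof -
  have "\<beta> (K0fd_coset id C T c) \<in> carrier (K0T C T)"
    using hom_in_carrier[OF bhom] assms by (auto simp: K0_carrier)
  then show thesis using that by (auto simp: K0_carrier)
qed

lemma beta_compatible:
  assumes c: "Poly_Mapping.keys c \<subseteq> fd_modules id C T"
  shows "\<beta>' (K0fd_coset id D T (Phi c)) = proj_K0 C P T (\<beta> (K0fd_coset id C T c))"
proof -
  note grp = K0_comm_group[OF fd_seqs_sub, THEN comm_group.axioms(2)] K0_comm_group[OF split_seqs_sub, THEN comm_group.axioms(2)]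
  have zero1: "\<beta> (K0fd_coset id C T 0) = K0_coset T (split_seqs C T) 0"
    by (rule hom_one[OF bhom grp, unfolded K0_one[OF fd_seqs_sub] K0_one[OF split_seqs_sub]])
  have zero2: "\<beta>' (K0fd_coset id D T 0) = K0_coset T (split_seqs D T) 0"
    by (rule hom_one[OF bhom' grp, unfolded K0_one[OF fd_seqs_sub] K0_one[OF split_seqs_sub]])
  obtain n where n: "Poly_Mapping.keys n \<subseteq> reps" "c - simple_sum n \<in> fd_rel"
    using generation_frag[OF c] by blast
  have ss: "Poly_Mapping.keys (simple_sum n) \<subseteq> fd_modules id C T" if "Poly_Mapping.keys n \<subseteq> reps" for n
    by (rule frag_extend_keys[OF simple_mod_fd(1) that])
  \<comment> \<open>Both values are cosets of one common element t, a formulation stable under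
    differences. For a simple module, t is a representative in C of coindex minus index.\<close>
  have "\<exists>t. Poly_Mapping.keys t \<subseteq> T \<and> \<beta> (K0fd_coset id C T (simple_sum n)) = K0_coset T (split_seqs C T) t \<and>
      \<beta>' (K0fd_coset id D T (Phi (simple_sum n))) = K0_coset T (split_seqs D T) t"
    using n(1)
  proof (induction n rule: K0_induct[consumes 1, case_names zero single diff])
    case zero
    show ?case unfolding frag_extend_0 Phi_simps by (intro exI[of _ 0] conjI zero1 zero2) (simp only: keys_zero empty_subsetI)
  next
    case (single U)
    let ?K = "simple_object U"
    note fd = simple_mod_fd[OF single]
    obtain r where r: "Poly_Mapping.keys r \<subseteq> T" "index C T ?K = K0_coset T (split_seqs C T) r" using index_frag[OF fd(3)] .
    obtain s where s: "Poly_Mapping.keys s \<subseteq> T" "coindex C T ?K = K0_coset T (split_seqs C T) s" using coindex_frag[OF fd(3)] .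
    have diff: "K0_coset T (split_seqs A T) s \<otimes>\<^bsub>K0T A T\<^esub> inv\<^bsub>K0T A T\<^esub> K0_coset T (split_seqs A T) r = K0_coset T (split_seqs A T) (s - r)"
      for A :: "('x, 'o, 'y, 'z) lincat_scheme"
      using K0_inv[OF split_seqs_sub[of A T] r(1)] K0_mult[OF split_seqs_sub[of A T] s(1), of "- r"] r(1) by simp
    have "\<beta> (class_fd C T (Efun C ?K)) = coindex C T ?K \<otimes>\<^bsub>K0T C T\<^esub> inv\<^bsub>K0T C T\<^esub> index C T ?K"
      using b fd unfolding is_beta_def by blast
    then have 1: "\<beta> (K0fd_coset id C T (frag_of (simple_mod U))) = K0_coset T (split_seqs C T) (s - r)"
      unfolding class_fd_def r(2) s(2) diff .
    have fdD: "fd_module id D T (Efun D ?K)"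
      using push_fd[OF fd(2)] by (simp only: push_mod_commute)
    have "?K \<in> Obj D" using fd(3) by simp
    then have "\<beta>' (class_fd D T (Efun D ?K)) = coindex D T ?K \<otimes>\<^bsub>K0T D T\<^esub> inv\<^bsub>K0T D T\<^esub> index D T ?K"
      using b' fdD unfolding is_beta_def by blast
    then have 2: "\<beta>' (K0fd_coset id D T (Phi (frag_of (simple_mod U)))) = K0_coset T (split_seqs D T) (s - r)"
      unfolding class_fd_def Phi_simps push_mod_commute index_D[OF fd(3)] coindex_D[OF fd(3)] r(2) s(2) proj_coset diff .
    have "Poly_Mapping.keys (s - r) \<subseteq> T" using keys_diff[of s r] r s by blast
    then show ?case using 1 2 unfolding frag_extend_of by blast
  next
    case (diff x y)
    then obtain t s where t: "Poly_Mapping.keys t \<subseteq> T" "\<beta> (K0fd_coset id C T (simple_sum x)) = K0_coset T (split_seqs C T) t"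
        "\<beta>' (K0fd_coset id D T (Phi (simple_sum x))) = K0_coset T (split_seqs D T) t"
      and s: "Poly_Mapping.keys s \<subseteq> T" "\<beta> (K0fd_coset id C T (simple_sum y)) = K0_coset T (split_seqs C T) s"
        "\<beta>' (K0fd_coset id D T (Phi (simple_sum y))) = K0_coset T (split_seqs D T) s"
      by (elim exE conjE)
    note k = ss[OF diff.hyps(1)] ss[OF diff.hyps(2)]
    have "\<beta> (K0fd_coset id C T (simple_sum x - simple_sum y)) = K0_coset T (split_seqs C T) (t - s)"
      by (rule hom_coset_diff[OF fd_seqs_sub split_seqs_sub bhom k t(1,2) s(1,2)])
    moreover have "\<beta>' (K0fd_coset id D T (Phi (simple_sum x) - Phi (simple_sum y))) = K0_coset T (split_seqs D T) (t - s)"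
      by (rule hom_coset_diff[OF fd_seqs_sub split_seqs_sub bhom' Phi_keys[OF k(1)] Phi_keys[OF k(2)] t(1,3) s(1,3)])
    moreover have "Poly_Mapping.keys (t - s) \<subseteq> T" using keys_diff[of t s] t s by blast
    ultimately show ?case unfolding frag_extend_diff Phi_simps by blast
  qed
  then obtain t where t: "\<beta> (K0fd_coset id C T (simple_sum n)) = K0_coset T (split_seqs C T) t"
    "\<beta>' (K0fd_coset id D T (Phi (simple_sum n))) = K0_coset T (split_seqs D T) t"
    by (elim exE conjE)
  have e: "K0fd_coset id C T c = K0fd_coset id C T (simple_sum n)"
    unfolding K0_coset_eq[OF fd_seqs_sub] by (rule n(2))
  then have "K0fd_coset id D T (Phi c) = K0fd_coset id D T (Phi (simple_sum n))"
    using coset_Phi_eq[OF c ss[OF n(1)]] by simp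
  then show ?thesis unfolding e by (simp only: t proj_coset)
qed

end

end

text \<open>Additivity for the empty set as the union of two copies of itself. It is constructible
  as the complement of the zero locus of the zero polynomial.\<close>

lemma euler_characteristic_empty:
  fixes \<chi> :: "'k::field point set \<Rightarrow> int"
  assumes "euler_characteristic \<chi>"
  shows "\<chi> {} = 0"
proof -
  have z: "constructible_in 0 {x \<in> proj_space 0. eval_mpoly (0 :: 'k mpoly) x = 0}"
    by (rule constructible_in.zero_locus[of 0]) (simp add: homogeneous_def)
  have "proj_space 0 - {x \<in> proj_space 0. eval_mpoly (0 :: 'k mpoly) x = 0} = {}"
    by (auto simp: eval_mpoly_def)
  with constructible_in.complement[OF z] have c: "constructible ({} :: 'k point set)"
    unfolding constructible_def by (intro exI[of _ 0]) (simp only:)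
  have "\<chi> {} = \<chi> {} + \<chi> {}"
    using assms c unfolding euler_characteristic_def by blast
  then show ?thesis by simp
qed

section \<open>Dimension bounds for classes with non-empty Grassmannian\<close>

lemma dimf_cmul: "dimf X (frag_cmul n c) = n * dimf X c"
  by (simp add: dimf_def frag_extend_cmul lookup_frag_cmul)

context clustP
begin

lemma finite_dimf_support:
  assumes "Poly_Mapping.keys c \<subseteq> fd_modules id C T"
  shows "finite {U \<in> reps. dimf U c \<noteq> 0}"
  using assms
proof (induction c rule: K0_induct[consumes 1, case_names zero single diff])
  case zero
  show ?case by simp
next
  case (single M)
  then have fd: "fd_module id C T M" by (simp add: fd_modules_def)
  have "{U \<in> reps. dimf U (frag_of M) \<noteq> 0} \<subseteq> supp M"
  proof
    fix U assume "U \<in> {U \<in> reps. dimf U (frag_of M) \<noteq> 0}"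
    then have U: "U \<in> reps" "U \<in> T" "vdim (mval M U) \<noteq> 0" by (simp_all add: reps_def)
    show "U \<in> supp M"
      using U vdim_zero_iff[OF TM_vs[OF fd_T_module[OF fd] U(2)] fd_findim[OF fd U(2)]] by (simp add: supp_def)
  qed
  then show ?case using finite_supp[OF fd] finite_subset by blast
next
  case (diff a b)
  have "{U \<in> reps. dimf U (a - b) \<noteq> 0} \<subseteq> {U \<in> reps. dimf U a \<noteq> 0} \<union> {U \<in> reps. dimf U b \<noteq> 0}"
    by auto
  then show ?case using diff.IH finite_subset[OF _ finite_UnI] by blast
qed

text \<open>A point W is a submodule of a base change, and its class is the base change of that of
  c. Base change preserves dimensions, so the dimension of c at U is that of a subspace of a space
  of dimension dim Ext(U, X0).\<close>

lemma grassmannian_dimf: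
  assumes X0: "X0 \<in> Obj C" and c: "Poly_Mapping.keys c \<subseteq> fd_modules id C T"
    and ne: "grassmannian C T (Efun C X0) (K0fd_coset id C T c) \<noteq> {}" and U: "U \<in> T"
  shows "0 \<le> dimf U c" "dimf U c \<le> int (vdim (Ext C U X0))"
proof -
  obtain W where "W \<in> grass_points C T (Efun C X0) (K0fd_coset id C T c)"
    using ne unfolding grassmannian_def Let_def by blast
  then obtain d where W: "T_submodule C T (base_change to_ac (Efun C X0)) W"
    and d: "d \<in> K0fd_coset id C T c"
    and e: "K0fd_coset to_ac C T (frag_of (restrict_mod (base_change to_ac (Efun C X0)) W)) =
      K0fd_coset to_ac C T (bcx d)"
    unfolding grass_points_def by blast
  have "dimf U c = dimf U d" using dimf_coset[OF K0_coset_mem[OF fd_seqs_sub d] U] by (rule sym)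
  also have "\<dots> = dimf U (bcx d)" by (rule dimf_base_change[symmetric])
  also have "\<dots> = dimf U (frag_of (restrict_mod (base_change to_ac (Efun C X0)) W))"
    by (rule dimf_coset[OF e[symmetric] U])
  also have "\<dots> = int (vdim (module_vec TYPE('k alg_closure) (vdim (Ext C U X0))\<lparr>carrier := W U\<rparr>))"
    by (simp add: restrict_mod_def base_change_def)
  finally have eq: "dimf U c = \<dots>" .
  have "subspace class_ring (W U) (module_vec TYPE('k alg_closure) (vdim (Ext C U X0)))"
    using W U by (simp add: T_submodule_def base_change_def)
  from vdim_subspace_le[OF findim_vec this]
  show "0 \<le> dimf U c" "dimf U c \<le> int (vdim (Ext C U X0))" unfolding eq by (simp_all add: vdim_vec)
qed

text \<open>Dimension at U is additive, so it vanishes on a subgroup as soon as it does on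
  generators. Representatives are explicit because \<open>dimf\<close> lives on the free abelian
  group rather than on classes.\<close>

lemma generate_dimf:
  assumes S: "\<And>s. s \<in> S \<Longrightarrow> \<exists>c. Poly_Mapping.keys c \<subseteq> fd_modules id D T \<and> dimf U c = 0 \<and> s = K0fd_coset id D T c"
    and h: "h \<in> generate (K0fd id D T) S"
  shows "\<exists>c. Poly_Mapping.keys c \<subseteq> fd_modules id D T \<and> dimf U c = 0 \<and> h = K0fd_coset id D T c"
  using h
proof (induction rule: generate.induct)
  case one
  show ?case unfolding K0_one[OF fd_seqs_sub[of id D T]] by (intro exI[of _ 0] conjI refl) simp_all
next
  case (incl s)
  then show ?case by (rule S)
next
  case (inv s)
  from S[OF this] obtain c where c: "Poly_Mapping.keys c \<subseteq> fd_modules id D T" "dimf U c = 0" "s = K0fd_coset id D T c"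
    by (elim exE conjE)
  show ?case
    unfolding c(3) K0_inv[OF fd_seqs_sub c(1)] by (intro exI[of _ "- c"] conjI refl) (simp_all only: keys_minus c dimf_simps minus_zero)
next
  case (eng h1 h2)
  then obtain c d where c: "Poly_Mapping.keys c \<subseteq> fd_modules id D T" "dimf U c = 0" "h1 = K0fd_coset id D T c"
    and d: "Poly_Mapping.keys d \<subseteq> fd_modules id D T" "dimf U d = 0" "h2 = K0fd_coset id D T d"
    by (elim exE conjE)
  have k: "Poly_Mapping.keys (c + d) \<subseteq> fd_modules id D T" using keys_add[of c d] c(1) d(1) by blast
  show ?case
    unfolding c(3) d(3) K0_mult[OF fd_seqs_sub c(1) d(1)]
    by (intro exI[of _ "c + d"] conjI refl k) (use c(2) d(2) in simp)
qed

definition lift where "lift \<xi> = K0fd_coset id D T (Phi (SOME c. c \<in> \<xi> \<and> Poly_Mapping.keys c \<subseteq> fd_modules id C T))"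

lemma lift_coset:
  assumes c: "Poly_Mapping.keys c \<subseteq> fd_modules id C T"
  shows "lift (K0fd_coset id C T c) = K0fd_coset id D T (Phi c)"
proof -
  let ?d = "SOME d. d \<in> K0fd_coset id C T c \<and> Poly_Mapping.keys d \<subseteq> fd_modules id C T"
  have d: "?d \<in> K0fd_coset id C T c \<and> Poly_Mapping.keys ?d \<subseteq> fd_modules id C T"
    by (rule someI[of _ c]) (use c K0_coset_self[OF fd_seqs_sub[of id C T], of c] in blast)
  show ?thesis
    unfolding lift_def coset_Phi_eq[OF conjunct2[OF d] c] by (rule K0_coset_mem[OF fd_seqs_sub conjunct1[OF d]])
qed

lemma lift_bij: "bij_betw lift (carrier (K0fd id C T)) (carrier (K0fd id D T))"
  unfolding bij_betw_def K0_carrier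
proof
  show "inj_on lift (K0fd_coset id C T ` {c. Poly_Mapping.keys c \<subseteq> fd_modules id C T})"
    by (rule inj_onI, elim imageE CollectE) (simp only: lift_coset coset_Phi_eq)
  show "lift ` K0fd_coset id C T ` {c. Poly_Mapping.keys c \<subseteq> fd_modules id C T} =
      K0fd_coset id D T ` {c. Poly_Mapping.keys c \<subseteq> fd_modules id D T}"
  proof (intro subset_antisym subsetI)
    fix \<xi> assume "\<xi> \<in> lift ` K0fd_coset id C T ` {c. Poly_Mapping.keys c \<subseteq> fd_modules id C T}"
    then obtain c where c: "Poly_Mapping.keys c \<subseteq> fd_modules id C T" "\<xi> = lift (K0fd_coset id C T c)"
      by (elim imageE CollectE) simp
    show "\<xi> \<in> K0fd_coset id D T ` {c. Poly_Mapping.keys c \<subseteq> fd_modules id D T}"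
      unfolding c(2) lift_coset[OF c(1)] by (intro imageI CollectI Phi_keys c)
  next
    fix \<xi> assume "\<xi> \<in> K0fd_coset id D T ` {c. Poly_Mapping.keys c \<subseteq> fd_modules id D T}"
    then obtain d where d: "Poly_Mapping.keys d \<subseteq> fd_modules id D T" "\<xi> = K0fd_coset id D T d"
      by (elim imageE CollectE)
    have "\<xi> = lift (K0fd_coset id C T (Psi d))"
      unfolding d(2) lift_coset[OF Psi_keys[OF d(1)]]
      using Phi_Psi[OF d(1)] unfolding K0_coset_eq[OF fd_seqs_sub, symmetric] by (rule sym)
    then show "\<xi> \<in> lift ` K0fd_coset id C T ` {c. Poly_Mapping.keys c \<subseteq> fd_modules id C T}"
      using Psi_keys[OF d(1)] by blast
  qed
qed

section \<open>Comparison of the two cluster characters\<close>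

context
  fixes X0 :: 'o and \<chi> :: "'k point set \<Rightarrow> int" and \<beta> \<beta>'
  assumes b: "is_beta C T \<beta>" and b': "is_beta D T \<beta>'" and X0: "X0 \<in> Obj C"
    and euler: "euler_characteristic \<chi>"
    and fin: "fd_module id C T (Efun C X0) \<or>
      finite_rank (K0fd id D T) (kernel (K0fd id D T) (K0T D T) \<beta>')"
begin

text \<open>The exponent of the term of \<xi> in the cluster character.\<close>

definition deg where "deg \<xi> = index C T X0 \<otimes>\<^bsub>K0T C T\<^esub> \<beta> \<xi>"

lemma deg_carrier: "\<xi> \<in> carrier (K0fd id C T) \<Longrightarrow> deg \<xi> \<in> carrier (K0T C T)"
proof -
  assume \<xi>: "\<xi> \<in> carrier (K0fd id C T)"
  obtain t where t: "Poly_Mapping.keys t \<subseteq> T" "index C T X0 = K0_coset T (split_seqs C T) t"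
    using index_frag[OF X0] .
  have h: "\<beta> \<in> hom (K0fd id C T) (K0T C T)" using b by (simp add: is_beta_def)
  have "\<beta> \<xi> \<in> carrier (K0T C T)" by (rule hom_in_carrier[OF h \<xi>])
  moreover have "index C T X0 \<in> carrier (K0T C T)" using t by (auto simp: K0_carrier)
  ultimately show "deg \<xi> \<in> carrier (K0T C T)"
    unfolding deg_def using K0_comm_group[OF split_seqs_sub[of C T]]
    by (simp add: comm_group_def group.is_monoid monoid.m_closed)
qed

lemma deg_D:
  assumes \<xi>: "\<xi> \<in> carrier (K0fd id C T)"
  shows "index D T X0 \<otimes>\<^bsub>K0T D T\<^esub> \<beta>' (lift \<xi>) = proj_K0 C P T (deg \<xi>)"
proof -
  obtain c where c: "Poly_Mapping.keys c \<subseteq> fd_modules id C T" "\<xi> = K0fd_coset id C T c"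
    using \<xi> unfolding K0_carrier by (elim imageE CollectE)
  obtain t where t: "Poly_Mapping.keys t \<subseteq> T" "index C T X0 = K0_coset T (split_seqs C T) t"
    using index_frag[OF X0] .
  obtain s where s: "Poly_Mapping.keys s \<subseteq> T" "\<beta> (K0fd_coset id C T c) = K0_coset T (split_seqs C T) s"
    using beta_frag[OF b b' c(1)] .
  show ?thesis
    unfolding deg_def c(2) lift_coset[OF c(1)] beta_compatible[OF b b' c(1)] index_D[OF X0] t(2) s(2)
      proj_coset K0_mult[OF split_seqs_sub t(1) s(1)] ..
qed

lemma grassmannian_lift:
  assumes \<xi>: "\<xi> \<in> carrier (K0fd id C T)"
  shows "grassmannian D T (Efun D X0) (lift \<xi>) = grassmannian C T (Efun C X0) \<xi>"
proof -
  obtain c where c: "Poly_Mapping.keys c \<subseteq> fd_modules id C T" "\<xi> = K0fd_coset id C T c"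
    using \<xi> unfolding K0_carrier by (elim imageE CollectE)
  show ?thesis unfolding c(2) lift_coset[OF c(1)] by (rule grassmannian_D[OF X0 c(1)])
qed

text \<open>The classes that contribute to the coefficient at w after projection. Both sides of the
  theorem turn out to be sums over this one set.\<close>

definition contributing where
  "contributing w = {\<xi> \<in> carrier (K0fd id C T). proj_K0 C P T (deg \<xi>) = w \<and>
     \<chi> (grassmannian C T (Efun C X0) \<xi>) \<noteq> 0}"

lemma contributing_dimf:
  assumes "K0fd_coset id C T c \<in> contributing w" "Poly_Mapping.keys c \<subseteq> fd_modules id C T" "U \<in> T"
  shows "0 \<le> dimf U c" "dimf U c \<le> int (vdim (Ext C U X0))"
proof -
  have "grassmannian C T (Efun C X0) (K0fd_coset id C T c) \<noteq> {}"
    using assms(1) euler_characteristic_empty[OF euler] unfolding contributing_def by (intro notI) simp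
  from grassmannian_dimf[OF X0 assms(2) this assms(3)]
  show "0 \<le> dimf U c" "dimf U c \<le> int (vdim (Ext C U X0))" by blast+
qed

text \<open>The dimension of a contributing class at any U in T lies between 0 and dim Ext(U, X0).
  So \<open>finite_classes\<close> applies once these dimensions vanish outside a finite set of
  representatives.\<close>

lemma finite_contributing_if:
  assumes J: "finite J"
    and z: "\<And>c U. K0fd_coset id C T c \<in> contributing w \<Longrightarrow> Poly_Mapping.keys c \<subseteq> fd_modules id C T \<Longrightarrow>
      U \<in> reps - J \<Longrightarrow> dimf U c = 0"
  shows "finite (contributing w)"
proof (rule finite_subset[OF _ finite_classes[OF J, of "\<lambda>U. int (vdim (Ext C U X0))"]], rule subsetI)
  fix \<xi> assume \<xi>: "\<xi> \<in> contributing w"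
  then obtain c where c: "Poly_Mapping.keys c \<subseteq> fd_modules id C T" "\<xi> = K0fd_coset id C T c"
    unfolding contributing_def K0_carrier by (elim CollectE conjE imageE)
  note m = \<xi>[unfolded c(2)]
  have "\<forall>U\<in>reps - J. dimf U c = 0" using z[OF m c(1)] by blast
  moreover have "\<forall>U\<in>reps \<inter> J. 0 \<le> dimf U c \<and> dimf U c \<le> int (vdim (Ext C U X0))"
    using contributing_dimf[OF m c(1)] by (simp add: reps_def)
  ultimately show "\<xi> \<in> K0fd_coset id C T ` {c. Poly_Mapping.keys c \<subseteq> fd_modules id C T \<and>
    (\<forall>U\<in>reps - J. dimf U c = 0) \<and> (\<forall>U\<in>reps \<inter> J. 0 \<le> dimf U c \<and> dimf U c \<le> int (vdim (Ext C U X0)))}"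
    unfolding c(2) by (intro imageI CollectI conjI c)
qed

lemma finite_contributing: "finite (contributing w)"
proof (cases "fd_module id C T (Efun C X0)")
  case True
  show ?thesis
  proof (rule finite_contributing_if[OF finite_supp[OF True]])
    fix c U assume m: "K0fd_coset id C T c \<in> contributing w" and c: "Poly_Mapping.keys c \<subseteq> fd_modules id C T"
      and U: "U \<in> reps - supp (Efun C X0)"
    have UT: "U \<in> T" using U by (simp add: reps_def)
    have "vdim (Ext C U X0) = 0"
      using U UT X0 vdim_zero_iff[OF ext_vs ext_findim, of U X0] by (simp add: supp_def)
    then show "dimf U c = 0" using contributing_dimf[OF m c UT] by simp
  qed
next
  case False
  with fin obtain S where S: "finite S" "S \<subseteq> kernel (K0fd id D T) (K0T D T) \<beta>'"
    "\<forall>h\<in>kernel (K0fd id D T) (K0T D T) \<beta>'. \<exists>n>0::nat. h [^]\<^bsub>K0fd id D T\<^esub> n \<in> generate (K0fd id D T) S"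
    unfolding finite_rank_def by blast
  show ?thesis
  proof (cases "contributing w = {}")
    case ne: False
    then obtain \<xi>0 where \<xi>0: "\<xi>0 \<in> contributing w" by blast
    then obtain c0 where c0: "Poly_Mapping.keys c0 \<subseteq> fd_modules id C T" "\<xi>0 = K0fd_coset id C T c0"
      unfolding contributing_def K0_carrier by (elim CollectE conjE imageE)
    have "\<exists>c. Poly_Mapping.keys c \<subseteq> fd_modules id D T \<and> s = K0fd_coset id D T c" if s: "s \<in> S" for s
    proof -
      have "s \<in> carrier (K0fd id D T)" using S(2) s by (auto simp: kernel_def)
      then show ?thesis unfolding K0_carrier by (elim imageE CollectE) blast
    qed
    then obtain f where f: "\<And>s. s \<in> S \<Longrightarrow> Poly_Mapping.keys (f s) \<subseteq> fd_modules id D T"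
      "\<And>s. s \<in> S \<Longrightarrow> s = K0fd_coset id D T (f s)" by metis
    \<comment> \<open>Outside J neither the fixed contributing class nor any of the finitely many
      elements of S has nonzero dimension.\<close>
    define J where "J = {U \<in> reps. dimf U c0 \<noteq> 0} \<union> (\<Union>s\<in>S. {U \<in> reps. dimf U (Psi (f s)) \<noteq> 0})"
    have Psif: "dimf U (Psi (f s)) = dimf U (f s)" if "s \<in> S" "U \<in> T" for s U
      using dimf_rel[OF Phi_Psi[OF f(1)[OF that(1)]] that(2)] by (simp add: dimf_Phi)
    have fJ: "finite J"
      unfolding J_def by (intro finite_UnI finite_UN_I S(1) finite_dimf_support c0 Psi_keys f)
    show ?thesis
    proof (rule finite_contributing_if[OF fJ])
      fix c U assume m: "K0fd_coset id C T c \<in> contributing w" and c: "Poly_Mapping.keys c \<subseteq> fd_modules id C T"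
        and U: "U \<in> reps - J"
      have UT: "U \<in> T" using U by (simp add: reps_def)
      let ?h = "K0fd_coset id D T (Phi (c - c0))"
      have kd: "Poly_Mapping.keys (c - c0) \<subseteq> fd_modules id C T" using keys_diff[of c c0] c c0 by blast
      have deg_eq: "proj_K0 C P T (deg (K0fd_coset id C T c)) = proj_K0 C P T (deg (K0fd_coset id C T c0))"
        using m \<xi>0 unfolding c0(2) contributing_def by simp
      obtain t where t: "Poly_Mapping.keys t \<subseteq> T" "index C T X0 = K0_coset T (split_seqs C T) t"
        using index_frag[OF X0] .
      obtain x where x: "Poly_Mapping.keys x \<subseteq> T" "\<beta> (K0fd_coset id C T c) = K0_coset T (split_seqs C T) x"
        using beta_frag[OF b b' c] .
      obtain y where y: "Poly_Mapping.keys y \<subseteq> T" "\<beta> (K0fd_coset id C T c0) = K0_coset T (split_seqs C T) y"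
        using beta_frag[OF b b' c0(1)] .
      \<comment> \<open>The projected exponents of c and c0 are equal; cancelling the common index
        shows that the class of c - c0 lies in the kernel of \<open>\<beta>'\<close>.\<close>
      have xy: "K0_coset T (split_seqs D T) (x - y) = K0_coset T (split_seqs D T) 0"
      proof -
        from deg_eq have "K0_coset T (split_seqs D T) (t + x) = K0_coset T (split_seqs D T) (t + y)"
          unfolding deg_def t(2) x(2) y(2) K0_mult[OF split_seqs_sub t(1) x(1)] K0_mult[OF split_seqs_sub t(1) y(1)] proj_coset .
        then show ?thesis unfolding K0_coset_eq[OF split_seqs_sub] by simp
      qed
      have "\<beta>' ?h = K0_coset T (split_seqs D T) (x - y)"
        unfolding Phi_simps
      proof (rule hom_coset_diff[OF fd_seqs_sub split_seqs_sub _ Phi_keys[OF c] Phi_keys[OF c0(1)] x(1) _ y(1)])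
        show "\<beta>' \<in> hom (K0fd id D T) (K0T D T)" using b' by (simp add: is_beta_def)
      qed (simp_all only: beta_compatible[OF b b' c] beta_compatible[OF b b' c0(1)] x(2) y(2) proj_coset)
      then have "\<beta>' ?h = \<one>\<^bsub>K0T D T\<^esub>" unfolding xy K0_one[OF split_seqs_sub[of D T]] .
      moreover have "?h \<in> carrier (K0fd id D T)" unfolding K0_carrier by (intro imageI CollectI Phi_keys kd)
      ultimately have "?h \<in> kernel (K0fd id D T) (K0T D T) \<beta>'" unfolding kernel_def by (intro CollectI conjI)
      then obtain n :: nat where n: "n > 0" "?h [^]\<^bsub>K0fd id D T\<^esub> n \<in> generate (K0fd id D T) S"
        using S(3) by blast
      have g: "K0fd_coset id D T (frag_cmul (int n) (Phi (c - c0))) \<in> generate (K0fd id D T) S"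
        using n(2) unfolding K0_nat_pow[OF fd_seqs_sub Phi_keys[OF kd]] .
      have "\<exists>d. Poly_Mapping.keys d \<subseteq> fd_modules id D T \<and> dimf U d = 0 \<and>
          K0fd_coset id D T (frag_cmul (int n) (Phi (c - c0))) = K0fd_coset id D T d"
      proof (rule generate_dimf[OF _ g])
        fix s assume s: "s \<in> S"
        have "dimf U (f s) = 0" using U s Psif[OF s UT] unfolding J_def by auto
        then show "\<exists>c. Poly_Mapping.keys c \<subseteq> fd_modules id D T \<and> dimf U c = 0 \<and> s = K0fd_coset id D T c"
          using f[OF s] by (intro exI[of _ "f s"] conjI)
      qed
      then obtain d where d: "dimf U d = 0"
          "K0fd_coset id D T (frag_cmul (int n) (Phi (c - c0))) = K0fd_coset id D T d"
        by (elim exE conjE)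
      \<comment> \<open>A multiple of c - c0 lies in the group generated by S, on which the
        dimension at U vanishes. As n is positive, the dimension of c - c0 itself is 0.\<close>
      have "int n * dimf U (c - c0) = 0"
        using dimf_coset[OF d(2) UT] d(1) by (simp only: dimf_cmul dimf_Phi)
      moreover have "dimf U c0 = 0" using U unfolding J_def by blast
      ultimately show "dimf U c = 0" using n(1) by simp
    qed
  qed simp
qed

lemma cc_terms_C: "cc_terms \<chi> C T \<beta> X0 v = {\<xi> \<in> contributing (proj_K0 C P T v). deg \<xi> = v}"
  unfolding cc_terms_def contributing_def deg_def[symmetric] by (rule Set.set_eqI, unfold mem_Collect_eq, rule iffI; elim conjE; intro conjI; (assumption | simp only:))

lemma cc_terms_D: "cc_terms \<chi> D T \<beta>' X0 w = lift ` contributing w"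
proof (intro subset_antisym subsetI)
  fix \<eta> assume e: "\<eta> \<in> cc_terms \<chi> D T \<beta>' X0 w"
  then have "\<eta> \<in> lift ` carrier (K0fd id C T)" using bij_betw_imp_surj_on[OF lift_bij] unfolding cc_terms_def by simp
  then obtain \<xi> where \<xi>: "\<xi> \<in> carrier (K0fd id C T)" "\<eta> = lift \<xi>" by (elim imageE)
  have "index D T X0 \<otimes>\<^bsub>K0T D T\<^esub> \<beta>' (lift \<xi>) = w \<and> \<chi> (grassmannian D T (Efun D X0) (lift \<xi>)) \<noteq> 0"
    using e unfolding \<xi>(2) cc_terms_def by (elim CollectE conjE) (rule conjI)
  then have "\<xi> \<in> contributing w"
    unfolding contributing_def deg_D[OF \<xi>(1)] grassmannian_lift[OF \<xi>(1)] by (intro CollectI conjI[OF \<xi>(1)])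
  then show "\<eta> \<in> lift ` contributing w" unfolding \<xi>(2) by (rule imageI)
next
  fix \<eta> assume "\<eta> \<in> lift ` contributing w"
  then obtain \<xi> where \<xi>: "\<xi> \<in> contributing w" "\<eta> = lift \<xi>" by (elim imageE)
  have c: "\<xi> \<in> carrier (K0fd id C T)" using \<xi>(1) unfolding contributing_def by simp
  have m: "lift \<xi> \<in> carrier (K0fd id D T)" using bij_betw_apply[OF lift_bij c] .
  have "proj_K0 C P T (deg \<xi>) = w \<and> \<chi> (grassmannian C T (Efun C X0) \<xi>) \<noteq> 0"
    using \<xi>(1) unfolding contributing_def by (elim CollectE conjE) (rule conjI)
  then show "\<eta> \<in> cc_terms \<chi> D T \<beta>' X0 w"
    unfolding \<xi>(2) cc_terms_def deg_D[OF c, symmetric] grassmannian_lift[OF c, symmetric]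
    by (intro CollectI conjI[OF m])
qed

lemma finite_cc_terms: "finite (cc_terms \<chi> C T \<beta> X0 v)" "finite (cc_terms \<chi> D T \<beta>' X0 w)"
  unfolding cc_terms_C cc_terms_D using finite_contributing by simp_all

lemma pushforward_terms_sub:
  "pushforward_terms (K0T C T) (proj_K0 C P T) (CC \<chi> C T \<beta> X0) w \<subseteq> deg ` contributing w"
proof
  fix v assume "v \<in> pushforward_terms (K0T C T) (proj_K0 C P T) (CC \<chi> C T \<beta> X0) w"
  then have v: "proj_K0 C P T v = w" "CC \<chi> C T \<beta> X0 v \<noteq> 0" unfolding pushforward_terms_def by simp_all
  have "cc_terms \<chi> C T \<beta> X0 v \<noteq> {}" using v(2) unfolding CC_def by (intro notI) simp
  then obtain \<xi> where "\<xi> \<in> contributing w" "deg \<xi> = v" unfolding cc_terms_C v(1) by blast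
  then show "v \<in> deg ` contributing w" by blast
qed

text \<open>Both sides are the sum over \<open>contributing w\<close>: on the left it is grouped by
  the exponent \<open>deg\<close>, on the right it is reindexed along the bijection
  \<open>lift\<close>.\<close>

lemma pushforward_CC: "pushforward (K0T C T) (proj_K0 C P T) (CC \<chi> C T \<beta> X0) w = CC \<chi> D T \<beta>' X0 w"
proof -
  let ?g = "\<lambda>\<xi>. (of_int (\<chi> (grassmannian C T (Efun C X0) \<xi>)) :: 'k)"
  have car: "\<xi> \<in> carrier (K0fd id C T)" "proj_K0 C P T (deg \<xi>) = w" if "\<xi> \<in> contributing w" for \<xi>
    using that unfolding contributing_def by simp_all
  have "pushforward (K0T C T) (proj_K0 C P T) (CC \<chi> C T \<beta> X0) w = (\<Sum>v\<in>deg ` contributing w. CC \<chi> C T \<beta> X0 v)"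
    unfolding pushforward_def
  proof (rule sum.mono_neutral_left[OF finite_imageI[OF finite_contributing] pushforward_terms_sub], rule ballI)
    \<comment> \<open>An exponent missing from \<open>pushforward_terms\<close> has coefficient 0 in
      the field, possibly through cancellation or because of the characteristic, so adding it
      changes nothing.\<close>
    fix v assume v: "v \<in> deg ` contributing w - pushforward_terms (K0T C T) (proj_K0 C P T) (CC \<chi> C T \<beta> X0) w"
    then obtain \<xi> where \<xi>: "\<xi> \<in> contributing w" "v = deg \<xi>" by blast
    show "CC \<chi> C T \<beta> X0 v = 0"
      using v deg_carrier[OF car(1)[OF \<xi>(1)]] car(2)[OF \<xi>(1)] unfolding \<xi>(2) pushforward_terms_def by simp
  qed
  also have "\<dots> = (\<Sum>v\<in>deg ` contributing w. \<Sum>\<xi>\<in>{\<xi> \<in> contributing w. deg \<xi> = v}. ?g \<xi>)"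
  proof (rule sum.cong[OF refl])
    fix v assume "v \<in> deg ` contributing w"
    then have "proj_K0 C P T v = w" using car(2) by blast
    then show "CC \<chi> C T \<beta> X0 v = (\<Sum>\<xi>\<in>{\<xi> \<in> contributing w. deg \<xi> = v}. ?g \<xi>)"
      unfolding CC_def cc_terms_C by simp
  qed
  also have "\<dots> = (\<Sum>\<xi>\<in>contributing w. ?g \<xi>)"
    by (rule sum.image_gen[OF finite_contributing, symmetric])
  also have "\<dots> = (\<Sum>\<xi>\<in>contributing w. of_int (\<chi> (grassmannian D T (Efun D X0) (lift \<xi>))))"
    by (rule sum.cong[OF refl]) (simp only: grassmannian_lift[OF car(1)])
  also have "\<dots> = CC \<chi> D T \<beta>' X0 w"
    unfolding CC_def cc_terms_D
    by (rule sum.reindex[symmetric, unfolded o_def])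
      (rule inj_on_subset[OF bij_betw_imp_inj_on[OF lift_bij]], rule subsetI, rule car(1))
  finally show ?thesis .
qed

end

end

theorem proposition5p28:
  fixes C :: "('k::field, 'o, 'm, 'e) extricat"
    and E :: "('k, 'o2, 'm2, 'e2) extricat" and Q :: "'o2 set"
    and T P :: "'o set" and X0 :: 'o
    and \<chi> :: "'k point set \<Rightarrow> int"
    and \<beta> :: "(('k, 'o, 'm, 'k vec) tmod \<Rightarrow>\<^sub>0 int) set \<Rightarrow> ('o \<Rightarrow>\<^sub>0 int) set"
    and \<beta>' :: "(('k, 'o, 'm set, 'k vec) tmod \<Rightarrow>\<^sub>0 int) set \<Rightarrow> ('o \<Rightarrow>\<^sub>0 int) set"
  assumes "perfect_field TYPE('k)"
    and "euler_characteristic \<chi>"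
    and "cluster_category C E Q"
    and "krull_schmidt C"
    and "cluster_tilting C T"
    and "maximally_mutable C T"
    and "additively_closed C P"
    and "P \<subseteq> projectives C \<inter> injectives C"
    and "is_beta C T \<beta>"
    and "is_beta (partial_stab C P) T \<beta>'"
    and "X0 \<in> Obj C"
    and "fd_module id C T (Efun C X0) \<or>
         finite_rank (K0fd id (partial_stab C P) T)
           (kernel (K0fd id (partial_stab C P) T) (K0T (partial_stab C P) T) \<beta>')"
  shows "(\<forall>v. finite (cc_terms \<chi> C T \<beta> X0 v)) \<and>
         (\<forall>w. finite (cc_terms \<chi> (partial_stab C P) T \<beta>' X0 w)) \<and>
         (\<forall>w. finite (pushforward_terms (K0T C T) (proj_K0 C P T) (CC \<chi> C T \<beta> X0) w)) \<and>
         pushforward (K0T C T) (proj_K0 C P T) (CC \<chi> C T \<beta> X0) =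
           CC \<chi> (partial_stab C P) T \<beta>' X0"
proof -
  interpret clustP C T P
    by unfold_locales (use assms(3-8) in \<open>simp_all add: cluster_category_def\<close>)
  note a = assms(9-11,2,12)
  show ?thesis
  proof (intro conjI allI HOL.ext)
    show "finite (cc_terms \<chi> C T \<beta> X0 v)" for v by (rule finite_cc_terms(1)[OF a])
    show "finite (cc_terms \<chi> (partial_stab C P) T \<beta>' X0 w)" for w by (rule finite_cc_terms(2)[OF a])
    show "finite (pushforward_terms (K0T C T) (proj_K0 C P T) (CC \<chi> C T \<beta> X0) w)" for w
      by (rule finite_subset[OF pushforward_terms_sub[OF a] finite_imageI[OF finite_contributing[OF a]]])
    show "pushforward (K0T C T) (proj_K0 C P T) (CC \<chi> C T \<beta> X0) w = CC \<chi> (partial_stab C P) T \<beta>' X0 w" for w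
      by (rule pushforward_CC[OF a])
  qed
qed

end
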